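(* Let $k$ be a field of characteristic different from $2$, let $a,b\in k$, $c=-a-b$, and let $J_{(a,b)}\subset\mathbb{P}^3$ be the elliptic curve $aX_0^2+X_1^2=X_2^2$, $bX_0^2+X_2^2=X_3^2$, $cX_0^2+X_3^2=X_1^2$ (assumed nonsingular) with identity $O=(0:1:1:1)$. Write $(X_0:X_1:X_2:X_3)$ and $(Y_0:Y_1:Y_2:Y_3)$ for the coordinates of the two summands. The space of addition laws of bidegree $(2,2)$ for $J_{(a,b)}$ is spanned by $$\begin{aligned}\mathfrak{s}_0=(&X_0^2Y_1^2-X_1^2Y_0^2,\ X_0X_1Y_2Y_3-X_2X_3Y_0Y_1,\ X_0X_2Y_1Y_3-X_1X_3Y_0Y_2,\ X_0X_3Y_1Y_2-X_1X_2Y_0Y_3),\\ \mathfrak{s}_1=(&X_0X_2Y_1Y_3+X_1X_3Y_0Y_2,\ -aX_0X_3Y_0Y_3+X_1X_2Y_1Y_2,\ abX_0^2Y_0^2+X_2^2Y_2^2,\ bX_0X_1Y_0Y_1+X_2X_3Y_2Y_3),\\ \mathfrak{s}_2=(&X_0X_1Y_2Y_3+X_2X_3Y_0Y_1,\ acX_0^2Y_0^2+X_1^2Y_1^2,\ aX_0X_3Y_0Y_3+X_1X_2Y_1Y_2,\ -cX_0X_2Y_0Y_2+X_1X_3Y_1Y_3),\\ \mathfrak{s}_3=(&a(X_0X_3Y_1Y_2+X_1X_2Y_0Y_3),\ a(cX_0X_2Y_0Y_2+X_1X_3Y_1Y_3),\ a(-bX_0X_1Y_0Y_1+X_2X_3Y_2Y_3),\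 -bX_1^2Y_1^2-cX_2^2Y_2^2),\end{aligned}$$ and the exceptional divisor of $\mathfrak{s}_i$ is $\delta^*(D_i)$, where $D_i$ is the divisor on $J_{(a,b)}$ cut out by $X_i=0$.
   Context: $\delta:E\times E\to E$ is $(P,Q)\mapsto P-Q$. An addition law of bidegree $(2,2)$ is a $4$-tuple of polynomials in $(X_0,\dots,X_3),(Y_0,\dots,Y_3)$, bihomogeneous of bidegree $(2,2)$, modulo the bihomogeneous ideal of $J_{(a,b)}\times J_{(a,b)}$ and not all zero modulo it, such that evaluation at $(P,Q)$ gives coordinates of $P+Q$ whenever not all vanish; with $0$ these form a $k$-vector space. Such a law corresponds to a global section of $\mu^*\mathcal{L}^{-1}\otimes\pi_1^*\mathcal{L}^2\otimes\pi_2^*\mathcal{L}^2$ ($\mathcal{L}=\mathcal{O}(1)$, $\mu$ addition, $\pi_i$ projections), and its exceptional divisor is the divisor of zeros of that section (supported on the common zero set of the components).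
   Formalization: The exceptional divisors of s_1 and s_2 are stated as δ*(D_2) and δ*(D_1), exchanged from the text: at Q=O, s_1 restricts to X_2·(X_0,X_1,X_2,X_3) and s_2 to X_1·(X_0,X_1,X_2,X_3), so the printed matching fails for i=1,2. *)

theory Defs
  imports
    "HOL-Analysis.Cartesian_Space"
    "HOL-Library.Poly_Mapping"
    "HOL-Algebra.Algebraic_Closure_Type"
begin

type_synonym ('v, 'a) mpol = "('v \<Rightarrow>\<^sub>0 nat) \<Rightarrow>\<^sub>0 'a"

definition mconst :: "'a::comm_ring_1 \<Rightarrow> ('v, 'a) mpol" where
  "mconst r = Poly_Mapping.single 0 r"

definition mvar :: "'v \<Rightarrow> ('v, 'a::comm_ring_1) mpol" where
  "mvar v = Poly_Mapping.single (Poly_Mapping.single v 1) 1"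

text \<open>Evaluation at \<open>\<sigma>\<close>, the coefficients being mapped into the target ring by \<open>h\<close>.\<close>

definition mp_eval :: "('a::zero \<Rightarrow> 'b::comm_ring_1) \<Rightarrow> ('v \<Rightarrow> 'b) \<Rightarrow> ('v, 'a) mpol \<Rightarrow> 'b" where
  "mp_eval h \<sigma> p =
    (\<Sum>m\<in>Poly_Mapping.keys p. h (Poly_Mapping.lookup p m) * (\<Prod>v\<in>Poly_Mapping.keys m. \<sigma> v ^ Poly_Mapping.lookup m v))"

definition homogeneous :: "nat \<Rightarrow> (4, 'a::zero) mpol \<Rightarrow> bool" where
  "homogeneous d p \<longleftrightarrow> (\<forall>m\<in>Poly_Mapping.keys p. (\<Sum>i\<in>UNIV. Poly_Mapping.lookup m i) = d)"

text \<open>The variables \<^term>\<open>Inl i\<close> and \<^term>\<open>Inr i\<close> stand for \<open>X\<^sub>i\<close> and \<open>Y\<^sub>i\<close>. The index type \<^typ>\<open>4\<close>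
  is the integers modulo 4, so its elements are \<open>0, 1, 2, 3\<close>.\<close>

definition bihomogeneous :: "nat \<Rightarrow> nat \<Rightarrow> (4 + 4, 'a::zero) mpol \<Rightarrow> bool" where
  "bihomogeneous d e p \<longleftrightarrow> (\<forall>m\<in>Poly_Mapping.keys p.
     (\<Sum>i\<in>UNIV. Poly_Mapping.lookup m (Inl i)) = d \<and> (\<Sum>i\<in>UNIV. Poly_Mapping.lookup m (Inr i)) = e)"

definition quad :: "'a \<Rightarrow> 'a \<Rightarrow> 'a \<Rightarrow> 'a \<Rightarrow> 'a ^ 4" where
  "quad x0 x1 x2 x3 =
    (\<chi> i. if i = 0 then x0 else if i = 1 then x1 else if i = 2 then x2 else x3)"

definition proportional :: "'k::field ^ 4 \<Rightarrow> 'k ^ 4 \<Rightarrow> bool" where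
  "proportional v w \<longleftrightarrow> v \<noteq> 0 \<and> w \<noteq> 0 \<and> (\<exists>r. r \<noteq> 0 \<and> w = r *s v)"

lemma part_equivp_proportional: "part_equivp (proportional :: 'k::field ^ 4 \<Rightarrow> _)"
proof (rule part_equivpI)
  show "\<exists>x::'k ^ 4. proportional x x"
    unfolding proportional_def
    by (rule exI[of _ 1]) (auto intro!: exI[of _ 1] simp: vec_eq_iff)
  show "symp (proportional :: 'k ^ 4 \<Rightarrow> _)"
  proof (rule sympI)
    fix v w :: "'k ^ 4"
    assume "proportional v w"
    then obtain r where "v \<noteq> 0" "w \<noteq> 0" "r \<noteq> 0" "w = r *s v"
      unfolding proportional_def by blast
    then show "proportional w v"
      unfolding proportional_def
      by (auto intro!: exI[of _ "inverse r"] simp: vector_smult_assoc)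
  qed
  show "transp (proportional :: 'k ^ 4 \<Rightarrow> _)"
  proof (rule transpI)
    fix u v w :: "'k ^ 4"
    assume "proportional u v" "proportional v w"
    then obtain r s where "u \<noteq> 0" "w \<noteq> 0" "r \<noteq> 0" "s \<noteq> 0" "w = s *s (r *s u)"
      unfolding proportional_def by blast
    then show "proportional u w"
      unfolding proportional_def
      by (auto intro!: exI[of _ "s * r"] simp: vector_smult_assoc)
  qed
qed

quotient_type (overloaded) 'k proj3 = "'k::field ^ 4" / partial: proportional
  by (rule part_equivp_proportional)

text \<open>\<^term>\<open>abs_proj3 v\<close> is the point with homogeneous coordinate vector \<open>v \<noteq> 0\<close>;
  \<^term>\<open>rep_proj3 P\<close> is some homogeneous coordinate vector of \<open>P\<close>. Everything below is independent
  of this choice, since only zero sets of forms and quotients of forms of equal degree are used.\<close>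

definition on_cone :: "'k::field \<Rightarrow> 'k \<Rightarrow> 'k ^ 4 \<Rightarrow> bool" where
  "on_cone a b v \<longleftrightarrow> (let c = - a - b in
     a * (v $ 0)^2 + (v $ 1)^2 = (v $ 2)^2 \<and>
     b * (v $ 0)^2 + (v $ 2)^2 = (v $ 3)^2 \<and>
     c * (v $ 0)^2 + (v $ 3)^2 = (v $ 1)^2)"

definition curveJ :: "'k::field \<Rightarrow> 'k \<Rightarrow> 'k proj3 set" where
  "curveJ a b = {P. on_cone a b (rep_proj3 P)}"

definition originJ :: "'k::field proj3" where
  "originJ = abs_proj3 (quad 0 1 1 1)"

definition jacobianJ :: "'k::field \<Rightarrow> 'k \<Rightarrow> 'k ^ 4 \<Rightarrow> 'k ^ 4 ^ 3" where
  "jacobianJ a b v = (let c = - a - b in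
     \<chi> i. if i = 0 then quad (2 * a * v $ 0) (2 * v $ 1) (- 2 * v $ 2) 0
         else if i = 1 then quad (2 * b * v $ 0) 0 (2 * v $ 2) (- 2 * v $ 3)
         else quad (2 * c * v $ 0) (- 2 * v $ 1) 0 (2 * v $ 3))"

text \<open>Jacobian criterion: the rank is the codimension of a curve in 3-space.\<close>

definition nonsingularJ :: "'k::alg_closed_field \<Rightarrow> 'k \<Rightarrow> bool" where
  "nonsingularJ a b \<longleftrightarrow> (\<forall>P\<in>curveJ a b. rank (jacobianJ a b (rep_proj3 P)) = 2)"

text \<open>Projective varieties over an algebraically closed field are given classically by their set
  \<open>V\<close> of points together with the collection \<open>\<F>\<close> of the spaces of forms on the ambient space, one
  space for each degree (or bidegree). A form is represented by its values at the chosen coordinate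
  vectors. The sets where a form does not vanish are a basis of the Zariski topology.\<close>

definition forms3 :: "('k::field proj3 \<Rightarrow> 'k) set set" where
  "forms3 = range (\<lambda>d. {(\<lambda>P. mp_eval id (($) (rep_proj3 P)) F) |F. homogeneous d F})"

definition biforms :: "nat \<Rightarrow> nat \<Rightarrow> ('k::field proj3 \<times> 'k proj3 \<Rightarrow> 'k) set" where
  "biforms d e = {(\<lambda>(P, Q). mp_eval id (case_sum (($) (rep_proj3 P)) (($) (rep_proj3 Q))) F) |F.
     bihomogeneous d e F}"

definition forms33 :: "('k::field proj3 \<times> 'k proj3 \<Rightarrow> 'k) set set" where
  "forms33 = {biforms d e |d e. True}"

definition near :: "'p set \<Rightarrow> ('p \<Rightarrow> 'k::field) set set \<Rightarrow> 'p \<Rightarrow> ('p \<Rightarrow> bool) \<Rightarrow> bool" where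
  "near V \<F> x R \<longleftrightarrow> (\<exists>S\<in>\<F>. \<exists>g\<in>S. g x \<noteq> 0 \<and> (\<forall>y\<in>V. g y \<noteq> 0 \<longrightarrow> R y))"

definition regular_at :: "'p set \<Rightarrow> ('p \<Rightarrow> 'k::field) set set \<Rightarrow> 'p \<Rightarrow> ('p \<Rightarrow> 'k) \<Rightarrow> bool" where
  "regular_at V \<F> x \<phi> \<longleftrightarrow>
    (\<exists>S\<in>\<F>. \<exists>f\<in>S. \<exists>g\<in>S. near V \<F> x (\<lambda>y. g y \<noteq> 0 \<and> \<phi> y = f y / g y))"

definition unit_at :: "'p set \<Rightarrow> ('p \<Rightarrow> 'k::field) set set \<Rightarrow> 'p \<Rightarrow> ('p \<Rightarrow> 'k) \<Rightarrow> bool" where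
  "unit_at V \<F> x u \<longleftrightarrow> regular_at V \<F> x u \<and> u x \<noteq> 0"

definition associated_at ::
  "'p set \<Rightarrow> ('p \<Rightarrow> 'k::field) set set \<Rightarrow> 'p \<Rightarrow> ('p \<Rightarrow> 'k) \<Rightarrow> ('p \<Rightarrow> 'k) \<Rightarrow> bool" where
  "associated_at V \<F> x \<phi> \<psi> \<longleftrightarrow>
    (\<exists>u. unit_at V \<F> x u \<and> near V \<F> x (\<lambda>y. \<phi> y = u y * \<psi> y))"

text \<open>An effective Cartier divisor is represented by the map sending each point \<open>x\<close> of \<open>V\<close> to the
  set of all its local equations at \<open>x\<close>, an equivalence class under multiplication by units of the
  local ring. Here \<open>L x\<close> is a given nonempty set of local equations at \<open>x\<close>, associated to each
  other.\<close>

type_synonym ('p, 'k) cdivisor = "'p \<Rightarrow> ('p \<Rightarrow> 'k) set"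

definition cartier ::
  "'p set \<Rightarrow> ('p \<Rightarrow> 'k::field) set set \<Rightarrow> ('p \<Rightarrow> ('p \<Rightarrow> 'k) set) \<Rightarrow> ('p, 'k) cdivisor" where
  "cartier V \<F> L x = {\<phi>. x \<in> V \<and> (\<exists>\<psi>\<in>L x. associated_at V \<F> x \<phi> \<psi>)}"

definition pullback ::
  "'p set \<Rightarrow> ('p \<Rightarrow> 'k::field) set set \<Rightarrow> ('p \<Rightarrow> 'q) \<Rightarrow> ('q, 'k) cdivisor \<Rightarrow> ('p, 'k) cdivisor" where
  "pullback V \<F> f D = cartier V \<F> (\<lambda>x. {\<phi> \<circ> f |\<phi>. \<phi> \<in> D (f x)})"

definition uniformizer_at ::
  "'p set \<Rightarrow> ('p \<Rightarrow> 'k::field) set set \<Rightarrow> 'p \<Rightarrow> ('p \<Rightarrow> 'k) \<Rightarrow> bool" where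
  "uniformizer_at V \<F> x t \<longleftrightarrow> regular_at V \<F> x t \<and> t x = 0 \<and>
    (\<forall>\<phi>. regular_at V \<F> x \<phi> \<and> \<phi> x = 0 \<longrightarrow>
      (\<exists>\<psi>. regular_at V \<F> x \<psi> \<and> near V \<F> x (\<lambda>y. \<phi> y = t y * \<psi> y)))"

definition ord_at :: "'p set \<Rightarrow> ('p \<Rightarrow> 'k::field) set set \<Rightarrow> 'p \<Rightarrow> ('p \<Rightarrow> 'k) \<Rightarrow> nat" where
  "ord_at V \<F> x \<phi> =
    (THE n. \<exists>t. uniformizer_at V \<F> x t \<and> associated_at V \<F> x \<phi> (\<lambda>y. t y ^ n))"

text \<open>Weil divisors on a nonsingular curve are elements of the free abelian group on its points.
  The order of the rational function \<open>f / g\<close> at \<open>P\<close> is computed by trivialising numerator and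
  denominator with a form \<open>h\<close> of the same degree that does not vanish at \<open>P\<close>.\<close>

definition lin_equiv ::
  "'p set \<Rightarrow> ('p \<Rightarrow> 'k::field) set set \<Rightarrow> ('p \<Rightarrow>\<^sub>0 int) \<Rightarrow> ('p \<Rightarrow>\<^sub>0 int) \<Rightarrow> bool" where
  "lin_equiv V \<F> D E \<longleftrightarrow>
    (\<exists>S\<in>\<F>. \<exists>f\<in>S. \<exists>g\<in>S. (\<exists>P\<in>V. f P \<noteq> 0) \<and> (\<exists>P\<in>V. g P \<noteq> 0) \<and>
      (\<forall>P\<in>V. \<exists>h\<in>S. h P \<noteq> 0 \<and>
        int (ord_at V \<F> P (\<lambda>y. f y / h y)) - int (ord_at V \<F> P (\<lambda>y. g y / h y))
          = Poly_Mapping.lookup D P - Poly_Mapping.lookup E P))"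

text \<open>The group law of the elliptic curve, transported from the group of divisor classes of degree
  0 along \<open>P \<mapsto> (P) - (O)\<close>: the sum of \<open>P\<close> and \<open>Q\<close> is the point \<open>R\<close> with
  \<open>(P) + (Q) \<sim> (R) + (O)\<close>.\<close>

definition addJ :: "'k::alg_closed_field \<Rightarrow> 'k \<Rightarrow> 'k proj3 \<Rightarrow> 'k proj3 \<Rightarrow> 'k proj3" where
  "addJ a b P Q = (THE R. R \<in> curveJ a b \<and>
     lin_equiv (curveJ a b) forms3
       (Poly_Mapping.single P 1 + Poly_Mapping.single Q 1)
       (Poly_Mapping.single R 1 + Poly_Mapping.single originJ 1))"

definition negJ :: "'k::alg_closed_field \<Rightarrow> 'k \<Rightarrow> 'k proj3 \<Rightarrow> 'k proj3" where
  "negJ a b Q = (THE R. R \<in> curveJ a b \<and> addJ a b Q R = originJ)"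

definition deltaJ :: "'k::alg_closed_field \<Rightarrow> 'k \<Rightarrow> 'k proj3 \<times> 'k proj3 \<Rightarrow> 'k proj3" where
  "deltaJ a b = (\<lambda>(P, Q). addJ a b P (negJ a b Q))"

text \<open>Coefficients of addition laws lie in the base field \<open>k\<close>, points have coordinates in its
  algebraic closure.\<close>

type_synonym 'a tuple = "((4 + 4, 'a) mpol) ^ 4"

definition eval2 :: "'a::field alg_closure ^ 4 \<Rightarrow> 'a alg_closure ^ 4 \<Rightarrow> (4 + 4, 'a) mpol
    \<Rightarrow> 'a alg_closure" where
  "eval2 v w p = mp_eval to_ac (case_sum (($) v) (($) w)) p"

definition eval_tuple :: "'a::field tuple \<Rightarrow> 'a alg_closure proj3 \<Rightarrow> 'a alg_closure proj3
    \<Rightarrow> 'a alg_closure ^ 4" where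
  "eval_tuple s P Q = (\<chi> j. eval2 (rep_proj3 P) (rep_proj3 Q) (s $ j))"

text \<open>The bihomogeneous ideal of the product of the curve with itself. Vanishing is required for
  all coordinate vectors, hence for all bihomogeneous components separately.\<close>

definition ideal_JJ :: "'a::field \<Rightarrow> 'a \<Rightarrow> (4 + 4, 'a) mpol set" where
  "ideal_JJ a b = {p. \<forall>v w. v \<noteq> 0 \<and> on_cone (to_ac a) (to_ac b) v \<and>
     w \<noteq> 0 \<and> on_cone (to_ac a) (to_ac b) w \<longrightarrow> eval2 v w p = 0}"

definition tuples22 :: "'a::field tuple set" where
  "tuples22 = {s. \<forall>j. bihomogeneous 2 2 (s $ j)}"

definition null_tuples :: "'a::field \<Rightarrow> 'a \<Rightarrow> 'a tuple set" where
  "null_tuples a b = {s \<in> tuples22. \<forall>j. s $ j \<in> ideal_JJ a b}"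

definition addition_laws :: "'a::field \<Rightarrow> 'a \<Rightarrow> 'a tuple set" where
  "addition_laws a b = {s \<in> tuples22 - null_tuples a b.
     \<forall>P\<in>curveJ (to_ac a) (to_ac b). \<forall>Q\<in>curveJ (to_ac a) (to_ac b).
       eval_tuple s P Q \<noteq> 0 \<longrightarrow>
       abs_proj3 (eval_tuple s P Q) = addJ (to_ac a) (to_ac b) P Q}"

definition scale_tuple :: "'a::field \<Rightarrow> 'a tuple \<Rightarrow> 'a tuple" where
  "scale_tuple r s = (\<chi> j. mconst r * s $ j)"

text \<open>A law \<open>s\<close> corresponds to the homomorphism \<open>\<mu>\<^sup>* \<L> \<rightarrow> \<pi>\<^sub>1\<^sup>* \<L>\<^sup>2 \<otimes> \<pi>\<^sub>2\<^sup>* \<L>\<^sup>2\<close> that sends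
  \<open>\<mu>\<^sup>* X\<^sub>j\<close> to \<open>s\<^sub>j\<close>. Near \<open>(P, Q)\<close> the sheaf \<open>\<mu>\<^sup>* \<L>\<close> is generated by \<open>\<mu>\<^sup>* X\<^sub>j\<close> for any \<open>j\<close> with
  \<open>X\<^sub>j (P + Q) \<noteq> 0\<close>, and \<open>\<pi>\<^sub>1\<^sup>* \<L>\<^sup>2 \<otimes> \<pi>\<^sub>2\<^sup>* \<L>\<^sup>2\<close> by any form \<open>h\<close> of bidegree \<open>(2, 2)\<close> with
  \<open>h (P, Q) \<noteq> 0\<close>; so \<open>s\<^sub>j / h\<close> is a local equation of the divisor of zeros of the section.\<close>

definition exceptional_divisor :: "'a::field \<Rightarrow> 'a \<Rightarrow> 'a tuple \<Rightarrow>
    ('a alg_closure proj3 \<times> 'a alg_closure proj3, 'a alg_closure) cdivisor" where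
  "exceptional_divisor a b s =
    (let V = curveJ (to_ac a) (to_ac b) \<times> curveJ (to_ac a) (to_ac b) in
     cartier V forms33 (\<lambda>(P, Q).
       {(\<lambda>(P', Q'). eval_tuple s P' Q' $ j / h (P', Q')) |j h.
          rep_proj3 (addJ (to_ac a) (to_ac b) P Q) $ j \<noteq> 0 \<and>
          h \<in> biforms 2 2 \<and> h (P, Q) \<noteq> 0}))"

definition coord_divisor :: "'k::field \<Rightarrow> 'k \<Rightarrow> 4 \<Rightarrow> ('k proj3, 'k) cdivisor" where
  "coord_divisor a b i = cartier (curveJ a b) forms3
     (\<lambda>P. {(\<lambda>R. rep_proj3 R $ i / rep_proj3 R $ n) |n. rep_proj3 P $ n \<noteq> 0})"

definition delta_pullback :: "'a::field \<Rightarrow> 'a \<Rightarrow> 4 \<Rightarrow>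
    ('a alg_closure proj3 \<times> 'a alg_closure proj3, 'a alg_closure) cdivisor" where
  "delta_pullback a b i =
    pullback (curveJ (to_ac a) (to_ac b) \<times> curveJ (to_ac a) (to_ac b)) forms33
      (deltaJ (to_ac a) (to_ac b)) (coord_divisor (to_ac a) (to_ac b) i)"

abbreviation XX :: "4 \<Rightarrow> (4 + 4, 'a::comm_ring_1) mpol" where "XX i \<equiv> mvar (Inl i)"
abbreviation YY :: "4 \<Rightarrow> (4 + 4, 'a::comm_ring_1) mpol" where "YY i \<equiv> mvar (Inr i)"

text \<open>On \<open>Y = (0, 1, 1, 1)\<close>, that is \<open>Q = O\<close>, the four laws below restrict to the tuple
  \<open>(X\<^sub>0, X\<^sub>1, X\<^sub>2, X\<^sub>3)\<close> multiplied by \<open>X\<^sub>0\<close>, \<open>X\<^sub>2\<close>, \<open>X\<^sub>1\<close> and \<open>a X\<^sub>3\<close> respectively. Since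
  \<open>\<delta> (P, O) = P\<close>, the divisors attached to \<open>law1\<close> and \<open>law2\<close> are the pullbacks of the
  divisors of \<open>X\<^sub>2\<close> and \<open>X\<^sub>1\<close>, in this order.\<close>

definition law0 :: "'a::field \<Rightarrow> 'a \<Rightarrow> 'a tuple" where
  "law0 a b = quad
     (XX 0^2 * YY 1^2 - XX 1^2 * YY 0^2)
     (XX 0 * XX 1 * YY 2 * YY 3 - XX 2 * XX 3 * YY 0 * YY 1)
     (XX 0 * XX 2 * YY 1 * YY 3 - XX 1 * XX 3 * YY 0 * YY 2)
     (XX 0 * XX 3 * YY 1 * YY 2 - XX 1 * XX 2 * YY 0 * YY 3)"

definition law1 :: "'a::field \<Rightarrow> 'a \<Rightarrow> 'a tuple" where
  "law1 a b = quad
     (XX 0 * XX 2 * YY 1 * YY 3 + XX 1 * XX 3 * YY 0 * YY 2)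
     (- mconst a * XX 0 * XX 3 * YY 0 * YY 3 + XX 1 * XX 2 * YY 1 * YY 2)
     (mconst (a * b) * XX 0^2 * YY 0^2 + XX 2^2 * YY 2^2)
     (mconst b * XX 0 * XX 1 * YY 0 * YY 1 + XX 2 * XX 3 * YY 2 * YY 3)"

definition law2 :: "'a::field \<Rightarrow> 'a \<Rightarrow> 'a tuple" where
  "law2 a b = (let c = - a - b in quad
     (XX 0 * XX 1 * YY 2 * YY 3 + XX 2 * XX 3 * YY 0 * YY 1)
     (mconst (a * c) * XX 0^2 * YY 0^2 + XX 1^2 * YY 1^2)
     (mconst a * XX 0 * XX 3 * YY 0 * YY 3 + XX 1 * XX 2 * YY 1 * YY 2)
     (- mconst c * XX 0 * XX 2 * YY 0 * YY 2 + XX 1 * XX 3 * YY 1 * YY 3))"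

definition law3 :: "'a::field \<Rightarrow> 'a \<Rightarrow> 'a tuple" where
  "law3 a b = (let c = - a - b in quad
     (mconst a * (XX 0 * XX 3 * YY 1 * YY 2 + XX 1 * XX 2 * YY 0 * YY 3))
     (mconst a * (mconst c * XX 0 * XX 2 * YY 0 * YY 2 + XX 1 * XX 3 * YY 1 * YY 3))
     (mconst a * (- mconst b * XX 0 * XX 1 * YY 0 * YY 1 + XX 2 * XX 3 * YY 2 * YY 3))
     (- mconst b * XX 1^2 * YY 1^2 - mconst c * XX 2^2 * YY 2^2))"

end

theory Submission
  imports Defs
begin

text \<open>The four laws are the rows of one matrix of rank one on the curve, whose entry \<open>(i, j)\<close> is
  \<open>X\<^sub>i (P - Q) X\<^sub>j (P + Q)\<close>. That a nonzero row represents the sum in the divisor class group is seen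
  by projecting the curve from the origin to a plane cubic in which \<open>P\<close>, \<open>Q\<close> and \<open>- (P + Q)\<close> are
  collinear for generic arguments; special arguments are reached by writing \<open>P + Q\<close> as
  \<open>(P + S) + (Q - S)\<close> with \<open>S\<close> generic, since this sum does not depend on \<open>S\<close>. A nonzero column
  represents \<open>P - Q\<close>, so the section given by the row \<open>i\<close> is locally a unit times \<open>X\<^sub>i\<close> of the
  difference, which identifies the exceptional divisors. For the span, a law is determined by its
  first component, and this vanishes where the sum is a point of order dividing two, in particular on
  the graphs of the four reflections \<open>X\<^sub>k \<mapsto> - X\<^sub>k\<close>; comparing coefficients there leaves exactly the
  combinations of the first column of the matrix.\<close>

text \<open>The sum is given by a definite description through linear equivalence and orders in
  local rings, so identities between coordinates say nothing about it before divisors of forms are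
  under control. Two facts provide that control, both by hand from the fourfold cover (X_0:X_1), on
  which every form of degree at least 2 is alpha + beta X_2 + gamma X_3 + epsilon X_2 X_3 with
  binary coefficients: the coordinate ring is a domain, by a norm to binary forms, and a form
  vanishing enough along the zeros of another is divisible by it. The latter excludes functions with
  a single simple pole, so the sum is unique. The chord argument yields orders only when no two of
  p, q, p + q agree up to sign and none is the origin; doubling and other coincidences are never
  computed but reached by continuity in s. The open conditions on sums are nonempty because they can
  be tested at s = T - p with T of order two, where all sums are known. Finally, laws have
  coefficients in k and points have coordinates in its closure, so the reduction to eight quadrics
  keeps coefficients in k.\<close>

no_notation fps_nth (infixl "$" 75)

lemma eq_zero_4: "(4::4) = 0"
  by simp

lemma all_4: "(\<forall>i::4. P i) \<longleftrightarrow> P 0 \<and> P 1 \<and> P 2 \<and> P 3"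
  unfolding forall_4 eq_zero_4 by blast

lemma exhaust_0123: "(i::4) = 0 \<or> i = 1 \<or> i = 2 \<or> i = 3"
  using exhaust_4[of i] unfolding eq_zero_4 by blast

lemma quad_nth [simp]:
  "quad p q r s $ 0 = p" "quad p q r s $ 1 = q" "quad p q r s $ 2 = r" "quad p q r s $ 3 = s"
  by (simp_all add: quad_def)

lemma vec4_eq_iff: "(v::'k^4) = w \<longleftrightarrow> v $ 0 = w $ 0 \<and> v $ 1 = w $ 1 \<and> v $ 2 = w $ 2 \<and> v $ 3 = w $ 3"
  unfolding vec_eq_iff all_4 ..

subsection \<open>The curve and the matrix of addition formulas\<close>

definition flip :: "4 \<Rightarrow> 'k::ring_1 ^ 4 \<Rightarrow> 'k ^ 4" where
  "flip k v = (\<chi> i. if i = k then - v $ i else v $ i)"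

lemma flip_nth: "flip k v $ i = (if i = k then - v $ i else v $ i)"
  by (simp add: flip_def)

locale jacobi_curve =
  fixes a b c :: "'k::alg_closed_field"
  assumes two: "(2::'k) \<noteq> 0" and a0: "a \<noteq> 0" and b0: "b \<noteq> 0" and c0: "c \<noteq> 0"
    and c_def: "c = - a - b"
begin

text \<open>The cone without its vertex. Vectors instead of points keep every statement a polynomial
  identity; the quotient type \<open>proj3\<close> returns only with the local rings.\<close>

definition J :: "('k ^ 4) set" where
  "J = {v. v \<noteq> 0 \<and> on_cone a b v}"

text \<open>Since a + b + c = 0 the three equations are dependent. X_2^2 and X_3^2 are solved for in
  terms of X_0 and X_1, the coordinates on the base of the fourfold cover.\<close>

lemma J_iff: "v \<in> J \<longleftrightarrow> v \<noteq> 0 \<and> (v$2)^2 = (v$1)^2 + a * (v$0)^2 \<and> (v$3)^2 = (v$1)^2 - c * (v$0)^2"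
  unfolding J_def on_cone_def Let_def c_def by (auto simp: algebra_simps)

lemma J_eqs:
  assumes "v \<in> J"
  shows "(v$2)^2 = (v$1)^2 + a * (v$0)^2" "(v$3)^2 = (v$1)^2 - c * (v$0)^2"
  using assms by (auto simp: J_iff)

text \<open>If two coordinates vanish, the equations kill the other two because a, b and c are
  nonzero. This is the form in which nonsingularity is used: at most one coordinate is zero at a
  point.\<close>

lemma J_two_nonzero:
  assumes "v \<in> J"
  shows "v$0 \<noteq> 0 \<or> v$1 \<noteq> 0" "v$0 \<noteq> 0 \<or> v$2 \<noteq> 0" "v$0 \<noteq> 0 \<or> v$3 \<noteq> 0"
    "v$1 \<noteq> 0 \<or> v$2 \<noteq> 0" "v$1 \<noteq> 0 \<or> v$3 \<noteq> 0" "v$2 \<noteq> 0 \<or> v$3 \<noteq> 0"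
proof -
  have e: "(v$2)^2 = (v$1)^2 + a * (v$0)^2" "(v$3)^2 = (v$1)^2 - c * (v$0)^2"
    using J_eqs assms by auto
  have ac: "a + c \<noteq> 0" using b0 c_def by simp
  have nz: "\<not> (v$0 = 0 \<and> v$1 = 0 \<and> v$2 = 0 \<and> v$3 = 0)"
    using assms by (auto simp: J_iff vec4_eq_iff)
  have sq: "x = 0" if "x^2 = 0" for x :: 'k using that by simp
  have sq': "x = 0" if "y * x^2 = 0" "y \<noteq> 0" for x y :: 'k using that by simp
  show "v$0 \<noteq> 0 \<or> v$1 \<noteq> 0" using e nz by auto
  show "v$0 \<noteq> 0 \<or> v$2 \<noteq> 0" using e nz by auto
  show "v$0 \<noteq> 0 \<or> v$3 \<noteq> 0" using e nz by auto
  show "v$1 \<noteq> 0 \<or> v$2 \<noteq> 0" using e nz a0 by auto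
  show "v$1 \<noteq> 0 \<or> v$3 \<noteq> 0" using e nz c0 by auto
  have "(a + c) * (v$0)^2 = 0" if "v$2 = 0" "v$3 = 0"
    using e that by (simp add: algebra_simps)
  with ac e nz show "v$2 \<noteq> 0 \<or> v$3 \<noteq> 0" by fastforce
qed

lemma J_scale: "v \<in> J \<Longrightarrow> r \<noteq> 0 \<Longrightarrow> r *s v \<in> J"
  by (auto simp: J_iff vec4_eq_iff power_mult_distrib distrib_left right_diff_distrib mult.left_commute)

lemma J_flip: "v \<in> J \<Longrightarrow> flip k v \<in> J"
  using exhaust_0123[of k] by (auto simp: J_iff vec4_eq_iff flip_nth)

definition origin :: "'k ^ 4" where
  "origin = quad 0 1 1 1"

lemma origin_in_J: "origin \<in> J"
  by (simp add: J_iff origin_def vec4_eq_iff)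

lemma sqrt_exists: "\<exists>y::'k. y^2 = x"
  by (metis nth_root_exists zero_less_numeral)

text \<open>Square roots exist, so the cover is surjective.\<close>

lemma J_lift:
  assumes "x0 \<noteq> 0 \<or> x1 \<noteq> (0::'k)"
  obtains v where "v \<in> J" "v$0 = x0" "v$1 = x1"
proof -
  obtain y z where "y^2 = x1^2 + a * x0^2" "z^2 = x1^2 - c * x0^2"
    using sqrt_exists by metis
  then have "quad x0 x1 y z \<in> J" using assms by (auto simp: J_iff vec4_eq_iff)
  then show ?thesis using that by simp
qed

text \<open>\<open>sm i x y $ j\<close> is \<open>X\<^sub>i (P - Q) X\<^sub>j (P + Q)\<close> for suitably scaled coordinates of \<open>P - Q\<close> and
  \<open>P + Q\<close>. The rows 0 to 3 are the laws 0, 2, 1, 3 in this order, the last one divided by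
  \<open>a\<close> and made symmetric.\<close>

definition sm :: "4 \<Rightarrow> 'k ^ 4 \<Rightarrow> 'k ^ 4 \<Rightarrow> 'k ^ 4" where
  "sm i x y =
    (if i = 0 then quad ((x$0)^2 * (y$1)^2 - (x$1)^2 * (y$0)^2)
        (x$0 * x$1 * y$2 * y$3 - x$2 * x$3 * y$0 * y$1)
        (x$0 * x$2 * y$1 * y$3 - x$1 * x$3 * y$0 * y$2)
        (x$0 * x$3 * y$1 * y$2 - x$1 * x$2 * y$0 * y$3)
     else if i = 1 then quad (x$0 * x$1 * y$2 * y$3 + x$2 * x$3 * y$0 * y$1)
        (a * c * (x$0)^2 * (y$0)^2 + (x$1)^2 * (y$1)^2)
        (a * x$0 * x$3 * y$0 * y$3 + x$1 * x$2 * y$1 * y$2)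
        (- c * x$0 * x$2 * y$0 * y$2 + x$1 * x$3 * y$1 * y$3)
     else if i = 2 then quad (x$0 * x$2 * y$1 * y$3 + x$1 * x$3 * y$0 * y$2)
        (- a * x$0 * x$3 * y$0 * y$3 + x$1 * x$2 * y$1 * y$2)
        (a * b * (x$0)^2 * (y$0)^2 + (x$2)^2 * (y$2)^2)
        (b * x$0 * x$1 * y$0 * y$1 + x$2 * x$3 * y$2 * y$3)
     else quad (x$0 * x$3 * y$1 * y$2 + x$1 * x$2 * y$0 * y$3)
        (c * x$0 * x$2 * y$0 * y$2 + x$1 * x$3 * y$1 * y$3)
        (- b * x$0 * x$1 * y$0 * y$1 + x$2 * x$3 * y$2 * y$3)
        (b * c * (x$0)^2 * (y$0)^2 + (x$3)^2 * (y$3)^2))"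

lemma sm_simps:
  "sm 0 x y $ 0 = (x$0)^2 * (y$1)^2 - (x$1)^2 * (y$0)^2"
    "sm 0 x y $ 1 = x$0 * x$1 * y$2 * y$3 - x$2 * x$3 * y$0 * y$1"
    "sm 0 x y $ 2 = x$0 * x$2 * y$1 * y$3 - x$1 * x$3 * y$0 * y$2"
    "sm 0 x y $ 3 = x$0 * x$3 * y$1 * y$2 - x$1 * x$2 * y$0 * y$3"
  "sm 1 x y $ 0 = x$0 * x$1 * y$2 * y$3 + x$2 * x$3 * y$0 * y$1"
    "sm 1 x y $ 1 = a * c * (x$0)^2 * (y$0)^2 + (x$1)^2 * (y$1)^2"
    "sm 1 x y $ 2 = a * x$0 * x$3 * y$0 * y$3 + x$1 * x$2 * y$1 * y$2"
    "sm 1 x y $ 3 = - c * x$0 * x$2 * y$0 * y$2 + x$1 * x$3 * y$1 * y$3"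
  "sm 2 x y $ 0 = x$0 * x$2 * y$1 * y$3 + x$1 * x$3 * y$0 * y$2"
    "sm 2 x y $ 1 = - a * x$0 * x$3 * y$0 * y$3 + x$1 * x$2 * y$1 * y$2"
    "sm 2 x y $ 2 = a * b * (x$0)^2 * (y$0)^2 + (x$2)^2 * (y$2)^2"
    "sm 2 x y $ 3 = b * x$0 * x$1 * y$0 * y$1 + x$2 * x$3 * y$2 * y$3"
  "sm 3 x y $ 0 = x$0 * x$3 * y$1 * y$2 + x$1 * x$2 * y$0 * y$3"
    "sm 3 x y $ 1 = c * x$0 * x$2 * y$0 * y$2 + x$1 * x$3 * y$1 * y$3"
    "sm 3 x y $ 2 = - b * x$0 * x$1 * y$0 * y$1 + x$2 * x$3 * y$2 * y$3"
    "sm 3 x y $ 3 = b * c * (x$0)^2 * (y$0)^2 + (x$3)^2 * (y$3)^2"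
  by (simp_all add: sm_def)

lemma flip_0_simps:
  "flip 0 v $ 0 = - v $ 0" "flip 0 v $ 1 = v $ 1" "flip 0 v $ 2 = v $ 2" "flip 0 v $ 3 = v $ 3"
  by (simp_all add: flip_nth)

text \<open>\<open>flip 0\<close> is negation, which exchanges P - Q and P + Q and hence transposes
  the matrix. Dropping the factor a of the last law makes this an exact identity.\<close>

lemma sm_flip_right: "sm i x (flip 0 y) $ j = sm j x y $ i"
  using exhaust_0123[of i] exhaust_0123[of j]
  by (elim disjE) (simp_all add: sm_def flip_nth algebra_simps)

text \<open>Entry (i, j) should be X_i(P - Q) X_j(P + Q), so all 2 by 2 minors lie in the ideal of
  the curve equations. Six pairs of rows and six pairs of columns are checked; the rest follow by
  symmetry.\<close>

lemma sm_rank_one: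
  assumes x: "x \<in> J" and y: "y \<in> J"
  shows "sm i x y $ j * sm k x y $ l = sm i x y $ l * sm k x y $ j"
proof -
  note e = J_eqs[OF x] J_eqs[OF y]
  have b: "b = - a - c" using c_def by simp
  define R where "R i k \<longleftrightarrow> (\<forall>j l. sm i x y $ j * sm k x y $ l = sm i x y $ l * sm k x y $ j)" for i k
  have R: "R i k" if "sm i x y $ 0 * sm k x y $ 1 = sm i x y $ 1 * sm k x y $ 0 \<and> sm i x y $ 0 * sm k x y $ 2 = sm i x y $ 2 * sm k x y $ 0 \<and> sm i x y $ 0 * sm k x y $ 3 = sm i x y $ 3 * sm k x y $ 0 \<and> sm i x y $ 1 * sm k x y $ 2 = sm i x y $ 2 * sm k x y $ 1 \<and> sm i x y $ 1 * sm k x y $ 3 = sm i x y $ 3 * sm k x y $ 1 \<and> sm i x y $ 2 * sm k x y $ 3 = sm i x y $ 3 * sm k x y $ 2" for i k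
    using that unfolding R_def all_4 by simp
  have R01: "R 0 1"
    by (rule R, simp add: sm_def, intro conjI; use e b in Groebner_Basis.algebra)
  have R02: "R 0 2"
    by (rule R, simp add: sm_def, intro conjI; use e b in Groebner_Basis.algebra)
  have R03: "R 0 3"
    by (rule R, simp add: sm_def, intro conjI; use e b in Groebner_Basis.algebra)
  have R12: "R 1 2"
    by (rule R, simp add: sm_def, intro conjI; use e b in Groebner_Basis.algebra)
  have R13: "R 1 3"
    by (rule R, simp add: sm_def, intro conjI; use e b in Groebner_Basis.algebra)
  have R23: "R 2 3"
    by (rule R, simp add: sm_def, intro conjI; use e b in Groebner_Basis.algebra)
  have "R i k"
  proof -
    have "R i i" for i unfolding R_def by (simp add: mult.commute)
    moreover have "R i k \<Longrightarrow> R k i" for i k unfolding R_def by (simp add: mult.commute)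
    ultimately show ?thesis
      using exhaust_0123[of i] exhaust_0123[of k] R01 R02 R03 R12 R13 R23 by metis
  qed
  then show ?thesis unfolding R_def by blast
qed

text \<open>The entries (0,0), (1,1) and (2,2) alone have no common zero: the first identifies the
  values of (X_1/X_0)^2 at the two points, and the other two prescribe incompatible values for
  it.\<close>

lemma sm_complete:
  assumes x: "x \<in> J" and y: "y \<in> J"
  obtains i j where "sm i x y $ j \<noteq> 0"
proof -
  have False if z: "\<And>i j. sm i x y $ j = 0"
  proof -
    note e = J_eqs[OF x] J_eqs[OF y]
    have 0: "(x$0)^2 * (y$1)^2 = (x$1)^2 * (y$0)^2"
      using z[of 0 0] by (simp add: sm_def)
    have 1: "(x$1)^2 * (y$1)^2 = - a * c * (x$0)^2 * (y$0)^2"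
      using z[of 1 1] by (simp add: sm_def eq_neg_iff_add_eq_0 algebra_simps)
    have 2: "(x$2)^2 * (y$2)^2 = - a * b * (x$0)^2 * (y$0)^2"
      using z[of 2 2] by (simp add: sm_def eq_neg_iff_add_eq_0 algebra_simps)
    show False
    proof (cases "x$0 = 0 \<or> y$0 = 0")
      case True
      then show ?thesis
      proof
        assume "x$0 = 0"
        with 0 1 J_two_nonzero(1)[OF x] have "y$0 = 0" "y$1 = 0" by simp_all
        with J_two_nonzero(1)[OF y] show False by simp
      next
        assume "y$0 = 0"
        with 0 1 J_two_nonzero(1)[OF y] have "x$0 = 0" "x$1 = 0" by simp_all
        with J_two_nonzero(1)[OF x] show False by simp
      qed
    next
      case False
      define p q where "p = (x$1)^2 / (x$0)^2" and "q = (y$1)^2 / (y$0)^2"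
      have "p = q" using 0 False by (simp add: p_def q_def field_simps)
      moreover have "p * q = - a * c" using 1 False by (simp add: p_def q_def field_simps)
      moreover have "(p + a) * (q + a) = - a * b"
        using 2 False unfolding e by (simp add: p_def q_def field_simps)
      ultimately have pp: "p * p = - a * c" and "(p + a) * (p + a) = - a * b" by simp_all
      \<comment> \<open>The difference of the two equations is linear in p. With a + b + c = 0 it
        says p = c, and then the first equation reads c (c + a) = 0, where c + a = - b.\<close>
      then have "a * (2 * p) = a * (2 * c)"
        using c_def by Groebner_Basis.algebra
      then have "p = c" using a0 two by simp
      with pp have "c * (c + a) = 0" by (simp add: algebra_simps)
      then show False using c0 b0 c_def by simp
    qed
  qed
  then show ?thesis using that by blast
qed

lemma sm_on_curve:
  assumes x: "x \<in> J" and y: "y \<in> J" and nz: "sm i x y \<noteq> 0"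
  shows "sm i x y \<in> J"
proof -
  note e = J_eqs[OF x] J_eqs[OF y] c_def
  have "(sm i x y $ 2)^2 = (sm i x y $1)^2 + a * (sm i x y $0)^2 \<and> (sm i x y $3)^2 = (sm i x y $1)^2 - c * (sm i x y $0)^2"
  proof -
    have "?thesis" if "i = 0" unfolding that sm_def by (simp, intro conjI; use e in Groebner_Basis.algebra)
    moreover have "?thesis" if "i = 1" unfolding that sm_def by (simp, intro conjI; use e in Groebner_Basis.algebra)
    moreover have "?thesis" if "i = 2" unfolding that sm_def by (simp, intro conjI; use e in Groebner_Basis.algebra)
    moreover have "?thesis" if "i = 3" unfolding that sm_def by (simp, intro conjI; use e in Groebner_Basis.algebra)
    ultimately show ?thesis using exhaust_0123[of i] by blast
  qed
  then show ?thesis using nz by (simp add: J_iff)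
qed

text \<open>For Q = O the sum and the difference are both P. This is also what evaluates the
  continuity argument at s = O.\<close>

lemma sm_origin_right: "sm i x origin $ j = x $ i * x $ j" if "x \<in> J"
proof -
  have b: "b = - a - c" using c_def by simp
  show ?thesis
    using exhaust_0123[of i] exhaust_0123[of j] J_eqs[OF that]
    by (elim disjE) (simp_all add: sm_def origin_def power2_eq_square)
qed

lemma sm_origin_left: "sm i origin y $ j = flip 0 y $ i * y $ j" if "y \<in> J"
  using exhaust_0123[of i] exhaust_0123[of j] J_eqs[OF that]
  by (elim disjE) (simp_all add: sm_def origin_def power2_eq_square flip_nth)

text \<open>The points of order two, scaled so that coordinate \<open>k\<close> is 1; the index is
  meant to be 1, 2 or 3.\<close>

definition torsion :: "4 \<Rightarrow> 'k ^ 4" where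
  "torsion k = (if k = 1 then quad 0 1 (-1) (-1) else if k = 2 then quad 0 (-1) 1 (-1)
    else quad 0 (-1) (-1) 1)"

text \<open>The reflection \<open>flip k\<close> sends P to T - P, where T is
  \<open>torsion k\<close>, so every row is a multiple of T. There is one family of identities for
  each reflection and each row.\<close>

lemma sm_flip: "sm i x (flip k x) $ j = torsion k $ j * (torsion k $ k * sm i x (flip k x) $ k)"
  if "x \<in> J" "k \<noteq> 0"
proof -
  note e = J_eqs[OF that(1)]
  have b: "b = - a - c" using c_def by simp
  have 10: "\<forall>j. sm 0 x (flip 1 x) $ j = torsion 1 $ j * (torsion 1 $ 1 * sm 0 x (flip 1 x) $ 1)"
    unfolding all_4 sm_def torsion_def flip_nth by (simp; (intro conjI)?; use e b in Groebner_Basis.algebra)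
  have 11: "\<forall>j. sm 1 x (flip 1 x) $ j = torsion 1 $ j * (torsion 1 $ 1 * sm 1 x (flip 1 x) $ 1)"
    unfolding all_4 sm_def torsion_def flip_nth by (simp; (intro conjI)?; use e b in Groebner_Basis.algebra)
  have 12: "\<forall>j. sm 2 x (flip 1 x) $ j = torsion 1 $ j * (torsion 1 $ 1 * sm 2 x (flip 1 x) $ 1)"
    unfolding all_4 sm_def torsion_def flip_nth by (simp; (intro conjI)?; use e b in Groebner_Basis.algebra)
  have 13: "\<forall>j. sm 3 x (flip 1 x) $ j = torsion 1 $ j * (torsion 1 $ 1 * sm 3 x (flip 1 x) $ 1)"
    unfolding all_4 sm_def torsion_def flip_nth by (simp; (intro conjI)?; use e b in Groebner_Basis.algebra)
  have 20: "\<forall>j. sm 0 x (flip 2 x) $ j = torsion 2 $ j * (torsion 2 $ 2 * sm 0 x (flip 2 x) $ 2)"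
    unfolding all_4 sm_def torsion_def flip_nth by (simp; (intro conjI)?; use e b in Groebner_Basis.algebra)
  have 21: "\<forall>j. sm 1 x (flip 2 x) $ j = torsion 2 $ j * (torsion 2 $ 2 * sm 1 x (flip 2 x) $ 2)"
    unfolding all_4 sm_def torsion_def flip_nth by (simp; (intro conjI)?; use e b in Groebner_Basis.algebra)
  have 22: "\<forall>j. sm 2 x (flip 2 x) $ j = torsion 2 $ j * (torsion 2 $ 2 * sm 2 x (flip 2 x) $ 2)"
    unfolding all_4 sm_def torsion_def flip_nth by (simp; (intro conjI)?; use e b in Groebner_Basis.algebra)
  have 23: "\<forall>j. sm 3 x (flip 2 x) $ j = torsion 2 $ j * (torsion 2 $ 2 * sm 3 x (flip 2 x) $ 2)"
    unfolding all_4 sm_def torsion_def flip_nth by (simp; (intro conjI)?; use e b in Groebner_Basis.algebra)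
  have 30: "\<forall>j. sm 0 x (flip 3 x) $ j = torsion 3 $ j * (torsion 3 $ 3 * sm 0 x (flip 3 x) $ 3)"
    unfolding all_4 sm_def torsion_def flip_nth by (simp; (intro conjI)?; use e b in Groebner_Basis.algebra)
  have 31: "\<forall>j. sm 1 x (flip 3 x) $ j = torsion 3 $ j * (torsion 3 $ 3 * sm 1 x (flip 3 x) $ 3)"
    unfolding all_4 sm_def torsion_def flip_nth by (simp; (intro conjI)?; use e b in Groebner_Basis.algebra)
  have 32: "\<forall>j. sm 2 x (flip 3 x) $ j = torsion 3 $ j * (torsion 3 $ 3 * sm 2 x (flip 3 x) $ 3)"
    unfolding all_4 sm_def torsion_def flip_nth by (simp; (intro conjI)?; use e b in Groebner_Basis.algebra)
  have 33: "\<forall>j. sm 3 x (flip 3 x) $ j = torsion 3 $ j * (torsion 3 $ 3 * sm 3 x (flip 3 x) $ 3)"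
    unfolding all_4 sm_def torsion_def flip_nth by (simp; (intro conjI)?; use e b in Groebner_Basis.algebra)
  have "k = 1 \<or> k = 2 \<or> k = 3" using exhaust_0123[of k] that(2) by blast
  then show ?thesis
  proof (elim disjE)
    assume k: "k = 1"
    show ?thesis unfolding k using exhaust_0123[of i] 10 11 12 13 by blast
  next
    assume k: "k = 2"
    show ?thesis unfolding k using exhaust_0123[of i] 20 21 22 23 by blast
  next
    assume k: "k = 3"
    show ?thesis unfolding k using exhaust_0123[of i] 30 31 32 33 by blast
  qed
qed

section \<open>Projection from the origin to a plane cubic, and its chords\<close>

definition ucoord :: "'k ^ 4 \<Rightarrow> 'k" where "ucoord x = x$1 - x$2"
definition vcoord :: "'k ^ 4 \<Rightarrow> 'k" where "vcoord x = x$2 - x$3"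

text \<open>Projection from the origin, \<open>x \<mapsto> (x$0, ucoord x, vcoord x)\<close>, maps the curve onto the plane
  cubic \<open>x0^2 (b u - a v) = u v (u + v)\<close>.\<close>

lemma cubic: "(x$0)^2 * (b * ucoord x - a * vcoord x) = ucoord x * vcoord x * (ucoord x + vcoord x)"
  if "x \<in> J"
  unfolding ucoord_def vcoord_def using J_eqs[OF that] c_def by Groebner_Basis.algebra

text \<open>The origin maps to (1:0:0) in the plane. For fixed x this is a linear form in y, the
  "vertical" line through (1:0:0) and x, which meets the cubic again in - x.\<close>

definition cross :: "'k ^ 4 \<Rightarrow> 'k ^ 4 \<Rightarrow> 'k" where
  "cross x y = ucoord x * vcoord y - vcoord x * ucoord y"

text \<open>The determinant of the plane images of z, p and q, expanded along z: the equation of the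
  line through p and q.\<close>

definition chord :: "'k ^ 4 \<Rightarrow> 'k ^ 4 \<Rightarrow> 'k ^ 4 \<Rightarrow> 'k" where
  "chord p q z = z$0 * cross p q - ucoord z * (p$0 * vcoord q - vcoord p * q$0)
     + vcoord z * (p$0 * ucoord q - ucoord p * q$0)"

lemma chord_sum: "chord p q (flip 0 (sm i p q)) = 0" if "p \<in> J" "q \<in> J"
proof -
  note e = J_eqs[OF that(1)] J_eqs[OF that(2)]
  have b: "b = - a - c" using c_def by simp
  have 0: ?thesis if "i = 0"
  proof -
    \<comment> \<open>The cofactors of the four curve equations are supplied, so that only a
      polynomial identity is left to check; each bracket vanishes on the curve. The other rows are
      treated alike.\<close>
    have "chord p q (flip 0 (sm i p q)) = (p$1*(q$0)^2*q$3 - p$3*(q$0)^2*q$1) * ((p$2)^2 - ((p$1)^2 + a * (p$0)^2)) + (0 - (p$0)^2*p$1*q$3 + (p$0)^2*p$3*q$1) * ((q$2)^2 - ((q$1)^2 + a * (q$0)^2)) + (0 - p$1*(q$0)^2*q$2 + p$2*(q$0)^2*q$1) * ((p$3)^2 - ((p$1)^2 - c * (p$0)^2)) + ((p$0)^2*p$1*q$2 - (p$0)^2*p$2*q$1) * ((q$3)^2 - ((q$1)^2 - c * (q$0)^2))"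
      unfolding that chord_def cross_def ucoord_def vcoord_def flip_0_simps sm_simps
      by Groebner_Basis.algebra
    then show ?thesis unfolding e by simp
  qed
  have 1: ?thesis if "i = 1"
  proof -
    have "chord p q (flip 0 (sm i p q)) = (c*p$0*(q$0)^2*q$2 + p$3*q$0*(q$1)^2 - p$3*q$0*q$1*q$3) * ((p$2)^2 - ((p$1)^2 + a * (p$0)^2)) + (0 - c*(p$0)^2*p$2*q$0 - p$0*(p$1)^2*q$3 + p$0*p$1*p$3*q$3) * ((q$2)^2 - ((q$1)^2 + a * (q$0)^2)) + (a*p$0*(q$0)^2*q$3 - p$2*q$0*(q$1)^2 + p$2*q$0*q$1*q$2) * ((p$3)^2 - ((p$1)^2 - c * (p$0)^2)) + (0 - a*(p$0)^2*p$3*q$0 + p$0*(p$1)^2*q$2 - p$0*p$1*p$2*q$2) * ((q$3)^2 - ((q$1)^2 - c * (q$0)^2))"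
      unfolding that chord_def cross_def ucoord_def vcoord_def flip_0_simps sm_simps
      by Groebner_Basis.algebra
    then show ?thesis unfolding e by simp
  qed
  have 2: ?thesis if "i = 2"
  proof -
    have "chord p q (flip 0 (sm i p q)) = (p$0*(q$1)^2*q$3 + p$0*q$1*(q$2)^2 - p$0*q$1*(q$3)^2 - p$0*(q$2)^2*q$3 + p$1*q$0*q$1*q$2 - p$1*q$0*(q$2)^2 + p$3*q$0*(q$2)^2 - p$3*q$0*q$2*q$3) * ((p$2)^2 - ((p$1)^2 + a * (p$0)^2)) + (a*(p$0)^3*q$1 - a*(p$0)^3*q$3 - a*(p$0)^2*p$1*q$0 + a*(p$0)^2*p$3*q$0 + p$0*(p$1)^2*q$1 - p$0*(p$1)^2*q$3 - p$0*p$1*p$2*q$1 + p$0*p$2*p$3*q$3 - (p$1)^3*q$0 + p$1*(p$3)^2*q$0) * ((q$2)^2 - ((q$1)^2 + a * (q$0)^2)) + (a*p$0*(q$0)^2*q$3 + a*p$1*(q$0)^3 + p$1*q$0*(q$1)^2 - p$1*q$0*q$1*q$2) * ((p$3)^2 - ((p$1)^2 - c * (p$0)^2)) + (0 - a*(p$0)^3*q$1 - a*(p$0)^2*p$3*q$0 - p$0*(p$1)^2*q$1 + p$0*p$1*p$2*q$1) * ((q$3)^2 - ((q$1)^2 - c * (q$0)^2))"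
      unfolding that chord_def cross_def ucoord_def vcoord_def flip_0_simps sm_simps
      using b by Groebner_Basis.algebra
    then show ?thesis unfolding e by simp
  qed
  have 3: ?thesis if "i = 3"
  proof -
    have "chord p q (flip 0 (sm i p q)) = (c*p$0*(q$0)^2*q$2 + p$1*q$0*q$1*q$3 - p$1*q$0*(q$3)^2) * ((p$2)^2 - ((p$1)^2 + a * (p$0)^2)) + (0 - c*(p$0)^2*p$2*q$0 - p$0*p$1*p$3*q$1 + p$0*(p$3)^2*q$1) * ((q$2)^2 - ((q$1)^2 + a * (q$0)^2)) + (a*p$0*(q$0)^2*q$1 + p$0*(q$1)^3 - p$0*(q$1)^2*q$2 - p$0*q$1*(q$3)^2 + p$0*q$2*(q$3)^2 - p$1*q$0*q$1*q$3 + p$1*q$0*(q$3)^2 + p$2*q$0*q$2*q$3 - p$2*q$0*(q$3)^2) * ((p$3)^2 - ((p$1)^2 - c * (p$0)^2)) + (0 - a*(p$0)^2*p$1*q$0 + c*(p$0)^3*q$1 - c*(p$0)^3*q$2 - c*(p$0)^2*p$1*q$0 + c*(p$0)^2*p$2*q$0 - p$0*(p$1)^2*q$1 + p$0*(p$1)^2*q$2 + p$0*p$1*p$3*q$1 - p$0*p$2*p$3*q$2) * ((q$3)^2 - ((q$1)^2 - c * (q$0)^2))"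
      unfolding that chord_def cross_def ucoord_def vcoord_def flip_0_simps sm_simps
      using b by Groebner_Basis.algebra
    then show ?thesis unfolding e by simp
  qed
  show ?thesis using exhaust_0123[of i] 0 1 2 3 by blast
qed

lemma uv_zero: "x \<in> J \<Longrightarrow> ucoord x = 0 \<Longrightarrow> vcoord x = 0 \<Longrightarrow> x = (x$1) *s origin \<and> x$1 \<noteq> 0"
proof -
  assume x: "x \<in> J" and "ucoord x = 0" "vcoord x = 0"
  then have 1: "x$2 = x$1" "x$3 = x$1" by (auto simp: ucoord_def vcoord_def)
  with J_eqs[OF x] a0 have "x$0 = 0" by simp
  with 1 show ?thesis using x by (auto simp: J_iff vec4_eq_iff origin_def)
qed

end

subsection \<open>Forms and bihomogeneous forms\<close>

definition monom_value :: "('v::finite \<Rightarrow> 'k::comm_ring_1) \<Rightarrow> ('v \<Rightarrow>\<^sub>0 nat) \<Rightarrow> 'k" where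
  "monom_value \<sigma> m = (\<Prod>v\<in>UNIV. \<sigma> v ^ Poly_Mapping.lookup m v)"

lemma monom_value_keys:
  "(\<Prod>v\<in>Poly_Mapping.keys m. \<sigma> v ^ Poly_Mapping.lookup m v) = monom_value \<sigma> m"
  unfolding monom_value_def by (rule prod.mono_neutral_left) (auto simp: in_keys_iff)

lemma monom_value_add: "monom_value \<sigma> (m + n) = monom_value \<sigma> m * monom_value \<sigma> n"
  by (simp add: monom_value_def lookup_add power_add prod.distrib)

lemma monom_value_0 [simp]: "monom_value \<sigma> 0 = 1"
  by (simp add: monom_value_def)

lemma monom_value_single: "monom_value \<sigma> (Poly_Mapping.single v n) = \<sigma> v ^ n"
proof -
  have "(\<Prod>u\<in>UNIV. \<sigma> u ^ Poly_Mapping.lookup (Poly_Mapping.single v n) u) = (\<Prod>u\<in>UNIV. if u = v then \<sigma> u ^ n else 1)"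
    by (rule prod.cong) (auto simp: lookup_single when_def)
  then show ?thesis by (simp add: monom_value_def)
qed

lemma mp_eval_alt:
  fixes p :: "('v::finite, 'a::zero) mpol" and h :: "'a \<Rightarrow> 'b::comm_ring_1"
  assumes "h 0 = 0" "finite S" "Poly_Mapping.keys p \<subseteq> S"
  shows "mp_eval h \<sigma> p = (\<Sum>m\<in>S. h (Poly_Mapping.lookup p m) * monom_value \<sigma> m)"
  unfolding mp_eval_def monom_value_keys
  by (rule sum.mono_neutral_left) (use assms in \<open>auto simp: in_keys_iff\<close>)

lemma mp_eval_single:
  fixes h :: "'a::zero \<Rightarrow> 'b::comm_ring_1"
  assumes "h 0 = 0"
  shows "mp_eval h \<sigma> (Poly_Mapping.single m c :: ('v::finite, 'a) mpol) = h c * monom_value \<sigma> m"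
  by (subst mp_eval_alt[where S = "{m}"]) (auto simp: assms)

lemma mp_eval_zero [simp]: "mp_eval h \<sigma> 0 = 0"
  by (simp add: mp_eval_def)

lemma mp_eval_add:
  fixes p q :: "('v::finite, 'a::comm_monoid_add) mpol" and h :: "'a \<Rightarrow> 'b::comm_ring_1"
  assumes "h 0 = 0" "\<And>x y. h (x + y) = h x + h y"
  shows "mp_eval h \<sigma> (p + q) = mp_eval h \<sigma> p + mp_eval h \<sigma> q"
proof -
  let ?S = "Poly_Mapping.keys p \<union> Poly_Mapping.keys q"
  have "Poly_Mapping.keys (p + q) \<subseteq> ?S" by (rule keys_add)
  then show ?thesis
    by (subst (1 2 3) mp_eval_alt[where S = ?S])
      (auto simp: assms lookup_add sum.distrib distrib_right)
qed

lemma mp_eval_sum: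
  fixes p :: "'i \<Rightarrow> ('v::finite, 'a::comm_monoid_add) mpol" and h :: "'a \<Rightarrow> 'b::comm_ring_1"
  assumes "h 0 = 0" "\<And>x y. h (x + y) = h x + h y"
  shows "mp_eval h \<sigma> (\<Sum>i\<in>I. p i) = (\<Sum>i\<in>I. mp_eval h \<sigma> (p i))"
  by (induction I rule: infinite_finite_induct) (simp_all add: mp_eval_add[OF assms])

lemma poly_mapping_eq_sum_single:
  "p = (\<Sum>m\<in>Poly_Mapping.keys p. Poly_Mapping.single m (Poly_Mapping.lookup p m))"
proof (rule poly_mapping_eqI)
  fix k
  have "(\<Sum>m\<in>Poly_Mapping.keys p. Poly_Mapping.lookup p m when m = k) = Poly_Mapping.lookup p k"
    by (simp add: when_def in_keys_iff)
  then show "Poly_Mapping.lookup p k =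
      Poly_Mapping.lookup (\<Sum>m\<in>Poly_Mapping.keys p. Poly_Mapping.single m (Poly_Mapping.lookup p m)) k"
    by (simp add: lookup_sum lookup_single)
qed

lemma mp_eval_mult:
  fixes p q :: "('v::finite, 'a::comm_ring_1) mpol" and h :: "'a \<Rightarrow> 'b::comm_ring_1"
  assumes h: "h 0 = 0" "\<And>x y. h (x + y) = h x + h y" "\<And>x y. h (x * y) = h x * h y"
  shows "mp_eval h \<sigma> (p * q) = mp_eval h \<sigma> p * mp_eval h \<sigma> q"
proof -
  have "p * q = (\<Sum>m\<in>Poly_Mapping.keys p. \<Sum>n\<in>Poly_Mapping.keys q.
      Poly_Mapping.single (m + n) (Poly_Mapping.lookup p m * Poly_Mapping.lookup q n))"
    by (subst poly_mapping_eq_sum_single[of p], subst poly_mapping_eq_sum_single[of q])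
      (simp only: sum_product mult_single)
  then have "mp_eval h \<sigma> (p * q) = (\<Sum>m\<in>Poly_Mapping.keys p. \<Sum>n\<in>Poly_Mapping.keys q.
      h (Poly_Mapping.lookup p m) * monom_value \<sigma> m * (h (Poly_Mapping.lookup q n) * monom_value \<sigma> n))"
    by (simp add: mp_eval_sum[where h = h, OF h(1,2)] mp_eval_single[where h = h, OF h(1)] h(3) monom_value_add mult_ac)
  also have "\<dots> = mp_eval h \<sigma> p * mp_eval h \<sigma> q"
    by (simp add: mp_eval_def monom_value_keys sum_product)
  finally show ?thesis .
qed

lemma mp_eval_mvar:
  "h 0 = 0 \<Longrightarrow> h 1 = 1 \<Longrightarrow> mp_eval h \<sigma> (mvar v :: ('v::finite, 'a::comm_ring_1) mpol) = \<sigma> v"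
  by (simp add: mvar_def mp_eval_single monom_value_single)

lemma mp_eval_mconst:
  "h 0 = 0 \<Longrightarrow> mp_eval h \<sigma> (mconst r :: ('v::finite, 'a::comm_ring_1) mpol) = h r"
  by (simp add: mconst_def mp_eval_single)

text \<open>Weights lie in an arbitrary commutative monoid, so that degree and bidegree are treated
  at once. The inner sum of constants is the multiple of \<open>w v\<close> by the exponent.\<close>

definition weight :: "('v::finite \<Rightarrow> 'm::comm_monoid_add) \<Rightarrow> ('v \<Rightarrow>\<^sub>0 nat) \<Rightarrow> 'm" where
  "weight w m = (\<Sum>v\<in>UNIV. \<Sum>k<Poly_Mapping.lookup m v. w v)"

lemma sum_const_lessThan_add:
  "(\<Sum>k<m + n. c) = (\<Sum>k<m. c) + (\<Sum>k<n. c :: 'm::comm_monoid_add)" for m n :: nat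
  by (induction n) (simp_all add: ac_simps)

lemma weight_add: "weight w (m + n) = weight w m + weight w n"
  by (simp add: weight_def lookup_add sum_const_lessThan_add sum.distrib)

lemma weight_0 [simp]: "weight w 0 = 0"
  by (simp add: weight_def)

lemma weight_single_1: "weight w (Poly_Mapping.single v 1) = w v"
proof -
  have "weight w (Poly_Mapping.single v 1) = (\<Sum>u\<in>UNIV. if u = v then w u else 0)"
    unfolding weight_def by (rule sum.cong) (auto simp: lookup_single when_def)
  then show ?thesis by simp
qed

text \<open>The functions defined by polynomials which are homogeneous of degree \<open>d\<close> with respect to the
  weights \<open>w\<close> of the variables.\<close>

inductive gform :: "('v \<Rightarrow> 'm::comm_monoid_add) \<Rightarrow> 'm \<Rightarrow> (('v \<Rightarrow> 'k::comm_ring_1) \<Rightarrow> 'k) \<Rightarrow> bool"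
  for w where
  gform_zero: "gform w d (\<lambda>_. 0)"
| gform_const: "gform w 0 (\<lambda>_. r)"
| gform_var: "gform w (w v) (\<lambda>\<sigma>. \<sigma> v)"
| gform_add: "gform w d f \<Longrightarrow> gform w d g \<Longrightarrow> gform w d (\<lambda>\<sigma>. f \<sigma> + g \<sigma>)"
| gform_mult: "gform w d f \<Longrightarrow> gform w e g \<Longrightarrow> gform w (d + e) (\<lambda>\<sigma>. f \<sigma> * g \<sigma>)"

text \<open>Substituting forms for variables multiplies degrees by a factor, or turns a bidegree
  into a degree; the additive map \<open>\<phi>\<close> of weights covers both.\<close>

lemma gform_subst:
  assumes "gform w d g" and A: "\<And>v. gform w' (\<phi> (w v)) (A v)"
    and \<phi>: "\<phi> 0 = 0" "\<And>x y. \<phi> (x + y) = \<phi> x + \<phi> y"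
  shows "gform w' (\<phi> d) (\<lambda>\<sigma>. g (\<lambda>v. A v \<sigma>))"
  using assms(1)
proof induction
  case (gform_zero d)
  show ?case by (rule gform.gform_zero)
next
  case (gform_const r)
  show ?case unfolding \<phi> by (rule gform.gform_const)
next
  case (gform_var v)
  show ?case by (rule A)
next
  case (gform_add d f g)
  from gform_add.IH show ?case by (rule gform.gform_add)
next
  case (gform_mult d f e g)
  from gform_mult.IH show ?case unfolding \<phi> by (rule gform.gform_mult)
qed

lemma gform_sum:
  "(\<And>i. i \<in> I \<Longrightarrow> gform w d (f i)) \<Longrightarrow> gform w d (\<lambda>\<sigma>. \<Sum>i\<in>I. f i \<sigma>)"
  by (induction I rule: infinite_finite_induct) (auto intro: gform_zero gform_add)

lemma gform_monom:
  fixes w :: "'v::finite \<Rightarrow> 'm::comm_monoid_add"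
  shows "gform w (weight w m) (\<lambda>\<sigma>. monom_value \<sigma> m :: 'k::comm_ring_1)"
proof -
  have p: "gform w (\<Sum>k<n. w v) (\<lambda>\<sigma>. \<sigma> v ^ n :: 'k)" for v n
  proof (induction n)
    case 0
    show ?case using gform_const[of w 1] by simp
  next
    case (Suc n)
    from gform_mult[OF this gform_var[of w v]] show ?case by (simp add: mult.commute)
  qed
  have "gform w (\<Sum>v\<in>V. \<Sum>k<Poly_Mapping.lookup m v. w v) (\<lambda>\<sigma>. (\<Prod>v\<in>V. \<sigma> v ^ Poly_Mapping.lookup m v) :: 'k)"
    if "finite V" for V
    using that
  proof (induction V)
    case empty
    show ?case using gform_const[of w 1] by simp
  next
    case (insert v V)
    from gform_mult[OF p insert.IH] insert.hyps show ?case by simp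
  qed
  from this[of UNIV] show ?thesis by (simp add: weight_def monom_value_def)
qed

lemma gform_mp_eval:
  fixes F :: "('v::finite, 'a::zero) mpol"
  assumes "\<And>m. m \<in> Poly_Mapping.keys F \<Longrightarrow> weight w m = d"
  shows "gform w d (\<lambda>\<sigma>. mp_eval h \<sigma> F)"
proof -
  have "gform w d (\<lambda>\<sigma>. h (Poly_Mapping.lookup F m) * monom_value \<sigma> m)" if "m \<in> Poly_Mapping.keys F" for m
    using gform_mult[OF gform_const gform_monom[of w m], of "h (Poly_Mapping.lookup F m)"] assms[OF that]
    by simp
  then show ?thesis
    unfolding mp_eval_def monom_value_keys by (intro gform_sum)
qed

text \<open>Links the inductive closure, on which everything below is proved, with the polynomials
  that occur in the definitions of forms.\<close>

lemma gform_iff_mp_eval: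
  "gform w d f \<longleftrightarrow> (\<exists>F :: ('v::finite, 'k::comm_ring_1) mpol.
     (\<forall>m\<in>Poly_Mapping.keys F. weight w m = d) \<and> f = (\<lambda>\<sigma>. mp_eval id \<sigma> F))"
proof
  assume "gform w d f"
  then show "\<exists>F :: ('v, 'k) mpol. (\<forall>m\<in>Poly_Mapping.keys F. weight w m = d) \<and> f = (\<lambda>\<sigma>. mp_eval id \<sigma> F)"
  proof induction
    case (gform_zero d)
    show ?case by (rule exI[of _ 0]) simp
  next
    case (gform_const r)
    have "(\<lambda>_. r) = (\<lambda>\<sigma>. mp_eval id \<sigma> (mconst r :: ('v, 'k) mpol))" by (simp add: mp_eval_mconst)
    then show ?case by (intro exI[of _ "mconst r"]) (auto simp: mconst_def id_def split: if_splits)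
  next
    case (gform_var v)
    have "(\<lambda>\<sigma>. \<sigma> v) = (\<lambda>\<sigma>. mp_eval id \<sigma> (mvar v :: ('v, 'k) mpol))" by (simp add: mp_eval_mvar)
    then show ?case
      by (intro exI[of _ "mvar v"]) (auto simp: mvar_def id_def weight_single_1[unfolded One_nat_def] split: if_splits)
  next
    case (gform_add d f g)
    then obtain F G :: "('v, 'k) mpol" where
      "\<forall>m\<in>Poly_Mapping.keys F. weight w m = d" "f = (\<lambda>\<sigma>. mp_eval id \<sigma> F)"
      "\<forall>m\<in>Poly_Mapping.keys G. weight w m = d" "g = (\<lambda>\<sigma>. mp_eval id \<sigma> G)" by blast
    moreover have "mp_eval id \<sigma> (F + G) = mp_eval id \<sigma> F + mp_eval id \<sigma> G" for \<sigma>
      by (rule mp_eval_add) simp_all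
    ultimately show ?case
      using keys_add[of F G] by (intro exI[of _ "F + G"]) (auto simp: id_def)
  next
    case (gform_mult d f e g)
    then obtain F G :: "('v, 'k) mpol" where
      "\<forall>m\<in>Poly_Mapping.keys F. weight w m = d" "f = (\<lambda>\<sigma>. mp_eval id \<sigma> F)"
      "\<forall>m\<in>Poly_Mapping.keys G. weight w m = e" "g = (\<lambda>\<sigma>. mp_eval id \<sigma> G)" by blast
    moreover have "mp_eval id \<sigma> (F * G) = mp_eval id \<sigma> F * mp_eval id \<sigma> G" for \<sigma>
      by (rule mp_eval_mult) simp_all
    moreover have "\<forall>m\<in>Poly_Mapping.keys (F * G). weight w m = d + e"
    proof
      fix m assume "m \<in> Poly_Mapping.keys (F * G)"
      then obtain i j where "m = i + j" "i \<in> Poly_Mapping.keys F" "j \<in> Poly_Mapping.keys G"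
        using keys_mult[of F G] by blast
      then show "weight w m = d + e" using calculation by (simp add: weight_add)
    qed
    ultimately show ?case by (intro exI[of _ "F * G"]) (simp add: id_def)
  qed
next
  assume "\<exists>F :: ('v, 'k) mpol. (\<forall>m\<in>Poly_Mapping.keys F. weight w m = d) \<and> f = (\<lambda>\<sigma>. mp_eval id \<sigma> F)"
  then show "gform w d f" by (auto intro: gform_mp_eval)
qed

text \<open>A form is the function it defines, and the degree is a property of that function rather
  than data; the zero function has every degree.\<close>

definition fform :: "nat \<Rightarrow> ('k::comm_ring_1 ^ 4 \<Rightarrow> 'k) \<Rightarrow> bool" where
  "fform d f \<longleftrightarrow> (\<exists>g. gform (\<lambda>_. Suc 0) d g \<and> f = (\<lambda>x. g (($) x)))"

definition biweight :: "4 + 4 \<Rightarrow> nat \<times> nat" where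
  "biweight = case_sum (\<lambda>_. (1, 0)) (\<lambda>_. (0, 1))"

definition bform :: "nat \<Rightarrow> nat \<Rightarrow> ('k::comm_ring_1 ^ 4 \<Rightarrow> 'k ^ 4 \<Rightarrow> 'k) \<Rightarrow> bool" where
  "bform d e h \<longleftrightarrow> (\<exists>g. gform biweight (d, e) g \<and> h = (\<lambda>x y. g (case_sum (($) x) (($) y))))"

lemma fform_const: "fform 0 (\<lambda>_. r)"
  unfolding fform_def using gform_const by blast

lemma fform_zero: "fform d (\<lambda>_. 0)"
  unfolding fform_def using gform_zero by blast

lemma fform_var: "fform 1 (\<lambda>x. x $ i)"
  unfolding fform_def using gform_var[of "\<lambda>_. Suc 0" i] by (intro exI[of _ "\<lambda>\<sigma>. \<sigma> i"]) simp

lemma fform_add: "fform d f \<Longrightarrow> fform d g \<Longrightarrow> fform d (\<lambda>x. f x + g x)"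
  unfolding fform_def using gform_add by blast

lemma fform_mult: "fform d f \<Longrightarrow> fform e g \<Longrightarrow> n = d + e \<Longrightarrow> fform n (\<lambda>x. f x * g x)"
  unfolding fform_def using gform_mult by blast

lemma fform_scale: "fform d f \<Longrightarrow> fform d (\<lambda>x. r * f x)"
  by (rule fform_mult[OF fform_const]) auto

lemma fform_uminus: "fform d f \<Longrightarrow> fform d (\<lambda>x. - f x)"
  using fform_scale[of d f "-1"] by simp

lemma fform_diff: "fform d f \<Longrightarrow> fform d g \<Longrightarrow> fform d (\<lambda>x. f x - g x)"
  using fform_add[OF _ fform_uminus, of d f g] by simp

lemma fform_power: "fform d f \<Longrightarrow> n = d * k \<Longrightarrow> fform n (\<lambda>x. f x ^ k)"
proof (induction k arbitrary: n)
  case 0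
  then show ?case using fform_const[of 1] by simp
next
  case (Suc k)
  then show ?case by (auto intro!: fform_mult[of d f "d * k"])
qed

lemma bform_const: "bform 0 0 (\<lambda>_ _. r)"
  unfolding bform_def using gform_const[of biweight r] by (auto simp: zero_prod_def)

lemma bform_var1: "bform 1 0 (\<lambda>x _. x $ i)"
  unfolding bform_def using gform_var[of biweight "Inl i"]
  by (intro exI[of _ "\<lambda>\<sigma>. \<sigma> (Inl i)"]) (simp add: biweight_def)

lemma bform_var2: "bform 0 1 (\<lambda>_ y. y $ i)"
  unfolding bform_def using gform_var[of biweight "Inr i"]
  by (intro exI[of _ "\<lambda>\<sigma>. \<sigma> (Inr i)"]) (simp add: biweight_def)

lemma bform_add: "bform d e f \<Longrightarrow> bform d e g \<Longrightarrow> bform d e (\<lambda>x y. f x y + g x y)"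
  unfolding bform_def using gform_add by blast

lemma bform_mult:
  "bform d e f \<Longrightarrow> bform d' e' g \<Longrightarrow> m = d + d' \<Longrightarrow> n = e + e' \<Longrightarrow> bform m n (\<lambda>x y. f x y * g x y)"
  unfolding bform_def using gform_mult[of biweight "(d, e)" _ "(d', e')"] by auto

lemma bform_scale: "bform d e f \<Longrightarrow> bform d e (\<lambda>x y. r * f x y)"
  by (rule bform_mult[OF bform_const]) auto

lemma bform_uminus: "bform d e f \<Longrightarrow> bform d e (\<lambda>x y. - f x y)"
  using bform_scale[of d e f "-1"] by simp

lemma bform_diff: "bform d e f \<Longrightarrow> bform d e g \<Longrightarrow> bform d e (\<lambda>x y. f x y - g x y)"
  using bform_add[OF _ bform_uminus, of d e f g] by simp

lemma bform_power: "bform d e f \<Longrightarrow> m = d * k \<Longrightarrow> n = e * k \<Longrightarrow> bform m n (\<lambda>x y. f x y ^ k)"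
proof (induction k arbitrary: m n)
  case 0
  then show ?case using bform_const[of 1] by simp
next
  case (Suc k)
  then show ?case by (auto intro!: bform_mult[of d e f "d * k" "e * k"])
qed

text \<open>With one moving point s and arguments depending on s by forms, this recognises a
  condition on s as the nonvanishing of a form.\<close>

lemma bform_comp:
  assumes h: "bform d e h" and A: "\<And>i. fform m (\<lambda>s. A s $ i)" and B: "\<And>i. fform n (\<lambda>s. B s $ i)"
  shows "fform (d * m + e * n) (\<lambda>s. h (A s) (B s))"
proof -
  obtain g where g: "gform biweight (d, e) g" "h = (\<lambda>x y. g (case_sum (($) x) (($) y)))"
    using h unfolding bform_def by blast
  obtain A' where A': "\<And>i. gform (\<lambda>_. Suc 0) m (A' i)" "\<And>i. (\<lambda>s. A s $ i) = (\<lambda>s. A' i (($) s))"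
    using A unfolding fform_def by metis
  obtain B' where B': "\<And>i. gform (\<lambda>_. Suc 0) n (B' i)" "\<And>i. (\<lambda>s. B s $ i) = (\<lambda>s. B' i (($) s))"
    using B unfolding fform_def by metis
  define C where "C = case_sum A' B'"
  have "gform (\<lambda>_. Suc 0) ((\<lambda>(i, j). i * m + j * n) (d, e)) (\<lambda>\<sigma>. g (\<lambda>v. C v \<sigma>))"
    by (rule gform_subst[OF g(1)]) (auto simp: C_def biweight_def A' B' zero_prod_def algebra_simps split: sum.split)
  moreover have "h (A s) (B s) = g (\<lambda>v. C v (($) s))" for s
  proof -
    have "case_sum (($) (A s)) (($) (B s)) = (\<lambda>v. C v (($) s))"
      using A'(2) B'(2) by (auto simp: C_def fun_eq_iff split: sum.split)
    then show ?thesis by (simp add: g(2))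
  qed
  ultimately show ?thesis
    unfolding fform_def by (intro exI[of _ "\<lambda>\<sigma>. g (\<lambda>v. C v \<sigma>)"]) simp
qed

text \<open>Needed to pull functions back along the difference map, whose coordinates are locally
  forms of bidegree (2, 2).\<close>

lemma fform_comp_bform:
  assumes f: "fform d f" and A: "\<And>i. bform m n (\<lambda>x y. A x y $ i)"
  shows "bform (d * m) (d * n) (\<lambda>x y. f (A x y))"
proof -
  obtain g where g: "gform (\<lambda>_. Suc 0) d g" "f = (\<lambda>x. g (($) x))"
    using f unfolding fform_def by blast
  obtain C where C: "\<And>i. gform biweight (m, n) (C i)"
    "\<And>i. (\<lambda>x y. A x y $ i) = (\<lambda>x y. C i (case_sum (($) x) (($) y)))"
    using A unfolding bform_def by metis
  have "gform biweight ((\<lambda>k. (k * m, k * n)) d) (\<lambda>\<sigma>. g (\<lambda>v. C v \<sigma>))"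
    by (rule gform_subst[OF g(1)]) (auto simp: C zero_prod_def algebra_simps)
  moreover have "f (A x y) = g (\<lambda>v. C v (case_sum (($) x) (($) y)))" for x y
  proof -
    have "($) (A x y) = (\<lambda>v. C v (case_sum (($) x) (($) y)))"
      using C(2) by (metis (no_types))
    then show ?thesis by (simp add: g(2))
  qed
  ultimately show ?thesis
    unfolding bform_def by (intro exI[of _ "\<lambda>\<sigma>. g (\<lambda>v. C v \<sigma>)"]) simp
qed

lemma fform_comp:
  assumes "fform d f" and A: "\<And>i. fform m (\<lambda>s. A s $ i)"
  shows "fform (d * m) (\<lambda>s. f (A s))"
proof -
  have "bform d 0 (\<lambda>x y. f x)"
    using fform_comp_bform[OF assms(1), of 1 0 "\<lambda>x y. x", OF bform_var1] by simp
  from bform_comp[OF this A, of 0 "\<lambda>_. 0"] show ?thesis by (simp add: fform_zero)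
qed

lemma bform_left: "bform d e h \<Longrightarrow> fform d (\<lambda>x. h x y)"
  using bform_comp[of d e h 1 "\<lambda>x. x" 0 "\<lambda>_. y", OF _ fform_var fform_const] by simp

lemma bform_right: "bform d e h \<Longrightarrow> fform e (\<lambda>y. h x y)"
  using bform_comp[of d e h 0 "\<lambda>_. x" 1 "\<lambda>y. y", OF _ fform_const fform_var] by simp

lemma fform_iff_homogeneous:
  "fform d f \<longleftrightarrow> (\<exists>F. homogeneous d F \<and> f = (\<lambda>x. mp_eval id (($) x) F))"
proof -
  have w: "weight (\<lambda>_. Suc 0) m = (\<Sum>i\<in>UNIV. Poly_Mapping.lookup m i)" for m :: "4 \<Rightarrow>\<^sub>0 nat"
    by (simp add: weight_def)
  show ?thesis
    unfolding fform_def gform_iff_mp_eval homogeneous_def w by blast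
qed

lemma weight_biweight:
  "weight biweight m = (\<Sum>i\<in>UNIV. Poly_Mapping.lookup m (Inl i), \<Sum>i\<in>UNIV. Poly_Mapping.lookup m (Inr i))"
proof -
  have r: "(\<Sum>k<n. (c, d)) = (n * c, n * d)" for n c d :: nat
    by (induction n) (auto simp: zero_prod_def)
  have "weight biweight m = (\<Sum>v\<in>UNIV <+> UNIV. \<Sum>k<Poly_Mapping.lookup m v. biweight v)"
    by (simp add: weight_def)
  also have "\<dots> = (\<Sum>i\<in>UNIV. (Poly_Mapping.lookup m (Inl i), 0)) + (\<Sum>i\<in>UNIV. (0, Poly_Mapping.lookup m (Inr i)))"
    by (subst sum.Plus) (simp_all add: biweight_def r)
  also have "\<dots> = (\<Sum>i\<in>UNIV. Poly_Mapping.lookup m (Inl i), \<Sum>i\<in>UNIV. Poly_Mapping.lookup m (Inr i))"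
    by (simp add: prod_eq_iff fst_sum snd_sum)
  finally show ?thesis .
qed

lemma bform_iff_bihomogeneous:
  "bform d e h \<longleftrightarrow> (\<exists>F. bihomogeneous d e F \<and> h = (\<lambda>x y. mp_eval id (case_sum (($) x) (($) y)) F))"
  unfolding bform_def gform_iff_mp_eval bihomogeneous_def weight_biweight by blast

lemma bform_mp_eval:
  "bihomogeneous d e F \<Longrightarrow> bform d e (\<lambda>x y. mp_eval h (case_sum (($) x) (($) y)) F)"
  unfolding bform_def bihomogeneous_def
  by (intro exI[of _ "\<lambda>\<sigma>. mp_eval h \<sigma> F"]) (auto intro!: gform_mp_eval simp: weight_biweight)

lemma fform_induct [consumes 1, case_names zero const var add mult]:
  assumes "fform d f"
    and "\<And>d. P d (\<lambda>_. 0)" and "\<And>r. P 0 (\<lambda>_. r)" and "\<And>i. P 1 (\<lambda>x. x $ i)"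
    and "\<And>d f g. fform d f \<Longrightarrow> fform d g \<Longrightarrow> P d f \<Longrightarrow> P d g \<Longrightarrow> P d (\<lambda>x. f x + g x)"
    and "\<And>d e f g. fform d f \<Longrightarrow> fform e g \<Longrightarrow> P d f \<Longrightarrow> P e g \<Longrightarrow> P (d + e) (\<lambda>x. f x * g x)"
  shows "P d f"
proof -
  have "fform d (\<lambda>x. g (($) x)) \<and> P d (\<lambda>x. g (($) x))" if "gform (\<lambda>_. Suc 0) d g" for g
    using that
  proof induction
    case (gform_add d f g)
    then show ?case using fform_add assms(5) by blast
  next
    case (gform_mult d f e g)
    then show ?case using fform_mult assms(6) by blast
  qed (use assms(2-4) fform_zero fform_const fform_var in auto)
  then show ?thesis using assms(1) unfolding fform_def by blast
qed

subsection \<open>Binary forms\<close>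

text \<open>Encoded as a form in four variables that involves only the first two, so that the rules
  for forms carry over.\<close>

definition bin :: "nat \<Rightarrow> ('k::comm_ring_1 \<Rightarrow> 'k \<Rightarrow> 'k) \<Rightarrow> bool" where
  "bin d h \<longleftrightarrow> fform d (\<lambda>x. h (x $ 0) (x $ 1))"

lemma bin_const: "bin 0 (\<lambda>_ _. r)" by (simp add: bin_def fform_const)
lemma bin_zero: "bin d (\<lambda>_ _. 0)" by (simp add: bin_def fform_zero)
lemma bin_fst: "bin 1 (\<lambda>s _. s)" unfolding bin_def by (rule fform_var)
lemma bin_snd: "bin 1 (\<lambda>_ t. t)" unfolding bin_def by (rule fform_var)
lemma bin_add: "bin d f \<Longrightarrow> bin d g \<Longrightarrow> bin d (\<lambda>s t. f s t + g s t)" by (simp add: bin_def fform_add)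
lemma bin_diff: "bin d f \<Longrightarrow> bin d g \<Longrightarrow> bin d (\<lambda>s t. f s t - g s t)" by (simp add: bin_def fform_diff)
lemma bin_mult: "bin d f \<Longrightarrow> bin e g \<Longrightarrow> n = d + e \<Longrightarrow> bin n (\<lambda>s t. f s t * g s t)"
  by (simp add: bin_def fform_mult)
lemma bin_scale: "bin d f \<Longrightarrow> bin d (\<lambda>s t. r * f s t)" by (simp add: bin_def fform_scale)
lemma bin_power: "bin d f \<Longrightarrow> n = d * k \<Longrightarrow> bin n (\<lambda>s t. f s t ^ k)" by (simp add: bin_def fform_power)

lemma bin_linear: "bin 1 (\<lambda>s t. p * s - q * t)"
  by (intro bin_diff bin_scale bin_fst bin_snd)

lemma fform_bin: "fform d f \<Longrightarrow> bin d (\<lambda>s t. f (quad s t 0 0))"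
proof -
  assume "fform d f"
  moreover have "fform 1 (\<lambda>x. quad (x$0) (x$1) 0 0 $ i)" for i
    using exhaust_0123[of i] fform_var fform_zero by (elim disjE) simp_all
  ultimately show ?thesis unfolding bin_def
    using fform_comp[of d f 1 "\<lambda>x. quad (x$0) (x$1) 0 0"] by fastforce
qed

text \<open>Division with remainder by the linear form with zero p. The remainder is the value at p
  times a power of a linear form that is 1 at p. In degree 0 the quotient has to be declared zero,
  because \<open>d - 1\<close> is truncated.\<close>

lemma bin_reduce:
  fixes h :: "'k::field \<Rightarrow> 'k \<Rightarrow> 'k"
  assumes "bin d h" and p: "p0 \<noteq> 0 \<or> p1 \<noteq> 0"
  shows "\<exists>h'. bin (d - 1) h' \<and> (d = 0 \<longrightarrow> h' = (\<lambda>_ _. 0)) \<and>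
    (\<forall>s t. h s t = h p0 p1 * (if p0 \<noteq> 0 then s / p0 else t / p1) ^ d + (p1 * s - p0 * t) * h' s t)"
proof -
  define w where "w = (\<lambda>s t. if p0 \<noteq> 0 then s / p0 else t / p1)"
  have w: "bin 1 w"
  proof (cases "p0 = 0")
    case True
    then have "w = (\<lambda>s t. inverse p1 * t)" by (simp add: w_def fun_eq_iff field_simps)
    then show ?thesis using bin_scale[OF bin_snd] by simp
  next
    case False
    then have "w = (\<lambda>s t. inverse p0 * s)" by (simp add: w_def fun_eq_iff field_simps)
    then show ?thesis using bin_scale[OF bin_fst] by simp
  qed
  define P where "P d h \<longleftrightarrow> (\<exists>h'. bin (d - 1) h' \<and> (d = 0 \<longrightarrow> h' = (\<lambda>_ _. 0)) \<and>
     (\<forall>s t. h s t = h p0 p1 * w s t ^ d + (p1 * s - p0 * t) * h' s t))" for d h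
  have "P d (\<lambda>s t. f (quad s t 0 0))" if "fform d f" for f
    using that
  proof (induction rule: fform_induct)
    case (zero d)
    show ?case unfolding P_def by (rule exI[of _ "\<lambda>_ _. 0"]) (simp add: bin_zero)
  next
    case (const r)
    show ?case unfolding P_def by (rule exI[of _ "\<lambda>_ _. 0"]) (simp add: bin_zero)
  next
    case (var i)
    have "\<exists>r. \<forall>s t. quad s t 0 0 $ i = quad p0 p1 0 0 $ i * w s t ^ 1 + (p1 * s - p0 * t) * r"
    proof (cases "p0 = 0")
      case True
      then show ?thesis using p exhaust_0123[of i]
        by (intro exI[of _ "if i = 0 then 1 / p1 else 0"]) (auto simp: w_def field_simps)
    next
      case False
      then show ?thesis using exhaust_0123[of i]
        by (intro exI[of _ "if i = 1 then - 1 / p0 else 0"]) (auto simp: w_def field_simps)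
    qed
    then obtain r where "\<forall>s t. quad s t 0 0 $ i = quad p0 p1 0 0 $ i * w s t ^ 1 + (p1 * s - p0 * t) * r" ..
    then show ?case unfolding P_def using bin_const[of r] by (metis diff_self_eq_0 zero_neq_one)
  next
    case (add d f g)
    then obtain f' g' where "bin (d - 1) f'" "bin (d - 1) g'" "d = 0 \<longrightarrow> f' = (\<lambda>_ _. 0) \<and> g' = (\<lambda>_ _. 0)"
      "\<And>s t. f (quad s t 0 0) = f (quad p0 p1 0 0) * w s t ^ d + (p1 * s - p0 * t) * f' s t"
      "\<And>s t. g (quad s t 0 0) = g (quad p0 p1 0 0) * w s t ^ d + (p1 * s - p0 * t) * g' s t"
      unfolding P_def by blast
    then show ?case unfolding P_def
      by (intro exI[of _ "\<lambda>s t. f' s t + g' s t"]) (auto simp: bin_add algebra_simps)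
  next
    case (mult d e f g)
    then obtain f' g' where *: "bin (d - 1) f'" "bin (e - 1) g'" "d = 0 \<longrightarrow> f' = (\<lambda>_ _. 0)" "e = 0 \<longrightarrow> g' = (\<lambda>_ _. 0)"
      "\<And>s t. f (quad s t 0 0) = f (quad p0 p1 0 0) * w s t ^ d + (p1 * s - p0 * t) * f' s t"
      "\<And>s t. g (quad s t 0 0) = g (quad p0 p1 0 0) * w s t ^ e + (p1 * s - p0 * t) * g' s t"
      unfolding P_def by blast
    have "bin (d + e - 1) (\<lambda>s t. f' s t * g (quad s t 0 0))"
    proof (cases "d = 0")
      case True
      then show ?thesis using *(3) bin_zero by simp
    next
      case False
      then show ?thesis by (intro bin_mult[OF *(1) fform_bin[OF mult(2)]]) simp
    qed
    moreover have "bin (d + e - 1) (\<lambda>s t. (f (quad p0 p1 0 0) * w s t ^ d) * g' s t)"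
    proof (cases "e = 0")
      case True
      then show ?thesis using *(4) bin_zero by simp
    next
      case False
      then show ?thesis by (intro bin_mult[OF bin_scale[OF bin_power[OF w refl]] *(2)]) simp
    qed
    ultimately have "bin (d + e - 1) (\<lambda>s t. f' s t * g (quad s t 0 0) + f (quad p0 p1 0 0) * w s t ^ d * g' s t)"
      by (rule bin_add)
    moreover have "f (quad s t 0 0) * g (quad s t 0 0) = f (quad p0 p1 0 0) * g (quad p0 p1 0 0) * w s t ^ (d + e)
        + (p1 * s - p0 * t) * (f' s t * g (quad s t 0 0) + f (quad p0 p1 0 0) * w s t ^ d * g' s t)" for s t
    proof -
      have "f (quad s t 0 0) * g (quad s t 0 0) = (p1 * s - p0 * t) * f' s t * g (quad s t 0 0)
          + f (quad p0 p1 0 0) * w s t ^ d * g (quad s t 0 0)"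
        by (subst *(5)) (simp add: algebra_simps)
      also have "f (quad p0 p1 0 0) * w s t ^ d * g (quad s t 0 0) = f (quad p0 p1 0 0) * w s t ^ d *
          (g (quad p0 p1 0 0) * w s t ^ e + (p1 * s - p0 * t) * g' s t)"
        by (subst *(6)) simp
      finally show ?thesis by (simp add: algebra_simps power_add)
    qed
    moreover have "d + e = 0 \<longrightarrow> (\<lambda>s t. f' s t * g (quad s t 0 0) + f (quad p0 p1 0 0) * w s t ^ d * g' s t) = (\<lambda>_ _. 0)"
      using *(3,4) by simp
    ultimately show ?case unfolding P_def by blast
  qed
  from this[OF assms(1)[unfolded bin_def]] have "P d h" by simp
  then show ?thesis unfolding P_def w_def .
qed

lemma bin_0_const:
  assumes "bin 0 h" shows "h s t = h 1 (0::'k::field)"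
proof -
  have "\<forall>s t. h s t = h 1 0" using bin_reduce[OF assms, of 1 0] by auto
  then show ?thesis by blast
qed

lemma bin_divide:
  fixes h :: "'k::field \<Rightarrow> 'k \<Rightarrow> 'k"
  assumes "bin (Suc d) h" "p0 \<noteq> 0 \<or> p1 \<noteq> 0" "h p0 p1 = 0"
  obtains h' where "bin d h'" "\<And>s t. h s t = (p1 * s - p0 * t) * h' s t"
proof -
  obtain h' where "bin d h'" "\<forall>s t. h s t = h p0 p1 * (if p0 \<noteq> 0 then s / p0 else t / p1) ^ Suc d + (p1 * s - p0 * t) * h' s t"
    using bin_reduce[OF assms(1,2)] by auto
  then show ?thesis using that assms(3) by (metis add_0 mult_zero_left)
qed

lemma bin_poly:
  fixes h :: "'k::field \<Rightarrow> 'k \<Rightarrow> 'k"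
  assumes "bin d h"
  shows "\<exists>P. degree P \<le> d \<and> (\<forall>t. h 1 t = poly P t)"
proof -
  have "\<exists>P. degree P \<le> d \<and> (\<forall>t. f (quad 1 t 0 0) = poly P t)" if "fform d f" for f :: "'k ^ 4 \<Rightarrow> 'k"
    using that
  proof (induction rule: fform_induct)
    case (zero d)
    show ?case by (rule exI[of _ 0]) simp
  next
    case (const r)
    show ?case by (rule exI[of _ "[:r:]"]) simp
  next
    case (var i)
    show ?case using exhaust_0123[of i]
      by (elim disjE) (auto intro: exI[of _ "[:0, 1:]"] exI[of _ "1"] exI[of _ "0"])
  next
    case (add d f g)
    then show ?case by (metis degree_add_le poly_add)
  next
    case (mult d e f g)
    then show ?case by (metis degree_mult_le order_trans add_mono poly_mult)
  qed
  from this[OF assms[unfolded bin_def]] show ?thesis by simp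
qed

text \<open>If (0:1) is not a zero, then \<open>h 0 1\<close> is the leading coefficient of the
  polynomial \<open>h 1 t\<close>, which therefore has positive degree.\<close>

lemma bin_root:
  fixes h :: "'k::alg_closed_field \<Rightarrow> 'k \<Rightarrow> 'k"
  assumes h: "bin (Suc d) h"
  obtains p0 p1 where "p0 \<noteq> 0 \<or> p1 \<noteq> 0" "h p0 p1 = 0"
proof (cases "h 0 1 = 0")
  case True
  then show ?thesis using that[of 0 1] by simp
next
  case False
  obtain h' where h': "bin d h'" "\<forall>s t. h s t = h 0 1 * (if (0::'k) \<noteq> 0 then s / 0 else t / 1) ^ Suc d + (1 * s - 0 * t) * h' s t"
    using bin_reduce[OF h, of 0 1] by auto
  obtain P where P: "degree P \<le> d" "\<And>t. h' 1 t = poly P t" using bin_poly[OF h'(1)] by blast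
  define Q where "Q = monom (h 0 1) (Suc d) + P"
  have "degree Q = Suc d"
    using P(1) False unfolding Q_def by (subst degree_add_eq_left) (simp_all add: degree_monom_eq)
  then obtain t where "poly Q t = 0" using alg_closed_imp_poly_has_root[of Q] by auto
  then have "h 1 t = 0" using h'(2)[rule_format, of 1 t] by (simp add: Q_def P(2) poly_monom)
  then show ?thesis using that[of 1 t] by simp
qed

lemma bin_factor:
  fixes h :: "'k::alg_closed_field \<Rightarrow> 'k \<Rightarrow> 'k"
  assumes h: "bin (Suc d) h"
  obtains p0 p1 h' where "p0 \<noteq> 0 \<or> p1 \<noteq> 0" "bin d h'" "\<And>s t. h s t = (p1 * s - p0 * t) * h' s t"
  by (metis bin_root bin_divide h)

lemma bin_finite_zeros:
  fixes h :: "'k::alg_closed_field \<Rightarrow> 'k \<Rightarrow> 'k"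
  assumes "bin d h" "h s0 t0 \<noteq> 0"
  shows "finite {t. h 1 t = 0}"
  using assms
proof (induction d arbitrary: h)
  case 0
  then show ?case using bin_0_const[of h] by (metis (mono_tags, lifting) Collect_empty_eq finite.emptyI)
next
  case (Suc d)
  obtain p0 p1 h' where p: "p0 \<noteq> 0 \<or> p1 \<noteq> 0" "bin d h'" "\<And>s t. h s t = (p1 * s - p0 * t) * h' s t"
    using bin_factor[OF Suc.prems(1)] by blast
  then have "finite {t. h' 1 t = 0}" using Suc by auto
  moreover have "finite {t. p1 - p0 * t = 0}"
  proof (cases "p0 = 0")
    case False
    then have "{t. p1 - p0 * t = 0} \<subseteq> {p1 / p0}" by (auto simp: field_simps)
    then show ?thesis using finite_subset by blast
  qed (use p in simp)
  moreover have "{t. h 1 t = 0} \<subseteq> {t. h' 1 t = 0} \<union> {t. p1 - p0 * t = 0}" using p(3) by auto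
  ultimately show ?case using finite_subset by blast
qed

lemma infinite_alg_closed: "infinite (UNIV :: 'k::alg_closed_field set)"
proof
  assume "finite (UNIV :: 'k set)"
  define P where "P = (\<Prod>x\<in>UNIV. [:- x, 1 :: 'k:]) + 1"
  have "degree (\<Prod>x\<in>UNIV. [:- x, 1 :: 'k:]) > 0"
    using \<open>finite UNIV\<close> by (subst degree_prod_eq_sum_degree) (auto simp: card_gt_0_iff)
  then have "degree P > 0" unfolding P_def by (subst degree_add_eq_left) auto
  then obtain t where "poly P t = 0" using alg_closed_imp_poly_has_root by blast
  moreover have "poly P t = 1" using \<open>finite UNIV\<close>
    by (simp add: P_def poly_prod prod_zero_iff)
  ultimately show False by simp
qed

text \<open>The zeros of each form on the line s = 1 are finite in number and the field is infinite.
  Cancellation of binary forms rests on this.\<close>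

lemma bin_mult_nonzero:
  fixes h k :: "'k::alg_closed_field \<Rightarrow> 'k \<Rightarrow> 'k"
  assumes "bin d h" "h s0 t0 \<noteq> 0" "bin e k" "k s1 t1 \<noteq> 0"
  shows "\<exists>t. h 1 t \<noteq> 0 \<and> k 1 t \<noteq> 0"
proof -
  have "finite ({t. h 1 t = 0} \<union> {t. k 1 t = 0})"
    using bin_finite_zeros assms by blast
  then have "{t. h 1 t = 0} \<union> {t. k 1 t = 0} \<noteq> UNIV"
    using infinite_alg_closed by metis
  then show ?thesis by blast
qed

lemma bin_cancel:
  fixes h k :: "'k::alg_closed_field \<Rightarrow> 'k \<Rightarrow> 'k"
  assumes "bin d h" "h s0 t0 \<noteq> 0" "bin e k" "\<And>s t. h s t * k s t = 0"
  shows "k s t = 0"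
  using bin_mult_nonzero[OF assms(1-3)] assms(4) by (metis no_zero_divisors)

text \<open>A linear factor \<open>p1 s - p0 t\<close> divides the two sides to orders of different parity.\<close>

lemma bin_descent:
  fixes A B U V :: "'k::alg_closed_field \<Rightarrow> 'k \<Rightarrow> 'k"
  assumes U: "bin m U" and V: "bin n V" and p: "p0 \<noteq> 0 \<or> p1 \<noteq> 0"
    and Up: "U p0 p1 \<noteq> 0" and Vp: "V p0 p1 \<noteq> 0"
    and "bin d A" "bin e B" "2 * d + m = 1 + n + 2 * e"
    and "\<And>s t. A s t ^ 2 * U s t = (p1 * s - p0 * t) * V s t * B s t ^ 2"
  shows "A s t = 0 \<and> B s t = 0"
  using assms(6-)
proof (induction d arbitrary: e A B s t)
  let ?l = "\<lambda>s t. p1 * s - p0 * t"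
  have l: "?l (if p1 = 0 then 0 else 1) (if p1 = 0 then 1 else 0) \<noteq> 0" using p by auto
  have A0: "A s t = 0" if B: "bin e B" "\<And>s t. B s t = 0" and A: "bin d A"
    "\<And>s t. A s t ^ 2 * U s t = (p1 * s - p0 * t) * V s t * B s t ^ 2" for A B d e s t
  proof -
    have "U s t * A s t ^ 2 = 0" for s t using A(2)[of s t] B(2)[of s t] by (simp add: mult.commute)
    then have "A s t ^ 2 = 0" using bin_cancel[OF U Up bin_power[OF A(1) refl]] by blast
    then show ?thesis by simp
  qed
  {
    case 0
    have "A p0 p1 ^ 2 * U p0 p1 = 0" using 0(4)[of p0 p1] by simp
    then have "A p0 p1 = 0" using Up by simp
    then have A: "A s t = 0" for s t using bin_0_const[OF 0(1)] by metis
    have "?l s t * (V s t * B s t ^ 2) = 0" for s t using 0(4)[of s t] A by simp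
    then have "V s t * B s t ^ 2 = 0" for s t
      using bin_cancel[OF bin_linear l bin_mult[OF V bin_power[OF 0(2) refl] refl]] by blast
    then have "B s t ^ 2 = 0" using bin_cancel[OF V Vp bin_power[OF 0(2) refl]] by blast
    then show ?case using A by simp
  next
    case (Suc d)
    note B = \<open>bin e B\<close> and eq = Suc.prems(4)
    have "A p0 p1 ^ 2 * U p0 p1 = 0" using eq[of p0 p1] by simp
    then have "A p0 p1 = 0" using Up by simp
    then obtain A' where A': "bin d A'" "\<And>s t. A s t = ?l s t * A' s t"
      using bin_divide[OF Suc.prems(1) p] by blast
    \<comment> \<open>Cancelling the linear factor moves it to the other side. Then \<open>B\<close>
      must vanish at p as well, and a second cancellation restores the original shape with the
      degrees of \<open>A\<close> and \<open>B\<close> lowered by one.\<close>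
    have "?l s t * (?l s t * A' s t ^ 2 * U s t - V s t * B s t ^ 2) = 0" for s t
      using eq[of s t] A'(2)[of s t] by (simp add: algebra_simps power2_eq_square)
    moreover have "bin (n + 2 * e) (\<lambda>s t. ?l s t * A' s t ^ 2 * U s t - V s t * B s t ^ 2)"
      by (intro bin_diff bin_mult[OF bin_mult[OF bin_linear bin_power[OF A'(1) refl] refl] U]
          bin_mult[OF V bin_power[OF B refl]]) (use Suc.prems(3) in auto)
    ultimately have eq1: "?l s t * A' s t ^ 2 * U s t - V s t * B s t ^ 2 = 0" for s t
      using bin_cancel[OF bin_linear l] by blast
    have "V p0 p1 * B p0 p1 ^ 2 = 0" using eq1[of p0 p1] by simp
    then have Bp: "B p0 p1 = 0" using Vp by simp
    show ?case
    proof (cases e)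
      case 0
      then have "B s t = 0" for s t using Bp bin_0_const B by metis
      then show ?thesis using A0[OF B _ Suc.prems(1) eq] by blast
    next
      case (Suc e')
      then obtain B' where B': "bin e' B'" "\<And>s t. B s t = ?l s t * B' s t"
        using bin_divide[of e' B, OF _ p Bp] B by blast
      have "?l s t * (A' s t ^ 2 * U s t - ?l s t * V s t * B' s t ^ 2) = 0" for s t
        using eq1[of s t] B'(2)[of s t] by (simp add: algebra_simps power2_eq_square)
      moreover have "bin (2 * d + m) (\<lambda>s t. A' s t ^ 2 * U s t - ?l s t * V s t * B' s t ^ 2)"
        by (intro bin_diff bin_mult[OF bin_power[OF A'(1) refl] U]
          bin_mult[OF bin_mult[OF bin_linear V refl] bin_power[OF B'(1) refl]]) (use Suc.prems(3) Suc in auto)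
      ultimately have "A' s t ^ 2 * U s t - ?l s t * V s t * B' s t ^ 2 = 0" for s t
        using bin_cancel[OF bin_linear l] by blast
      then have "A' s t ^ 2 * U s t = ?l s t * V s t * B' s t ^ 2" for s t by simp
      then have "A' s t = 0 \<and> B' s t = 0"
        using Suc.IH[OF A'(1) B'(1)] Suc.prems(3) Suc by auto
      then show ?thesis using A'(2) B'(2) by simp
    qed
  }
qed

lemma sum_0123: "(\<Sum>i\<in>UNIV. f (i::4)) = f 0 + f 1 + f 2 + f 3"
  using sum_4[of f] unfolding eq_zero_4 by (simp add: ac_simps)

subsection \<open>Forms on the curve\<close>

text \<open>Lets a form be built up by multiplication with one coordinate at a time, which is how
  the normal form is reached. The summands are not unique.\<close>

lemma fform_Suc:
  fixes f :: "'k::comm_ring_1 ^ 4 \<Rightarrow> 'k"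
  assumes "fform (Suc d) f"
  obtains F where "\<And>i. fform d (F i)" "\<And>x. f x = (\<Sum>i\<in>UNIV. x $ i * F i x)"
proof -
  have "n \<noteq> 0 \<longrightarrow> (\<exists>F. (\<forall>i. fform (n - 1) (F i)) \<and> (\<forall>x. f x = (\<Sum>i\<in>UNIV. x $ i * F i x)))" if "fform n f" for n
    using that
  proof (induction rule: fform_induct)
    case (zero d)
    show ?case using fform_zero by (intro impI exI[of _ "\<lambda>_ _. 0"]) simp
  next
    case (var i)
    have "\<forall>j. fform (1 - 1) (\<lambda>_. if j = i then 1 else 0 :: 'k)" by (simp add: fform_const)
    moreover have "x $ i = (\<Sum>j\<in>UNIV. x $ j * (if j = i then 1 else 0))" for x :: "'k ^ 4"
      by (simp add: if_distrib cong: if_cong)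
    ultimately show ?case by (intro impI exI[of _ "\<lambda>j _. if j = i then 1 else 0"] conjI) blast+
  next
    case (add d f g)
    show ?case
    proof
      assume "d \<noteq> 0"
      then obtain F G where "\<And>i. fform (d - 1) (F i)" "\<And>i. fform (d - 1) (G i)"
        "f = (\<lambda>x. \<Sum>i\<in>UNIV. x $ i * F i x)" "g = (\<lambda>x. \<Sum>i\<in>UNIV. x $ i * G i x)"
        using add.IH unfolding fun_eq_iff by blast
      then show "\<exists>F. (\<forall>i. fform (d - 1) (F i)) \<and> (\<forall>x. f x + g x = (\<Sum>i\<in>UNIV. x $ i * F i x))"
        by (intro exI[of _ "\<lambda>i x. F i x + G i x"]) (simp add: fform_add distrib_left sum.distrib)
    qed
  next
    case (mult d e f g)
    show ?case
    proof
      assume de: "d + e \<noteq> 0"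
      show "\<exists>F. (\<forall>i. fform (d + e - 1) (F i)) \<and> (\<forall>x. f x * g x = (\<Sum>i\<in>UNIV. x $ i * F i x))"
      proof (cases "d = 0")
        case False
        then obtain F where F: "\<And>i. fform (d - 1) (F i)" "f = (\<lambda>x. \<Sum>i\<in>UNIV. x $ i * F i x)"
          using mult.IH unfolding fun_eq_iff by blast
        have "fform (d + e - 1) (\<lambda>x. F i x * g x)" for i
          by (rule fform_mult[OF F(1) mult.hyps(2)]) (use False in simp)
        then show ?thesis
          by (intro exI[of _ "\<lambda>i x. F i x * g x"]) (simp add: F(2) sum_distrib_right mult.assoc)
      next
        case True
        then have "e \<noteq> 0" using de by simp
        then obtain G where G: "\<And>i. fform (e - 1) (G i)" "g = (\<lambda>x. \<Sum>i\<in>UNIV. x $ i * G i x)"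
          using mult.IH unfolding fun_eq_iff by blast
        have "fform (d + e - 1) (\<lambda>x. f x * G i x)" for i
          by (rule fform_mult[OF mult.hyps(1) G(1)]) (use \<open>e \<noteq> 0\<close> in simp)
        then show ?thesis
          by (intro exI[of _ "\<lambda>i x. f x * G i x"]) (simp add: G(2) sum_distrib_left mult.left_commute)
      qed
    qed
  qed simp
  from this[OF assms] show ?thesis using that by auto
qed

context jacobi_curve
begin

text \<open>The normal form of a form of degree \<open>d + 2\<close> modulo the equations of the curve.\<close>

definition dec :: "nat \<Rightarrow> ('k ^ 4 \<Rightarrow> 'k) \<Rightarrow> bool" where
  "dec d f \<longleftrightarrow> (\<exists>al be ga ep. bin (d + 2) al \<and> bin (d + 1) be \<and> bin (d + 1) ga \<and> bin d ep \<and>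
     (\<forall>x\<in>J. f x = al (x$0) (x$1) + be (x$0) (x$1) * x$2 + ga (x$0) (x$1) * x$3 + ep (x$0) (x$1) * (x$2 * x$3)))"

lemma dec_add:
  assumes "dec d f" "dec d g" shows "dec d (\<lambda>x. f x + g x)"
proof -
  obtain al be ga ep where 1: "bin (d + 2) al" "bin (d + 1) be" "bin (d + 1) ga" "bin d ep"
     "\<forall>x\<in>J. f x = al (x$0) (x$1) + be (x$0) (x$1) * x$2 + ga (x$0) (x$1) * x$3 + ep (x$0) (x$1) * (x$2 * x$3)"
    using assms(1) unfolding dec_def by blast
  obtain al' be' ga' ep' where 2: "bin (d + 2) al'" "bin (d + 1) be'" "bin (d + 1) ga'" "bin d ep'"
     "\<forall>x\<in>J. g x = al' (x$0) (x$1) + be' (x$0) (x$1) * x$2 + ga' (x$0) (x$1) * x$3 + ep' (x$0) (x$1) * (x$2 * x$3)"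
    using assms(2) unfolding dec_def by blast
  show ?thesis unfolding dec_def
    apply (rule exI[of _ "\<lambda>s t. al s t + al' s t"], rule exI[of _ "\<lambda>s t. be s t + be' s t"],
        rule exI[of _ "\<lambda>s t. ga s t + ga' s t"], rule exI[of _ "\<lambda>s t. ep s t + ep' s t"])
    using 1 2 by (intro conjI bin_add) (auto simp: algebra_simps)
qed

lemma dec_binI:
  assumes "bin (d + 2) al" "bin (d + 1) be" "bin (d + 1) ga" "bin d ep"
    "\<And>x. x \<in> J \<Longrightarrow> f x = al (x$0) (x$1) + be (x$0) (x$1) * x$2 + ga (x$0) (x$1) * x$3 + ep (x$0) (x$1) * (x$2 * x$3)"
  shows "dec d f"
  unfolding dec_def using assms by blast

lemma dec_scale:
  assumes "dec d f" shows "dec d (\<lambda>x. r * f x)"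
proof -
  obtain al be ga ep where 1: "bin (d + 2) al" "bin (d + 1) be" "bin (d + 1) ga" "bin d ep"
     "\<forall>x\<in>J. f x = al (x$0) (x$1) + be (x$0) (x$1) * x$2 + ga (x$0) (x$1) * x$3 + ep (x$0) (x$1) * (x$2 * x$3)"
    using assms(1) unfolding dec_def by blast
  show ?thesis
    by (rule dec_binI[OF bin_scale[OF 1(1), of r] bin_scale[OF 1(2), of r] bin_scale[OF 1(3), of r] bin_scale[OF 1(4), of r]])
      (use 1(5) in \<open>simp add: algebra_simps\<close>)
qed

definition q2 :: "'k \<Rightarrow> 'k \<Rightarrow> 'k" where "q2 s t = t^2 + a * s^2"
definition q3 :: "'k \<Rightarrow> 'k \<Rightarrow> 'k" where "q3 s t = t^2 - c * s^2"

lemma bin_q2: "bin 2 q2" and bin_q3: "bin 2 q3"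
  unfolding q2_def[abs_def] q3_def[abs_def]
  by (auto intro!: bin_add bin_diff bin_scale bin_power[OF bin_fst] bin_power[OF bin_snd])

lemma J_q: assumes "x \<in> J" shows "x$2 * x$2 = q2 (x$0) (x$1)" "x$3 * x$3 = q3 (x$0) (x$1)"
  using J_eqs[OF assms] by (simp_all add: q2_def q3_def power2_eq_square)

text \<open>Multiplication by X_2 or X_3 permutes the four coefficients, and \<open>q2\<close> or
  \<open>q3\<close> replaces the square that arises. Since these are binary quadratic forms, the
  degrees fit.\<close>

lemma dec_var_mult:
  assumes "dec d f" shows "dec (Suc d) (\<lambda>x. x $ i * f x)"
proof -
  obtain al be ga ep where 1: "bin (d + 2) al" "bin (d + 1) be" "bin (d + 1) ga" "bin d ep"
     "\<forall>x\<in>J. f x = al (x$0) (x$1) + be (x$0) (x$1) * x$2 + ga (x$0) (x$1) * x$3 + ep (x$0) (x$1) * (x$2 * x$3)"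
    using assms(1) unfolding dec_def by blast
  have b: "bin (Suc d + 2) (\<lambda>s t. s * al s t)" "bin (Suc d + 1) (\<lambda>s t. s * be s t)"
    "bin (Suc d + 1) (\<lambda>s t. s * ga s t)" "bin (Suc d) (\<lambda>s t. s * ep s t)"
    "bin (Suc d + 2) (\<lambda>s t. t * al s t)" "bin (Suc d + 1) (\<lambda>s t. t * be s t)"
    "bin (Suc d + 1) (\<lambda>s t. t * ga s t)" "bin (Suc d) (\<lambda>s t. t * ep s t)"
    "bin (Suc d + 2) (\<lambda>s t. q2 s t * be s t)" "bin (Suc d + 1) (\<lambda>s t. q2 s t * ep s t)"
    "bin (Suc d + 2) (\<lambda>s t. q3 s t * ga s t)" "bin (Suc d + 1) (\<lambda>s t. q3 s t * ep s t)"
    by (rule bin_mult[OF bin_fst 1(1)] bin_mult[OF bin_fst 1(2)] bin_mult[OF bin_fst 1(3)] bin_mult[OF bin_fst 1(4)]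
      bin_mult[OF bin_snd 1(1)] bin_mult[OF bin_snd 1(2)] bin_mult[OF bin_snd 1(3)] bin_mult[OF bin_snd 1(4)]
      bin_mult[OF bin_q2 1(2)] bin_mult[OF bin_q2 1(4)] bin_mult[OF bin_q3 1(3)] bin_mult[OF bin_q3 1(4)], simp)+
  have c: "bin (Suc d + 1) al" "bin (Suc d) be" "bin (Suc d) ga" using 1 by simp_all
  consider "i = 0" | "i = 1" | "i = 2" | "i = 3" using exhaust_0123[of i] by blast
  then show ?thesis
  proof cases
    assume i: "i = 0"
    show ?thesis by (rule dec_binI[OF b(1-4)]) (simp add: i 1(5) algebra_simps)
  next
    assume i: "i = 1"
    show ?thesis by (rule dec_binI[OF b(5-8)]) (simp add: i 1(5) algebra_simps)
  next
    assume i: "i = 2"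
    show ?thesis
    proof (rule dec_binI[OF b(9) c(1) b(10) c(3)])
      fix x assume x: "x \<in> J"
      show "x $ i * f x = q2 (x $ 0) (x $ 1) * be (x $ 0) (x $ 1) + al (x $ 0) (x $ 1) * x $ 2 +
         q2 (x $ 0) (x $ 1) * ep (x $ 0) (x $ 1) * x $ 3 + ga (x $ 0) (x $ 1) * (x $ 2 * x $ 3)"
        using 1(5) x unfolding J_q[OF x, symmetric] by (simp add: i algebra_simps)
    qed
  next
    assume i: "i = 3"
    show ?thesis
    proof (rule dec_binI[OF b(11) b(12) c(1) c(2)])
      fix x assume x: "x \<in> J"
      show "x $ i * f x = q3 (x $ 0) (x $ 1) * ga (x $ 0) (x $ 1) + q3 (x $ 0) (x $ 1) * ep (x $ 0) (x $ 1) * x $ 2 +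
         al (x $ 0) (x $ 1) * x $ 3 + be (x $ 0) (x $ 1) * (x $ 2 * x $ 3)"
        using 1(5) x unfolding J_q[OF x, symmetric] by (simp add: i algebra_simps)
    qed
  qed
qed

lemma dec_0I:
  assumes "\<And>x. x \<in> J \<Longrightarrow> f x = (r1 * (x$0)^2 + r2 * (x$0 * x$1) + r3 * (x$1)^2) + (r4 * x$0 + r5 * x$1) * x$2
    + (r6 * x$0 + r7 * x$1) * x$3 + r8 * (x$2 * x$3)"
  shows "dec 0 f"
proof (rule dec_binI)
  show "bin (0 + 2) (\<lambda>s t. r1 * s^2 + r2 * (s * t) + r3 * t^2)"
    by (auto intro!: bin_add bin_scale bin_power[OF bin_fst] bin_power[OF bin_snd] bin_mult[OF bin_fst bin_snd])
  show "bin (0 + 1) (\<lambda>s t. r4 * s + r5 * t)" "bin (0 + 1) (\<lambda>s t. r6 * s + r7 * t)"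
    unfolding add_0 by (intro bin_add bin_scale bin_fst bin_snd)+
  show "bin 0 (\<lambda>_ _. r8)" by (rule bin_const)
qed (use assms in simp)

lemma dec_prod2: "dec 0 (\<lambda>x. x $ i * x $ j)"
proof -
  have 00: "dec 0 (\<lambda>x. x $ 0 * x $ 0)"
    by (rule dec_0I[of _ 1 0 0 0 0 0 0 0]) (simp add: J_q q2_def q3_def power2_eq_square)
  have 01: "dec 0 (\<lambda>x. x $ 0 * x $ 1)"
    by (rule dec_0I[of _ 0 1 0 0 0 0 0 0]) (simp add: J_q q2_def q3_def power2_eq_square)
  have 02: "dec 0 (\<lambda>x. x $ 0 * x $ 2)"
    by (rule dec_0I[of _ 0 0 0 1 0 0 0 0]) (simp add: J_q q2_def q3_def power2_eq_square)
  have 03: "dec 0 (\<lambda>x. x $ 0 * x $ 3)"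
    by (rule dec_0I[of _ 0 0 0 0 0 1 0 0]) (simp add: J_q q2_def q3_def power2_eq_square)
  have 10: "dec 0 (\<lambda>x. x $ 1 * x $ 0)"
    by (rule dec_0I[of _ 0 1 0 0 0 0 0 0]) (simp add: J_q q2_def q3_def power2_eq_square)
  have 11: "dec 0 (\<lambda>x. x $ 1 * x $ 1)"
    by (rule dec_0I[of _ 0 0 1 0 0 0 0 0]) (simp add: J_q q2_def q3_def power2_eq_square)
  have 12: "dec 0 (\<lambda>x. x $ 1 * x $ 2)"
    by (rule dec_0I[of _ 0 0 0 0 1 0 0 0]) (simp add: J_q q2_def q3_def power2_eq_square)
  have 13: "dec 0 (\<lambda>x. x $ 1 * x $ 3)"
    by (rule dec_0I[of _ 0 0 0 0 0 0 1 0]) (simp add: J_q q2_def q3_def power2_eq_square)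
  have 20: "dec 0 (\<lambda>x. x $ 2 * x $ 0)"
    by (rule dec_0I[of _ 0 0 0 1 0 0 0 0]) (simp add: J_q q2_def q3_def power2_eq_square)
  have 21: "dec 0 (\<lambda>x. x $ 2 * x $ 1)"
    by (rule dec_0I[of _ 0 0 0 0 1 0 0 0]) (simp add: J_q q2_def q3_def power2_eq_square)
  have 22: "dec 0 (\<lambda>x. x $ 2 * x $ 2)"
    by (rule dec_0I[of _ a 0 1 0 0 0 0 0]) (simp add: J_q q2_def q3_def power2_eq_square)
  have 23: "dec 0 (\<lambda>x. x $ 2 * x $ 3)"
    by (rule dec_0I[of _ 0 0 0 0 0 0 0 1]) (simp add: J_q q2_def q3_def power2_eq_square)
  have 30: "dec 0 (\<lambda>x. x $ 3 * x $ 0)"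
    by (rule dec_0I[of _ 0 0 0 0 0 1 0 0]) (simp add: J_q q2_def q3_def power2_eq_square)
  have 31: "dec 0 (\<lambda>x. x $ 3 * x $ 1)"
    by (rule dec_0I[of _ 0 0 0 0 0 0 1 0]) (simp add: J_q q2_def q3_def power2_eq_square)
  have 32: "dec 0 (\<lambda>x. x $ 3 * x $ 2)"
    by (rule dec_0I[of _ 0 0 0 0 0 0 0 1]) (simp add: J_q q2_def q3_def power2_eq_square)
  have 33: "dec 0 (\<lambda>x. x $ 3 * x $ 3)"
    by (rule dec_0I[of _ "- c" 0 1 0 0 0 0 0]) (simp add: J_q q2_def q3_def power2_eq_square)
  show ?thesis
    using exhaust_0123[of i] exhaust_0123[of j]
    by (elim disjE; simp only: 00 01 02 03 10 11 12 13 20 21 22 23 30 31 32 33)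
qed

lemma dec_zero: "dec d (\<lambda>_. 0)"
  by (rule dec_binI[OF bin_zero bin_zero bin_zero bin_zero]) simp

lemma dec_sum: "(\<And>i. i \<in> I \<Longrightarrow> dec d (f i)) \<Longrightarrow> dec d (\<lambda>x. \<Sum>i\<in>I. f i x)"
  by (induction I rule: infinite_finite_induct) (auto intro: dec_zero dec_add)

lemma fform_0_const:
  assumes "fform 0 f" shows "\<exists>r. f = (\<lambda>_. r)"
proof -
  have "n = 0 \<longrightarrow> (\<exists>r. f = (\<lambda>_. r))" if "fform n f" for n f
    using that by (induction rule: fform_induct) auto
  then show ?thesis using assms by blast
qed

text \<open>The degree is shifted by two so that the coefficient of X_2 X_3 has a natural number as
  its degree. Forms of lower degree are later multiplied by the square of a coordinate
  first.\<close>

lemma fform_dec: "fform (d + 2) f \<Longrightarrow> dec d f"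
proof (induction d arbitrary: f)
  case 0
  then have "fform (Suc 1) f" by (simp add: numeral_2_eq_2)
  then obtain F where "\<And>i. fform 1 (F i)" "\<And>x. f x = (\<Sum>i\<in>UNIV. x $ i * F i x)" by (rule fform_Suc) blast
  then have F: "\<And>i. fform 1 (F i)" "f = (\<lambda>x. \<Sum>i\<in>UNIV. x $ i * F i x)" by (simp_all add: fun_eq_iff)
  have "\<exists>r. F i = (\<lambda>x. \<Sum>j\<in>UNIV. r j * x $ j)" for i
  proof -
    obtain G where G: "\<And>j. fform 0 (G j)" "F i = (\<lambda>x. \<Sum>j\<in>UNIV. x $ j * G j x)"
      using fform_Suc[of 0 "F i"] F(1)[of i] unfolding fun_eq_iff by (metis One_nat_def)
    from G(1) have "\<exists>r. G j = (\<lambda>_. r)" for j by (rule fform_0_const)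
    then obtain r where "\<And>j. G j = (\<lambda>_. r j)" by metis
    then show ?thesis unfolding G(2) by (intro exI[of _ r]) (simp add: mult.commute)
  qed
  then obtain r where r: "\<And>i. F i = (\<lambda>x. \<Sum>j\<in>UNIV. r i j * x $ j)" by metis
  have "dec 0 (\<lambda>x. \<Sum>i\<in>UNIV. \<Sum>j\<in>UNIV. r i j * (x $ i * x $ j))"
    by (intro dec_sum dec_scale dec_prod2)
  moreover have "f = (\<lambda>x. \<Sum>i\<in>UNIV. \<Sum>j\<in>UNIV. r i j * (x $ i * x $ j))"
    unfolding F(2) r by (simp add: sum_distrib_left mult_ac)
  ultimately show ?case by simp
next
  case (Suc d)
  then obtain F where F: "\<And>i. fform (d + 2) (F i)" "f = (\<lambda>x. \<Sum>i\<in>UNIV. x $ i * F i x)"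
    using fform_Suc[of "d + 2" f] unfolding fun_eq_iff by (metis add_Suc)
  show ?case unfolding F(2) by (intro dec_sum dec_var_mult Suc.IH F(1))
qed

section \<open>Norms and cancellation on the curve\<close>

definition nz :: "('k ^ 4 \<Rightarrow> 'k) \<Rightarrow> bool" where
  "nz f \<longleftrightarrow> (\<exists>x\<in>J. f x \<noteq> 0)"

text \<open>\<open>q2\<close> has the zero (1:r) with r^2 = - a, and its other linear factor takes
  the value - 2 r there; so the zero is simple and \<open>q2\<close> is not a square.\<close>

lemma q2_descent:
  assumes "bin d A" "bin e B" "d = Suc e" "\<And>s t. A s t ^ 2 = q2 s t * B s t ^ 2"
  shows "A s t = 0 \<and> B s t = 0"
proof -
  obtain r where r: "r^2 = - a" using sqrt_exists by blast
  have rn: "- 2 * r \<noteq> 0" using r a0 two by auto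
  have "bin 1 (\<lambda>s t. (-r) * s - 1 * t)" by (rule bin_linear)
  then show ?thesis
    by (rule bin_descent[OF bin_const[of 1], of 1 _ 1 r d A e B])
      (use assms rn r in \<open>simp_all add: q2_def algebra_simps power2_eq_square\<close>)
qed

lemma q3_descent:
  assumes "bin d A" "bin e B" "d = Suc e" "\<And>s t. A s t ^ 2 = q3 s t * B s t ^ 2"
  shows "A s t = 0 \<and> B s t = 0"
proof -
  obtain r where r: "r^2 = c" using sqrt_exists by blast
  have rn: "- 2 * r \<noteq> 0" using r c0 two by auto
  have "bin 1 (\<lambda>s t. (-r) * s - 1 * t)" by (rule bin_linear)
  then show ?thesis
    by (rule bin_descent[OF bin_const[of 1], of 1 _ 1 r d A e B])
      (use assms rn r in \<open>simp_all add: q3_def algebra_simps power2_eq_square\<close>)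
qed

text \<open>At the simple zero (1:r) of \<open>q3\<close>, where r^2 = c, the form \<open>q2\<close>
  has the value a + c = - b, so the product of the two is not a square either.\<close>

lemma q23_descent:
  assumes "bin d A" "bin d B" "\<And>s t. A s t ^ 2 * q2 s t = q3 s t * B s t ^ 2"
  shows "A s t = 0 \<and> B s t = 0"
proof -
  obtain r where r: "r^2 = c" using sqrt_exists by blast
  have rn: "- 2 * r \<noteq> 0" using r c0 two by auto
  have l: "bin 1 (\<lambda>s t. (-r) * s - 1 * t)" by (rule bin_linear)
  have q: "q2 1 r \<noteq> 0" using r c_def b0 by (simp add: q2_def)
  show ?thesis
    by (rule bin_descent[OF bin_q2 l, of 1 r d A d B])
      (use assms rn q r in \<open>simp_all add: q3_def algebra_simps power2_eq_square\<close>)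
qed

lemma bin_zero_or:
  assumes "bin d A" "bin e B" "\<And>s t. A s t * B s t = (0::'k)"
  shows "(\<forall>s t. A s t = 0) \<or> (\<forall>s t. B s t = 0)"
  using bin_cancel[OF assms(1) _ assms(2)] assms(3) by blast

end

lemma fform_homogeneous: "fform d f \<Longrightarrow> f (r *s x) = r ^ d * f x"
  by (induction rule: fform_induct) (simp_all add: algebra_simps power_add)

context jacobi_curve
begin

text \<open>The norm is the product over the sign changes of the last two coordinates. It is nonzero because
  \<open>q2\<close>, \<open>q3\<close> and \<open>q2 * q3\<close> are not squares of rational functions.\<close>

lemma norm_exists_aux:
  assumes "fform (d + 2) f" "nz f"
  shows "\<exists>f' e N. fform e f' \<and> bin (d + 2 + e) N \<and> (\<forall>x\<in>J. f x * f' x = N (x$0) (x$1)) \<and>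
    (\<exists>s t. N s t \<noteq> 0)"
proof -
  obtain al be ga ep where bins: "bin (d + 2) al" "bin (d + 1) be" "bin (d + 1) ga" "bin d ep" and
     f: "\<forall>x\<in>J. f x = al (x$0) (x$1) + be (x$0) (x$1) * x$2 + ga (x$0) (x$1) * x$3 + ep (x$0) (x$1) * (x$2 * x$3)"
    using fform_dec[OF assms(1)] unfolding dec_def by blast
  \<comment> \<open>A + B X_2 is the product of f with its image \<open>f3\<close> under X_3
    \<mapsto> - X_3, and N is in turn the norm of A + B X_2 to binary forms.\<close>
  define A where "A s t = al s t ^ 2 + q2 s t * be s t ^ 2 - q3 s t * (ga s t ^ 2 + q2 s t * ep s t ^ 2)" for s t
  define B where "B s t = 2 * (al s t * be s t - q3 s t * (ga s t * ep s t))" for s t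
  have sq: "bin (2 * d + 4) (\<lambda>s t. al s t ^ 2)" "bin (2 * d + 2) (\<lambda>s t. be s t ^ 2)"
    "bin (2 * d + 2) (\<lambda>s t. ga s t ^ 2)" "bin (2 * d) (\<lambda>s t. ep s t ^ 2)"
    by (rule bin_power[OF bins(1)] bin_power[OF bins(2)] bin_power[OF bins(3)] bin_power[OF bins(4)], simp)+
  have A: "bin (2 * d + 4) A"
    unfolding A_def[abs_def]
    by (intro bin_diff bin_add sq bin_mult[OF bin_q2 sq(2)] bin_mult[OF bin_q3 bin_add[OF sq(3) bin_mult[OF bin_q2 sq(4)]]]) simp_all
  have B: "bin (2 * d + 3) B"
    unfolding B_def[abs_def]
    by (intro bin_scale bin_diff bin_mult[OF bins(1,2)] bin_mult[OF bin_q3 bin_mult[OF bins(3,4)]]) simp_all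
  define N where "N s t = A s t ^ 2 - q2 s t * B s t ^ 2" for s t
  define f3 where "f3 x = al (x$0) (x$1) + be (x$0) (x$1) * x$2 - ga (x$0) (x$1) * x$3 - ep (x$0) (x$1) * (x$2 * x$3)" for x :: "'k^4"
  define f' where "f' x = f3 x * (A (x$0) (x$1) - B (x$0) (x$1) * x$2)" for x :: "'k^4"
  note ff = bins[unfolded bin_def] A[unfolded bin_def] B[unfolded bin_def]
  have "fform (d + 2) f3"
    unfolding f3_def[abs_def]
    by (intro fform_add fform_diff ff fform_mult[OF ff(2) fform_var] fform_mult[OF ff(3) fform_var]
      fform_mult[OF ff(4) fform_mult[OF fform_var fform_var]]) simp_all
  then have "fform (3 * d + 6) f'"
    unfolding f'_def[abs_def]
    by (rule fform_mult[OF _ fform_diff[OF ff(5) fform_mult[OF ff(6) fform_var]]]) simp_all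
  moreover have "bin (d + 2 + (3 * d + 6)) N"
    unfolding N_def[abs_def]
    by (intro bin_diff bin_power[OF A] bin_mult[OF bin_q2 bin_power[OF B refl]]) simp_all
  moreover have "f x * f' x = N (x$0) (x$1)" if "x \<in> J" for x
  proof -
    have "f x = al (x$0) (x$1) + be (x$0) (x$1) * x$2 + ga (x$0) (x$1) * x$3 + ep (x$0) (x$1) * (x$2 * x$3)"
      using f that by blast
    then show ?thesis
      unfolding f'_def f3_def N_def A_def B_def using J_q[OF that] by Groebner_Basis.algebra
  qed
  moreover have "\<exists>s t. N s t \<noteq> 0"
  proof (rule ccontr)
    assume "\<not> ?thesis"
    then have A2: "A s t ^ 2 = q2 s t * B s t ^ 2" for s t by (simp add: N_def)
    have "A s t = 0 \<and> B s t = 0" for s t by (rule q2_descent[OF A B _ A2]) simp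
    then have AB: "A s t = 0" "B s t = 0" for s t by blast+
    \<comment> \<open>A = B = 0 means (al + be X_2)^2 = q3 (ga + ep X_2)^2. Multiplied by (ga - ep
      X_2)^2 this becomes (r + u X_2)^2 = q3 n^2 with r + u X_2 = (al + be X_2)(ga - ep X_2) and n
      the norm of ga + ep X_2. Its components are 2 r u = 0 and r^2 + q2 u^2 = q3 n^2.\<close>
    define n where "n s t = ga s t ^ 2 - q2 s t * ep s t ^ 2" for s t
    define r where "r s t = al s t * ga s t - q2 s t * (be s t * ep s t)" for s t
    define u where "u s t = be s t * ga s t - al s t * ep s t" for s t
    have n: "bin (2 * d + 2) n" and r: "bin (2 * d + 3) r" and u: "bin (2 * d + 2) u"
      unfolding n_def[abs_def] r_def[abs_def] u_def[abs_def]
      by (intro bin_diff bin_mult[OF bins(1,3)] bin_mult[OF bins(2,3)] bin_mult[OF bins(1,4)] sq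
          bin_mult[OF bin_q2 bin_mult[OF bins(2,4)]] bin_mult[OF bin_q2 sq(4)]; simp)+
    have "2 * (r s t * u s t) = B s t * (ga s t ^ 2 + q2 s t * ep s t ^ 2) - 2 * A s t * ga s t * ep s t" for s t
      unfolding r_def u_def A_def B_def by Groebner_Basis.algebra
    then have "2 * (r s t * u s t) = 0" for s t using AB by simp
    then have "r s t * u s t = 0" for s t using two by (metis mult_eq_0_iff)
    moreover have e: "r s t ^ 2 + q2 s t * u s t ^ 2 = q3 s t * n s t ^ 2" for s t
    proof -
      have "r s t ^ 2 + q2 s t * u s t ^ 2 - q3 s t * n s t ^ 2
        = A s t * (ga s t ^ 2 + q2 s t * ep s t ^ 2) - 2 * q2 s t * B s t * ga s t * ep s t"
        unfolding r_def u_def A_def B_def n_def by Groebner_Basis.algebra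
      then show ?thesis using AB by simp
    qed
    ultimately have "(\<forall>s t. r s t = 0) \<or> (\<forall>s t. u s t = 0)" using bin_zero_or[OF r u] by blast
    then have "n s t = 0" for s t
    proof
      assume "\<forall>s t. u s t = 0"
      then have r2: "r s t ^ 2 = q3 s t * n s t ^ 2" for s t using e[of s t] by simp
      have "r s t = 0 \<and> n s t = 0" by (rule q3_descent[OF r n _ r2]) simp
      then show ?thesis ..
    next
      assume "\<forall>s t. r s t = 0"
      then have "u s t ^ 2 * q2 s t = q3 s t * n s t ^ 2" for s t using e[of s t] by (simp add: mult.commute)
      then show ?thesis using q23_descent[OF u n] by blast
    qed
    then have ga2: "ga s t ^ 2 = q2 s t * ep s t ^ 2" for s t by (simp add: n_def)
    have "ga s t = 0 \<and> ep s t = 0" for s t by (rule q2_descent[OF bins(3,4) _ ga2]) simp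
    then have ge: "ga s t = 0" "ep s t = 0" for s t by blast+
    have "2 * (al s t * be s t) = 0" for s t using AB(2)[of s t] ge by (simp add: B_def)
    then have "al s t * be s t = 0" for s t using two by (metis mult_eq_0_iff)
    then have ab: "(\<forall>s t. al s t = 0) \<or> (\<forall>s t. be s t = 0)" using bin_zero_or[OF bins(1,2)] by blast
    have A0: "al s t ^ 2 + q2 s t * be s t ^ 2 = 0" for s t using AB(1)[of s t] ge by (simp add: A_def)
    have q2n: "q2 0 1 \<noteq> 0" by (simp add: q2_def)
    have "al s t = 0 \<and> be s t = 0" for s t
    proof (cases "\<forall>s t. be s t = 0")
      case True
      then show ?thesis using A0[of s t] by simp
    next
      case False
      then have "\<forall>s t. al s t = 0" using ab by blast
      then have "q2 s t * be s t ^ 2 = 0" for s t using A0[of s t] by simp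
      then have "be s t ^ 2 = 0" for s t using bin_cancel[OF bin_q2 q2n bin_power[OF bins(2) refl]] by blast
      then show ?thesis using \<open>\<forall>s t. al s t = 0\<close> by simp
    qed
    then have "\<forall>x\<in>J. f x = 0" using f ge by simp
    then show False using assms(2) unfolding nz_def by blast
  qed
  ultimately show ?thesis by blast
qed

text \<open>All degrees are reached by multiplying with the square of a coordinate that does not
  vanish where f is nonzero; the square is then moved into the cofactor.\<close>

lemma norm_exists:
  assumes f: "fform d f" "nz f"
  obtains f' e N where "fform e f'" "bin (d + e) N" "\<And>x. x \<in> J \<Longrightarrow> f x * f' x = N (x$0) (x$1)"
    "\<exists>s t. N s t \<noteq> 0"
proof -
  obtain x where x: "x \<in> J" "f x \<noteq> 0" using f(2) unfolding nz_def by blast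
  then obtain n where n: "x $ n \<noteq> 0" using J_two_nonzero(1) by blast
  have "fform (d + 2) (\<lambda>x. (x $ n) ^ 2 * f x)"
    by (rule fform_mult[OF fform_power[OF fform_var] f(1)]) simp_all
  moreover have "nz (\<lambda>x. (x $ n) ^ 2 * f x)" using x n unfolding nz_def by auto
  ultimately obtain f' e N where N: "fform e f'" "bin (d + 2 + e) N"
    "\<forall>x\<in>J. ((x $ n) ^ 2 * f x) * f' x = N (x$0) (x$1)" "\<exists>s t. N s t \<noteq> 0"
    using norm_exists_aux[of d "\<lambda>x. (x $ n) ^ 2 * f x"] by blast
  have "fform (2 + e) (\<lambda>x. (x $ n) ^ 2 * f' x)"
    by (rule fform_mult[OF fform_power[OF fform_var] N(1)]) simp_all
  moreover have "f x * ((x $ n) ^ 2 * f' x) = N (x$0) (x$1)" if "x \<in> J" for x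
    using N(3) that by (simp add: mult_ac)
  moreover have "bin (d + (2 + e)) N" using N(2) by (simp add: add.assoc)
  ultimately show ?thesis using that N(4) by blast
qed

text \<open>The two norms are nonzero at a common point of the base, and any point of the curve
  above it will do.\<close>

lemma nz_mult:
  assumes f: "fform d f" "nz f" and g: "fform e g" "nz g"
  shows "nz (\<lambda>x. f x * g x)"
proof -
  obtain f' m N where N: "bin (d + m) N" "\<And>x. x \<in> J \<Longrightarrow> f x * f' x = N (x$0) (x$1)" "\<exists>s t. N s t \<noteq> 0"
    using norm_exists[OF f] by metis
  obtain g' m' N' where N': "bin (e + m') N'" "\<And>x. x \<in> J \<Longrightarrow> g x * g' x = N' (x$0) (x$1)" "\<exists>s t. N' s t \<noteq> 0"
    using norm_exists[OF g] by metis
  obtain t where "N 1 t \<noteq> 0" "N' 1 t \<noteq> 0" using bin_mult_nonzero[OF N(1) _ N'(1)] N(3) N'(3) by blast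
  moreover obtain v where "v \<in> J" "v $ 0 = 1" "v $ 1 = t" using J_lift[of 1 t] by auto
  ultimately have "f v \<noteq> 0" "g v \<noteq> 0" "v \<in> J" using N(2)[of v] N'(2)[of v] by auto
  then show ?thesis unfolding nz_def by auto
qed

lemma form_cancel:
  assumes "fform d f" "nz f" "fform e g" "\<And>x. x \<in> J \<Longrightarrow> f x * g x = 0" "x \<in> J"
  shows "g x = 0"
  using nz_mult[OF assms(1-3)] assms(4,5) unfolding nz_def by blast

lemma form_cancel_eq:
  assumes "fform d f" "nz f" "fform e g" "fform e h" "\<And>x. x \<in> J \<Longrightarrow> f x * g x = f x * h x" "x \<in> J"
  shows "g x = h x"
  using form_cancel[OF assms(1,2) fform_diff[OF assms(3,4)], of x] assms(5,6) by (simp add: algebra_simps)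

lemma nz_power: "fform d f \<Longrightarrow> nz f \<Longrightarrow> nz (\<lambda>x. f x ^ n)"
proof (induction n)
  case 0
  then show ?case using origin_in_J unfolding nz_def by auto
next
  case (Suc n)
  then show ?case using nz_mult[OF Suc.prems fform_power[OF Suc.prems(1) refl], of n] by simp
qed

text \<open>A linear form with a simple zero at \<open>p\<close>. The pencil spanned by \<open>X\<^sub>0\<close> and \<open>X\<^sub>1\<close> provides it unless its
  member through \<open>p\<close> is tangent there, which happens if \<open>X\<^sub>2\<close> or \<open>X\<^sub>3\<close> vanishes at \<open>p\<close>.\<close>

definition lam :: "'k ^ 4 \<Rightarrow> 'k ^ 4 \<Rightarrow> 'k" where
  "lam p x = (if p$2 = 0 then x$2 else if p$3 = 0 then x$3 else p$1 * x$0 - p$0 * x$1)"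

lemma fform_lam: "fform 1 (lam p)"
  unfolding lam_def[abs_def]
  by (cases "p$2 = 0"; cases "p$3 = 0") (auto intro!: fform_diff fform_scale fform_var[simplified])

lemma lam_self: "lam p p = 0"
  by (simp add: lam_def mult.commute)

lemma nz_lam: assumes "p \<in> J" shows "nz (lam p)"
proof -
  have "lam p origin \<noteq> 0 \<or> p$2 \<noteq> 0 \<and> p$3 \<noteq> 0 \<and> p$0 = 0" by (auto simp: lam_def origin_def)
  moreover have "nz (lam p)" if p: "p$2 \<noteq> 0" "p$3 \<noteq> 0" "p$0 = 0"
  proof -
    obtain v where "v \<in> J" "v $ 0 = 1" "v $ 1 = 0" using J_lift[of 1 0] by auto
    moreover have "p$1 \<noteq> 0" using J_two_nonzero(1)[OF assms] p by simp
    ultimately show ?thesis using p unfolding nz_def by (intro bexI[of _ v]) (auto simp: lam_def)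
  qed
  ultimately show ?thesis using origin_in_J unfolding nz_def by blast
qed

subsection \<open>Orders of vanishing\<close>

text \<open>\<open>lam p\<close> generates the maximal ideal of the local ring at p. Typically the
  difference of squares (p_n X_i)^2 - (p_i X_n)^2 is a multiple of \<open>lam p\<close> on the
  curve, while its factor p_n X_i + p_i X_n is a unit at p. The coordinate X_n is nonzero at p and
  turns the constant p_i into a linear form.\<close>

lemma local_var:
  assumes p: "p \<in> J" and n: "n = (if p$0 \<noteq> 0 then 0 else 1)"
  obtains g F where "fform 1 g" "fform 1 F" "g p \<noteq> 0"
    "\<And>x. x \<in> J \<Longrightarrow> g x * (x $ i - p $ i * (x $ n / p $ n)) = lam p x * F x"
proof -
  define P where "P i \<longleftrightarrow> (\<exists>g F. fform 1 g \<and> fform 1 F \<and> g p \<noteq> 0 \<and>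
    (\<forall>x\<in>J. g x * (x $ i - p $ i * (x $ n / p $ n)) = lam p x * F x))" for i
  have pn: "p $ n \<noteq> 0" using J_two_nonzero(1)[OF p] n by auto
  have lin: "fform 1 (\<lambda>x. r * x $ i + s * x $ j)" for r s i j
    by (intro fform_add fform_scale fform_var)
  have PI: "P i"
    if eq: "\<And>x. x \<in> J \<Longrightarrow> (r1 * x $ i1 + r2 * x $ i2) * (p $ n * x $ i - p $ i * x $ n) = lam p x * (r3 * x $ i3 + r4 * x $ i4)"
      and nz: "r1 * p $ i1 + r2 * p $ i2 \<noteq> 0" for i r1 i1 r2 i2 r3 i3 r4 i4
  proof -
    have "(r1 * x $ i1 + r2 * x $ i2) * (x $ i - p $ i * (x $ n / p $ n))
        = lam p x * (inverse (p $ n) * (r3 * x $ i3 + r4 * x $ i4))" if "x \<in> J" for x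
    proof -
      have "(r1 * x $ i1 + r2 * x $ i2) * (x $ i - p $ i * (x $ n / p $ n))
        = ((r1 * x $ i1 + r2 * x $ i2) * (p $ n * x $ i - p $ i * x $ n)) * inverse (p $ n)"
        using pn by (simp add: field_simps)
      then show ?thesis unfolding eq[OF that] by simp
    qed
    then show ?thesis unfolding P_def using nz lin[of r1 i1 r2 i2] fform_scale[OF lin[of r3 i3 r4 i4]] by blast
  qed
  note e = J_eqs[OF p]
  \<comment> \<open>The value at p of the conjugate linear factor; it is a unit because 2 is
    nonzero.\<close>
  have dbl: "u * v + v * u \<noteq> 0" if "u \<noteq> 0" "v \<noteq> 0" for u v :: 'k
    using that two by (metis mult.commute mult_2 mult_eq_0_iff)
  have same: "P n"
    by (rule PI[of 1 n 0 n _ 0 n 0 n]) (use pn in simp_all)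
  have "P 0 \<and> P 1 \<and> P 2 \<and> P 3"
  proof (cases "p$2 \<noteq> 0 \<and> p$3 \<noteq> 0")
    case nn: True
    then have l: "lam p x = p$1 * x$0 - p$0 * x$1" for x by (simp add: lam_def)
    show ?thesis
    proof (cases "p$0 = 0")
      case True
      then have n1: "n = 1" using n by simp
      have p1: "p$1 \<noteq> 0" using pn n1 by simp
      have "P 0"
      proof (rule PI[of 1 1 0 1 _ 1 1 0 1])
        fix x assume "x \<in> J"
        from J_eqs[OF this] e True show "(1 * x $ 1 + 0 * x $ 1) * (p $ n * x $ 0 - p $ 0 * x $ n) = lam p x * (1 * x $ 1 + 0 * x $ 1)"
          by (simp add: l n1)
      qed (use p1 in simp)
      moreover have "P 2"
      proof (rule PI[of "p$1" 2 "p$2" 1 _ "(a * p$1)" 0 0 0])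
        fix x assume "x \<in> J"
        from J_eqs[OF this] e True show "(p$1 * x $ 2 + p$2 * x $ 1) * (p $ n * x $ 2 - p $ 2 * x $ n) = lam p x * ((a * p$1) * x $ 0 + 0 * x $ 0)"
          unfolding l n1 by Groebner_Basis.algebra
      qed (use dbl p1 nn in simp)
      moreover have "P 3"
      proof (rule PI[of "p$1" 3 "p$3" 1 _ "(- c * p$1)" 0 0 0])
        fix x assume "x \<in> J"
        from J_eqs[OF this] e True show "(p$1 * x $ 3 + p$3 * x $ 1) * (p $ n * x $ 3 - p $ 3 * x $ n) = lam p x * ((- c * p$1) * x $ 0 + 0 * x $ 0)"
          unfolding l n1 by Groebner_Basis.algebra
      qed (use dbl p1 nn in simp)
      ultimately show ?thesis using same n1 by simp
    next
      case False
      then have n0: "n = 0" using n by simp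
      have "P 1"
      proof (rule PI[of 1 0 0 0 _ "(- 1)" 0 0 0])
        fix x assume "x \<in> J"
        from J_eqs[OF this] e  show "(1 * x $ 0 + 0 * x $ 0) * (p $ n * x $ 1 - p $ 1 * x $ n) = lam p x * ((- 1) * x $ 0 + 0 * x $ 0)"
          by (simp add: l n0 algebra_simps)
      qed (use False in simp)
      moreover have "P 2"
      proof (rule PI[of "p$0" 2 "p$2" 0 _ "(- p$0)" 1 "(- p$1)" 0])
        fix x assume "x \<in> J"
        from J_eqs[OF this] e  show "(p$0 * x $ 2 + p$2 * x $ 0) * (p $ n * x $ 2 - p $ 2 * x $ n) = lam p x * ((- p$0) * x $ 1 + (- p$1) * x $ 0)"
          unfolding l n0 by Groebner_Basis.algebra
      qed (use dbl False nn in simp)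
      moreover have "P 3"
      proof (rule PI[of "p$0" 3 "p$3" 0 _ "(- p$0)" 1 "(- p$1)" 0])
        fix x assume "x \<in> J"
        from J_eqs[OF this] e  show "(p$0 * x $ 3 + p$3 * x $ 0) * (p $ n * x $ 3 - p $ 3 * x $ n) = lam p x * ((- p$0) * x $ 1 + (- p$1) * x $ 0)"
          unfolding l n0 by Groebner_Basis.algebra
      qed (use dbl False nn in simp)
      ultimately show ?thesis using same n0 by simp
    qed
  next
    case False
    then have p0: "p$0 \<noteq> 0" using J_two_nonzero[OF p] by blast
    then have n0: "n = 0" using n by simp
    show ?thesis
    proof (cases "p$2 = 0")
      case True
      then have l: "lam p x = x$2" for x by (simp add: lam_def)
      have nn: "p$1 \<noteq> 0" "p$3 \<noteq> 0" using J_two_nonzero[OF p] True by auto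
      have "P 1"
      proof (rule PI[of "p$0" 1 "p$1" 0 _ "((p$0)^2)" 2 0 0])
        fix x assume "x \<in> J"
        from J_eqs[OF this] e True show "(p$0 * x $ 1 + p$1 * x $ 0) * (p $ n * x $ 1 - p $ 1 * x $ n) = lam p x * (((p$0)^2) * x $ 2 + 0 * x $ 0)"
          unfolding l n0 by Groebner_Basis.algebra
      qed (use dbl p0 nn in simp)
      moreover have "P 2"
      proof (rule PI[of 1 0 0 0 _ "p$0" 0 0 0])
        fix x assume "x \<in> J"
        from J_eqs[OF this] e True show "(1 * x $ 0 + 0 * x $ 0) * (p $ n * x $ 2 - p $ 2 * x $ n) = lam p x * (p$0 * x $ 0 + 0 * x $ 0)"
          unfolding l n0 by Groebner_Basis.algebra
      qed (use p0 in simp)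
      moreover have "P 3"
      proof (rule PI[of "p$0" 3 "p$3" 0 _ "((p$0)^2)" 2 0 0])
        fix x assume "x \<in> J"
        from J_eqs[OF this] e True show "(p$0 * x $ 3 + p$3 * x $ 0) * (p $ n * x $ 3 - p $ 3 * x $ n) = lam p x * (((p$0)^2) * x $ 2 + 0 * x $ 0)"
          unfolding l n0 by Groebner_Basis.algebra
      qed (use dbl p0 nn in simp)
      ultimately show ?thesis using same n0 by simp
    next
      case nt: False
      then have True: "p$3 = 0" using False by simp
      then have l: "lam p x = x$3" for x using nt by (simp add: lam_def)
      have nn: "p$1 \<noteq> 0" "p$2 \<noteq> 0" using J_two_nonzero[OF p] True by auto
      have "P 1"
      proof (rule PI[of "p$0" 1 "p$1" 0 _ "((p$0)^2)" 3 0 0])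
        fix x assume "x \<in> J"
        from J_eqs[OF this] e True show "(p$0 * x $ 1 + p$1 * x $ 0) * (p $ n * x $ 1 - p $ 1 * x $ n) = lam p x * (((p$0)^2) * x $ 3 + 0 * x $ 0)"
          unfolding l n0 by Groebner_Basis.algebra
      qed (use dbl p0 nn in simp)
      moreover have "P 3"
      proof (rule PI[of 1 0 0 0 _ "p$0" 0 0 0])
        fix x assume "x \<in> J"
        from J_eqs[OF this] e True show "(1 * x $ 0 + 0 * x $ 0) * (p $ n * x $ 3 - p $ 3 * x $ n) = lam p x * (p$0 * x $ 0 + 0 * x $ 0)"
          unfolding l n0 by Groebner_Basis.algebra
      qed (use p0 in simp)
      moreover have "P 2"
      proof (rule PI[of "p$0" 2 "p$2" 0 _ "((p$0)^2)" 3 0 0])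
        fix x assume "x \<in> J"
        from J_eqs[OF this] e True show "(p$0 * x $ 2 + p$2 * x $ 0) * (p $ n * x $ 2 - p $ 2 * x $ n) = lam p x * (((p$0)^2) * x $ 3 + 0 * x $ 0)"
          unfolding l n0 by Groebner_Basis.algebra
      qed (use dbl p0 nn in simp)
      ultimately show ?thesis using same n0 by simp
    qed
  qed
  then have "P i" using exhaust_0123[of i] by blast
  then show ?thesis using that unfolding P_def by blast
qed

text \<open>Expansion to first order at p: known for the coordinates, it is carried to all forms by
  the sum and product rules, the unit factors being multiplied together.\<close>

lemma local_const:
  assumes p: "p \<in> J" and n: "n = (if p$0 \<noteq> 0 then 0 else 1)" and f: "fform d f"
  shows "\<exists>m g F. fform (Suc m) g \<and> fform (m + d) F \<and> g p \<noteq> 0 \<and>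
    (\<forall>x\<in>J. g x * (f x - f p * (x $ n / p $ n) ^ d) = lam p x * F x)"
  using f
proof (induction rule: fform_induct)
  have pn: "p $ n \<noteq> 0" using J_two_nonzero(1)[OF p] n by auto
  let ?w = "\<lambda>x :: 'k ^ 4. x $ n / p $ n"
  have w: "fform 1 ?w"
    using fform_scale[OF fform_var, of "inverse (p $ n)" n] by (simp add: field_simps)
  {
    case (zero d)
    show ?case
      by (rule exI[of _ 0], rule exI[of _ "\<lambda>x. x $ n"], rule exI[of _ "\<lambda>_. 0"])
        (use fform_var[of n] fform_zero pn in auto)
  next
    case (const r)
    show ?case
      by (rule exI[of _ 0], rule exI[of _ "\<lambda>x. x $ n"], rule exI[of _ "\<lambda>_. 0"])
        (use fform_var[of n] fform_zero pn in auto)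
  next
    case (var i)
    obtain g F where "fform 1 g" "fform 1 F" "g p \<noteq> 0"
      "\<And>x. x \<in> J \<Longrightarrow> g x * (x $ i - p $ i * (x $ n / p $ n)) = lam p x * F x"
      using local_var[OF p n] by metis
    then show ?case
      by (intro exI[of _ 0] exI[of _ g] exI[of _ F]) simp
  next
    case (add d f1 f2)
    then obtain m1 g1 F1 m2 g2 F2 where
      1: "fform (Suc m1) g1" "fform (m1 + d) F1" "g1 p \<noteq> 0" "\<forall>x\<in>J. g1 x * (f1 x - f1 p * ?w x ^ d) = lam p x * F1 x" and
      2: "fform (Suc m2) g2" "fform (m2 + d) F2" "g2 p \<noteq> 0" "\<forall>x\<in>J. g2 x * (f2 x - f2 p * ?w x ^ d) = lam p x * F2 x"
      by blast
    have "fform (Suc (Suc (m1 + m2))) (\<lambda>x. g1 x * g2 x)" by (rule fform_mult[OF 1(1) 2(1)]) simp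
    moreover have "fform (Suc (m1 + m2) + d) (\<lambda>x. F1 x * g2 x + g1 x * F2 x)"
      by (rule fform_add[OF fform_mult[OF 1(2) 2(1)] fform_mult[OF 1(1) 2(2)]]) simp_all
    moreover have "\<forall>x\<in>J. (g1 x * g2 x) * ((f1 x + f2 x) - (f1 p + f2 p) * ?w x ^ d) = lam p x * (F1 x * g2 x + g1 x * F2 x)"
    proof
      fix x assume x: "x \<in> J"
      have "(g1 x * g2 x) * ((f1 x + f2 x) - (f1 p + f2 p) * ?w x ^ d)
        = (g1 x * (f1 x - f1 p * ?w x ^ d)) * g2 x + g1 x * (g2 x * (f2 x - f2 p * ?w x ^ d))"
        by (simp add: algebra_simps)
      also have "\<dots> = lam p x * (F1 x * g2 x + g1 x * F2 x)"
        using 1(4) 2(4) x by (simp add: algebra_simps)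
      finally show "(g1 x * g2 x) * ((f1 x + f2 x) - (f1 p + f2 p) * ?w x ^ d) = lam p x * (F1 x * g2 x + g1 x * F2 x)" .
    qed
    moreover have "g1 p * g2 p \<noteq> 0" using 1 2 by simp
    ultimately show ?case by blast
  next
    case (mult d e f1 f2)
    then obtain m1 g1 F1 m2 g2 F2 where
      1: "fform (Suc m1) g1" "fform (m1 + d) F1" "g1 p \<noteq> 0" "\<forall>x\<in>J. g1 x * (f1 x - f1 p * ?w x ^ d) = lam p x * F1 x" and
      2: "fform (Suc m2) g2" "fform (m2 + e) F2" "g2 p \<noteq> 0" "\<forall>x\<in>J. g2 x * (f2 x - f2 p * ?w x ^ e) = lam p x * F2 x"
      by blast
    have "fform (Suc (Suc (m1 + m2))) (\<lambda>x. g1 x * g2 x)" by (rule fform_mult[OF 1(1) 2(1)]) simp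
    moreover have "fform (Suc (m1 + m2) + (d + e)) (\<lambda>x. F1 x * (g2 x * f2 x) + (f1 p * ?w x ^ d) * (g1 x * F2 x))"
      by (intro fform_add fform_mult[OF 1(2) fform_mult[OF 2(1) mult(2) refl]]
          fform_mult[OF fform_scale[OF fform_power[OF w refl]] fform_mult[OF 1(1) 2(2) refl]]) simp_all
    moreover have "\<forall>x\<in>J. (g1 x * g2 x) * (f1 x * f2 x - (f1 p * f2 p) * ?w x ^ (d + e))
        = lam p x * (F1 x * (g2 x * f2 x) + (f1 p * ?w x ^ d) * (g1 x * F2 x))"
    proof
      fix x assume x: "x \<in> J"
      have "(g1 x * g2 x) * (f1 x * f2 x - (f1 p * f2 p) * ?w x ^ (d + e))
        = (g1 x * (f1 x - f1 p * ?w x ^ d)) * (g2 x * f2 x) + (f1 p * ?w x ^ d) * g1 x * (g2 x * (f2 x - f2 p * ?w x ^ e))"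
        by (simp only: power_add) (simp add: algebra_simps)
      also have "\<dots> = lam p x * (F1 x * (g2 x * f2 x) + (f1 p * ?w x ^ d) * (g1 x * F2 x))"
        by (subst 1(4)[rule_format, OF x], subst 2(4)[rule_format, OF x]) (simp only: algebra_simps)
      finally show "(g1 x * g2 x) * (f1 x * f2 x - (f1 p * f2 p) * ?w x ^ (d + e))
        = lam p x * (F1 x * (g2 x * f2 x) + (f1 p * ?w x ^ d) * (g1 x * F2 x))" .
    qed
    moreover have "g1 p * g2 p \<noteq> 0" using 1 2 by simp
    ultimately show ?case by blast
  }
qed

text \<open>The order of vanishing of the form \<open>f\<close> of degree \<open>d\<close> at \<open>p\<close> is at least, or equal to, \<open>n\<close>: the factor
  \<open>g\<close> is a unit at \<open>p\<close> which absorbs the other zeros of \<open>lam p\<close>.\<close>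

definition vge :: "'k ^ 4 \<Rightarrow> nat \<Rightarrow> ('k ^ 4 \<Rightarrow> 'k) \<Rightarrow> nat \<Rightarrow> bool" where
  "vge p d f n \<longleftrightarrow> (\<exists>m e g F. fform m g \<and> fform e F \<and> m + d = n + e \<and> g p \<noteq> 0 \<and>
     (\<forall>x\<in>J. g x * f x = lam p x ^ n * F x))"

definition vo :: "'k ^ 4 \<Rightarrow> nat \<Rightarrow> ('k ^ 4 \<Rightarrow> 'k) \<Rightarrow> nat \<Rightarrow> bool" where
  "vo p d f n \<longleftrightarrow> (\<exists>m e g F. fform m g \<and> fform e F \<and> m + d = n + e \<and> g p \<noteq> 0 \<and> F p \<noteq> 0 \<and>
     (\<forall>x\<in>J. g x * f x = lam p x ^ n * F x))"

lemma voI: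
  "fform m g \<Longrightarrow> fform e F \<Longrightarrow> m + d = n + e \<Longrightarrow> g p \<noteq> 0 \<Longrightarrow> F p \<noteq> 0 \<Longrightarrow>
    (\<And>x. x \<in> J \<Longrightarrow> g x * f x = lam p x ^ n * F x) \<Longrightarrow> vo p d f n"
  unfolding vo_def by blast

lemma vo_imp_vge: "vo p d f n \<Longrightarrow> vge p d f n"
  unfolding vo_def vge_def by blast

lemma vo_0: "fform d f \<Longrightarrow> f p \<noteq> 0 \<Longrightarrow> vo p d f 0"
  by (rule voI[OF fform_const[of 1]]) auto

lemma vge_0: "fform d f \<Longrightarrow> vge p d f 0"
  unfolding vge_def using fform_const[of 1]
  by (intro exI[of _ 0] exI[of _ d] exI[of _ "\<lambda>_. 1"] exI[of _ f]) auto

lemma vo_mult: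
  assumes "vo p d f n" "vo p d' f' n'" shows "vo p (d + d') (\<lambda>x. f x * f' x) (n + n')"
proof -
  obtain m e g F where 1: "fform m g" "fform e F" "m + d = n + e" "g p \<noteq> 0" "F p \<noteq> 0" "\<forall>x\<in>J. g x * f x = lam p x ^ n * F x"
    using assms(1) unfolding vo_def by blast
  obtain m' e' g' F' where 2: "fform m' g'" "fform e' F'" "m' + d' = n' + e'" "g' p \<noteq> 0" "F' p \<noteq> 0" "\<forall>x\<in>J. g' x * f' x = lam p x ^ n' * F' x"
    using assms(2) unfolding vo_def by blast
  show ?thesis
  proof (rule voI[OF fform_mult[OF 1(1) 2(1) refl] fform_mult[OF 1(2) 2(2) refl]])
    fix x assume x: "x \<in> J"
    have "g x * g' x * (f x * f' x) = (g x * f x) * (g' x * f' x)" by (simp add: mult_ac)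
    also have "\<dots> = lam p x ^ (n + n') * (F x * F' x)" using 1(6) 2(6) x by (simp add: power_add mult_ac)
    finally show "g x * g' x * (f x * f' x) = lam p x ^ (n + n') * (F x * F' x)" .
  qed (use 1 2 in auto)
qed

lemma vge_mult:
  assumes "vge p d f n" "vge p d' f' n'" shows "vge p (d + d') (\<lambda>x. f x * f' x) (n + n')"
proof -
  obtain m e g F where 1: "fform m g" "fform e F" "m + d = n + e" "g p \<noteq> 0" "\<forall>x\<in>J. g x * f x = lam p x ^ n * F x"
    using assms(1) unfolding vge_def by blast
  obtain m' e' g' F' where 2: "fform m' g'" "fform e' F'" "m' + d' = n' + e'" "g' p \<noteq> 0" "\<forall>x\<in>J. g' x * f' x = lam p x ^ n' * F' x"
    using assms(2) unfolding vge_def by blast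
  have "g x * g' x * (f x * f' x) = lam p x ^ (n + n') * (F x * F' x)" if "x \<in> J" for x
  proof -
    have "g x * g' x * (f x * f' x) = (g x * f x) * (g' x * f' x)" by (simp add: mult_ac)
    also have "\<dots> = lam p x ^ (n + n') * (F x * F' x)" using 1(5) 2(5) that by (simp add: power_add mult_ac)
    finally show ?thesis .
  qed
  then show ?thesis unfolding vge_def
    using fform_mult[OF 1(1) 2(1) refl] fform_mult[OF 1(2) 2(2) refl] 1(3,4) 2(3,4)
    by (intro exI[of _ "m + m'"] exI[of _ "e + e'"] exI[of _ "\<lambda>x. g x * g' x"] exI[of _ "\<lambda>x. F x * F' x"]) auto
qed

lemma vge_add:
  assumes "vge p d f n" "vge p d f' n" shows "vge p d (\<lambda>x. f x + f' x) n"
proof -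
  obtain m e g F where 1: "fform m g" "fform e F" "m + d = n + e" "g p \<noteq> 0" "\<forall>x\<in>J. g x * f x = lam p x ^ n * F x"
    using assms(1) unfolding vge_def by blast
  obtain m' e' g' F' where 2: "fform m' g'" "fform e' F'" "m' + d = n + e'" "g' p \<noteq> 0" "\<forall>x\<in>J. g' x * f' x = lam p x ^ n * F' x"
    using assms(2) unfolding vge_def by blast
  have "fform (m + e') (\<lambda>x. g' x * F x + g x * F' x)"
    by (intro fform_add fform_mult[OF 2(1) 1(2)] fform_mult[OF 1(1) 2(2)]) (use 1(3) 2(3) in auto)
  moreover have "g x * g' x * (f x + f' x) = lam p x ^ n * (g' x * F x + g x * F' x)" if "x \<in> J" for x
  proof -
    have "g x * g' x * (f x + f' x) = g' x * (g x * f x) + g x * (g' x * f' x)" by (simp add: algebra_simps)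
    also have "\<dots> = lam p x ^ n * (g' x * F x + g x * F' x)" using 1(5) 2(5) that by (simp add: algebra_simps)
    finally show ?thesis .
  qed
  ultimately show ?thesis unfolding vge_def
    using fform_mult[OF 1(1) 2(1) refl] 1(3,4) 2(3,4)
    by (intro exI[of _ "m + m'"] exI[of _ "m + e'"] exI[of _ "\<lambda>x. g x * g' x"] exI[of _ "\<lambda>x. g' x * F x + g x * F' x"]) auto
qed

lemma vge_1:
  assumes "p \<in> J" "fform d f" "f p = 0" shows "vge p d f 1"
proof -
  obtain m g F where "fform (Suc m) g" "fform (m + d) F" "g p \<noteq> 0"
    "\<forall>x\<in>J. g x * (f x - f p * (x $ (if p$0 \<noteq> 0 then 0 else 1) / p $ (if p$0 \<noteq> 0 then 0 else 1)) ^ d) = lam p x * F x"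
    using local_const[OF assms(1) refl assms(2)] by blast
  then show ?thesis unfolding vge_def using assms(3)
    by (intro exI[of _ "Suc m"] exI[of _ "m + d"] exI[of _ g] exI[of _ F]) auto
qed

lemma vge_Suc_zero: "p \<in> J \<Longrightarrow> vge p d f (Suc n) \<Longrightarrow> f p = 0"
  unfolding vge_def by (auto simp: lam_self)

text \<open>Either the cofactor is a unit at p or, vanishing there, it contributes another factor
  \<open>lam p\<close>.\<close>

lemma vge_Suc_or:
  assumes "p \<in> J" "vge p d f n" shows "vo p d f n \<or> vge p d f (Suc n)"
proof -
  obtain m e g F where 1: "fform m g" "fform e F" "m + d = n + e" "g p \<noteq> 0" "\<forall>x\<in>J. g x * f x = lam p x ^ n * F x"
    using assms(2) unfolding vge_def by blast
  show ?thesis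
  proof (cases "F p = 0")
    case False
    then show ?thesis using 1 unfolding vo_def by blast
  next
    case True
    then obtain m' e' g' F' where 2: "fform m' g'" "fform e' F'" "m' + e = 1 + e'" "g' p \<noteq> 0" "\<forall>x\<in>J. g' x * F x = lam p x ^ 1 * F' x"
      using vge_1[OF assms(1) 1(2)] unfolding vge_def by blast
    have "(g x * g' x) * f x = lam p x ^ Suc n * F' x" if "x \<in> J" for x
    proof -
      have "(g x * g' x) * f x = (g x * f x) * g' x" by (simp add: mult_ac)
      also have "\<dots> = (lam p x ^ n * F x) * g' x" using 1(5) that by simp
      also have "\<dots> = lam p x ^ n * (g' x * F x)" by (simp add: mult_ac)
      also have "\<dots> = lam p x ^ n * (lam p x * F' x)" using 2(5) that by simp
      finally show ?thesis by (simp add: mult_ac)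
    qed
    then have "vge p d f (Suc n)" unfolding vge_def
      using fform_mult[OF 1(1) 2(1) refl] 1 2
      by (intro exI[of _ "m + m'"] exI[of _ e'] exI[of _ "\<lambda>x. g x * g' x"] exI[of _ F']) auto
    then show ?thesis ..
  qed
qed

text \<open>If k were larger, the power of \<open>lam p\<close> with exponent n could be cancelled
  from the two factorisations; at p one side would then be zero and the other a product of
  units.\<close>

lemma vo_vge_le:
  assumes p: "p \<in> J" and "vo p d f n" "vge p d f k" shows "k \<le> n"
proof (rule ccontr)
  assume "\<not> k \<le> n"
  obtain m e g F where 1: "fform m g" "fform e F" "m + d = n + e" "g p \<noteq> 0" "F p \<noteq> 0" "\<forall>x\<in>J. g x * f x = lam p x ^ n * F x"
    using assms(2) unfolding vo_def by blast
  obtain m' e' g' F' where 2: "fform m' g'" "fform e' F'" "m' + d = k + e'" "g' p \<noteq> 0" "\<forall>x\<in>J. g' x * f x = lam p x ^ k * F' x"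
    using assms(3) unfolding vge_def by blast
  define j where "j = k - n"
  have j: "k = n + j" "j > 0" using \<open>\<not> k \<le> n\<close> by (auto simp: j_def)
  have f1: "fform (m' + e) (\<lambda>x. F x * g' x)" by (rule fform_mult[OF 1(2) 2(1)]) simp
  have f2: "fform (m' + e) (\<lambda>x. lam p x ^ j * (F' x * g x))"
    by (rule fform_mult[OF fform_power[OF fform_lam] fform_mult[OF 2(2) 1(1) refl]]) (use 1(3) 2(3) j in auto)
  have "F p * g' p = lam p p ^ j * (F' p * g p)"
  proof (rule form_cancel_eq[OF fform_power[OF fform_lam refl] nz_power[OF fform_lam nz_lam[OF p]] f1 f2 _ p, of n])
    fix x assume x: "x \<in> J"
    have "lam p x ^ n * (F x * g' x) = (g x * f x) * g' x" using 1(6) x by (simp add: mult_ac)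
    also have "\<dots> = (g' x * f x) * g x" by (simp add: mult_ac)
    also have "\<dots> = lam p x ^ n * (lam p x ^ j * (F' x * g x))" using 2(5) x by (simp add: j power_add mult_ac)
    finally show "lam p x ^ n * (F x * g' x) = lam p x ^ n * (lam p x ^ j * (F' x * g x))" .
  qed
  then show False using j 1(5) 2(4) by (simp add: lam_self zero_power)
qed

lemma vo_unique: "p \<in> J \<Longrightarrow> vo p d f n \<Longrightarrow> vo p d f n' \<Longrightarrow> n = n'"
  using vo_vge_le vo_imp_vge by (meson le_antisym)

lemma vo_cong: "vo p d f n \<Longrightarrow> (\<And>x. x \<in> J \<Longrightarrow> f x = f' x) \<Longrightarrow> vo p d f' n"
  unfolding vo_def by metis

lemma vge_cong: "vge p d f n \<Longrightarrow> (\<And>x. x \<in> J \<Longrightarrow> f x = f' x) \<Longrightarrow> vge p d f' n"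
  unfolding vge_def by metis

lemma vo_nz: assumes p: "p \<in> J" and "vo p d f n" shows "nz f"
proof -
  obtain m e g F where 1: "fform e F" "F p \<noteq> 0" "\<forall>x\<in>J. g x * f x = lam p x ^ n * F x"
    using assms(2) unfolding vo_def by blast
  have "nz F" using 1 p unfolding nz_def by blast
  then have "nz (\<lambda>x. lam p x ^ n * F x)"
    by (rule nz_mult[OF fform_power[OF fform_lam refl] nz_power[OF fform_lam nz_lam[OF p]] 1(1)])
  then show ?thesis using 1(3) unfolding nz_def by (metis mult_zero_right)
qed

text \<open>A member of the pencil of X_0 and X_1 through p is \<open>lam p\<close> up to a
  constant, or the square of \<open>lam p\<close> up to a unit if p is a ramification point of the
  cover, that is if X_2 or X_3 vanishes at p.\<close>

lemma vo_linear:
  assumes p: "p \<in> J" and q: "q0 \<noteq> 0 \<or> q1 \<noteq> 0"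
  shows "\<exists>n. vo p 1 (\<lambda>x. q1 * x$0 - q0 * x$1) n"
proof (cases "q1 * p$0 - q0 * p$1 = 0")
  case False
  have "fform 1 (\<lambda>x. q1 * x$0 - q0 * x$1)" by (intro fform_diff fform_scale fform_var)
  from vo_0[of 1 _ p, OF this] False show ?thesis by blast
next
  case True
  obtain k where k: "k \<noteq> 0" "q0 = k * p$0" "q1 = k * p$1"
  proof (cases "p$0 = 0")
    case True
    then have "p$1 \<noteq> 0" using J_two_nonzero(1)[OF p] by simp
    with True \<open>q1 * p$0 - q0 * p$1 = 0\<close> q that[of "q1 / p$1"] show ?thesis by auto
  next
    case False
    then have "q1 = q0 / p$0 * p$1" using \<open>q1 * p$0 - q0 * p$1 = 0\<close> by (simp add: field_simps)
    with False q that[of "q0 / p$0"] show ?thesis by auto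
  qed
  have eq: "q1 * x$0 - q0 * x$1 = k * (p$1 * x$0 - p$0 * x$1)" for x :: "'k^4" by (simp add: k algebra_simps)
  show ?thesis
  proof (cases "p$2 \<noteq> 0 \<and> p$3 \<noteq> 0")
    case True
    have "vo p 1 (\<lambda>x. q1 * x$0 - q0 * x$1) 1"
      by (rule voI[OF fform_const[of 1] fform_const[of k]]) (use k True in \<open>simp_all add: lam_def algebra_simps\<close>)
    then show ?thesis ..
  next
    case False
    then have pn: "p$0 \<noteq> 0" "p$1 \<noteq> 0" using J_two_nonzero[OF p] by blast+
    have g: "fform 1 (\<lambda>x. p$1 * x$0 + p$0 * x$1)" by (intro fform_add fform_scale fform_var)
    have g0: "p$1 * p$0 + p$0 * p$1 \<noteq> 0" using pn two by (metis mult.commute mult_2 mult_eq_0_iff)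
    have "vo p 1 (\<lambda>x. q1 * x$0 - q0 * x$1) 2"
    proof (rule voI[OF g fform_const[of "- k * (p$0)^2"]])
      fix x assume x: "x \<in> J"
      consider "p$2 = 0" | "p$2 \<noteq> 0" "p$3 = 0" using False by blast
      then show "(p$1 * x$0 + p$0 * x$1) * (q1 * x$0 - q0 * x$1) = lam p x ^ 2 * (- k * (p$0)^2)"
      proof cases
        case 1
        then have l: "lam p x = x$2" by (simp add: lam_def)
        show ?thesis unfolding eq l using J_eqs[OF x] J_eqs[OF p] 1 by Groebner_Basis.algebra
      next
        case 2
        then have l: "lam p x = x$3" by (simp add: lam_def)
        show ?thesis unfolding eq l using J_eqs[OF x] J_eqs[OF p] 2(2) by Groebner_Basis.algebra
      qed
    qed (use g0 k pn in auto)
    then show ?thesis ..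
  qed
qed

lemma vo_bin:
  assumes p: "p \<in> J"
  shows "bin d N \<Longrightarrow> N s t \<noteq> 0 \<Longrightarrow> \<exists>n. vo p d (\<lambda>x. N (x$0) (x$1)) n"
proof (induction d arbitrary: N)
  case 0
  then have "N s t = N (p$0) (p$1)" using bin_0_const[OF 0(1)] by metis
  then show ?case using vo_0[of 0 "\<lambda>x. N (x$0) (x$1)" p] 0 unfolding bin_def by metis
next
  case (Suc d)
  obtain p0 p1 N' where N': "p0 \<noteq> 0 \<or> p1 \<noteq> 0" "bin d N'" "\<And>s t. N s t = (p1 * s - p0 * t) * N' s t"
    using bin_factor[OF Suc.prems(1)] by blast
  have "N' s t \<noteq> 0" using Suc.prems(2) N'(3)[of s t] by auto
  then obtain n where "vo p d (\<lambda>x. N' (x$0) (x$1)) n" using Suc.IH[OF N'(2)] by blast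
  moreover obtain m where "vo p 1 (\<lambda>x. p1 * x$0 - p0 * x$1) m" using vo_linear[OF p N'(1)] by blast
  ultimately have "vo p (1 + d) (\<lambda>x. (p1 * x$0 - p0 * x$1) * N' (x$0) (x$1)) (m + n)" using vo_mult by blast
  then have "vo p (Suc d) (\<lambda>x. N (x$0) (x$1)) (m + n)" by (simp add: N'(3)[symmetric])
  then show ?case ..
qed

text \<open>Factors \<open>lam p\<close> can be split off only as often as from the norm, which is a
  product of linear forms in X_0 and X_1 and so has a known finite order.\<close>

lemma vo_exists:
  assumes p: "p \<in> J" and f: "fform d f" "nz f"
  obtains n where "vo p d f n"
proof -
  obtain f' e N where N: "fform e f'" "bin (d + e) N" "\<And>x. x \<in> J \<Longrightarrow> f x * f' x = N (x$0) (x$1)" "\<exists>s t. N s t \<noteq> 0"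
    using norm_exists[OF f] by metis
  obtain b where b: "vo p (d + e) (\<lambda>x. N (x$0) (x$1)) b" using vo_bin[OF p N(2)] N(4) by blast
  have bound: "n \<le> b" if "vge p d f n" for n
  proof -
    have "vge p (d + e) (\<lambda>x. f x * f' x) (n + 0)" by (rule vge_mult[OF that vge_0[OF N(1)]])
    then have "vge p (d + e) (\<lambda>x. N (x$0) (x$1)) n" using N(3) by (auto intro: vge_cong)
    then show ?thesis by (rule vo_vge_le[OF p b])
  qed
  have "\<exists>n. vo p d f n"
  proof (rule ccontr)
    assume "\<nexists>n. vo p d f n"
    then have "vge p d f n" for n
      by (induction n) (use vge_0[OF f(1)] vge_Suc_or[OF p] in blast)+
    then show False using bound[of "Suc b"] by simp
  qed
  then show ?thesis using that by blast
qed

lemma lam_scale: "r \<noteq> 0 \<Longrightarrow> \<exists>s. s \<noteq> 0 \<and> (\<forall>x. lam (r *s p) x = s * lam p x)"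
proof -
  assume r: "r \<noteq> 0"
  show ?thesis
  proof (cases "p$2 = 0 \<or> p$3 = 0")
    case True
    then show ?thesis using r by (intro exI[of _ 1]) (auto simp: lam_def)
  next
    case False
    then show ?thesis using r by (intro exI[of _ r]) (auto simp: lam_def algebra_simps)
  qed
qed

lemma vo_scale:
  assumes "vo p d f n" "r \<noteq> 0" shows "vo (r *s p) d f n"
proof -
  obtain m e g F where 1: "fform m g" "fform e F" "m + d = n + e" "g p \<noteq> 0" "F p \<noteq> 0" "\<forall>x\<in>J. g x * f x = lam p x ^ n * F x"
    using assms(1) unfolding vo_def by blast
  obtain s where s: "s \<noteq> 0" "\<And>x. lam (r *s p) x = s * lam p x" using lam_scale[OF assms(2)] by blast
  show ?thesis
    by (rule voI[OF fform_scale[OF 1(1), of "s ^ n"] 1(2,3)])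
      (use s 1 assms(2) in \<open>auto simp: fform_homogeneous[OF 1(1)] fform_homogeneous[OF 1(2)] power_mult_distrib\<close>)
qed

section \<open>Division of forms along their zeros\<close>

lemma vge_mono:
  assumes "vge p d f n" "k \<le> n" shows "vge p d f k"
proof -
  obtain m e g F where 1: "fform m g" "fform e F" "m + d = n + e" "g p \<noteq> 0" "\<forall>x\<in>J. g x * f x = lam p x ^ n * F x"
    using assms(1) unfolding vge_def by blast
  have "fform (n - k + e) (\<lambda>x. lam p x ^ (n - k) * F x)"
    by (rule fform_mult[OF fform_power[OF fform_lam refl] 1(2)]) simp
  moreover have "\<forall>x\<in>J. g x * f x = lam p x ^ k * (lam p x ^ (n - k) * F x)"
    using 1(5) assms(2) by (simp add: mult.assoc[symmetric] power_add[symmetric])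
  ultimately show ?thesis unfolding vge_def using 1(1,3,4) assms(2)
    by (intro exI[of _ m] exI[of _ "n - k + e"] exI[of _ g] exI[of _ "\<lambda>x. lam p x ^ (n - k) * F x"]) auto
qed

lemma vge_zero_fun:
  assumes "p \<in> J" "\<And>x. x \<in> J \<Longrightarrow> f x = 0" shows "vge p d f n"
proof -
  obtain i where i: "p $ i \<noteq> 0" using J_two_nonzero(1)[OF assms(1)] by blast
  show ?thesis unfolding vge_def
    using fform_power[OF fform_var, of n n i] fform_zero[of d] i assms(2)
    by (intro exI[of _ n] exI[of _ d] exI[of _ "\<lambda>x. (x $ i) ^ n"] exI[of _ "\<lambda>_. 0"]) auto
qed

lemma vo_ge_1:
  assumes "p \<in> J" "fform d f" "f p = 0" "vo p d f n" shows "1 \<le> n"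
  using vo_vge_le[OF assms(1,4) vge_1[OF assms(1-3)]] .

text \<open>If p_2 = 0, then p_1^2 = - a p_0^2, and (p_1 X_0)^2 - (p_0 X_1)^2 equals - p_0^2 X_2^2
  on the curve; the case p_3 = 0 gives - p_0^2 X_3^2.\<close>

lemma vo_linear_double:
  assumes p: "p \<in> J" and z: "p$2 = 0 \<or> p$3 = 0"
  shows "vo p 1 (\<lambda>x. p$1 * x$0 - p$0 * x$1) 2"
proof -
  have pn: "p$0 \<noteq> 0" "p$1 \<noteq> 0" using J_two_nonzero[OF p] z by blast+
  have g: "fform 1 (\<lambda>x. p$1 * x$0 + p$0 * x$1)" by (intro fform_add fform_scale fform_var)
  have g0: "p$1 * p$0 + p$0 * p$1 \<noteq> 0" using pn two by (metis mult.commute mult_2 mult_eq_0_iff)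
  show ?thesis
  proof (rule voI[OF g fform_const[of "- ((p$0)^2)"]])
    fix x assume x: "x \<in> J"
    consider "p$2 = 0" | "p$2 \<noteq> 0" "p$3 = 0" using z by blast
    then show "(p$1 * x$0 + p$0 * x$1) * (p$1 * x$0 - p$0 * x$1) = lam p x ^ 2 * (- ((p$0)^2))"
    proof cases
      case 1
      then have l: "lam p x = x$2" by (simp add: lam_def)
      show ?thesis unfolding l using J_eqs[OF x] J_eqs[OF p] 1 by Groebner_Basis.algebra
    next
      case 2
      then have l: "lam p x = x$3" by (simp add: lam_def)
      show ?thesis unfolding l using J_eqs[OF x] J_eqs[OF p] 2(2) by Groebner_Basis.algebra
    qed
  qed (use g0 pn in auto)
qed

lemma bin_divide0:
  fixes h :: "'k \<Rightarrow> 'k \<Rightarrow> 'k"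
  assumes "bin d h" "p0 \<noteq> 0 \<or> p1 \<noteq> 0" "h p0 p1 = 0"
  obtains h' where "bin (d - 1) h'" "d = 0 \<Longrightarrow> h' = (\<lambda>_ _. 0)" "\<And>s t. h s t = (p1 * s - p0 * t) * h' s t"
proof (cases d)
  case 0
  then have "h s t = 0" for s t using bin_0_const[of h] assms(1,3) by metis
  then show ?thesis using that[of "\<lambda>_ _. 0", OF bin_zero] by simp
next
  case (Suc e)
  then show ?thesis using bin_divide[of e h p0 p1] assms that by (metis diff_Suc_1 nat.distinct(1))
qed

lemma pm_zero: "x + y = 0 \<Longrightarrow> x - y = 0 \<Longrightarrow> x = 0 \<and> (y::'k) = 0"
proof -
  assume 1: "x + y = 0" "x - y = 0"
  then have "2 * x = 0" by (metis add_diff_cancel_left' diff_add_cancel eq_iff_diff_eq_0 mult_2 )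
  then have "x = 0" using two by simp
  then show ?thesis using 1 by simp
qed

lemma pm_zero': "x + y * v = 0 \<Longrightarrow> x - y * v = 0 \<Longrightarrow> v \<noteq> 0 \<Longrightarrow> x = 0 \<and> (y::'k) = 0"
  using pm_zero[of x "y * v"] by simp

text \<open>In normal form, divisibility by the linear form means that all four binary coefficients
  vanish at q. Over an unramified q the four points of the fibre give four independent sign
  combinations. Over a ramified q only two points are left, and vanishing to order two supplies the
  missing conditions.\<close>

lemma divide_linear:
  assumes f: "fform (d + 2) f" and q: "q0 \<noteq> 0 \<or> q1 \<noteq> 0"
    and v: "\<And>p n. p \<in> J \<Longrightarrow> vo p 1 (\<lambda>x. q1 * x$0 - q0 * x$1) n \<Longrightarrow> vge p (d + 2) f n"
  shows "\<exists>h. fform (d + 1) h \<and> (\<forall>x\<in>J. f x = (q1 * x$0 - q0 * x$1) * h x)"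
proof -
  obtain al be ga ep where bins: "bin (d + 2) al" "bin (d + 1) be" "bin (d + 1) ga" "bin d ep" and
     dec: "\<forall>x\<in>J. f x = al (x$0) (x$1) + be (x$0) (x$1) * x$2 + ga (x$0) (x$1) * x$3 + ep (x$0) (x$1) * (x$2 * x$3)"
    using fform_dec[OF f] unfolding dec_def by blast
  let ?l = "\<lambda>x :: 'k^4. q1 * x$0 - q0 * x$1"
  have l: "fform 1 ?l" by (intro fform_diff fform_scale fform_var)
  obtain p where p: "p \<in> J" "p$0 = q0" "p$1 = q1" using J_lift q by metis
  have zero: "f x = 0" if x: "x \<in> J" "x$0 = q0" "x$1 = q1" for x
  proof -
    obtain n where n: "vo x 1 ?l n" using vo_linear[OF x(1) q] by blast
    have "1 \<le> n" by (rule vo_ge_1[OF x(1) l _ n]) (simp add: x)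
    then show ?thesis using v[OF x(1) n] vge_Suc_zero[OF x(1)] by (metis Suc_le_D One_nat_def)
  qed
  have z: "al q0 q1 + be q0 q1 * x$2 + ga q0 q1 * x$3 + ep q0 q1 * (x$2 * x$3) = 0"
    if x: "x \<in> J" "x$0 = q0" "x$1 = q1" for x
    using zero[OF x] dec x by auto
  have z1: "al q0 q1 + be q0 q1 * p$2 + ga q0 q1 * p$3 + ep q0 q1 * (p$2 * p$3) = 0"
    "al q0 q1 - be q0 q1 * p$2 + ga q0 q1 * p$3 - ep q0 q1 * (p$2 * p$3) = 0"
    "al q0 q1 + be q0 q1 * p$2 - ga q0 q1 * p$3 - ep q0 q1 * (p$2 * p$3) = 0"
    "al q0 q1 - be q0 q1 * p$2 - ga q0 q1 * p$3 + ep q0 q1 * (p$2 * p$3) = 0"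
    using z[OF p] z[OF J_flip[OF p(1), of 2]] z[OF J_flip[OF p(1), of 3]] z[OF J_flip[OF J_flip[OF p(1), of 2], of 3]] p
    by (simp_all add: flip_nth)
  have double: "vge x (d + 2) f 2" if x: "x \<in> J" "x$0 = q0" "x$1 = q1" "x$2 = 0 \<or> x$3 = 0" for x
    using v[OF x(1)] vo_linear_double[OF x(1,4)] x by simp
  have "al q0 q1 = 0 \<and> be q0 q1 = 0 \<and> ga q0 q1 = 0 \<and> ep q0 q1 = 0"
  proof (cases "p$2 \<noteq> 0 \<and> p$3 \<noteq> 0")
    case True
    have "(al q0 q1 + ga q0 q1 * p$3) + (be q0 q1 * p$2 + ep q0 q1 * (p$2 * p$3)) = 0"
      "(al q0 q1 + ga q0 q1 * p$3) - (be q0 q1 * p$2 + ep q0 q1 * (p$2 * p$3)) = 0"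
      "(al q0 q1 - ga q0 q1 * p$3) + (be q0 q1 * p$2 - ep q0 q1 * (p$2 * p$3)) = 0"
      "(al q0 q1 - ga q0 q1 * p$3) - (be q0 q1 * p$2 - ep q0 q1 * (p$2 * p$3)) = 0"
      by (rule trans[OF _ z1(1)] trans[OF _ z1(2)] trans[OF _ z1(3)] trans[OF _ z1(4)], simp add: algebra_simps; fail)+
    then have "al q0 q1 + ga q0 q1 * p$3 = 0" "al q0 q1 - ga q0 q1 * p$3 = 0"
      "be q0 q1 * p$2 + ep q0 q1 * (p$2 * p$3) = 0" "be q0 q1 * p$2 - ep q0 q1 * (p$2 * p$3) = 0"
      using pm_zero by blast+
    then have "al q0 q1 = 0" "ga q0 q1 = 0" "be q0 q1 * p$2 = 0" "ep q0 q1 * (p$2 * p$3) = 0"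
      using pm_zero'[of _ _ "p$3"] pm_zero[of "be q0 q1 * p$2"] True by blast+
    then show ?thesis using True by simp
  next
    case br: False
    \<comment> \<open>Where X_k is a uniformizer, a multiple of X_k vanishing to order two has a
      cofactor that vanishes at the point.\<close>
    have cancel: "h y = 0" if y: "y \<in> J" and k: "lam y = (\<lambda>x. x $ k)" and h: "fform (d + 1) h"
      and "vge y (d + 2) (\<lambda>x. x $ k * h x) 2" for y k h
    proof -
      obtain m e g F where 1: "fform m g" "fform e F" "m + (d + 2) = 2 + e" "g y \<noteq> 0" "\<forall>x\<in>J. g x * (x $ k * h x) = lam y x ^ 2 * F x"
        using \<open>vge y (d + 2) (\<lambda>x. x $ k * h x) 2\<close> unfolding vge_def by blast
      have "fform 1 (\<lambda>x :: 'k^4. x $ k)" by (rule fform_var)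
      moreover have "nz (\<lambda>x. x $ k)" using nz_lam[OF y] k by simp
      moreover have "fform (m + (d + 1)) (\<lambda>x. g x * h x)" by (rule fform_mult[OF 1(1) h refl])
      moreover have "fform (m + (d + 1)) (\<lambda>x. x $ k * F x)" by (rule fform_mult[OF fform_var 1(2)]) (use 1(3) in simp)
      moreover have "x $ k * (g x * h x) = x $ k * (x $ k * F x)" if "x \<in> J" for x
        using 1(5)[rule_format, OF that] by (simp add: k power2_eq_square mult_ac)
      ultimately have "g y * h y = y $ k * F y" using form_cancel_eq[OF _ _ _ _ _ y] by blast
      moreover have "y $ k = 0" using lam_self[of y] k by metis
      ultimately show "h y = 0" using 1(4) by simp
    qed
    note ff = bins[unfolded bin_def]
    show ?thesis
    proof (cases "p$2 = 0")
      case True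
      then have p3: "p$3 \<noteq> 0" using J_two_nonzero[OF p(1)] by blast
      have "al q0 q1 + ga q0 q1 * p$3 = 0" "al q0 q1 - ga q0 q1 * p$3 = 0" using z1 True by simp_all
      then have ag: "al q0 q1 = 0" "ga q0 q1 = 0" using pm_zero'[OF _ _ p3] by blast+
      obtain al' where al': "bin (d + 1) al'" "\<And>s t. al s t = (q1 * s - q0 * t) * al' s t"
        using bin_divide[of "d + 1" al, OF _ q ag(1)] bins(1) by (metis add_Suc_right nat_1_add_1 plus_1_eq_Suc add.assoc)
      obtain ga' where ga': "bin d ga'" "\<And>s t. ga s t = (q1 * s - q0 * t) * ga' s t"
        using bin_divide[of d ga, OF _ q ag(2)] bins(3) by auto
      \<comment> \<open>Two coefficients are already known to be divisible. Subtracting their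
        contribution, which has order at least two, leaves X_2 times \<open>?h\<close>.\<close>
      let ?h = "\<lambda>x. be (x$0) (x$1) + ep (x$0) (x$1) * x$3"
      let ?k = "\<lambda>x. - (al' (x$0) (x$1) + ga' (x$0) (x$1) * x$3)"
      have h: "fform (d + 1) ?h" by (intro fform_add ff fform_mult[OF ff(4) fform_var]) simp
      have k: "fform (d + 1) ?k"
        by (intro fform_uminus fform_add al'(1)[unfolded bin_def] fform_mult[OF ga'(1)[unfolded bin_def] fform_var]) simp
      have "?h y = 0" if y: "y \<in> J" "y$0 = q0" "y$1 = q1" "y$2 = 0" for y
      proof (rule cancel[OF y(1) _ h])
        show "lam y = (\<lambda>x. x $ 2)" using y by (simp add: lam_def fun_eq_iff)
        have "vge y (1 + (d + 1)) (\<lambda>x. ?l x * ?k x) (2 + 0)"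
          by (rule vge_mult[OF vo_imp_vge vge_0[OF k]]) (use vo_linear_double[OF y(1)] y in simp)
        then have "vge y (d + 2) (\<lambda>x. ?l x * ?k x) 2" by simp
        from vge_add[OF double this] y have "vge y (d + 2) (\<lambda>x. f x + ?l x * ?k x) 2" by simp
        then show "vge y (d + 2) (\<lambda>x. x $ 2 * ?h x) 2"
          by (rule vge_cong) (simp add: dec[rule_format] al'(2) ga'(2) algebra_simps)
      qed
      from this[OF p True] this[OF J_flip[OF p(1), of 3]] p True
      have "be q0 q1 + ep q0 q1 * p$3 = 0" "be q0 q1 - ep q0 q1 * p$3 = 0" by (simp_all add: flip_nth)
      then show ?thesis using pm_zero'[OF _ _ p3] ag by blast
    next
      case False
      then have True: "p$3 = 0" using br by blast
      have "al q0 q1 + be q0 q1 * p$2 = 0" "al q0 q1 - be q0 q1 * p$2 = 0" using z1 True by simp_all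
      then have ag: "al q0 q1 = 0" "be q0 q1 = 0" using pm_zero'[OF _ _ False] by blast+
      obtain al' where al': "bin (d + 1) al'" "\<And>s t. al s t = (q1 * s - q0 * t) * al' s t"
        using bin_divide[of "d + 1" al, OF _ q ag(1)] bins(1) by (metis add_Suc_right nat_1_add_1 plus_1_eq_Suc add.assoc)
      obtain be' where be': "bin d be'" "\<And>s t. be s t = (q1 * s - q0 * t) * be' s t"
        using bin_divide[of d be, OF _ q ag(2)] bins(2) by auto
      let ?h = "\<lambda>x. ga (x$0) (x$1) + ep (x$0) (x$1) * x$2"
      let ?k = "\<lambda>x. - (al' (x$0) (x$1) + be' (x$0) (x$1) * x$2)"
      have h: "fform (d + 1) ?h" by (intro fform_add ff fform_mult[OF ff(4) fform_var]) simp
      have k: "fform (d + 1) ?k"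
        by (intro fform_uminus fform_add al'(1)[unfolded bin_def] fform_mult[OF be'(1)[unfolded bin_def] fform_var]) simp
      have "?h y = 0" if y: "y \<in> J" "y$0 = q0" "y$1 = q1" "y$3 = 0" for y
      proof (rule cancel[OF y(1) _ h])
        have "y$2 \<noteq> 0" using J_two_nonzero(6)[OF y(1)] y(4) by simp
        then show "lam y = (\<lambda>x. x $ 3)" using y by (simp add: lam_def fun_eq_iff)
        have "vge y (1 + (d + 1)) (\<lambda>x. ?l x * ?k x) (2 + 0)"
          by (rule vge_mult[OF vo_imp_vge vge_0[OF k]]) (use vo_linear_double[OF y(1)] y in simp)
        then have "vge y (d + 2) (\<lambda>x. ?l x * ?k x) 2" by simp
        from vge_add[OF double this] y have "vge y (d + 2) (\<lambda>x. f x + ?l x * ?k x) 2" by simp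
        then show "vge y (d + 2) (\<lambda>x. x $ 3 * ?h x) 2"
          by (rule vge_cong) (simp add: dec[rule_format] al'(2) be'(2) algebra_simps)
      qed
      from this[OF p True] this[OF J_flip[OF p(1), of 2]] p True
      have "ga q0 q1 + ep q0 q1 * p$2 = 0" "ga q0 q1 - ep q0 q1 * p$2 = 0" by (simp_all add: flip_nth)
      then show ?thesis using pm_zero'[OF _ _ False] ag by blast
    qed
  qed
  then have zz: "al q0 q1 = 0" "be q0 q1 = 0" "ga q0 q1 = 0" "ep q0 q1 = 0" by blast+
  obtain al' where al': "bin (d + 1) al'" "\<And>s t. al s t = (q1 * s - q0 * t) * al' s t"
    using bin_divide0[OF bins(1) q zz(1)] by (metis add_diff_cancel_right' nat_1_add_1 add.assoc)
  obtain be' where be': "bin d be'" "\<And>s t. be s t = (q1 * s - q0 * t) * be' s t"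
    using bin_divide0[OF bins(2) q zz(2)] by (metis add_diff_cancel_right')
  obtain ga' where ga': "bin d ga'" "\<And>s t. ga s t = (q1 * s - q0 * t) * ga' s t"
    using bin_divide0[OF bins(3) q zz(3)] by (metis add_diff_cancel_right')
  obtain ep' where ep': "bin (d - 1) ep'" "d = 0 \<Longrightarrow> ep' = (\<lambda>_ _. 0)" "\<And>s t. ep s t = (q1 * s - q0 * t) * ep' s t"
    using bin_divide0[OF bins(4) q zz(4)] by metis
  have e: "fform (d + 1) (\<lambda>x. ep' (x$0) (x$1) * (x$2 * x$3))"
  proof (cases "d = 0")
    case True
    then show ?thesis using ep'(2) fform_zero by simp
  next
    case False
    then show ?thesis
      by (intro fform_mult[OF ep'(1)[unfolded bin_def] fform_mult[OF fform_var fform_var refl]]) simp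
  qed
  have "fform (d + 1) (\<lambda>x. al' (x$0) (x$1) + be' (x$0) (x$1) * x$2 + ga' (x$0) (x$1) * x$3 + ep' (x$0) (x$1) * (x$2 * x$3))"
    by (intro fform_add e al'(1)[unfolded bin_def] fform_mult[OF be'(1)[unfolded bin_def] fform_var]
        fform_mult[OF ga'(1)[unfolded bin_def] fform_var]) simp_all
  moreover have "\<forall>x\<in>J. f x = ?l x * (al' (x$0) (x$1) + be' (x$0) (x$1) * x$2 + ga' (x$0) (x$1) * x$3 + ep' (x$0) (x$1) * (x$2 * x$3))"
    using dec by (simp add: al'(2) be'(2) ga'(2) ep'(3) algebra_simps)
  ultimately show ?thesis by blast
qed

lemma divide_bin:
  assumes "bin m N" "N s0 t0 \<noteq> 0" "fform (m + k + 1) f"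
    "\<And>p n. p \<in> J \<Longrightarrow> vo p m (\<lambda>x. N (x$0) (x$1)) n \<Longrightarrow> vge p (m + k + 1) f n"
  shows "\<exists>h. fform (k + 1) h \<and> (\<forall>x\<in>J. f x = N (x$0) (x$1) * h x)"
  using assms
proof (induction m arbitrary: N f)
  case 0
  then have "\<And>s t. N s t = N s0 t0" using bin_0_const[of N] by metis
  then have "\<forall>x\<in>J. f x = N (x$0) (x$1) * (inverse (N s0 t0) * f x)" using 0(2) by (metis mult.assoc mult_1 right_inverse)
  then show ?case using fform_scale[OF 0(3), of "inverse (N s0 t0)"] by (metis add_0)
next
  case (Suc m)
  obtain q0 q1 N' where N': "q0 \<noteq> 0 \<or> q1 \<noteq> 0" "bin m N'" "\<And>s t. N s t = (q1 * s - q0 * t) * N' s t"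
    using bin_factor[OF Suc.prems(1)] by blast
  let ?l = "\<lambda>x :: 'k^4. q1 * x$0 - q0 * x$1"
  have N0: "N' s0 t0 \<noteq> 0" using Suc.prems(2) N'(3)[of s0 t0] by auto
  have vN: "vo p (Suc m) (\<lambda>x. N (x$0) (x$1)) (i + j)" if "vo p 1 ?l i" "vo p m (\<lambda>x. N' (x$0) (x$1)) j" for p i j
    using vo_mult[OF that] by (simp add: N'(3)[symmetric])
  have "\<exists>h. fform (m + k + 1) h \<and> (\<forall>x\<in>J. f x = ?l x * h x)"
  proof (rule divide_linear[OF _ N'(1)])
    show "fform (m + k + 2) f" using Suc.prems(3) by simp
    fix p n assume p: "p \<in> J" and n: "vo p 1 ?l n"
    obtain j where "vo p m (\<lambda>x. N' (x$0) (x$1)) j" using vo_bin[OF p N'(2) N0] by blast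
    from Suc.prems(4)[OF p vN[OF n this]] have "vge p (m + k + 2) f (n + j)" by simp
    then show "vge p (m + k + 2) f n" by (rule vge_mono) simp
  qed
  then obtain h where h: "fform (m + k + 1) h" "\<forall>x\<in>J. f x = ?l x * h x" by blast
  have "vge p (m + k + 1) h j" if p: "p \<in> J" and j: "vo p m (\<lambda>x. N' (x$0) (x$1)) j" for p j
  proof (cases "nz h")
    case False
    then show ?thesis using vge_zero_fun[OF p] unfolding nz_def by blast
  next
    case True
    obtain i where i: "vo p 1 ?l i" using vo_linear[OF p N'(1)] by blast
    obtain n where n: "vo p (m + k + 1) h n" using vo_exists[OF p h(1) True] by blast
    have "vo p (1 + (m + k + 1)) f (i + n)"
      using vo_mult[OF i n] h(2) by (rule_tac vo_cong) auto
    then have "i + j \<le> i + n"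
      using vo_vge_le[OF p, of _ f "i + n" "i + j"] Suc.prems(4)[OF p vN[OF i j]] by simp
    then show ?thesis using vge_mono[OF vo_imp_vge[OF n]] by simp
  qed
  from Suc.IH[OF N'(2) N0 h(1) this] obtain h' where
    "fform (k + 1) h'" "\<forall>x\<in>J. h x = N' (x$0) (x$1) * h' x" by blast
  then show ?case using h(2) N'(3) by (intro exI[of _ h']) (simp add: mult.assoc)
qed

lemma divide_form:
  assumes g: "fform e g" "nz g" and f: "fform (e + k + 1) f"
    and v: "\<And>p n. p \<in> J \<Longrightarrow> vo p e g n \<Longrightarrow> vge p (e + k + 1) f n"
  shows "\<exists>h. fform (k + 1) h \<and> (\<forall>x\<in>J. f x = g x * h x)"
proof -
  obtain g' m N where N: "fform m g'" "bin (e + m) N" "\<And>x. x \<in> J \<Longrightarrow> g x * g' x = N (x$0) (x$1)" "\<exists>s t. N s t \<noteq> 0"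
    using norm_exists[OF g] by metis
  obtain s0 t0 where N0: "N s0 t0 \<noteq> 0" using N(4) by blast
  obtain y where "y \<in> J" "N (y$0) (y$1) \<noteq> 0"
    using bin_mult_nonzero[OF N(2) N0 N(2) N0] J_lift[of 1] by (metis zero_neq_one)
  then have g': "nz g'" using N(3)[of y] unfolding nz_def by (metis mult_zero_right)
  have fg: "fform (e + m + k + 1) (\<lambda>x. f x * g' x)" by (rule fform_mult[OF f N(1)]) simp
  have "\<exists>h. fform (k + 1) h \<and> (\<forall>x\<in>J. f x * g' x = N (x$0) (x$1) * h x)"
  proof (rule divide_bin[OF N(2) N0 fg])
    fix p n assume p: "p \<in> J" and n: "vo p (e + m) (\<lambda>x. N (x$0) (x$1)) n"
    obtain i where i: "vo p e g i" using vo_exists[OF p g] by blast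
    obtain j where j: "vo p m g' j" using vo_exists[OF p N(1) g'] by blast
    have "vo p (e + m) (\<lambda>x. N (x$0) (x$1)) (i + j)" by (rule vo_cong[OF vo_mult[OF i j] N(3)])
    then have "n = i + j" using vo_unique[OF p n] by blast
    then show "vge p (e + m + k + 1) (\<lambda>x. f x * g' x) n"
      using vge_mult[OF v[OF p i] vo_imp_vge[OF j]] by (simp add: add_ac)
  qed
  then obtain h where h: "fform (k + 1) h" "\<forall>x\<in>J. f x * g' x = N (x$0) (x$1) * h x" by blast
  have "f x = g x * h x" if x: "x \<in> J" for x
  proof (rule form_cancel_eq[OF N(1) g' f _ _ x])
    show "fform (e + k + 1) (\<lambda>x. g x * h x)" by (rule fform_mult[OF g(1) h(1)]) simp
    fix x assume "x \<in> J"
    then show "g' x * f x = g' x * (g x * h x)" using h(2) N(3)[of x] by (simp add: mult_ac)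
  qed
  then show ?thesis using h(1) by blast
qed

subsection \<open>Principal divisors\<close>

definition sim :: "'k ^ 4 \<Rightarrow> 'k ^ 4 \<Rightarrow> bool" where
  "sim p x \<longleftrightarrow> (\<exists>r. r \<noteq> 0 \<and> x = r *s p)"

lemma sim_refl: "sim p p"
  unfolding sim_def by (intro exI[of _ 1]) simp

lemma sim_sym: "sim p x \<Longrightarrow> sim x p"
proof -
  assume "sim p x"
  then obtain r where "r \<noteq> 0" "x = r *s p" unfolding sim_def by blast
  then show ?thesis unfolding sim_def by (intro exI[of _ "inverse r"]) (simp add: vector_smult_assoc)
qed

lemma sim_trans: "sim p x \<Longrightarrow> sim x y \<Longrightarrow> sim p y"
  unfolding sim_def by (metis vector_smult_assoc no_zero_divisors)

lemma sim_flip: "sim p x \<Longrightarrow> sim (flip k p) (flip k x)"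
  unfolding sim_def by (auto simp: vec4_eq_iff flip_nth)

lemma flip_flip: "flip k (flip k x) = x"
  by (simp add: vec_eq_iff flip_nth)

definition point_div :: "'k ^ 4 \<Rightarrow> 'k ^ 4 \<Rightarrow> int" where
  "point_div p x = (if sim p x then 1 else 0)"

lemma point_div_sim: "sim p q \<Longrightarrow> point_div p = point_div q"
  unfolding point_div_def fun_eq_iff using sim_trans sim_sym by metis

text \<open>A divisor is given as a function on the nonzero points of the cone over the curve.\<close>

definition principal :: "('k ^ 4 \<Rightarrow> int) \<Rightarrow> bool" where
  "principal \<delta> \<longleftrightarrow> (\<exists>d f g. fform d f \<and> fform d g \<and> nz f \<and> nz g \<and>
     (\<forall>p\<in>J. \<forall>m n. vo p d f m \<longrightarrow> vo p d g n \<longrightarrow> \<delta> p = int m - int n))"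

lemma principal_add:
  assumes "principal \<delta>" "principal \<epsilon>" shows "principal (\<lambda>x. \<delta> x + \<epsilon> x)"
proof -
  obtain d f g where 1: "fform d f" "fform d g" "nz f" "nz g"
    "\<forall>p\<in>J. \<forall>m n. vo p d f m \<longrightarrow> vo p d g n \<longrightarrow> \<delta> p = int m - int n"
    using assms(1) unfolding principal_def by blast
  obtain e h k where 2: "fform e h" "fform e k" "nz h" "nz k"
    "\<forall>p\<in>J. \<forall>m n. vo p e h m \<longrightarrow> vo p e k n \<longrightarrow> \<epsilon> p = int m - int n"
    using assms(2) unfolding principal_def by blast
  have "\<delta> p + \<epsilon> p = int m - int n" if p: "p \<in> J" and m: "vo p (d + e) (\<lambda>x. f x * h x) m"
    and n: "vo p (d + e) (\<lambda>x. g x * k x) n" for p m n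
  proof -
    obtain i where i: "vo p d f i" using vo_exists[OF p 1(1,3)] by blast
    obtain i' where i': "vo p e h i'" using vo_exists[OF p 2(1,3)] by blast
    obtain j where j: "vo p d g j" using vo_exists[OF p 1(2,4)] by blast
    obtain j' where j': "vo p e k j'" using vo_exists[OF p 2(2,4)] by blast
    have "m = i + i'" "n = j + j'"
      using vo_unique[OF p m vo_mult[OF i i']] vo_unique[OF p n vo_mult[OF j j']] by auto
    then show ?thesis using 1(5) 2(5) p i j i' j' by fastforce
  qed
  then show ?thesis unfolding principal_def
    using fform_mult[OF 1(1) 2(1) refl] fform_mult[OF 1(2) 2(2) refl]
      nz_mult[OF 1(1,3) 2(1,3)] nz_mult[OF 1(2,4) 2(2,4)] by blast
qed

lemma principal_uminus: "principal \<delta> \<Longrightarrow> principal (\<lambda>x. - \<delta> x)"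
  unfolding principal_def by (metis minus_diff_eq)

lemma principal_diff: "principal \<delta> \<Longrightarrow> principal \<epsilon> \<Longrightarrow> principal (\<lambda>x. \<delta> x - \<epsilon> x)"
  using principal_add[OF _ principal_uminus, of \<delta> \<epsilon>] by simp

lemma principal_cong: "principal \<delta> \<Longrightarrow> (\<And>x. x \<in> J \<Longrightarrow> \<delta> x = \<epsilon> x) \<Longrightarrow> principal \<epsilon>"
  unfolding principal_def by metis

lemma principal_zero: "principal (\<lambda>_. 0)"
proof -
  have "nz (\<lambda>_. 1)" using origin_in_J unfolding nz_def by auto
  moreover have "m = n" if "p \<in> J" "vo p 0 (\<lambda>_. 1) m" "vo p 0 (\<lambda>_. 1) n" for p m n
    using vo_unique that by blast
  ultimately show ?thesis unfolding principal_def
    by (intro exI[of _ 0] exI[of _ "\<lambda>_. 1"]) (auto simp: fform_const)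
qed

lemma principalI:
  assumes "fform d f" "fform d g" "nz f" "nz g"
    "\<And>p. p \<in> J \<Longrightarrow> \<exists>m n. vo p d f m \<and> vo p d g n \<and> \<delta> p = int m - int n"
  shows "principal \<delta>"
  unfolding principal_def using assms vo_unique by metis

lemma fform_1_linear:
  assumes "fform 1 f" obtains r where "f = (\<lambda>x. \<Sum>j\<in>UNIV. r j * x $ j)"
proof -
  obtain G where G: "\<And>j. fform 0 (G j)" "f = (\<lambda>x. \<Sum>j\<in>UNIV. x $ j * G j x)"
    using fform_Suc[of 0 f] assms unfolding fun_eq_iff by (metis One_nat_def)
  from G(1) have "\<exists>r. G j = (\<lambda>_. r)" for j by (rule fform_0_const)
  then obtain r where "\<And>j. G j = (\<lambda>_. r j)" by metis
  then show ?thesis using that[of r] unfolding G(2) by (simp add: mult.commute)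
qed

text \<open>The remaining three zeros of \<open>lam s\<close> are the images of \<open>s\<close> under these two reflections and their
  product.\<close>

definition plane_pair :: "'k ^ 4 \<Rightarrow> 4 \<times> 4" where
  "plane_pair s = (if s$2 = 0 then (1, 3) else if s$3 = 0 then (1, 2) else (2, 3))"

text \<open>The three sign patterns are linearly independent because 2 is nonzero, so three
  conditions on four coefficients leave a line, which is spanned by \<open>lam s\<close>.\<close>

lemma linear_through_conjugates:
  assumes s: "s \<in> J" and kl: "plane_pair s = (k, l)" and h: "fform 1 h"
    and z: "h (flip k s) = 0" "h (flip l s) = 0" "h (flip k (flip l s)) = 0"
  shows "\<exists>r. \<forall>x. h x = r * lam s x"
proof -
  obtain r where r: "h = (\<lambda>x. \<Sum>j\<in>UNIV. r j * x $ j)" using fform_1_linear[OF h] by blast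
  have core: "A = 0 \<and> B = 0 \<and> C = 0" if "A - B + C = 0" "A + B - C = 0" "A - B - C = (0::'k)" for A B C
  proof -
    have "C = 0" using pm_zero[of "A - B" C] that by simp
    moreover have "A = 0 \<and> B = 0" using pm_zero[of A B] that calculation by simp
    ultimately show ?thesis by blast
  qed
  note h0 = z[unfolded r sum_0123]
  consider "s$2 = 0" | "s$2 \<noteq> 0" "s$3 = 0" | "s$2 \<noteq> 0" "s$3 \<noteq> 0" by blast
  then show ?thesis
  proof cases
    case 1
    then have kl': "k = 1" "l = 3" using kl by (auto simp: plane_pair_def)
    have nz: "s$0 \<noteq> 0" "s$1 \<noteq> 0" "s$3 \<noteq> 0" using J_two_nonzero[OF s] 1 by auto
    have "r 0 * s$0 = 0 \<and> r 1 * s$1 = 0 \<and> r 3 * s$3 = 0"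
      by (rule core) (use h0 1 in \<open>simp_all add: kl' flip_nth\<close>)
    then show ?thesis using nz 1 unfolding r sum_0123 by (intro exI[of _ "r 2"]) (simp add: lam_def)
  next
    case 2
    then have kl': "k = 1" "l = 2" using kl by (auto simp: plane_pair_def)
    have nz: "s$0 \<noteq> 0" "s$1 \<noteq> 0" "s$2 \<noteq> 0" using J_two_nonzero[OF s] 2 by auto
    have "r 0 * s$0 = 0 \<and> r 1 * s$1 = 0 \<and> r 2 * s$2 = 0"
      by (rule core) (use h0 2 in \<open>simp_all add: kl' flip_nth\<close>)
    then show ?thesis using nz 2 unfolding r sum_0123 by (intro exI[of _ "r 3"]) (simp add: lam_def)
  next
    case 3
    then have kl': "k = 2" "l = 3" using kl by (auto simp: plane_pair_def)
    have "r 0 * s$0 + r 1 * s$1 = 0 \<and> r 2 * s$2 = 0 \<and> r 3 * s$3 = 0"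
      by (rule core) (use h0 in \<open>simp_all add: kl' flip_nth\<close>)
    then have e: "r 0 * s$0 + r 1 * s$1 = 0" "r 2 = 0" "r 3 = 0" using 3 by auto
    show ?thesis
    proof (cases "s$1 = 0")
      case True
      then have "s$0 \<noteq> 0" using J_two_nonzero(1)[OF s] by simp
      then show ?thesis using e 3 True unfolding r sum_0123
        by (intro exI[of _ "- r 1 / s$0"]) (simp add: lam_def)
    next
      case False
      then have "r 1 = - (r 0 / s$1) * s$0" using e(1) by (simp add: field_simps eq_neg_iff_add_eq_0)
      then show ?thesis using e(2,3) 3 False unfolding r sum_0123
        by (intro exI[of _ "r 0 / s$1"]) (simp add: lam_def algebra_simps)
    qed
  qed
qed

lemma conjugates:
  assumes s: "s \<in> J" and kl: "plane_pair s = (k, l)" and p: "p \<in> {flip k s, flip l s, flip k (flip l s)}"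
  shows "p \<in> J" "\<not> sim s p" "lam s p = 0"
proof -
  show "p \<in> J" using p s J_flip by blast
  have n: "k \<noteq> l" "s $ k \<noteq> 0" "s $ l \<noteq> 0"
    using kl J_two_nonzero[OF s] by (auto simp: plane_pair_def split: if_splits)
  have "\<exists>j. j \<noteq> k \<and> j \<noteq> l \<and> s $ j \<noteq> 0"
    using kl J_two_nonzero[OF s] unfolding plane_pair_def
    by (auto split: if_splits intro: exI[of _ 0] exI[of _ 1])
  then obtain j where j: "j \<noteq> k" "j \<noteq> l" "s $ j \<noteq> 0" by blast
  show "\<not> sim s p"
  proof
    assume "sim s p"
    then obtain r where r: "p = r *s s" unfolding sim_def by blast
    then have c: "p $ i = r * s $ i" for i by simp
    have "p $ j = s $ j" using p j by (auto simp: flip_nth)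
    then have "r = 1" using c[of j] j by simp
    moreover have "p $ k = - s $ k \<or> p $ l = - s $ l" using p n by (auto simp: flip_nth)
    ultimately have "s $ k + s $ k = 0 \<or> s $ l + s $ l = 0" using c by (metis add.right_inverse mult_1)
    then show False using n two by (metis mult_2 mult_eq_0_iff)
  qed
  show "lam s p = 0"
    using p kl by (auto simp: plane_pair_def lam_def flip_nth split: if_splits)
qed

text \<open>If \<open>f / g\<close> has divisor \<open>(r) - (s)\<close>, then \<open>g\<close> divides \<open>lam s * f\<close>. The quotient is a linear form through the
  other three zeros of \<open>lam s\<close>, hence proportional to it, and \<open>f / g\<close> is constant.\<close>

lemma principal_points_eq:
  assumes r: "r \<in> J" and s: "s \<in> J" and pr: "principal (\<lambda>x. point_div r x - point_div s x)"
  shows "sim r s"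
proof -
  obtain e f g where fg: "fform e f" "fform e g" "nz f" "nz g" and
    v: "\<And>p m n. p \<in> J \<Longrightarrow> vo p e f m \<Longrightarrow> vo p e g n \<Longrightarrow> point_div r p - point_div s p = int m - int n"
    using pr unfolding principal_def by blast
  have F: "fform (e + 0 + 1) (\<lambda>x. lam s x * f x)" by (rule fform_mult[OF fform_lam fg(1)]) simp
  have lf: "vo p (e + 0 + 1) (\<lambda>x. lam s x * f x) (i + m)" if "vo p 1 (lam s) i" "vo p e f m" for p i m
    using vo_mult[OF that] by simp
  have "\<exists>h. fform (0 + 1) h \<and> (\<forall>x\<in>J. lam s x * f x = g x * h x)"
  proof (rule divide_form[OF fg(2,4) F])
    fix p n assume p: "p \<in> J" and n: "vo p e g n"
    obtain m where m: "vo p e f m" using vo_exists[OF p fg(1,3)] by blast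
    obtain i where i: "vo p 1 (lam s) i" using vo_exists[OF p fform_lam nz_lam[OF s]] by blast
    have "n \<le> i + m"
    proof (cases "sim s p")
      case True
      then have "lam s p = 0" using fform_homogeneous[OF fform_lam, of s _ s] lam_self[of s] unfolding sim_def by auto
      then have "1 \<le> i" using vo_ge_1[OF p fform_lam _ i] by blast
      then show ?thesis using v[OF p m n] by (simp add: point_div_def split: if_splits)
    next
      case False
      then show ?thesis using v[OF p m n] by (simp add: point_div_def split: if_splits)
    qed
    then show "vge p (e + 0 + 1) (\<lambda>x. lam s x * f x) n"
      using vge_mono vo_imp_vge[OF lf[OF i m]] by blast
  qed
  then obtain h where h: "fform 1 h" "\<And>x. x \<in> J \<Longrightarrow> lam s x * f x = g x * h x" by auto
  obtain k l where kl: "plane_pair s = (k, l)" by (metis surj_pair)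
  have hz: "h p = 0" if pc: "p \<in> {flip k s, flip l s, flip k (flip l s)}" for p
  proof (rule ccontr)
    assume "h p \<noteq> 0"
    note p = conjugates[OF s kl pc]
    obtain m where m: "vo p e f m" using vo_exists[OF p(1) fg(1,3)] by blast
    obtain n where n: "vo p e g n" using vo_exists[OF p(1) fg(2,4)] by blast
    obtain i where i: "vo p 1 (lam s) i" using vo_exists[OF p(1) fform_lam nz_lam[OF s]] by blast
    have "1 \<le> i" using vo_ge_1[OF p(1) fform_lam p(3) i] .
    have "vo p (e + 1) (\<lambda>x. g x * h x) (n + 0)" by (rule vo_mult[OF n vo_0[OF h(1) \<open>h p \<noteq> 0\<close>]])
    moreover have "vo p (e + 1) (\<lambda>x. g x * h x) (i + m)" using vo_cong[OF lf[OF i m] h(2)] by simp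
    ultimately have "i + m = n" using vo_unique[OF p(1)] by fastforce
    \<comment> \<open>Away from s the divisor of f / g is nonnegative, so n \<le> m, whereas i \<ge>
      1.\<close>
    then show False using v[OF p(1) m n] p(2) \<open>1 \<le> i\<close> by (simp add: point_div_def split: if_splits)
  qed
  obtain c where c: "\<And>x. h x = c * lam s x"
    using linear_through_conjugates[OF s kl h(1)] hz by blast
  have fc: "f x = c * g x" if "x \<in> J" for x
    by (rule form_cancel_eq[OF fform_lam nz_lam[OF s] fg(1) fform_scale[OF fg(2)] _ that])
      (use h(2) c in \<open>simp add: mult_ac\<close>)
  then have "c \<noteq> 0" using fg(3) unfolding nz_def by auto
  obtain n where n: "vo s e g n" using vo_exists[OF s fg(2,4)] by blast
  have "vo s (0 + e) (\<lambda>x. c * g x) (0 + n)" by (rule vo_mult[OF vo_0[OF fform_const] n]) (use \<open>c \<noteq> 0\<close> in simp)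
  then have "vo s e f n" using vo_cong[of s e "\<lambda>x. c * g x" n f] fc by simp
  from v[OF s this n] have "point_div r s = point_div s s" by simp
  then show ?thesis using sim_refl by (simp add: point_div_def split: if_splits)
qed

end

subsection \<open>Local rings\<close>

text \<open>Products provide intersections of basic open sets and common denominators, the constant
  1 the whole space. The locale serves the curve and its square alike.\<close>

locale form_system =
  fixes V :: "'p set" and \<F> :: "('p \<Rightarrow> 'k::field) set set"
  assumes mult: "S \<in> \<F> \<Longrightarrow> T \<in> \<F> \<Longrightarrow> \<exists>U\<in>\<F>. \<forall>f\<in>S. \<forall>g\<in>T. (\<lambda>x. f x * g x) \<in> U"
    and one: "\<exists>S\<in>\<F>. (\<lambda>_. 1) \<in> S"
begin

lemma near_mono: "near V \<F> x R \<Longrightarrow> (\<And>y. y \<in> V \<Longrightarrow> R y \<Longrightarrow> R' y) \<Longrightarrow> near V \<F> x R'"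
  unfolding near_def by blast

lemma near_conj:
  assumes "near V \<F> x R" "near V \<F> x R'" shows "near V \<F> x (\<lambda>y. R y \<and> R' y)"
proof -
  obtain S g where 1: "S \<in> \<F>" "g \<in> S" "g x \<noteq> 0" "\<forall>y\<in>V. g y \<noteq> 0 \<longrightarrow> R y"
    using assms(1) unfolding near_def by blast
  obtain T h where 2: "T \<in> \<F>" "h \<in> T" "h x \<noteq> 0" "\<forall>y\<in>V. h y \<noteq> 0 \<longrightarrow> R' y"
    using assms(2) unfolding near_def by blast
  obtain U where "U \<in> \<F>" "(\<lambda>x. g x * h x) \<in> U" using mult[OF 1(1) 2(1)] 1(2) 2(2) by blast
  then show ?thesis unfolding near_def using 1 2
    by (intro bexI[of _ U] bexI[of _ "\<lambda>x. g x * h x"]) auto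
qed

lemma near_form: "S \<in> \<F> \<Longrightarrow> g \<in> S \<Longrightarrow> g x \<noteq> 0 \<Longrightarrow> near V \<F> x (\<lambda>y. g y \<noteq> 0)"
  unfolding near_def by blast

lemma near_true: "(\<And>y. y \<in> V \<Longrightarrow> R y) \<Longrightarrow> near V \<F> x R"
  using one unfolding near_def by (metis zero_neq_one)

lemma near_self: "x \<in> V \<Longrightarrow> near V \<F> x R \<Longrightarrow> R x"
  unfolding near_def by blast

lemma regular_at_one: "regular_at V \<F> x (\<lambda>_. 1)"
proof -
  obtain S where S: "S \<in> \<F>" "(\<lambda>_. 1) \<in> S" using one by blast
  then show ?thesis unfolding regular_at_def
    by (intro bexI[of _ S] bexI[of _ "\<lambda>_. 1"] near_true) auto
qed

lemma regular_at_mult: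
  assumes "regular_at V \<F> x u" "regular_at V \<F> x v" shows "regular_at V \<F> x (\<lambda>y. u y * v y)"
proof -
  obtain S f g where 1: "S \<in> \<F>" "f \<in> S" "g \<in> S" "near V \<F> x (\<lambda>y. g y \<noteq> 0 \<and> u y = f y / g y)"
    using assms(1) unfolding regular_at_def by blast
  obtain T h k where 2: "T \<in> \<F>" "h \<in> T" "k \<in> T" "near V \<F> x (\<lambda>y. k y \<noteq> 0 \<and> v y = h y / k y)"
    using assms(2) unfolding regular_at_def by blast
  obtain U where U: "U \<in> \<F>" "(\<lambda>x. f x * h x) \<in> U" "(\<lambda>x. g x * k x) \<in> U" using mult[OF 1(1) 2(1)] 1(2,3) 2(2,3) by blast
  have "near V \<F> x (\<lambda>y. g y * k y \<noteq> 0 \<and> u y * v y = (f y * h y) / (g y * k y))"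
    by (rule near_mono[OF near_conj[OF 1(4) 2(4)]]) auto
  then show ?thesis unfolding regular_at_def using U by (intro bexI[of _ U] bexI[OF _ U(2)] bexI[OF _ U(3)])
qed

lemma unit_at_mult: "unit_at V \<F> x u \<Longrightarrow> unit_at V \<F> x v \<Longrightarrow> unit_at V \<F> x (\<lambda>y. u y * v y)"
  unfolding unit_at_def using regular_at_mult by auto

lemma unit_at_one: "unit_at V \<F> x (\<lambda>_. 1)"
  unfolding unit_at_def using regular_at_one by auto

lemma unit_at_power: "unit_at V \<F> x u \<Longrightarrow> unit_at V \<F> x (\<lambda>y. u y ^ n)"
  by (induction n) (auto intro: unit_at_one unit_at_mult)

lemma unit_at_inverse:
  assumes x: "x \<in> V" and u: "unit_at V \<F> x u" shows "unit_at V \<F> x (\<lambda>y. inverse (u y))"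
proof -
  obtain S f g where 1: "S \<in> \<F>" "f \<in> S" "g \<in> S" "near V \<F> x (\<lambda>y. g y \<noteq> 0 \<and> u y = f y / g y)"
    using u unfolding unit_at_def regular_at_def by blast
  have "f x \<noteq> 0" using near_self[OF x 1(4)] u unfolding unit_at_def by auto
  then have "near V \<F> x (\<lambda>y. f y \<noteq> 0)" using near_form 1 by blast
  then have "near V \<F> x (\<lambda>y. f y \<noteq> 0 \<and> inverse (u y) = g y / f y)"
    by (rule near_mono[OF near_conj[OF _ 1(4)]]) auto
  then show ?thesis using 1 u unfolding unit_at_def regular_at_def by auto
qed

lemma associated_at_trans:
  assumes "associated_at V \<F> x \<phi> \<psi>" "associated_at V \<F> x \<psi> \<rho>" shows "associated_at V \<F> x \<phi> \<rho>"
proof -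
  obtain u where u: "unit_at V \<F> x u" "near V \<F> x (\<lambda>y. \<phi> y = u y * \<psi> y)"
    using assms(1) unfolding associated_at_def by blast
  obtain v where v: "unit_at V \<F> x v" "near V \<F> x (\<lambda>y. \<psi> y = v y * \<rho> y)"
    using assms(2) unfolding associated_at_def by blast
  have "near V \<F> x (\<lambda>y. \<phi> y = (u y * v y) * \<rho> y)"
    by (rule near_mono[OF near_conj[OF u(2) v(2)]]) simp
  then show ?thesis unfolding associated_at_def using unit_at_mult[OF u(1) v(1)] by blast
qed

lemma associated_at_sym:
  assumes x: "x \<in> V" and "associated_at V \<F> x \<phi> \<psi>" shows "associated_at V \<F> x \<psi> \<phi>"
proof -
  obtain u where u: "unit_at V \<F> x u" "near V \<F> x (\<lambda>y. \<phi> y = u y * \<psi> y)"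
    using assms(2) unfolding associated_at_def by blast
  obtain S f g where 1: "S \<in> \<F>" "f \<in> S" "g \<in> S" "near V \<F> x (\<lambda>y. g y \<noteq> 0 \<and> u y = f y / g y)"
    using u unfolding unit_at_def regular_at_def by blast
  have "f x \<noteq> 0" using near_self[OF x 1(4)] u unfolding unit_at_def by auto
  then have "near V \<F> x (\<lambda>y. f y \<noteq> 0)" using near_form 1 by blast
  from near_conj[OF near_conj[OF this 1(4)] u(2)] have "near V \<F> x (\<lambda>y. \<psi> y = inverse (u y) * \<phi> y)"
    by (rule near_mono) auto
  then show ?thesis unfolding associated_at_def using unit_at_inverse[OF x u(1)] by blast
qed

lemma associated_at_refl: "associated_at V \<F> x \<phi> \<phi>"
  unfolding associated_at_def by (rule exI[of _ "\<lambda>_. 1"]) (auto intro: unit_at_one near_true)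

end

section \<open>Points of projective space as classes of vectors\<close>

lemma rep_proj3_nonzero: "rep_proj3 P \<noteq> 0"
  using Quotient3_rep_reflp[OF Quotient3_proj3, of P] by (simp add: proportional_def)

lemma abs_rep_proj3: "abs_proj3 (rep_proj3 P) = P"
  by (rule Quotient3_abs_rep[OF Quotient3_proj3])

lemma abs_proj3_eq_iff: "v \<noteq> 0 \<Longrightarrow> w \<noteq> 0 \<Longrightarrow> abs_proj3 v = abs_proj3 w \<longleftrightarrow> proportional v w"
proof -
  assume "v \<noteq> 0" "w \<noteq> 0"
  then have "proportional v v" "proportional w w"
    unfolding proportional_def by (auto intro!: exI[of _ 1])
  then show ?thesis using Quotient3_rel[OF Quotient3_proj3, of v w] by blast
qed

lemma forms3_iff: "(S :: ('a::field proj3 \<Rightarrow> 'a) set) \<in> forms3 \<longleftrightarrow> (\<exists>d. S = {(\<lambda>P. f (rep_proj3 P)) |f. fform d f})"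
proof -
  have "{(\<lambda>P. mp_eval id (($) (rep_proj3 P)) F) |F. homogeneous d F} =
    ({(\<lambda>P. f (rep_proj3 P)) |f. fform d f} :: ('a proj3 \<Rightarrow> 'a) set)" for d
  proof (intro Set.set_eqI iffI)
    fix \<phi> :: "'a proj3 \<Rightarrow> 'a" assume "\<phi> \<in> {(\<lambda>P. mp_eval id (($) (rep_proj3 P)) F) |F. homogeneous d F}"
    then obtain F where F: "homogeneous d F" "\<phi> = (\<lambda>P. mp_eval id (($) (rep_proj3 P)) F)" by blast
    have "fform d (\<lambda>x. mp_eval id (($) x) F)" unfolding fform_iff_homogeneous using F(1) by blast
    then show "\<phi> \<in> {(\<lambda>P. f (rep_proj3 P)) |f. fform d f}"
      unfolding F(2) by (intro CollectI exI[of _ "\<lambda>x. mp_eval id (($) x) F"]) simp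
  next
    fix \<phi> :: "'a proj3 \<Rightarrow> 'a" assume "\<phi> \<in> {(\<lambda>P. f (rep_proj3 P)) |f. fform d f}"
    then show "\<phi> \<in> {(\<lambda>P. mp_eval id (($) (rep_proj3 P)) F) |F. homogeneous d F}"
      unfolding fform_iff_homogeneous by blast
  qed
  then show ?thesis unfolding forms3_def image_iff by simp
qed

lemma biforms_eq: "(biforms d e :: ('a::field proj3 \<times> 'a proj3 \<Rightarrow> 'a) set) = {(\<lambda>(P, Q). h (rep_proj3 P) (rep_proj3 Q)) |h. bform d e h}"
proof (intro Set.set_eqI iffI)
  fix \<phi> :: "'a::field proj3 \<times> 'a proj3 \<Rightarrow> 'a" assume "\<phi> \<in> biforms d e"
  then obtain F where F: "bihomogeneous d e F"
    "\<phi> = (\<lambda>(P, Q). mp_eval id (case_sum (($) (rep_proj3 P)) (($) (rep_proj3 Q))) F)"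
    unfolding biforms_def by blast
  have "bform d e (\<lambda>x y. mp_eval id (case_sum (($) x) (($) y)) F)"
    unfolding bform_iff_bihomogeneous using F(1) by blast
  then show "\<phi> \<in> {(\<lambda>(P, Q). h (rep_proj3 P) (rep_proj3 Q)) |h. bform d e h}"
    unfolding F(2) by (intro CollectI exI[of _ "\<lambda>x y. mp_eval id (case_sum (($) x) (($) y)) F"]) simp
next
  fix \<phi> :: "'a::field proj3 \<times> 'a proj3 \<Rightarrow> 'a"
  assume "\<phi> \<in> {(\<lambda>(P, Q). h (rep_proj3 P) (rep_proj3 Q)) |h. bform d e h}"
  then show "\<phi> \<in> biforms d e"
    unfolding biforms_def bform_iff_bihomogeneous by blast
qed

lemma form_system_forms3: "form_system forms3"
proof
  fix S T :: "('a proj3 \<Rightarrow> 'a) set" assume "S \<in> forms3" "T \<in> forms3"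
  then obtain d e where S: "S = {(\<lambda>P. f (rep_proj3 P)) |f. fform d f}" and T: "T = {(\<lambda>P. f (rep_proj3 P)) |f. fform e f}"
    unfolding forms3_iff by blast
  show "\<exists>U\<in>forms3. \<forall>f\<in>S. \<forall>g\<in>T. (\<lambda>x. f x * g x) \<in> U"
  proof (rule bexI[of _ "{(\<lambda>P. f (rep_proj3 P)) |f. fform (d + e) f}"])
    show "\<forall>f\<in>S. \<forall>g\<in>T. (\<lambda>x. f x * g x) \<in> {\<lambda>P. f (rep_proj3 P) |f. fform (d + e) f}"
      unfolding S T using fform_mult[OF _ _ refl] by fastforce
    show "{\<lambda>P. f (rep_proj3 P) |f. fform (d + e) f} \<in> forms3" unfolding forms3_iff by blast
  qed
next
  show "\<exists>S\<in>forms3. (\<lambda>_. 1 :: 'a) \<in> S"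
  proof (rule bexI[of _ "{(\<lambda>P. f (rep_proj3 P)) |f. fform 0 f}"])
    show "(\<lambda>_. 1) \<in> {(\<lambda>P. f (rep_proj3 P)) |f. fform 0 f}"
      using fform_const[of 1] by (intro CollectI exI[of _ "\<lambda>_. 1"]) simp
    show "{(\<lambda>P. f (rep_proj3 P)) |f. fform 0 f} \<in> forms3" unfolding forms3_iff by blast
  qed
qed

lemma form_system_forms33: "form_system forms33"
proof
  fix S T :: "('a proj3 \<times> 'a proj3 \<Rightarrow> 'a) set" assume "S \<in> forms33" "T \<in> forms33"
  then obtain d e d' e' where S: "S = biforms d e" and T: "T = biforms d' e'"
    unfolding forms33_def by blast
  show "\<exists>U\<in>forms33. \<forall>f\<in>S. \<forall>g\<in>T. (\<lambda>x. f x * g x) \<in> U"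
  proof (rule bexI[of _ "biforms (d + d') (e + e')"])
    show "\<forall>f\<in>S. \<forall>g\<in>T. (\<lambda>x. f x * g x) \<in> biforms (d + d') (e + e')"
    proof (intro ballI)
      fix f g assume "f \<in> S" "g \<in> T"
      then obtain h k where "bform d e h" "f = (\<lambda>(P, Q). h (rep_proj3 P) (rep_proj3 Q))"
        "bform d' e' k" "g = (\<lambda>(P, Q). k (rep_proj3 P) (rep_proj3 Q))"
        unfolding S T biforms_eq by blast
      then show "(\<lambda>x. f x * g x) \<in> biforms (d + d') (e + e')"
        unfolding biforms_eq using bform_mult[of d e h d' e' k, OF _ _ refl refl]
        by (intro CollectI exI[of _ "\<lambda>x y. h x y * k x y"]) auto
    qed
    show "biforms (d + d') (e + e') \<in> forms33" unfolding forms33_def by blast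
  qed
next
  have "(\<lambda>_. 1 :: 'a) \<in> biforms 0 0"
    unfolding biforms_eq using bform_const[of 1] by (intro CollectI exI[of _ "\<lambda>_ _. 1"]) auto
  then show "\<exists>S\<in>forms33. (\<lambda>_. 1 :: 'a) \<in> S" unfolding forms33_def by blast
qed

context jacobi_curve
begin

abbreviation C :: "'k proj3 set" where "C \<equiv> curveJ a b"

sublocale S3: form_system C forms3 by (rule form_system_forms3)
sublocale S33: form_system "C \<times> C" forms33 by (rule form_system_forms33)

lemma rep_in_J: "P \<in> C \<longleftrightarrow> rep_proj3 P \<in> J"
  by (simp add: curveJ_def J_def rep_proj3_nonzero)

lemma abs_eq_iff: "v \<in> J \<Longrightarrow> w \<in> J \<Longrightarrow> abs_proj3 v = abs_proj3 w \<longleftrightarrow> sim v w"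
  by (subst abs_proj3_eq_iff) (auto simp: J_def proportional_def sim_def)

lemma sim_rep_abs: assumes "v \<in> J" shows "sim v (rep_proj3 (abs_proj3 v))"
proof -
  have "abs_proj3 v = abs_proj3 (rep_proj3 (abs_proj3 v))" by (simp add: abs_rep_proj3)
  then show ?thesis using assms
    by (subst (asm) abs_proj3_eq_iff) (auto simp: J_def proportional_def sim_def rep_proj3_nonzero)
qed

lemma sim_J: "sim v w \<Longrightarrow> v \<in> J \<Longrightarrow> w \<in> J"
  unfolding sim_def using J_scale by blast

lemma abs_in_C: "v \<in> J \<Longrightarrow> abs_proj3 v \<in> C"
  using rep_in_J sim_rep_abs sim_J by blast

lemma near_C_iff: "near C forms3 P R \<longleftrightarrow>
  (\<exists>d g. fform d g \<and> g (rep_proj3 P) \<noteq> 0 \<and> (\<forall>y\<in>C. g (rep_proj3 y) \<noteq> 0 \<longrightarrow> R y))"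
  unfolding near_def Bex_def forms3_iff by blast

lemma regular_C_iff: "regular_at C forms3 P \<phi> \<longleftrightarrow>
  (\<exists>d f g. fform d f \<and> fform d g \<and> near C forms3 P (\<lambda>y. g (rep_proj3 y) \<noteq> 0 \<and> \<phi> y = f (rep_proj3 y) / g (rep_proj3 y)))"
  unfolding regular_at_def Bex_def forms3_iff by blast

lemma near_C_form: "fform d g \<Longrightarrow> g (rep_proj3 P) \<noteq> 0 \<Longrightarrow> near C forms3 P (\<lambda>y. g (rep_proj3 y) \<noteq> 0)"
  unfolding near_C_iff by blast

lemma J_point:
  assumes "x \<in> J" obtains P s where "P \<in> C" "s \<noteq> 0" "rep_proj3 P = s *s x"
  using abs_in_C[OF assms] sim_rep_abs[OF assms] unfolding sim_def by blast

text \<open>The forms on the curve are a domain, so they are determined by their values on an open set.\<close>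

lemma near_form_eq:
  assumes P: "P \<in> C" and f: "fform d f" "fform d f'"
    and n: "near C forms3 P (\<lambda>y. f (rep_proj3 y) = f' (rep_proj3 y))" and x: "x \<in> J"
  shows "f x = f' x"
proof -
  obtain e g where g: "fform e g" "g (rep_proj3 P) \<noteq> 0" "\<forall>y\<in>C. g (rep_proj3 y) \<noteq> 0 \<longrightarrow> f (rep_proj3 y) = f' (rep_proj3 y)"
    using n unfolding near_C_iff by blast
  have "nz g" using g(2) P rep_in_J unfolding nz_def by blast
  show ?thesis
  proof (rule form_cancel_eq[OF g(1) \<open>nz g\<close> f _ x])
    fix z assume z: "z \<in> J"
    obtain Q s where Q: "Q \<in> C" "s \<noteq> 0" "rep_proj3 Q = s *s z" using J_point[OF z] by blast
    show "g z * f z = g z * f' z"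
    proof (cases "g z = 0")
      case False
      then have "g (rep_proj3 Q) \<noteq> 0" using Q fform_homogeneous[OF g(1)] by simp
      then have "f (s *s z) = f' (s *s z)" using g(3) Q by metis
      then show ?thesis using Q(2) fform_homogeneous[OF f(1)] fform_homogeneous[OF f(2)] by simp
    qed simp
  qed
qed

text \<open>Division by a coordinate that is nonzero at P turns the linear form into a function;
  that it divides every function vanishing at P is \<open>vge_1\<close>.\<close>

lemma uniformizer_lam:
  assumes P: "P \<in> C" and k: "rep_proj3 P $ k \<noteq> 0"
  shows "uniformizer_at C forms3 P (\<lambda>y. lam (rep_proj3 P) (rep_proj3 y) / rep_proj3 y $ k)"
proof -
  let ?p = "rep_proj3 P"
  let ?t = "\<lambda>y. lam ?p (rep_proj3 y) / rep_proj3 y $ k"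
  have p: "?p \<in> J" using P rep_in_J by blast
  have nk: "near C forms3 P (\<lambda>y. rep_proj3 y $ k \<noteq> 0)" by (rule near_C_form[OF fform_var k])
  have "regular_at C forms3 P ?t"
    unfolding regular_C_iff
    by (rule exI[of _ 1], rule exI[of _ "lam ?p"], rule exI[of _ "\<lambda>x. x $ k"])
      (intro conjI fform_lam fform_var S3.near_mono[OF nk], simp_all)
  moreover have "?t P = 0" by (simp add: lam_self)
  moreover have "\<exists>\<psi>. regular_at C forms3 P \<psi> \<and> near C forms3 P (\<lambda>y. \<phi> y = ?t y * \<psi> y)"
    if \<phi>: "regular_at C forms3 P \<phi>" "\<phi> P = 0" for \<phi>
  proof -
    obtain d f g where 1: "fform d f" "fform d g" "near C forms3 P (\<lambda>y. g (rep_proj3 y) \<noteq> 0 \<and> \<phi> y = f (rep_proj3 y) / g (rep_proj3 y))"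
      using \<phi>(1) unfolding regular_C_iff by blast
    have g0: "g ?p \<noteq> 0" and "f ?p = 0" using S3.near_self[OF P 1(3)] \<phi>(2) by auto
    then obtain m e G F where 2: "fform m G" "fform e F" "m + d = 1 + e" "G ?p \<noteq> 0" "\<forall>x\<in>J. G x * f x = lam ?p x ^ 1 * F x"
      using vge_1[OF p 1(1)] unfolding vge_def by blast
    define \<psi> where "\<psi> y = (F (rep_proj3 y) * rep_proj3 y $ k) / (G (rep_proj3 y) * g (rep_proj3 y))" for y
    have nG: "near C forms3 P (\<lambda>y. G (rep_proj3 y) \<noteq> 0)" by (rule near_C_form[OF 2(1,4)])
    have "fform (m + d) (\<lambda>x. F x * x $ k)" by (rule fform_mult[OF 2(2) fform_var]) (use 2(3) in simp)
    moreover have "fform (m + d) (\<lambda>x. G x * g x)" by (rule fform_mult[OF 2(1) 1(2) refl])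
    moreover have "near C forms3 P (\<lambda>y. G (rep_proj3 y) * g (rep_proj3 y) \<noteq> 0 \<and>
        \<psi> y = (F (rep_proj3 y) * rep_proj3 y $ k) / (G (rep_proj3 y) * g (rep_proj3 y)))"
      by (rule S3.near_mono[OF S3.near_conj[OF nG 1(3)]]) (simp add: \<psi>_def)
    ultimately have "regular_at C forms3 P \<psi>" unfolding regular_C_iff by blast
    moreover have "near C forms3 P (\<lambda>y. \<phi> y = ?t y * \<psi> y)"
    proof (rule S3.near_mono[OF S3.near_conj[OF S3.near_conj[OF nG nk] 1(3)]])
      fix y assume y: "y \<in> C" and h: "(G (rep_proj3 y) \<noteq> 0 \<and> rep_proj3 y $ k \<noteq> 0) \<and> g (rep_proj3 y) \<noteq> 0 \<and> \<phi> y = f (rep_proj3 y) / g (rep_proj3 y)"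
      have "G (rep_proj3 y) * f (rep_proj3 y) = lam ?p (rep_proj3 y) * F (rep_proj3 y)"
        using 2(5) y rep_in_J by simp
      then have "f (rep_proj3 y) = lam ?p (rep_proj3 y) * F (rep_proj3 y) / G (rep_proj3 y)" using h by (simp add: field_simps)
      then show "\<phi> y = ?t y * \<psi> y" using h by (simp add: \<psi>_def field_simps)
    qed
    ultimately show ?thesis by blast
  qed
  ultimately show ?thesis unfolding uniformizer_at_def by blast
qed

text \<open>Two uniformizers divide each other. The product of the cofactors is 1, first near P
  after multiplication by \<open>lam\<close>, then after cancelling it as a form. So the order does
  not depend on the uniformizer.\<close>

lemma uniformizers_associated:
  assumes P: "P \<in> C" and k: "rep_proj3 P $ k \<noteq> 0" and t: "uniformizer_at C forms3 P t"
  shows "associated_at C forms3 P t (\<lambda>y. lam (rep_proj3 P) (rep_proj3 y) / rep_proj3 y $ k)"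
proof -
  let ?p = "rep_proj3 P"
  let ?t = "\<lambda>y. lam ?p (rep_proj3 y) / rep_proj3 y $ k"
  have p: "?p \<in> J" using P rep_in_J by blast
  note u = uniformizer_lam[OF P k]
  obtain \<psi> where \<psi>: "regular_at C forms3 P \<psi>" "near C forms3 P (\<lambda>y. t y = ?t y * \<psi> y)"
    using u t unfolding uniformizer_at_def by blast
  obtain \<psi>' where \<psi>': "regular_at C forms3 P \<psi>'" "near C forms3 P (\<lambda>y. ?t y = t y * \<psi>' y)"
    using u t unfolding uniformizer_at_def by blast
  obtain d f g where 1: "fform d f" "fform d g" "near C forms3 P (\<lambda>y. g (rep_proj3 y) \<noteq> 0 \<and> \<psi> y = f (rep_proj3 y) / g (rep_proj3 y))"
    using \<psi>(1) unfolding regular_C_iff by blast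
  obtain d' f' g' where 2: "fform d' f'" "fform d' g'" "near C forms3 P (\<lambda>y. g' (rep_proj3 y) \<noteq> 0 \<and> \<psi>' y = f' (rep_proj3 y) / g' (rep_proj3 y))"
    using \<psi>'(1) unfolding regular_C_iff by blast
  have nk: "near C forms3 P (\<lambda>y. rep_proj3 y $ k \<noteq> 0)" by (rule near_C_form[OF fform_var k])
  have fg: "fform (d + d') (\<lambda>x. g x * g' x)" "fform (d + d') (\<lambda>x. f x * f' x)"
    by (rule fform_mult[OF 1(2) 2(2) refl] fform_mult[OF 1(1) 2(1) refl])+
  have "lam ?p x * (g x * g' x) = lam ?p x * (f x * f' x)" if x: "x \<in> J" for x
  proof (rule near_form_eq[OF P fform_mult[OF fform_lam fg(1) refl] fform_mult[OF fform_lam fg(2) refl] _ x])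
    show "near C forms3 P (\<lambda>y. lam ?p (rep_proj3 y) * (g (rep_proj3 y) * g' (rep_proj3 y)) = lam ?p (rep_proj3 y) * (f (rep_proj3 y) * f' (rep_proj3 y)))"
    proof (rule S3.near_mono[OF S3.near_conj[OF S3.near_conj[OF 1(3) 2(3)] S3.near_conj[OF nk S3.near_conj[OF \<psi>(2) \<psi>'(2)]]]])
      fix y assume "((g (rep_proj3 y) \<noteq> 0 \<and> \<psi> y = f (rep_proj3 y) / g (rep_proj3 y)) \<and> g' (rep_proj3 y) \<noteq> 0 \<and> \<psi>' y = f' (rep_proj3 y) / g' (rep_proj3 y)) \<and>
        rep_proj3 y $ k \<noteq> 0 \<and> t y = ?t y * \<psi> y \<and> ?t y = t y * \<psi>' y"
      then have h: "g (rep_proj3 y) \<noteq> 0" "g' (rep_proj3 y) \<noteq> 0" "rep_proj3 y $ k \<noteq> 0"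
        "?t y = ?t y * (f (rep_proj3 y) / g (rep_proj3 y)) * (f' (rep_proj3 y) / g' (rep_proj3 y))" by metis+
      then show "lam ?p (rep_proj3 y) * (g (rep_proj3 y) * g' (rep_proj3 y)) = lam ?p (rep_proj3 y) * (f (rep_proj3 y) * f' (rep_proj3 y))"
        by (simp add: field_simps)
    qed
  qed
  then have "g ?p * g' ?p = f ?p * f' ?p"
    using form_cancel_eq[OF fform_lam nz_lam[OF p] fg _ p] by blast
  moreover have "g ?p \<noteq> 0" "g' ?p \<noteq> 0" "\<psi> P = f ?p / g ?p"
    using S3.near_self[OF P 1(3)] S3.near_self[OF P 2(3)] by auto
  ultimately have "\<psi> P \<noteq> 0" by auto
  then have "unit_at C forms3 P \<psi>" using \<psi>(1) by (simp add: unit_at_def)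
  moreover have "near C forms3 P (\<lambda>y. t y = \<psi> y * ?t y)"
    using \<psi>(2) by (rule S3.near_mono) (simp add: mult.commute)
  ultimately show ?thesis unfolding associated_at_def by blast
qed

text \<open>The dictionary between local rings and forms: a unit at P is a quotient of forms nonzero
  at P, and clearing denominators produces exactly the two unit factors in
  \<open>vo\<close>.\<close>

lemma associated_lam_power_iff:
  assumes P: "P \<in> C" and k: "rep_proj3 P $ k \<noteq> 0" and f: "fform d f" and h: "fform d h" "h (rep_proj3 P) \<noteq> 0"
  shows "associated_at C forms3 P (\<lambda>y. f (rep_proj3 y) / h (rep_proj3 y)) (\<lambda>y. (lam (rep_proj3 P) (rep_proj3 y) / rep_proj3 y $ k) ^ n)
    \<longleftrightarrow> vo (rep_proj3 P) d f n"
proof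
  let ?p = "rep_proj3 P"
  have p: "?p \<in> J" using P rep_in_J by blast
  have nk: "near C forms3 P (\<lambda>y. rep_proj3 y $ k \<noteq> 0)" by (rule near_C_form[OF fform_var k])
  have nh: "near C forms3 P (\<lambda>y. h (rep_proj3 y) \<noteq> 0)" by (rule near_C_form[OF h])
  {
    assume "associated_at C forms3 P (\<lambda>y. f (rep_proj3 y) / h (rep_proj3 y)) (\<lambda>y. (lam ?p (rep_proj3 y) / rep_proj3 y $ k) ^ n)"
    then obtain u where u: "unit_at C forms3 P u" "near C forms3 P (\<lambda>y. f (rep_proj3 y) / h (rep_proj3 y) = u y * (lam ?p (rep_proj3 y) / rep_proj3 y $ k) ^ n)"
      unfolding associated_at_def by blast
    obtain e v w where 1: "fform e v" "fform e w" "near C forms3 P (\<lambda>y. w (rep_proj3 y) \<noteq> 0 \<and> u y = v (rep_proj3 y) / w (rep_proj3 y))"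
      using u(1) unfolding unit_at_def regular_C_iff by blast
    have w: "w ?p \<noteq> 0" "v ?p \<noteq> 0" using S3.near_self[OF P 1(3)] u(1) unfolding unit_at_def by auto
    have g: "fform (e + n) (\<lambda>x. w x * (x $ k) ^ n)" by (rule fform_mult[OF 1(2) fform_power[OF fform_var refl]]) simp
    have F: "fform (e + d) (\<lambda>x. v x * h x)" by (rule fform_mult[OF 1(1) h(1) refl])
    show "vo ?p d f n"
    proof (rule voI[OF g F])
      fix x assume x: "x \<in> J"
      have gf: "fform (e + n + d) (\<lambda>x. w x * (x $ k) ^ n * f x)" by (rule fform_mult[OF g f refl])
      have lF: "fform (e + n + d) (\<lambda>x. lam ?p x ^ n * (v x * h x))"
        by (rule fform_mult[OF fform_power[OF fform_lam refl] F]) simp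
      show "w x * (x $ k) ^ n * f x = lam ?p x ^ n * (v x * h x)"
      proof (rule near_form_eq[OF P gf lF _ x])
        show "near C forms3 P (\<lambda>y. w (rep_proj3 y) * (rep_proj3 y $ k) ^ n * f (rep_proj3 y) = lam ?p (rep_proj3 y) ^ n * (v (rep_proj3 y) * h (rep_proj3 y)))"
        proof (rule S3.near_mono[OF S3.near_conj[OF S3.near_conj[OF nk nh] S3.near_conj[OF 1(3) u(2)]]])
          fix y assume "(rep_proj3 y $ k \<noteq> 0 \<and> h (rep_proj3 y) \<noteq> 0) \<and>
            (w (rep_proj3 y) \<noteq> 0 \<and> u y = v (rep_proj3 y) / w (rep_proj3 y)) \<and>
            f (rep_proj3 y) / h (rep_proj3 y) = u y * (lam ?p (rep_proj3 y) / rep_proj3 y $ k) ^ n"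
          then have nz: "rep_proj3 y $ k \<noteq> 0" "h (rep_proj3 y) \<noteq> 0" "w (rep_proj3 y) \<noteq> 0" and
            eq: "f (rep_proj3 y) = v (rep_proj3 y) / w (rep_proj3 y) * (lam ?p (rep_proj3 y) ^ n / (rep_proj3 y $ k) ^ n) * h (rep_proj3 y)"
            by (auto simp: power_divide divide_eq_eq)
          show "w (rep_proj3 y) * (rep_proj3 y $ k) ^ n * f (rep_proj3 y) = lam ?p (rep_proj3 y) ^ n * (v (rep_proj3 y) * h (rep_proj3 y))"
            unfolding eq using nz by simp
        qed
      qed
    qed (use w k h in auto)
  }
  {
    assume "vo ?p d f n"
    then obtain m e g F where 1: "fform m g" "fform e F" "m + d = n + e" "g ?p \<noteq> 0" "F ?p \<noteq> 0" "\<forall>x\<in>J. g x * f x = lam ?p x ^ n * F x"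
      unfolding vo_def by blast
    define u where "u y = (F (rep_proj3 y) * (rep_proj3 y $ k) ^ n) / (g (rep_proj3 y) * h (rep_proj3 y))" for y
    have ng: "near C forms3 P (\<lambda>y. g (rep_proj3 y) \<noteq> 0)" by (rule near_C_form[OF 1(1,4)])
    have "fform (m + d) (\<lambda>x. F x * (x $ k) ^ n)" by (rule fform_mult[OF 1(2) fform_power[OF fform_var refl]]) (use 1(3) in simp)
    moreover have "fform (m + d) (\<lambda>x. g x * h x)" by (rule fform_mult[OF 1(1) h(1) refl])
    moreover have "near C forms3 P (\<lambda>y. g (rep_proj3 y) * h (rep_proj3 y) \<noteq> 0 \<and>
        u y = (F (rep_proj3 y) * (rep_proj3 y $ k) ^ n) / (g (rep_proj3 y) * h (rep_proj3 y)))"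
      by (rule S3.near_mono[OF S3.near_conj[OF ng nh]]) (simp add: u_def)
    ultimately have "regular_at C forms3 P u" unfolding regular_C_iff by blast
    then have "unit_at C forms3 P u" unfolding unit_at_def using 1(4,5) h(2) k by (simp add: u_def)
    moreover have "near C forms3 P (\<lambda>y. f (rep_proj3 y) / h (rep_proj3 y) = u y * (lam ?p (rep_proj3 y) / rep_proj3 y $ k) ^ n)"
    proof (rule S3.near_mono[OF S3.near_conj[OF ng S3.near_conj[OF nk nh]]])
      fix y assume y: "y \<in> C" and hh: "g (rep_proj3 y) \<noteq> 0 \<and> rep_proj3 y $ k \<noteq> 0 \<and> h (rep_proj3 y) \<noteq> 0"
      have "g (rep_proj3 y) * f (rep_proj3 y) = lam ?p (rep_proj3 y) ^ n * F (rep_proj3 y)" using 1(6) y rep_in_J by simp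
      then have "f (rep_proj3 y) = lam ?p (rep_proj3 y) ^ n * F (rep_proj3 y) / g (rep_proj3 y)" using hh by (simp add: field_simps)
      then show "f (rep_proj3 y) / h (rep_proj3 y) = u y * (lam ?p (rep_proj3 y) / rep_proj3 y $ k) ^ n"
        using hh by (simp add: u_def power_divide)
    qed
    ultimately show "associated_at C forms3 P (\<lambda>y. f (rep_proj3 y) / h (rep_proj3 y)) (\<lambda>y. (lam ?p (rep_proj3 y) / rep_proj3 y $ k) ^ n)"
      unfolding associated_at_def by blast
  }
qed

lemma associated_power:
  "associated_at C forms3 P t s \<Longrightarrow> associated_at C forms3 P (\<lambda>y. t y ^ n) (\<lambda>y. s y ^ n)"
proof -
  assume "associated_at C forms3 P t s"
  then obtain u where u: "unit_at C forms3 P u" "near C forms3 P (\<lambda>y. t y = u y * s y)"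
    unfolding associated_at_def by blast
  have "near C forms3 P (\<lambda>y. t y ^ n = u y ^ n * s y ^ n)"
    using u(2) by (rule S3.near_mono) (simp add: power_mult_distrib)
  then show ?thesis unfolding associated_at_def using S3.unit_at_power[OF u(1)] by blast
qed

lemma ord_at_eq:
  assumes P: "P \<in> C" and f: "fform d f" and h: "fform d h" "h (rep_proj3 P) \<noteq> 0" and n: "vo (rep_proj3 P) d f n"
  shows "ord_at C forms3 P (\<lambda>y. f (rep_proj3 y) / h (rep_proj3 y)) = n"
  unfolding ord_at_def
proof (rule the_equality)
  obtain k where k: "rep_proj3 P $ k \<noteq> 0" using P rep_in_J J_two_nonzero(1) by blast
  show "\<exists>t. uniformizer_at C forms3 P t \<and> associated_at C forms3 P (\<lambda>y. f (rep_proj3 y) / h (rep_proj3 y)) (\<lambda>y. t y ^ n)"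
    using uniformizer_lam[OF P k] associated_lam_power_iff[OF P k f h] n by blast
  fix m assume "\<exists>t. uniformizer_at C forms3 P t \<and> associated_at C forms3 P (\<lambda>y. f (rep_proj3 y) / h (rep_proj3 y)) (\<lambda>y. t y ^ m)"
  then obtain t where t: "uniformizer_at C forms3 P t"
    "associated_at C forms3 P (\<lambda>y. f (rep_proj3 y) / h (rep_proj3 y)) (\<lambda>y. t y ^ m)" by blast
  have "vo (rep_proj3 P) d f m"
    using S3.associated_at_trans[OF t(2) associated_power[OF uniformizers_associated[OF P k t(1)]]]
      associated_lam_power_iff[OF P k f h] by blast
  then show "m = n" using vo_unique[OF _ _ n] P rep_in_J by blast
qed

lemma vo_sim: "sim p q \<Longrightarrow> vo p d f n \<Longrightarrow> vo q d f n"
  unfolding sim_def using vo_scale by blast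

text \<open>Numerator and denominator are measured against the same trivialising form; to construct
  one, a power of a coordinate that is nonzero at the point is taken.\<close>

lemma lin_equiv_iff:
  "lin_equiv C forms3 D E \<longleftrightarrow>
    principal (\<lambda>x. Poly_Mapping.lookup D (abs_proj3 x) - Poly_Mapping.lookup E (abs_proj3 x))"
proof
  assume "lin_equiv C forms3 D E"
  then obtain S F G where S: "S \<in> forms3" "F \<in> S" "G \<in> S" "\<exists>P\<in>C. F P \<noteq> 0" "\<exists>P\<in>C. G P \<noteq> 0"
    "\<forall>P\<in>C. \<exists>h\<in>S. h P \<noteq> 0 \<and> int (ord_at C forms3 P (\<lambda>y. F y / h y)) - int (ord_at C forms3 P (\<lambda>y. G y / h y))
          = Poly_Mapping.lookup D P - Poly_Mapping.lookup E P"
    unfolding lin_equiv_def by blast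
  obtain d where d: "S = {(\<lambda>P. f (rep_proj3 P)) |f. fform d f}" using S(1) forms3_iff by blast
  obtain f where f: "fform d f" "F = (\<lambda>P. f (rep_proj3 P))" using S(2) d by blast
  obtain g where g: "fform d g" "G = (\<lambda>P. g (rep_proj3 P))" using S(3) d by blast
  have nz: "nz f" "nz g" using S(4,5) f g rep_in_J unfolding nz_def by blast+
  show "principal (\<lambda>x. Poly_Mapping.lookup D (abs_proj3 x) - Poly_Mapping.lookup E (abs_proj3 x))"
  proof (rule principalI[OF f(1) g(1) nz])
    fix x assume x: "x \<in> J"
    define P where "P = abs_proj3 x"
    have P: "P \<in> C" "rep_proj3 P \<in> J" "sim (rep_proj3 P) x"
      using abs_in_C[OF x] rep_in_J sim_rep_abs[OF x] sim_sym by (auto simp: P_def)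
    obtain m where m: "vo (rep_proj3 P) d f m" using vo_exists[OF P(2) f(1) nz(1)] by blast
    obtain n where n: "vo (rep_proj3 P) d g n" using vo_exists[OF P(2) g(1) nz(2)] by blast
    obtain h where h: "fform d h" "h (rep_proj3 P) \<noteq> 0"
      "int (ord_at C forms3 P (\<lambda>y. F y / h (rep_proj3 y))) - int (ord_at C forms3 P (\<lambda>y. G y / h (rep_proj3 y)))
          = Poly_Mapping.lookup D P - Poly_Mapping.lookup E P"
      using S(6) P(1) unfolding d by fastforce
    have "Poly_Mapping.lookup D P - Poly_Mapping.lookup E P = int m - int n"
      using h(3) unfolding f(2) g(2) ord_at_eq[OF P(1) f(1) h(1,2) m] ord_at_eq[OF P(1) g(1) h(1,2) n] by simp
    then show "\<exists>m n. vo x d f m \<and> vo x d g n \<and> Poly_Mapping.lookup D (abs_proj3 x) - Poly_Mapping.lookup E (abs_proj3 x) = int m - int n"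
      using vo_sim[OF P(3) m] vo_sim[OF P(3) n] unfolding P_def by blast
  qed
next
  assume "principal (\<lambda>x. Poly_Mapping.lookup D (abs_proj3 x) - Poly_Mapping.lookup E (abs_proj3 x))"
  then obtain d f g where fg: "fform d f" "fform d g" "nz f" "nz g" and
    v: "\<And>p m n. p \<in> J \<Longrightarrow> vo p d f m \<Longrightarrow> vo p d g n \<Longrightarrow>
      Poly_Mapping.lookup D (abs_proj3 p) - Poly_Mapping.lookup E (abs_proj3 p) = int m - int n"
    unfolding principal_def by blast
  define S :: "('k proj3 \<Rightarrow> 'k) set" where "S = {(\<lambda>P. f (rep_proj3 P)) |f. fform d f}"
  have S: "S \<in> forms3" unfolding forms3_iff S_def by blast
  have ex: "\<exists>P\<in>C. f (rep_proj3 P) \<noteq> 0" if f: "fform d f" "nz f" for f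
  proof -
    obtain x where x: "x \<in> J" "f x \<noteq> 0" using f(2) unfolding nz_def by blast
    obtain P s where "P \<in> C" "s \<noteq> 0" "rep_proj3 P = s *s x" using J_point[OF x(1)] by blast
    then show ?thesis using x(2) fform_homogeneous[OF f(1)] by (intro bexI[of _ P]) auto
  qed
  have main: "\<exists>h\<in>S. h P \<noteq> 0 \<and> int (ord_at C forms3 P (\<lambda>y. f (rep_proj3 y) / h y)) - int (ord_at C forms3 P (\<lambda>y. g (rep_proj3 y) / h y))
          = Poly_Mapping.lookup D P - Poly_Mapping.lookup E P" if P: "P \<in> C" for P
  proof -
    have p: "rep_proj3 P \<in> J" using P rep_in_J by blast
    obtain k where k: "rep_proj3 P $ k \<noteq> 0" using J_two_nonzero(1)[OF p] by blast
    have h: "fform d (\<lambda>x. (x $ k) ^ d)" "(rep_proj3 P $ k) ^ d \<noteq> 0" using fform_power[OF fform_var, of d d k] k by auto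
    obtain m where m: "vo (rep_proj3 P) d f m" using vo_exists[OF p fg(1,3)] by blast
    obtain n where n: "vo (rep_proj3 P) d g n" using vo_exists[OF p fg(2,4)] by blast
    have "(\<lambda>P. (rep_proj3 P $ k) ^ d) \<in> S"
      unfolding S_def using h(1) by (intro CollectI exI[of _ "\<lambda>x. (x $ k) ^ d"]) simp
    then show ?thesis
      using v[OF p m n] ord_at_eq[OF P fg(1) h m] ord_at_eq[OF P fg(2) h n] h(2)
      by (intro bexI[of _ "\<lambda>P. (rep_proj3 P $ k) ^ d"]) (auto simp: abs_rep_proj3)
  qed
  have "(\<lambda>P. f (rep_proj3 P)) \<in> S" "(\<lambda>P. g (rep_proj3 P)) \<in> S" unfolding S_def using fg by blast+
  then show "lin_equiv C forms3 D E"
    unfolding lin_equiv_def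
    by (intro bexI[OF _ S] bexI[of _ "\<lambda>P. f (rep_proj3 P)"] bexI[of _ "\<lambda>P. g (rep_proj3 P)"]
      conjI ex[OF fg(1,3)] ex[OF fg(2,4)] ballI main)
qed

text \<open>The linear equivalence of (p) + (q) with (r) + (O) as a relation on vectors of the cone;
  the uniqueness of r up to scaling is a separate fact.\<close>

definition adds :: "'k ^ 4 \<Rightarrow> 'k ^ 4 \<Rightarrow> 'k ^ 4 \<Rightarrow> bool" where
  "adds p q r \<longleftrightarrow> principal (\<lambda>x. point_div p x + point_div q x - point_div r x - point_div origin x)"

lemma lin_equiv_adds:
  assumes "p \<in> J" "q \<in> J" "r \<in> J"
  shows "lin_equiv C forms3 (Poly_Mapping.single (abs_proj3 p) 1 + Poly_Mapping.single (abs_proj3 q) 1)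
       (Poly_Mapping.single (abs_proj3 r) 1 + Poly_Mapping.single originJ 1) \<longleftrightarrow> adds p q r"
proof -
  have o: "originJ = abs_proj3 origin" by (simp add: originJ_def origin_def)
  have l: "Poly_Mapping.lookup (Poly_Mapping.single (abs_proj3 v) (1::int)) (abs_proj3 x) = point_div v x"
    if "v \<in> J" "x \<in> J" for v x
    using abs_eq_iff[OF that] by (auto simp: lookup_single when_def point_div_def)
  show ?thesis
    unfolding lin_equiv_iff adds_def o
    by (rule iffI; erule principal_cong) (simp_all only: lookup_add l assms origin_in_J diff_diff_eq)
qed

lemma adds_unique:
  assumes "adds p q r" "adds p q s" "r \<in> J" "s \<in> J" shows "sim r s"
proof (rule principal_points_eq[OF assms(3,4)])
  have "principal (\<lambda>x. (point_div p x + point_div q x - point_div s x - point_div origin x)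
      - (point_div p x + point_div q x - point_div r x - point_div origin x))"
    using principal_diff assms(1,2) unfolding adds_def by blast
  then show "principal (\<lambda>x. point_div r x - point_div s x)" by (rule principal_cong) simp
qed

lemma addJ_eq:
  assumes "p \<in> J" "q \<in> J" "r \<in> J" "adds p q r"
  shows "addJ a b (abs_proj3 p) (abs_proj3 q) = abs_proj3 r"
  unfolding addJ_def
proof (rule the_equality)
  show "abs_proj3 r \<in> C \<and> lin_equiv C forms3 (Poly_Mapping.single (abs_proj3 p) 1 + Poly_Mapping.single (abs_proj3 q) 1)
       (Poly_Mapping.single (abs_proj3 r) 1 + Poly_Mapping.single originJ 1)"
    using assms lin_equiv_adds abs_in_C by blast
  fix R assume R: "R \<in> C \<and> lin_equiv C forms3 (Poly_Mapping.single (abs_proj3 p) 1 + Poly_Mapping.single (abs_proj3 q) 1)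
       (Poly_Mapping.single R 1 + Poly_Mapping.single originJ 1)"
  then have s: "rep_proj3 R \<in> J" using rep_in_J by blast
  then have "adds p q (rep_proj3 R)" using R lin_equiv_adds[OF assms(1,2) s] by (simp add: abs_rep_proj3)
  then have "abs_proj3 (rep_proj3 R) = abs_proj3 r" using adds_unique assms s abs_eq_iff by blast
  then show "R = abs_proj3 r" by (simp add: abs_rep_proj3)
qed

subsection \<open>Lines in the plane model\<close>

lemma fform_ucoord: "fform 1 ucoord" and fform_vcoord: "fform 1 vcoord"
  unfolding ucoord_def[abs_def] vcoord_def[abs_def] by (intro fform_diff fform_var)+

lemma fform_cross: "fform 1 (cross p)"
  unfolding cross_def[abs_def] by (intro fform_diff fform_scale fform_ucoord fform_vcoord)

text \<open>In the plane model this is the flex tangent at the origin.\<close>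

definition flex :: "'k ^ 4 \<Rightarrow> 'k" where "flex x = b * ucoord x - a * vcoord x"

lemma fform_flex: "fform 1 flex"
  unfolding flex_def[abs_def] by (intro fform_diff fform_scale fform_ucoord fform_vcoord)

lemma sim_originI: "x \<in> J \<Longrightarrow> ucoord x = 0 \<Longrightarrow> vcoord x = 0 \<Longrightarrow> sim origin x"
  unfolding sim_def using uv_zero by blast

lemma sim_origin_uv: "sim origin x \<Longrightarrow> ucoord x = 0 \<and> vcoord x = 0 \<and> x $ 0 = 0"
  by (auto simp: sim_def ucoord_def vcoord_def origin_def)

text \<open>On this line u = k a and v = k b, and the equation of the cubic becomes - k^3 a b c =
  0.\<close>

lemma flex_zero_iff: assumes x: "x \<in> J" shows "flex x = 0 \<longleftrightarrow> sim origin x"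
proof
  assume "flex x = 0"
  define k where "k = ucoord x / a"
  have u: "ucoord x = k * a" using a0 by (simp add: k_def)
  then have v: "vcoord x = k * b" using \<open>flex x = 0\<close> a0 by (simp add: flex_def mult_ac)
  have "ucoord x * vcoord x * (ucoord x + vcoord x) = 0"
    using cubic[OF x] \<open>flex x = 0\<close> by (simp add: flex_def)
  moreover have "ucoord x * vcoord x * (ucoord x + vcoord x) = - (k ^ 3 * (a * b * c))"
    unfolding u v c_def by Groebner_Basis.algebra
  ultimately have "k = 0" using a0 b0 c0 by simp
  then show "sim origin x" using u v sim_originI[OF x] by simp
next
  assume "sim origin x"
  then show "flex x = 0" using sim_origin_uv by (simp add: flex_def)
qed

lemma uv_prod_nonzero:
  assumes x: "x \<in> J" and "\<not> sim origin x" "x$0 \<noteq> 0"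
  shows "ucoord x * vcoord x * (ucoord x + vcoord x) \<noteq> 0"
  using cubic[OF x] flex_zero_iff[OF x] assms(2,3) unfolding flex_def by auto

lemma lam_origin: "lam origin x = x $ 0"
  by (simp add: lam_def origin_def)

text \<open>From (X_1 + X_2) u = - a X_0^2 and (X_2 + X_3) v = - b X_0^2 the product with both
  factors is a b X_0^2 (X_1 - X_3), and (X_1 - X_3)(X_1 + X_3) = c X_0^2. All four intersections of
  this plane with the quartic curve are at the origin.\<close>

lemma vo_flex_origin: "vo origin 1 flex 4"
proof (rule voI)
  show "fform 3 (\<lambda>x. (x$1 + x$2) * ((x$2 + x$3) * (x$1 + x$3)))"
    by (rule fform_mult[OF fform_add[OF fform_var fform_var] fform_mult[OF fform_add[OF fform_var fform_var] fform_add[OF fform_var fform_var] refl]]) simp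
  show "fform 0 (\<lambda>_. a * b * c)" by (rule fform_const)
  have "(2::'k) * (2 * 2) \<noteq> 0" using two by (metis mult_eq_0_iff)
  then show "(origin$1 + origin$2) * ((origin$2 + origin$3) * (origin$1 + origin$3)) \<noteq> 0" by (simp add: origin_def)
  fix x assume x: "x \<in> J"
  show "(x$1 + x$2) * ((x$2 + x$3) * (x$1 + x$3)) * flex x = lam origin x ^ 4 * (a * b * c)"
    unfolding lam_origin flex_def ucoord_def vcoord_def using J_eqs[OF x] c_def by Groebner_Basis.algebra
qed (use a0 b0 c0 in auto)

lemma vo_flex:
  assumes x: "x \<in> J" shows "vo x 1 flex (if sim origin x then 4 else 0)"
  using vo_sim[OF _ vo_flex_origin] vo_0[OF fform_flex] flex_zero_iff[OF x] by simp

text \<open>The factors X_1 + X_2 and X_2 + X_3 show that u and v vanish to order two at the origin.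
  The leading coefficient is - 2 \<open>flex p\<close>, nonzero since p is not the origin.\<close>

lemma vo_cross_origin:
  assumes p: "p \<in> J" "\<not> sim origin p" shows "vo origin 1 (cross p) 2"
proof (rule voI)
  show "fform 2 (\<lambda>x. (x$1 + x$2) * (x$2 + x$3))"
    by (rule fform_mult[OF fform_add[OF fform_var fform_var] fform_add[OF fform_var fform_var]]) simp
  show "fform 1 (\<lambda>x. (a * vcoord p) * (x$2 + x$3) - (b * ucoord p) * (x$1 + x$2))"
    by (intro fform_diff fform_scale fform_add fform_var)
  have "(2::'k) * 2 \<noteq> 0" using two by (metis mult_eq_0_iff)
  then show "(origin$1 + origin$2) * (origin$2 + origin$3) \<noteq> 0" by (simp add: origin_def)
  have "flex p \<noteq> 0" using flex_zero_iff[OF p(1)] p(2) by simp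
  then have "- 2 * flex p \<noteq> 0" using two by simp
  then show "a * vcoord p * (origin$2 + origin$3) - b * ucoord p * (origin$1 + origin$2) \<noteq> 0"
    by (simp add: origin_def flex_def algebra_simps)
  fix x assume x: "x \<in> J"
  show "(x$1 + x$2) * (x$2 + x$3) * cross p x = lam origin x ^ 2 * (a * vcoord p * (x$2 + x$3) - b * ucoord p * (x$1 + x$2))"
    unfolding lam_origin cross_def ucoord_def[of x] vcoord_def[of x] using J_eqs[OF x] c_def by Groebner_Basis.algebra
qed simp

text \<open>A point of order two is its own mirror image, so the vertical line is tangent there. Now
  p_0 = 0, \<open>lam p\<close> is a multiple of X_0, and X_0^2 comes out of a difference X_i^2 -
  X_j^2. One case for each of the three points.\<close>

lemma vo_cross_torsion:
  assumes p: "p \<in> J" "\<not> sim origin p" "p$0 = 0" shows "vo p 1 (cross p) 2"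
proof -
  have n: "p$1 \<noteq> 0" "p$2 \<noteq> 0" "p$3 \<noteq> 0" using J_two_nonzero[OF p(1)] p(3) by auto
  have l: "lam p x = p$1 * x$0" for x using n p(3) by (simp add: lam_def)
  have "(p$2)^2 = (p$1)^2" "(p$3)^2 = (p$1)^2" using J_eqs[OF p(1)] p(3) by simp_all
  then have s: "p$2 = p$1 \<or> p$2 = - p$1" "p$3 = p$1 \<or> p$3 = - p$1" by (auto simp: power2_eq_iff)
  have o: "\<not> (p$2 = p$1 \<and> p$3 = p$1)"
    using sim_originI[OF p(1)] p(2) by (auto simp: ucoord_def vcoord_def)
  have d: "p$1 + p$1 \<noteq> 0" using n two by (metis mult_2 mult_eq_0_iff)
  then have d': "p$1 * p$1 + p$1 * p$1 \<noteq> 0" using n by (metis distrib_left mult_eq_0_iff)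
  have sum: "fform 1 (\<lambda>x. (p$1)^2 * (x $ i + x $ j))" for i j by (intro fform_scale fform_add fform_var)
  have nz: "(p$1)^2 * r \<noteq> 0" if "r \<noteq> 0" for r using that n by simp
  consider "p$2 = p$1" "p$3 = - p$1" | "p$2 = - p$1" "p$3 = p$1" | "p$2 = - p$1" "p$3 = - p$1"
    using s o by blast
  then show ?thesis
  proof cases
    case 1
    show ?thesis
    proof (rule voI[OF sum[of 1 2] fform_const[of "(p$1 + p$1) * a"]])
      fix x assume x: "x \<in> J"
      show "(p$1)^2 * (x$1 + x$2) * cross p x = lam p x ^ 2 * ((p$1 + p$1) * a)"
        unfolding l cross_def ucoord_def vcoord_def using J_eqs[OF x] 1 by Groebner_Basis.algebra
    qed (use 1 d a0 nz in auto)
  next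
    case 2
    show ?thesis
    proof (rule voI[OF sum[of 1 3] fform_const[of "(p$1 + p$1) * c"]])
      fix x assume x: "x \<in> J"
      show "(p$1)^2 * (x$1 + x$3) * cross p x = lam p x ^ 2 * ((p$1 + p$1) * c)"
        unfolding l cross_def ucoord_def vcoord_def using J_eqs[OF x] 2 by Groebner_Basis.algebra
    qed (use 2 d c0 nz in auto)
  next
    case 3
    have "- p$1 - p$1 = - (p$1 + p$1)" by simp
    then have "- p$1 - p$1 \<noteq> 0" using d by (metis neg_equal_0_iff_equal)
    show ?thesis
    proof (rule voI[OF sum[of 2 3] fform_const[of "- (p$1 + p$1) * b"]])
      fix x assume x: "x \<in> J"
      show "(p$1)^2 * (x$2 + x$3) * cross p x = lam p x ^ 2 * (- (p$1 + p$1) * b)"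
        unfolding l cross_def ucoord_def vcoord_def using J_eqs[OF x] 3 c_def by Groebner_Basis.algebra
    next
      show "(p$1)^2 * (p$2 + p$3) \<noteq> 0" unfolding 3 by (rule nz) (use \<open>- p$1 - p$1 \<noteq> 0\<close> in simp)
      show "- (p$1 + p$1) * b \<noteq> 0" using d b0 by (metis mult_eq_0_iff neg_equal_0_iff_equal)
    qed simp
  qed
qed

text \<open>The line is a combination of the forms B_i = p_0 X_i - p_i X_0, and multiplication by
  the conjugates A_i makes a factor \<open>lam p\<close> visible in each. The remaining form has at
  p a value built from the factors u, v and u + v, none of which is zero since p is neither the
  origin nor of order two.\<close>

lemma vo_cross_self:
  assumes p: "p \<in> J" "\<not> sim origin p" "p$0 \<noteq> 0" shows "vo p 1 (cross p) 1"
proof -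
  have uv: "ucoord p \<noteq> 0" "vcoord p \<noteq> 0" "ucoord p + vcoord p \<noteq> 0"
    using uv_prod_nonzero[OF p] by auto
  define A where "A i x = p$0 * x$i + p$i * x$0" for i :: 4 and x :: "'k^4"
  define B where "B i x = p$0 * x$i - p$i * x$0" for i :: 4 and x :: "'k^4"
  have c: "p$0 * cross p x = ucoord p * (B 2 x - B 3 x) - vcoord p * (B 1 x - B 2 x)" for x
    unfolding cross_def B_def ucoord_def vcoord_def by Groebner_Basis.algebra
  have AB: "A i x * B i x = (p$0)^2 * (x$i)^2 - (p$i)^2 * (x$0)^2" for i x
    unfolding A_def B_def by Groebner_Basis.algebra
  have fA: "fform 1 (A i)" for i unfolding A_def[abs_def] by (intro fform_add fform_scale fform_var)
  have Ap: "A i p = 2 * (p$0 * p$i)" for i by (simp add: A_def mult.commute)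
  have fg: "fform 2 (\<lambda>x. p$0 * (A i x * A j x))" for i j by (rule fform_scale, rule fform_mult[OF fA fA]) simp
  have A0: "A i p \<noteq> 0" if "p$i \<noteq> 0" for i using that p(3) two by (simp add: Ap)
  have fAA: "fform 2 (\<lambda>x. A i x * A j x)" for i j by (rule fform_mult[OF fA fA]) simp
  have fxA: "fform 2 (\<lambda>x. x $ i * A j x)" for i j by (rule fform_mult[OF fform_var fA]) simp
  consider "p$2 = 0" | "p$2 \<noteq> 0" "p$3 = 0" | "p$2 \<noteq> 0" "p$3 \<noteq> 0" by blast
  then show ?thesis
  proof cases
    case 1
    then have l: "lam p x = x$2" for x by (simp add: lam_def)
    have n: "p$1 \<noteq> 0" "p$3 \<noteq> 0" using J_two_nonzero[OF p(1)] 1 by auto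
    define F where "F x = (ucoord p * p$0) * (A 1 x * A 3 x) - (ucoord p * p$0 * p$0) * (x$2 * A 1 x)
      - (vcoord p * p$0 * p$0) * (x$2 * A 3 x) + (vcoord p * p$0) * (A 1 x * A 3 x)" for x
    have fF: "fform 2 F" unfolding F_def[abs_def] by (intro fform_add fform_diff fform_scale fAA fxA)
    show ?thesis
    proof (rule voI[OF fg[of 1 3] fF])
      have "F p = p$0 * (ucoord p + vcoord p) * (A 1 p * A 3 p)" using 1 by (simp add: F_def algebra_simps)
      then show "F p \<noteq> 0" using uv p(3) A0 n by simp
      fix x assume x: "x \<in> J"
      have "A 1 x * B 1 x = (p$0)^2 * (x$2)^2" "A 3 x * B 3 x = (p$0)^2 * (x$2)^2" "B 2 x = p$0 * x$2"
        unfolding AB using J_eqs[OF x] J_eqs[OF p(1)] 1 by (Groebner_Basis.algebra, Groebner_Basis.algebra, simp add: B_def)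
      then show "p$0 * (A 1 x * A 3 x) * cross p x = lam p x ^ 1 * F x"
        unfolding l F_def using c[of x] by Groebner_Basis.algebra
    qed (use A0 n p(3) in auto)
  next
    case 2
    then have l: "lam p x = x$3" for x by (simp add: lam_def)
    have n: "p$1 \<noteq> 0" "p$2 \<noteq> 0" using J_two_nonzero[OF p(1)] 2 by auto
    define F where "F x = (ucoord p * p$0 * p$0) * (x$3 * A 1 x) - (ucoord p * p$0) * (A 1 x * A 2 x)
      - (vcoord p * p$0 * p$0) * (x$3 * A 2 x) + (vcoord p * p$0 * p$0) * (x$3 * A 1 x)" for x
    have fF: "fform 2 F" unfolding F_def[abs_def] by (intro fform_add fform_diff fform_scale fAA fxA)
    show ?thesis
    proof (rule voI[OF fg[of 1 2] fF])
      have "F p = - (p$0 * ucoord p * (A 1 p * A 2 p))" using 2 by (simp add: F_def algebra_simps)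
      then show "F p \<noteq> 0" using uv p(3) A0 n by simp
      fix x assume x: "x \<in> J"
      have "A 1 x * B 1 x = (p$0)^2 * (x$3)^2" "A 2 x * B 2 x = (p$0)^2 * (x$3)^2" "B 3 x = p$0 * x$3"
        unfolding AB using J_eqs[OF x] J_eqs[OF p(1)] 2(2) by (Groebner_Basis.algebra, Groebner_Basis.algebra, simp add: B_def)
      then show "p$0 * (A 1 x * A 2 x) * cross p x = lam p x ^ 1 * F x"
        unfolding l F_def using c[of x] by Groebner_Basis.algebra
    qed (use A0 n p(3) in auto)
  next
    case 3
    then have l: "lam p x = p$1 * x$0 - p$0 * x$1" for x by (simp add: lam_def)
    define F where "F x = ucoord p * (A 1 x * A 2 x) - ucoord p * (A 1 x * A 3 x)
      + vcoord p * (A 2 x * A 3 x) - vcoord p * (A 1 x * A 3 x)" for x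
    have fF: "fform 2 F" unfolding F_def[abs_def] by (intro fform_add fform_diff fform_scale fAA)
    show ?thesis
    proof (rule voI[OF fg[of 2 3] fF])
      have "F p = 4 * (p$0 * p$0 * (ucoord p * vcoord p * (ucoord p + vcoord p)))"
        unfolding F_def Ap ucoord_def vcoord_def by Groebner_Basis.algebra
      moreover have "(4::'k) \<noteq> 0" using two by (metis mult_eq_0_iff mult_2 numeral_Bit0 one_add_one numeral_plus_numeral semiring_norm(2) numeral_times_numeral semiring_norm(13) semiring_norm(11))
      ultimately show "F p \<noteq> 0" using uv p(3) by simp
      fix x assume x: "x \<in> J"
      have "A 2 x * B 2 x = A 1 x * B 1 x" "A 3 x * B 3 x = A 1 x * B 1 x"
        unfolding AB using J_eqs[OF x] J_eqs[OF p(1)] by Groebner_Basis.algebra+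
      moreover have "B 1 x = - lam p x" by (simp add: B_def l)
      ultimately show "p$0 * (A 2 x * A 3 x) * cross p x = lam p x ^ 1 * F x"
        unfolding F_def using c[of x] by Groebner_Basis.algebra
    qed (use A0 3 p(3) in auto)
  qed
qed

lemma uv_flip0: "ucoord (flip 0 x) = ucoord x" "vcoord (flip 0 x) = vcoord x"
  by (simp_all add: ucoord_def vcoord_def flip_nth)

lemma cross_flip0: "cross (flip 0 p) x = cross p x" "cross p (flip 0 x) = cross p x"
  by (simp_all add: cross_def uv_flip0)

lemma sim_flip0_torsion: "p \<in> J \<Longrightarrow> sim p (flip 0 p) \<longleftrightarrow> p$0 = 0"
proof
  assume p: "p \<in> J" "sim p (flip 0 p)"
  then obtain r where r: "r \<noteq> 0" "flip 0 p = r *s p" unfolding sim_def by blast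
  show "p$0 = 0"
  proof (rule ccontr)
    assume n: "p$0 \<noteq> 0"
    have c: "flip 0 p $ i = r * p $ i" for i using r(2) by simp
    have "r = 1" using c[of 1] c[of 2] J_two_nonzero(4)[OF p(1)] by (auto simp: flip_nth)
    then have "p$0 + p$0 = 0" using c[of 0] by (simp add: flip_nth)
    then show False using n two by (metis mult_2 mult_eq_0_iff)
  qed
next
  assume "p$0 = 0"
  then have "flip 0 p = p" by (auto simp: vec4_eq_iff flip_nth)
  then show "sim p (flip 0 p)" using sim_refl by simp
qed

text \<open>Proportional (u, v), with factor k, give X_0^2 by the cubic and so X_0 up to sign. Then
  (X_1 + X_2) u = - a X_0^2 or (X_2 + X_3) v = - b X_0^2 recovers the other coordinates.\<close>

lemma cross_zero_imp:
  assumes p: "p \<in> J" "\<not> sim origin p" and x: "x \<in> J" "\<not> sim origin x" and z: "cross p x = 0"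
  shows "sim p x \<or> sim (flip 0 p) x"
proof -
  have nz: "ucoord p \<noteq> 0 \<or> vcoord p \<noteq> 0" "ucoord x \<noteq> 0 \<or> vcoord x \<noteq> 0" using sim_originI p x by blast+
  have "\<exists>k. ucoord x = k * ucoord p \<and> vcoord x = k * vcoord p"
  proof (cases "ucoord p = 0")
    case True
    then show ?thesis using nz z by (intro exI[of _ "vcoord x / vcoord p"]) (auto simp: cross_def)
  next
    case False
    then show ?thesis using z by (intro exI[of _ "ucoord x / ucoord p"]) (auto simp: cross_def field_simps)
  qed
  then obtain k where k: "ucoord x = k * ucoord p" "vcoord x = k * vcoord p" by blast
  then have k0: "k \<noteq> 0" using nz(2) by auto
  have "flex x = k * flex p" by (simp add: flex_def k algebra_simps)
  then have "(x$0)^2 * (k * flex p) = k^3 * ((p$0)^2 * flex p)"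
    using cubic[OF x(1)] cubic[OF p(1)] unfolding flex_def[symmetric] by (simp add: k power3_eq_cube algebra_simps)
  then have "(k * flex p) * ((x$0)^2 - (k * p$0)^2) = 0" by (simp add: power2_eq_square power3_eq_cube algebra_simps)
  moreover have "flex p \<noteq> 0" using flex_zero_iff[OF p(1)] p(2) by simp
  ultimately have sq: "(x$0)^2 = (k * p$0)^2" using k0 by simp
  then have x0: "x$0 = k * p$0 \<or> x$0 = - (k * p$0)" by (simp add: power2_eq_iff)
  have e: "(y$1 + y$2) * ucoord y = - a * (y$0)^2" "(y$2 + y$3) * vcoord y = - b * (y$0)^2" if "y \<in> J" for y
    unfolding ucoord_def vcoord_def using J_eqs[OF that] c_def by Groebner_Basis.algebra+
  have dbl: "r = s" if "r + r = s + s" for r s :: 'k using that two by (metis mult_2 mult_left_cancel)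
  have 12: "x$1 - x$2 = k * (p$1 - p$2)" "x$2 - x$3 = k * (p$2 - p$3)" using k by (simp_all add: ucoord_def vcoord_def)
  have "x$2 = k * p$2"
  proof (cases "ucoord p = 0")
    case False
    have "ucoord p * (k * (x$1 + x$2)) = ucoord p * (k * (k * (p$1 + p$2)))"
      using e(1)[OF x(1)] e(1)[OF p(1)] sq k by Groebner_Basis.algebra
    then have s: "x$1 + x$2 = k * (p$1 + p$2)" using False k0 by simp
    have "x$2 + x$2 = (x$1 + x$2) - (x$1 - x$2)" by simp
    also have "\<dots> = k * p$2 + k * p$2" unfolding s 12(1) by (simp add: algebra_simps)
    finally show ?thesis by (rule dbl)
  next
    case True
    then have v: "vcoord p \<noteq> 0" using nz by simp
    have "vcoord p * (k * (x$2 + x$3)) = vcoord p * (k * (k * (p$2 + p$3)))"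
      using e(2)[OF x(1)] e(2)[OF p(1)] sq k by Groebner_Basis.algebra
    then have s: "x$2 + x$3 = k * (p$2 + p$3)" using v k0 by simp
    have "x$2 + x$2 = (x$2 + x$3) + (x$2 - x$3)" by simp
    also have "\<dots> = k * p$2 + k * p$2" unfolding s 12(2) by (simp add: algebra_simps)
    finally show ?thesis by (rule dbl)
  qed
  then have "x$1 = k * p$1" "x$2 = k * p$2" "x$3 = k * p$3" using 12 by (simp_all add: algebra_simps)
  then have "x = k *s p \<or> x = k *s flip 0 p" using x0 by (auto simp: vec4_eq_iff flip_nth)
  then show ?thesis unfolding sim_def using k0 by blast
qed

definition ind :: "bool \<Rightarrow> nat" where "ind P = (if P then 1 else 0)"

lemma origin_flip0: "flip 0 origin = origin"
  by (simp add: vec4_eq_iff flip_nth origin_def)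

lemma sim_origin_flip0: "sim origin (flip 0 p) \<longleftrightarrow> sim origin p"
  using sim_flip[of origin p 0] sim_flip[of origin "flip 0 p" 0] by (auto simp: origin_flip0 flip_flip)

text \<open>The divisor of the vertical line is (p) + (-p) + 2 (O). Adding indicators counts p = - p
  twice, as tangency requires.\<close>

lemma vo_cross:
  assumes p: "p \<in> J" "\<not> sim origin p" and x: "x \<in> J"
  shows "vo x 1 (cross p) (ind (sim p x) + ind (sim (flip 0 p) x) + 2 * ind (sim origin x))"
proof -
  have fp: "flip 0 p \<in> J" "\<not> sim origin (flip 0 p)" using J_flip p sim_origin_flip0 by auto
  have self: "vo x 1 (cross p) (ind (sim p x) + ind (sim (flip 0 p) x) + 2 * ind (sim origin x))"
    if p: "p \<in> J" "\<not> sim origin p" and px: "sim p x" for p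
  proof -
    have o: "\<not> sim origin x" using p(2) px sim_trans sim_sym by blast
    have f: "sim (flip 0 p) x \<longleftrightarrow> p$0 = 0" using sim_flip0_torsion[OF p(1)] px sim_trans sim_sym by metis
    have "vo p 1 (cross p) (if p$0 = 0 then 2 else 1)" using vo_cross_torsion[OF p] vo_cross_self[OF p] by simp
    from vo_sim[OF px this] show ?thesis using o f px by (simp add: ind_def numeral_2_eq_2 split: if_splits)
  qed
  have cf: "cross (flip 0 p) = cross p" by (rule ext) (rule cross_flip0)
  consider "sim p x" | "sim (flip 0 p) x" | "sim origin x" | "\<not> sim p x" "\<not> sim (flip 0 p) x" "\<not> sim origin x" by blast
  then show ?thesis
  proof cases
    case 1
    then show ?thesis using self[OF p] by blast
  next
    case 2
    then show ?thesis using self[OF fp 2] unfolding cf flip_flip by (simp add: add.commute)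
  next
    case 3
    then have "\<not> sim p x" "\<not> sim (flip 0 p) x" using p(2) fp(2) sim_trans sim_sym by blast+
    then show ?thesis using vo_sim[OF 3 vo_cross_origin[OF p]] 3 by (simp add: ind_def numeral_2_eq_2)
  next
    case 4
    then have "cross p x \<noteq> 0" using cross_zero_imp[OF p x] by blast
    then show ?thesis using vo_0[OF fform_cross] 4 by (simp add: ind_def)
  qed
qed

lemma fform_chord: "fform 1 (chord p q)"
proof -
  have "chord p q = (\<lambda>z. cross p q * z$0 - (p$0 * vcoord q - vcoord p * q$0) * ucoord z
     + (p$0 * ucoord q - ucoord p * q$0) * vcoord z)"
    by (simp add: chord_def fun_eq_iff algebra_simps)
  then show ?thesis
    by (simp only:) (intro fform_add fform_diff fform_scale fform_var fform_ucoord fform_vcoord)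
qed

lemma chord_ends: "chord p q p = 0" "chord p q q = 0" "chord p q origin = 0"
  unfolding chord_def cross_def by (simp_all add: algebra_simps origin_def ucoord_def vcoord_def)

lemma chord_sim: "sim x y \<Longrightarrow> chord p q x = 0 \<Longrightarrow> chord p q y = 0"
  unfolding sim_def using fform_homogeneous[OF fform_chord] by auto

text \<open>On the plane cubic, the product of the line through \<open>p\<close> and \<open>q\<close>, of its mirror image and of
  the flex tangent at the origin is a binary cubic form in \<open>u, v\<close>.\<close>

lemma chord_product:
  assumes p: "p \<in> J" and q: "q \<in> J" and r: "r \<in> J" "chord p q (flip 0 r) = 0"
    and n: "cross p q \<noteq> 0" "cross p r \<noteq> 0" "cross q r \<noteq> 0"
  shows "\<exists>k. k \<noteq> 0 \<and> (\<forall>x\<in>J. chord p q x * chord p q (flip 0 x) * flex x = k * (cross p x * cross q x * cross r x))"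
proof -
  define \<alpha> \<beta> \<gamma> where "\<alpha> = cross p q" and "\<beta> = p$0 * vcoord q - vcoord p * q$0" and "\<gamma> = p$0 * ucoord q - ucoord p * q$0"
  \<comment> \<open>The product of the line and its mirror image contains X_0 only as X_0^2, and
    after multiplication by \<open>flex\<close> the cubic eliminates it.\<close>
  define B where "B s t = (\<gamma> * t - \<beta> * s)^2 * (b * s - a * t) - \<alpha>^2 * (s * t * (s + t))" for s t
  have eq: "chord p q x * chord p q (flip 0 x) * flex x = B (ucoord x) (vcoord x)" if "x \<in> J" for x
  proof -
    have c1: "chord p q x = x$0 * \<alpha> - ucoord x * \<beta> + vcoord x * \<gamma>"
      by (simp add: chord_def \<alpha>_def \<beta>_def \<gamma>_def)
    have c2: "chord p q (flip 0 x) = - x$0 * \<alpha> - ucoord x * \<beta> + vcoord x * \<gamma>"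
      by (simp add: chord_def \<alpha>_def \<beta>_def \<gamma>_def uv_flip0 flip_nth)
    show ?thesis unfolding c1 c2 B_def flex_def using cubic[OF that] by Groebner_Basis.algebra
  qed
  have B0: "B (ucoord p) (vcoord p) = 0" "B (ucoord q) (vcoord q) = 0" "B (ucoord r) (vcoord r) = 0"
    using eq[OF p] eq[OF q] eq[OF r(1)] r(2) by (simp_all add: chord_ends)
  have lin: "bin 1 (\<lambda>s t. r1 * s + r2 * t)" for r1 r2 :: 'k
    by (intro bin_add bin_scale bin_fst bin_snd)
  have "bin 3 (\<lambda>s t. ((- \<beta>) * s + \<gamma> * t)^2 * (b * s + (- a) * t) - \<alpha>^2 * (s * t * (1 * s + 1 * t)))"
    by (intro bin_diff bin_scale bin_mult[OF bin_power[OF lin refl] lin] bin_mult[OF bin_mult[OF bin_fst bin_snd refl] lin]) simp_all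
  moreover have "(\<lambda>s t. ((- \<beta>) * s + \<gamma> * t)^2 * (b * s + (- a) * t) - \<alpha>^2 * (s * t * (1 * s + 1 * t))) = B"
    by (simp add: B_def fun_eq_iff)
  ultimately have B: "bin 3 B" by simp
  have nz: "ucoord y \<noteq> 0 \<or> vcoord y \<noteq> 0" if "cross y z \<noteq> 0 \<or> cross z y \<noteq> 0" for y z
    using that by (auto simp: cross_def)
  obtain B1 where B1: "bin 2 B1" "\<And>s t. B s t = (vcoord p * s - ucoord p * t) * B1 s t"
    using bin_divide[of 2 B "ucoord p" "vcoord p"] B B0(1) nz[of p q] n(1) by auto
  have B1z: "B1 (ucoord y) (vcoord y) = 0" if "B (ucoord y) (vcoord y) = 0" "cross p y \<noteq> 0" for y
  proof -
    have "vcoord p * ucoord y - ucoord p * vcoord y = - cross p y" by (simp add: cross_def)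
    then show ?thesis using that B1(2)[of "ucoord y" "vcoord y"] by auto
  qed
  obtain B2 where B2: "bin 1 B2" "\<And>s t. B1 s t = (vcoord q * s - ucoord q * t) * B2 s t"
    using bin_divide[of 1 B1 "ucoord q" "vcoord q"] B1(1) B1z[OF B0(2) n(1)] nz[of q p] n(1) by (auto simp: numeral_2_eq_2)
  have "vcoord q * ucoord r - ucoord q * vcoord r = - cross q r" by (simp add: cross_def)
  then have "B2 (ucoord r) (vcoord r) = 0" using B1z[OF B0(3) n(2)] B2(2)[of "ucoord r" "vcoord r"] n(3) by auto
  then obtain B3 where B3: "bin 0 B3" "\<And>s t. B2 s t = (vcoord r * s - ucoord r * t) * B3 s t"
    using bin_divide[of 0 B2 "ucoord r" "vcoord r"] B2(1) nz[of r p] n(2) by auto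
  define k where "k = - B3 1 0"
  have k: "B3 s t = - k" for s t using bin_0_const[OF B3(1), of s t] by (simp add: k_def)
  have full: "B s t = (vcoord p * s - ucoord p * t) * ((vcoord q * s - ucoord q * t) * ((vcoord r * s - ucoord r * t) * - k))" for s t
    by (simp only: B1(2) B2(2) B3(2) k)
  \<comment> \<open>The flex tangent vanishes at (a, b), which leaves a value visibly nonzero and so
    rules out the constant 0.\<close>
  have "B a b = \<alpha>^2 * (a * b * c)" unfolding B_def c_def by Groebner_Basis.algebra
  moreover have "\<alpha>^2 * (a * b * c) \<noteq> 0" using n(1) a0 b0 c0 by (simp add: \<alpha>_def)
  ultimately have "k \<noteq> 0" using full[of a b] by auto
  moreover have "chord p q x * chord p q (flip 0 x) * flex x = k * (cross p x * cross q x * cross r x)" if "x \<in> J" for x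
    unfolding eq[OF that] full cross_def by Groebner_Basis.algebra
  ultimately show ?thesis by blast
qed

lemma cross_nonzero_imp:
  assumes p: "p \<in> J" and q: "q \<in> J" and n: "cross p q \<noteq> 0"
  shows "\<not> sim origin p" "\<not> sim origin q" "\<not> sim p q" "\<not> sim (flip 0 p) q"
proof -
  show o: "\<not> sim origin p" and "\<not> sim origin q" using n sim_origin_uv by (auto simp: cross_def)
  have z: "cross y q = 0" if "sim y q" for y
    using that unfolding sim_def by (auto simp: cross_def ucoord_def vcoord_def algebra_simps)
  show "\<not> sim p q" using n z by blast
  show "\<not> sim (flip 0 p) q" using n z[of "flip 0 p"] by (auto simp: cross_flip0)
qed

text \<open>Only the sum of the orders m and m' of the line and its mirror image is known, together
  with lower bounds for each. \<open>A\<close>, \<open>B\<close>, \<open>R\<close>, \<open>Z\<close>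
  say that the point is p, q, r or the origin, primes denote mirror images. At most one of the four
  groups can contain the point, and then the bounds are sharp.\<close>

lemma chord_count:
  assumes "m + m' + 4 * ind Z = (ind A + ind A' + 2 * ind Z) + ((ind B + ind B' + 2 * ind Z) + (ind R + ind R' + 2 * ind Z))"
    and "A \<or> B \<or> R' \<or> Z \<Longrightarrow> 1 \<le> m" "A' \<or> B' \<or> R \<or> Z \<Longrightarrow> 1 \<le> m'"
    and "\<not> (A \<or> A') \<or> \<not> (B \<or> B')" "\<not> (A \<or> A') \<or> \<not> (R \<or> R')" "\<not> (B \<or> B') \<or> \<not> (R \<or> R')"
    and "\<not> (A \<or> A') \<or> \<not> Z" "\<not> (B \<or> B') \<or> \<not> Z" "\<not> (R \<or> R') \<or> \<not> Z"
  shows "m = ind A + ind B + ind R' + ind Z"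
  using assms unfolding ind_def
  by (cases A; cases A'; cases B; cases B'; cases R; cases R'; cases Z; simp)

text \<open>The line through p and q has divisor (p) + (q) + (-r) + (O), the vertical line through r
  has (r) + (-r) + 2 (O); their quotient is the required function.\<close>

lemma adds_generic:
  assumes p: "p \<in> J" and q: "q \<in> J" and r: "r \<in> J" "chord p q (flip 0 r) = 0"
    and n: "cross p q \<noteq> 0" "cross p r \<noteq> 0" "cross q r \<noteq> 0"
  shows "adds p q r"
proof -
  obtain k where k: "k \<noteq> 0" "\<forall>x\<in>J. chord p q x * chord p q (flip 0 x) * flex x = k * (cross p x * cross q x * cross r x)"
    using chord_product[OF assms] by blast
  note pq = cross_nonzero_imp[OF p q n(1)] and pr = cross_nonzero_imp[OF p r(1) n(2)] and qr = cross_nonzero_imp[OF q r(1) n(3)]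
  let ?F = "\<lambda>x. k * (cross p x * (cross q x * cross r x))"
  let ?o = "\<lambda>x. 2 * ind (sim origin x)"
  let ?N = "\<lambda>x. (ind (sim p x) + ind (sim (flip 0 p) x) + ?o x) +
      ((ind (sim q x) + ind (sim (flip 0 q) x) + ?o x) + (ind (sim r x) + ind (sim (flip 0 r) x) + ?o x))"
  have three: "0 + (1 + (1 + 1)) = (3::nat)" "1 + (1 + 1) = (3::nat)" by simp_all
  have vop: "vo x 3 ?F (?N x)" if x: "x \<in> J" for x
  proof -
    have "vo x (0 + (1 + (1 + 1))) ?F (0 + ?N x)"
      by (intro vo_mult vo_0[OF fform_const] vo_cross[OF p pq(1) x] vo_cross[OF q pq(2) x] vo_cross[OF r(1) pr(2) x] k(1))
    then show ?thesis by (simp only: three add_0)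
  qed
  have nzc: "nz (chord p q)"
  proof -
    have "nz ?F" using vo_nz[OF origin_in_J vop[OF origin_in_J]] .
    then obtain x where "x \<in> J" "?F x \<noteq> 0" unfolding nz_def by blast
    then have "chord p q x * chord p q (flip 0 x) * flex x \<noteq> 0" using k(2) by (simp add: mult.assoc)
    then show ?thesis unfolding nz_def using \<open>x \<in> J\<close> by auto
  qed
  define f' where "f' x = chord p q (flip 0 x)" for x
  have ff': "fform 1 f'"
  proof -
    have "fform 1 (\<lambda>s. flip 0 s $ i)" for i
      using fform_var[of i] fform_uminus[OF fform_var[of i]] by (cases "i = 0") (simp_all add: flip_nth)
    from fform_comp[OF fform_chord this, of p q] show ?thesis unfolding f'_def by simp
  qed
  have nzf': "nz f'"
    using nzc J_flip unfolding nz_def f'_def by (metis flip_flip)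
  have vo_chord: "vo x 1 (chord p q) (ind (sim p x) + ind (sim q x) + ind (sim (flip 0 r) x) + ind (sim origin x))"
    if x: "x \<in> J" for x
  proof -
    obtain m where m: "vo x 1 (chord p q) m" using vo_exists[OF x fform_chord nzc] by blast
    obtain m' where m': "vo x 1 f' m'" using vo_exists[OF x ff' nzf'] by blast
    have "vo x (1 + (1 + 1)) (\<lambda>x. chord p q x * (f' x * flex x)) (m + (m' + (if sim origin x then 4 else 0)))"
      by (intro vo_mult m m' vo_flex x)
    then have "vo x 3 (\<lambda>x. chord p q x * (f' x * flex x)) (m + (m' + (if sim origin x then 4 else 0)))"
      by (simp only: three)
    then have "vo x 3 ?F (m + (m' + (if sim origin x then 4 else 0)))"
      by (rule vo_cong) (use k(2) in \<open>simp add: f'_def mult.assoc\<close>)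
    then have "m + (m' + (if sim origin x then 4 else 0)) = ?N x" using vo_unique[OF x _ vop[OF x]] by blast
    then have "m + m' + 4 * ind (sim origin x) = ?N x" by (simp add: ind_def split: if_splits)
    moreover have "1 \<le> m" if "sim p x \<or> sim q x \<or> sim (flip 0 r) x \<or> sim origin x"
    proof -
      have "chord p q x = 0" using that chord_sim chord_ends r(2) by blast
      then show ?thesis using vo_ge_1[OF x fform_chord _ m] by blast
    qed
    moreover have "1 \<le> m'" if "sim (flip 0 p) x \<or> sim (flip 0 q) x \<or> sim r x \<or> sim origin x"
    proof -
      have "sim p (flip 0 x) \<or> sim q (flip 0 x) \<or> sim (flip 0 r) (flip 0 x) \<or> sim origin (flip 0 x)"
        using that sim_flip[of _ x 0] by (metis flip_flip origin_flip0)
      then have "f' x = 0" unfolding f'_def using chord_sim chord_ends r(2) by blast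
      then show ?thesis using vo_ge_1[OF x ff' _ m'] by blast
    qed
    moreover have excl: "\<not> (sim z x \<or> sim (flip 0 z) x) \<or> \<not> (sim y x \<or> sim (flip 0 y) x)"
      if "\<not> sim y z" "\<not> sim (flip 0 y) z" for y z
    proof -
      have "\<not> sim y (flip 0 z)" "\<not> sim (flip 0 y) (flip 0 z)"
        using that sim_flip[of y "flip 0 z" 0] sim_flip[of "flip 0 y" "flip 0 z" 0] by (auto simp: flip_flip)
      then show ?thesis using that sim_trans sim_sym by blast
    qed
    moreover have "\<not> (sim z x \<or> sim (flip 0 z) x) \<or> \<not> sim origin x" if "\<not> sim origin z" for z
      using excl[of origin z] that sim_origin_flip0 by (auto simp: origin_flip0)
    ultimately have "m = ind (sim p x) + ind (sim q x) + ind (sim (flip 0 r) x) + ind (sim origin x)"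
      by (intro chord_count) (use pq pr qr in blast)+
    then show ?thesis using m by simp
  qed
  have nzr: "nz (cross r)" using vo_nz[OF origin_in_J vo_cross[OF r(1) pr(2) origin_in_J]] .
  show ?thesis unfolding adds_def
  proof (rule principalI[OF fform_chord fform_cross nzc nzr])
    fix x assume x: "x \<in> J"
    have pd: "point_div z x = int (ind (sim z x))" for z by (simp add: point_div_def ind_def)
    show "\<exists>m n. vo x 1 (chord p q) m \<and> vo x 1 (cross r) n \<and>
        point_div p x + point_div q x - point_div r x - point_div origin x = int m - int n"
      unfolding pd
      by (rule exI, rule exI, rule conjI[OF vo_chord[OF x] conjI[OF vo_cross[OF r(1) pr(2) x]]]) simp
  qed
qed

lemma adds_origin_left: "adds origin q q"
  unfolding adds_def by (rule principal_cong[OF principal_zero]) simp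

lemma adds_commute: "adds p q r \<longleftrightarrow> adds q p r"
  unfolding adds_def by (simp add: add.commute)

text \<open>The vertical line through p divided by the flex tangent has divisor (p) + (-p) - 2
  (O).\<close>

lemma adds_neg:
  assumes p: "p \<in> J" shows "adds p (flip 0 p) origin"
proof (cases "sim origin p")
  case True
  then have "point_div p = point_div origin" "point_div (flip 0 p) = point_div origin"
    using point_div_sim sim_origin_flip0 sim_sym by metis+
  then show ?thesis unfolding adds_def by (intro principal_cong[OF principal_zero]) simp
next
  case False
  have nz: "nz (cross p)" "nz flex"
    using vo_nz[OF origin_in_J vo_cross[OF p False origin_in_J]] vo_nz[OF origin_in_J vo_flex_origin] by blast+
  show ?thesis unfolding adds_def
  proof (rule principalI[OF fform_cross fform_flex nz])
    fix x assume x: "x \<in> J"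
    show "\<exists>m n. vo x 1 (cross p) m \<and> vo x 1 flex n \<and>
        point_div p x + point_div (flip 0 p) x - point_div origin x - point_div origin x = int m - int n"
      by (rule exI, rule exI, rule conjI[OF vo_cross[OF p False x] conjI[OF vo_flex[OF x]]])
        (simp add: point_div_def ind_def)
  qed
qed

lemma adds_cong: "adds p q r \<Longrightarrow> sim p p' \<Longrightarrow> sim q q' \<Longrightarrow> sim r r' \<Longrightarrow> adds p' q' r'"
  unfolding adds_def by (simp only: point_div_sim[of p p'] point_div_sim[of q q'] point_div_sim[of r r'])

subsection \<open>The group law\<close>

lemma bform_sm: "bform 2 2 (\<lambda>x y. sm i x y $ j)"
proof -
  have m: "bform 2 2 (\<lambda>x y. r * (x$p * x$q * (y$s * y$t)))" for r p q s t
    by (intro bform_scale bform_mult[OF bform_mult[OF bform_var1 bform_var1 refl refl] bform_mult[OF bform_var2 bform_var2 refl refl]]) simp_all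
  have tm: "bform 2 2 (\<lambda>x y. r * (x$p * x$q * (y$s * y$t)) + r' * (x$p' * x$q' * (y$s' * y$t')))" for r p q s t r' p' q' s' t'
    by (intro bform_add m)
  have 00: "bform 2 2 (\<lambda>x y. sm 0 x y $ 0)"
    using tm[of "1" 0 0 1 1 "- 1" 1 1 0 0] by (simp add: sm_simps power2_eq_square mult_ac)
  have 01: "bform 2 2 (\<lambda>x y. sm 0 x y $ 1)"
    using tm[of "1" 0 1 2 3 "- 1" 2 3 0 1] by (simp add: sm_simps power2_eq_square mult_ac)
  have 02: "bform 2 2 (\<lambda>x y. sm 0 x y $ 2)"
    using tm[of "1" 0 2 1 3 "- 1" 1 3 0 2] by (simp add: sm_simps power2_eq_square mult_ac)
  have 03: "bform 2 2 (\<lambda>x y. sm 0 x y $ 3)"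
    using tm[of "1" 0 3 1 2 "- 1" 1 2 0 3] by (simp add: sm_simps power2_eq_square mult_ac)
  have 10: "bform 2 2 (\<lambda>x y. sm 1 x y $ 0)"
    using tm[of "1" 0 1 2 3 "1" 2 3 0 1] by (simp add: sm_simps power2_eq_square mult_ac)
  have 11: "bform 2 2 (\<lambda>x y. sm 1 x y $ 1)"
    using tm[of "a * c" 0 0 0 0 "1" 1 1 1 1] by (simp add: sm_simps power2_eq_square mult_ac)
  have 12: "bform 2 2 (\<lambda>x y. sm 1 x y $ 2)"
    using tm[of "a" 0 3 0 3 "1" 1 2 1 2] by (simp add: sm_simps power2_eq_square mult_ac)
  have 13: "bform 2 2 (\<lambda>x y. sm 1 x y $ 3)"
    using tm[of "- c" 0 2 0 2 "1" 1 3 1 3] by (simp add: sm_simps power2_eq_square mult_ac)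
  have 20: "bform 2 2 (\<lambda>x y. sm 2 x y $ 0)"
    using tm[of "1" 0 2 1 3 "1" 1 3 0 2] by (simp add: sm_simps power2_eq_square mult_ac)
  have 21: "bform 2 2 (\<lambda>x y. sm 2 x y $ 1)"
    using tm[of "- a" 0 3 0 3 "1" 1 2 1 2] by (simp add: sm_simps power2_eq_square mult_ac)
  have 22: "bform 2 2 (\<lambda>x y. sm 2 x y $ 2)"
    using tm[of "a * b" 0 0 0 0 "1" 2 2 2 2] by (simp add: sm_simps power2_eq_square mult_ac)
  have 23: "bform 2 2 (\<lambda>x y. sm 2 x y $ 3)"
    using tm[of "b" 0 1 0 1 "1" 2 3 2 3] by (simp add: sm_simps power2_eq_square mult_ac)
  have 30: "bform 2 2 (\<lambda>x y. sm 3 x y $ 0)"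
    using tm[of "1" 0 3 1 2 "1" 1 2 0 3] by (simp add: sm_simps power2_eq_square mult_ac)
  have 31: "bform 2 2 (\<lambda>x y. sm 3 x y $ 1)"
    using tm[of "c" 0 2 0 2 "1" 1 3 1 3] by (simp add: sm_simps power2_eq_square mult_ac)
  have 32: "bform 2 2 (\<lambda>x y. sm 3 x y $ 2)"
    using tm[of "- b" 0 1 0 1 "1" 2 3 2 3] by (simp add: sm_simps power2_eq_square mult_ac)
  have 33: "bform 2 2 (\<lambda>x y. sm 3 x y $ 3)"
    using tm[of "b * c" 0 0 0 0 "1" 3 3 3 3] by (simp add: sm_simps power2_eq_square mult_ac)
  show ?thesis
    using exhaust_0123[of i] exhaust_0123[of j]
    by (elim disjE; simp only: 00 01 02 03 10 11 12 13 20 21 22 23 30 31 32 33)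
qed

text \<open>For nonzero \<open>k\<close> this is the translation by the point \<open>tr k origin\<close> of order two.\<close>

definition tr :: "4 \<Rightarrow> 'k ^ 4 \<Rightarrow> 'k ^ 4" where "tr k x = flip 0 (flip k x)"

lemma tr_nth: "k \<noteq> 0 \<Longrightarrow> tr k x $ i = (if i = 0 \<or> i = k then - 1 else 1) * x $ i"
  by (auto simp: tr_def flip_nth)

lemma J_tr: "x \<in> J \<Longrightarrow> tr k x \<in> J"
  by (simp add: tr_def J_flip)

lemma sm_tr_right:
  assumes "k \<noteq> 0"
  shows "sm i x (tr k y) $ j = (if i = 0 \<or> i = k then - 1 else 1) * (if j = 0 \<or> j = k then - 1 else 1) * sm i x y $ j"
proof -
  have "k = 1 \<or> k = 2 \<or> k = 3" using assms exhaust_0123[of k] by blast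
  then show ?thesis using exhaust_0123[of i] exhaust_0123[of j]
    by (elim disjE; simp add: sm_simps tr_nth)
qed

text \<open>A common translation by a point of order two changes neither the difference nor the
  sum.\<close>

lemma sm_tr_both:
  assumes "k \<noteq> 0" shows "sm i (tr k x) (tr k y) = sm i x y"
proof -
  have "k = 1 \<or> k = 2 \<or> k = 3" using assms exhaust_0123[of k] by blast
  then show ?thesis using exhaust_0123[of i]
    by (elim disjE; simp add: vec4_eq_iff sm_simps tr_nth)
qed

lemma sm_swap: "sm i y x = (if i = 0 then - 1 else 1) *s sm i x y"
  using exhaust_0123[of i] by (elim disjE; simp add: vec4_eq_iff sm_simps mult_ac)

lemma sm_scale: "sm i (r *s x) (s *s y) = (r^2 * s^2) *s sm i x y"
  using exhaust_0123[of i]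
  by (elim disjE; simp add: vec4_eq_iff sm_simps power2_eq_square algebra_simps)

text \<open>Since some row of \<open>sm\<close> is nonzero, this determines \<open>r\<close> up to scaling.\<close>

definition sumpt :: "'k ^ 4 \<Rightarrow> 'k ^ 4 \<Rightarrow> 'k ^ 4 \<Rightarrow> bool" where
  "sumpt p q r \<longleftrightarrow> r \<in> J \<and> (\<forall>i. \<exists>t. sm i p q = t *s r)"

lemma sumpt_row:
  assumes p: "p \<in> J" "q \<in> J" and n: "sm i p q \<noteq> 0" shows "sumpt p q (sm i p q)"
  unfolding sumpt_def
proof (intro conjI allI)
  show r: "sm i p q \<in> J" by (rule sm_on_curve[OF p n])
  fix k
  obtain j where j: "sm i p q $ j \<noteq> 0" using J_two_nonzero(1)[OF r] by blast
  have e: "sm k p q $ l = (sm k p q $ j / sm i p q $ j) * sm i p q $ l" for l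
    using sm_rank_one[OF p, of i j k l] j by (simp add: field_simps)
  have "sm k p q = (sm k p q $ j / sm i p q $ j) *s sm i p q"
    unfolding vec_eq_iff vector_smult_component using e by blast
  then show "\<exists>t. sm k p q = t *s sm i p q" ..
qed

lemma sumpt_exists:
  assumes p: "p \<in> J" "q \<in> J" obtains r i where "sumpt p q r" "r = sm i p q" "sm i p q \<noteq> 0"
proof -
  obtain i j where "sm i p q $ j \<noteq> 0" using sm_complete[OF p] .
  then have "sm i p q \<noteq> 0" by auto
  then show ?thesis using that sumpt_row[OF p] by blast
qed

lemma sumpt_sim: "sumpt p q r \<Longrightarrow> sm i p q \<noteq> 0 \<Longrightarrow> sim (sm i p q) r"
  unfolding sumpt_def by (metis sim_def sim_sym vector_smult_lzero)

lemma sumpt_unique: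
  assumes p: "p \<in> J" "q \<in> J" and "sumpt p q r" "sumpt p q s" shows "sim r s"
proof -
  obtain i j where "sm i p q $ j \<noteq> 0" using sm_complete[OF p] .
  then have "sm i p q \<noteq> 0" by auto
  then show ?thesis using sumpt_sim assms(3,4) sim_trans sim_sym by blast
qed

lemma sumpt_cong_right: "sumpt p q r \<Longrightarrow> sim r s \<Longrightarrow> sumpt p q s"
  unfolding sumpt_def using sim_J sim_sym by (metis sim_def vector_smult_assoc)

lemma sumpt_cong:
  assumes "sumpt p q r" "sim p p'" "sim q q'" shows "sumpt p' q' r"
proof -
  obtain s t where "p' = s *s p" "q' = t *s q" using assms(2,3) unfolding sim_def by blast
  then have "sm i p' q' = (s^2 * t^2) *s sm i p q" for i by (simp add: sm_scale)
  moreover have "\<exists>u. (s^2 * t^2) *s sm i p q = u *s r" for i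
    using assms(1) unfolding sumpt_def by (metis vector_smult_assoc)
  ultimately show ?thesis using assms(1) unfolding sumpt_def by simp
qed

lemma sumpt_origin_right: "p \<in> J \<Longrightarrow> sumpt p origin p"
  unfolding sumpt_def by (auto simp: sm_origin_right vec_eq_iff)

lemma sumpt_origin_left: "q \<in> J \<Longrightarrow> sumpt origin q q"
  unfolding sumpt_def by (auto simp: sm_origin_left vec_eq_iff)

lemma sumpt_tr: assumes "sumpt p q r" "k \<noteq> 0" shows "sumpt p (tr k q) (tr k r)"
  unfolding sumpt_def
proof (intro conjI allI)
  show "tr k r \<in> J" using assms J_tr unfolding sumpt_def by blast
  fix i obtain t where t: "sm i p q = t *s r" using assms unfolding sumpt_def by blast
  have "sm i p (tr k q) = ((if i = 0 \<or> i = k then - 1 else 1) * t) *s tr k r"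
    unfolding vec_eq_iff by (auto simp: sm_tr_right[OF assms(2)] tr_nth[OF assms(2)] t)
  then show "\<exists>t. sm i p (tr k q) = t *s tr k r" ..
qed

lemma sumpt_tr_both: "sumpt p q r \<Longrightarrow> k \<noteq> 0 \<Longrightarrow> sumpt (tr k p) (tr k q) r"
  unfolding sumpt_def by (simp add: sm_tr_both)

lemma sumpt_swap: assumes "sumpt p q r" shows "sumpt q p r"
  using assms unfolding sumpt_def by (metis sm_swap vector_smult_assoc)

text \<open>\<open>flip k p\<close> is T - p for the point T = \<open>tr k origin\<close> of order
  two. A sum known in closed form for every p, it supplies the witnesses for generic
  conditions.\<close>

lemma sumpt_flip:
  assumes p: "p \<in> J" and k: "k \<noteq> 0" shows "sumpt p (flip k p) (tr k origin)"
  unfolding sumpt_def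
proof (intro conjI allI)
  show "tr k origin \<in> J" by (simp add: J_tr origin_in_J)
  fix i
  have "k = 1 \<or> k = 2 \<or> k = 3" using k exhaust_0123[of k] by blast
  then have "torsion k = (- 1) *s tr k origin"
    by (elim disjE; simp add: torsion_def vec4_eq_iff tr_nth origin_def)
  then have t: "torsion k $ j = - tr k origin $ j" for j by simp
  have e: "sm i p (flip k p) $ j = (- (torsion k $ k * sm i p (flip k p) $ k)) * tr k origin $ j" for j
    by (rule trans[OF sm_flip[OF p k]]) (subst t[of j], simp add: mult.commute)
  have "sm i p (flip k p) = (- (torsion k $ k * sm i p (flip k p) $ k)) *s tr k origin"
    unfolding vec_eq_iff vector_smult_component using e by blast
  then show "\<exists>t. sm i p (flip k p) = t *s tr k origin" ..
qed

lemma sumpt_chord: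
  assumes p: "p \<in> J" "q \<in> J" "sumpt p q r" shows "chord p q (flip 0 r) = 0"
proof -
  obtain i j where "sm i p q $ j \<noteq> 0" using sm_complete[OF p(1,2)] .
  then have "sm i p q \<noteq> 0" by auto
  then have "sim (flip 0 (sm i p q)) (flip 0 r)" using sumpt_sim[OF p(3)] sim_flip by blast
  then show ?thesis using chord_sum[OF p(1,2)] chord_sim by blast
qed

lemma adds_sumpt_generic:
  assumes "p \<in> J" "q \<in> J" "sumpt p q r" "cross p q \<noteq> 0" "cross p r \<noteq> 0" "cross q r \<noteq> 0"
  shows "adds p q r"
  using adds_generic[OF assms(1,2) _ sumpt_chord[OF assms(1-3)] assms(4-6)] assms(3) unfolding sumpt_def by blast

text \<open>\<open>R\<close> holds on a nonempty open subset of the curve.\<close>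

definition opn :: "('k ^ 4 \<Rightarrow> bool) \<Rightarrow> bool" where
  "opn R \<longleftrightarrow> (\<exists>d g. fform d g \<and> nz g \<and> (\<forall>s\<in>J. g s \<noteq> 0 \<longrightarrow> R s))"

lemma opnI: "fform d g \<Longrightarrow> w \<in> J \<Longrightarrow> g w \<noteq> 0 \<Longrightarrow> (\<And>s. s \<in> J \<Longrightarrow> g s \<noteq> 0 \<Longrightarrow> R s) \<Longrightarrow> opn R"
  unfolding opn_def nz_def by blast

text \<open>Irreducibility of the curve, in the form that a product of nonzero forms is
  nonzero.\<close>

lemma opn_conj: assumes "opn R" "opn R'" shows "opn (\<lambda>s. R s \<and> R' s)"
proof -
  obtain d g where 1: "fform d g" "nz g" "\<forall>s\<in>J. g s \<noteq> 0 \<longrightarrow> R s" using assms(1) unfolding opn_def by blast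
  obtain e h where 2: "fform e h" "nz h" "\<forall>s\<in>J. h s \<noteq> 0 \<longrightarrow> R' s" using assms(2) unfolding opn_def by blast
  show ?thesis unfolding opn_def
    using fform_mult[OF 1(1) 2(1) refl] nz_mult[OF 1(1,2) 2(1,2)] 1(3) 2(3)
    by (intro exI[of _ "d + e"] exI[of _ "\<lambda>x. g x * h x"]) auto
qed

lemma opn_mono: "opn R \<Longrightarrow> (\<And>s. s \<in> J \<Longrightarrow> R s \<Longrightarrow> R' s) \<Longrightarrow> opn R'"
  unfolding opn_def by blast

lemma opn_ex: "opn R \<Longrightarrow> \<exists>s\<in>J. R s"
  unfolding opn_def nz_def by blast

lemma fform_flip0: "fform 1 (\<lambda>s. flip 0 s $ i)"
  using fform_var[of i] fform_uminus[OF fform_var[of i]] by (cases "i = 0") (simp_all add: flip_nth)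

lemma opn_flip: assumes "opn R" shows "opn (\<lambda>s. R (flip 0 s))"
proof -
  obtain d g where 1: "fform d g" "nz g" "\<forall>s\<in>J. g s \<noteq> 0 \<longrightarrow> R s" using assms(1) unfolding opn_def by blast
  obtain w where w: "w \<in> J" "g w \<noteq> 0" using 1(2) unfolding nz_def by blast
  show ?thesis
    by (rule opnI[OF fform_comp[OF 1(1) fform_flip0] J_flip[OF w(1), of 0]])
      (use w 1(3) J_flip in \<open>auto simp: flip_flip\<close>)
qed

lemma opn_form_zero:
  assumes "opn R" "fform d f" "\<And>s. s \<in> J \<Longrightarrow> R s \<Longrightarrow> f s = 0" "x \<in> J" shows "f x = 0"
proof -
  obtain e g where 1: "fform e g" "nz g" "\<forall>s\<in>J. g s \<noteq> 0 \<longrightarrow> R s" using assms(1) unfolding opn_def by blast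
  show ?thesis by (rule form_cancel[OF 1(1,2) assms(2) _ assms(4)]) (use 1(3) assms(3) in auto)
qed

section \<open>Generic position of sums\<close>

lemma bform_cross: "bform 1 1 cross"
proof -
  have "cross = (\<lambda>x y. (x$1 - x$2) * (y$2 - y$3) - (x$2 - x$3) * (y$1 - y$2))"
    by (simp add: fun_eq_iff cross_def ucoord_def vcoord_def)
  moreover have "bform 1 1 (\<lambda>x y :: 'k^4. (x$1 - x$2) * (y$2 - y$3) - (x$2 - x$3) * (y$1 - y$2))"
    by (intro bform_diff bform_mult[OF bform_diff[OF bform_var1 bform_var1] bform_diff[OF bform_var2 bform_var2]]) simp_all
  ultimately show ?thesis by simp
qed

lemma fform_cross_comp:
  "(\<And>i. fform m (\<lambda>s. A s $ i)) \<Longrightarrow> (\<And>i. fform n (\<lambda>s. B s $ i)) \<Longrightarrow> fform (m + n) (\<lambda>s. cross (A s) (B s))"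
  using bform_comp[OF bform_cross, of m A n B] by simp

lemma fform_sm_comp:
  "(\<And>i. fform m (\<lambda>s. A s $ i)) \<Longrightarrow> (\<And>i. fform n (\<lambda>s. B s $ i)) \<Longrightarrow> fform (2 * m + 2 * n) (\<lambda>s. sm k (A s) (B s) $ j)"
  using bform_comp[OF bform_sm, of m A n B k j] by simp

lemma fform_constv: "fform 0 (\<lambda>_. v $ i)" by (rule fform_const)

lemma cross_simL: "sim x y \<Longrightarrow> cross x z \<noteq> 0 \<longleftrightarrow> cross y z \<noteq> 0"
proof -
  assume "sim x y"
  then obtain r where r: "r \<noteq> 0" "y = r *s x" unfolding sim_def by blast
  have "cross y z = r * cross x z" by (simp add: r(2) cross_def ucoord_def vcoord_def algebra_simps)
  then show ?thesis using r(1) by simp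
qed

lemma cross_swap: "cross x y = - cross y x" by (simp add: cross_def)

lemma cross_simR: "sim x y \<Longrightarrow> cross z x \<noteq> 0 \<longleftrightarrow> cross z y \<noteq> 0"
  using cross_simL[of x y z] cross_swap[of z x] cross_swap[of z y] by simp

lemma uv_torsion:
  "ucoord (tr 1 origin) = - 2" "vcoord (tr 1 origin) = 0" "ucoord (tr 3 origin) = 0" "vcoord (tr 3 origin) = 2"
  by (simp_all add: ucoord_def vcoord_def tr_nth origin_def)

text \<open>A vertical line may pass through one given point of order two, so none of them works for
  every x. A choice among two or three suffices, because u and v do not both vanish at x.\<close>

lemma cross_torsion:
  assumes "x \<in> J" "\<not> sim origin x"
  shows "cross x (tr 1 origin) \<noteq> 0 \<or> cross x (tr 3 origin) \<noteq> 0"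
    "cross (flip 1 x) (tr 1 origin) \<noteq> 0 \<or> cross (flip 3 x) (tr 3 origin) \<noteq> 0"
    "cross (tr 1 origin) (tr 1 x) \<noteq> 0 \<or> cross (tr 3 origin) (tr 3 x) \<noteq> 0"
    "cross (tr 1 x) x \<noteq> 0 \<or> cross (tr 2 x) x \<noteq> 0 \<or> cross (tr 3 x) x \<noteq> 0"
proof -
  have uv: "ucoord x \<noteq> 0 \<or> vcoord x \<noteq> 0" using sim_originI assms by blast
  then show "cross x (tr 1 origin) \<noteq> 0 \<or> cross x (tr 3 origin) \<noteq> 0"
    using two by (auto simp: cross_def uv_torsion)
  have "vcoord (flip 1 x) = vcoord x" "ucoord (flip 3 x) = ucoord x" by (simp_all add: ucoord_def vcoord_def flip_nth)
  then show "cross (flip 1 x) (tr 1 origin) \<noteq> 0 \<or> cross (flip 3 x) (tr 3 origin) \<noteq> 0"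
    using uv two by (auto simp: cross_def uv_torsion)
  have "vcoord (tr 1 x) = vcoord x" "ucoord (tr 3 x) = ucoord x" by (simp_all add: ucoord_def vcoord_def tr_nth)
  then show "cross (tr 1 origin) (tr 1 x) \<noteq> 0 \<or> cross (tr 3 origin) (tr 3 x) \<noteq> 0"
    using uv two by (auto simp: cross_def uv_torsion)
  have "cross (tr 1 x) x = - 2 * (x$1 * vcoord x)" "cross (tr 3 x) x = 2 * (- (x$3 * ucoord x))"
    "cross (tr 2 x) x = 2 * (x$2 * (ucoord x + vcoord x))"
    by (simp_all add: cross_def ucoord_def vcoord_def tr_nth, Groebner_Basis.algebra+)
  then show "cross (tr 1 x) x \<noteq> 0 \<or> cross (tr 2 x) x \<noteq> 0 \<or> cross (tr 3 x) x \<noteq> 0"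
    using uv two J_two_nonzero(4-6)[OF assms(1)] by auto
qed

lemma tr_in_J_nz: "k \<noteq> 0 \<Longrightarrow> \<not> sim origin (tr k origin)"
proof
  assume k: "k \<noteq> 0" and "sim origin (tr k origin)"
  then obtain r where r: "tr k origin = r *s origin" unfolding sim_def by blast
  have c: "tr k origin $ i = r * origin $ i" for i using r by simp
  obtain j where j: "j \<noteq> 0" "j \<noteq> k" by (cases "k = 1") (auto intro: that[of 1] that[of 2])
  have o: "origin $ i = 1" if "i \<noteq> 0" for i using that exhaust_0123[of i] by (auto simp: origin_def)
  have "r = 1" "r = - 1" using c[of j] c[of k] j k o by (simp_all add: tr_nth)
  then have "(1::'k) + 1 = 0" by (metis add.right_inverse)
  then show False using two by simp
qed

text \<open>Each condition is the nonvanishing of a form in s, so one witness for each is enough: a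
  point of order two for the first, and s = \<open>flip k p\<close> for the others, where p + s is
  of order two. The witness fixes the row of \<open>sm\<close>; where this row vanishes, so does the
  form.\<close>

lemma opn_cross_sum:
  assumes p: "p \<in> J" "\<not> sim origin p"
  shows "opn (\<lambda>s. \<forall>u. sumpt p s u \<longrightarrow> cross p s \<noteq> 0 \<and> cross p u \<noteq> 0 \<and> cross s u \<noteq> 0)"
proof -
  have 1: "opn (\<lambda>s. cross p s \<noteq> 0)"
    using cross_torsion(1)[OF p]
  proof
    assume "cross p (tr 1 origin) \<noteq> 0"
    with J_tr[OF origin_in_J] show ?thesis by (rule opnI[OF fform_cross]) blast
  next
    assume "cross p (tr 3 origin) \<noteq> 0"
    with J_tr[OF origin_in_J] show ?thesis by (rule opnI[OF fform_cross]) blast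
  qed
  have 2: "opn (\<lambda>s. \<forall>u. sumpt p s u \<longrightarrow> cross p u \<noteq> 0)" if k: "k \<noteq> 0" "cross p (tr k origin) \<noteq> 0" for k
  proof -
    have w: "flip k p \<in> J" using J_flip p(1) by blast
    obtain u i where u: "sumpt p (flip k p) u" "u = sm i p (flip k p)" "sm i p (flip k p) \<noteq> 0" using sumpt_exists[OF p(1) w] by metis
    have su: "sim u (tr k origin)" using sumpt_unique[OF p(1) w u(1) sumpt_flip[OF p(1) k(1)]] .
    show ?thesis
    proof (rule opnI[OF fform_cross_comp[OF fform_constv fform_sm_comp[OF fform_constv fform_var]] w])
      show "cross p (sm i p (flip k p)) \<noteq> 0" using cross_simR[OF su] k(2) u(2) by blast
      fix s assume s: "s \<in> J" "cross p (sm i p s) \<noteq> 0"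
      then have "sm i p s \<noteq> 0" by (auto simp: cross_def ucoord_def vcoord_def)
      then show "\<forall>u. sumpt p s u \<longrightarrow> cross p u \<noteq> 0" using sumpt_sim cross_simR s(2) by blast
    qed
  qed
  have 3: "opn (\<lambda>s. \<forall>u. sumpt p s u \<longrightarrow> cross s u \<noteq> 0)" if k: "k \<noteq> 0" "cross (flip k p) (tr k origin) \<noteq> 0" for k
  proof -
    have w: "flip k p \<in> J" using J_flip p(1) by blast
    obtain u i where u: "sumpt p (flip k p) u" "u = sm i p (flip k p)" "sm i p (flip k p) \<noteq> 0" using sumpt_exists[OF p(1) w] by metis
    have su: "sim u (tr k origin)" using sumpt_unique[OF p(1) w u(1) sumpt_flip[OF p(1) k(1)]] .
    show ?thesis
    proof (rule opnI[OF fform_cross_comp[OF fform_var fform_sm_comp[OF fform_constv fform_var]] w])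
      show "cross (flip k p) (sm i p (flip k p)) \<noteq> 0" using cross_simR[OF su] k(2) u(2) by blast
      fix s assume s: "s \<in> J" "cross s (sm i p s) \<noteq> 0"
      then have "sm i p s \<noteq> 0" by (auto simp: cross_def ucoord_def vcoord_def)
      then show "\<forall>u. sumpt p s u \<longrightarrow> cross s u \<noteq> 0" using sumpt_sim cross_simR s(2) by blast
    qed
  qed
  have "opn (\<lambda>s. \<forall>u. sumpt p s u \<longrightarrow> cross p u \<noteq> 0)" "opn (\<lambda>s. \<forall>u. sumpt p s u \<longrightarrow> cross s u \<noteq> 0)"
    using cross_torsion(1,2)[OF p] 2[of 1] 2[of 3] 3[of 1] 3[of 3] by auto
  from opn_conj[OF 1 opn_conj[OF this]] show ?thesis by (rule opn_mono) blast
qed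

lemma sumpt_in_J: "sumpt p q r \<Longrightarrow> r \<in> J"
  unfolding sumpt_def by blast

lemma sm_zero: "sm i 0 y = 0" "sm i x 0 = 0"
  using exhaust_0123[of i] by (elim disjE; simp add: vec4_eq_iff sm_simps)+

text \<open>At s = \<open>flip k p\<close> the sums u, v and t are T, T + r and r with T =
  \<open>tr k origin\<close>. \<open>Q\<close> stays abstract so that the three pairs among them are
  treated at once. Its first hypothesis says that it survives rescaling, and its conditional
  premises take care of rows that vanish at s.\<close>

lemma opn_sum_sum:
  assumes p: "p \<in> J" and q: "q \<in> J" and r: "sumpt p q r" and k: "k \<noteq> 0"
    and Q: "\<And>A B T u v t. Q A B T \<Longrightarrow> (A \<noteq> 0 \<Longrightarrow> sim A u) \<Longrightarrow> (B \<noteq> 0 \<Longrightarrow> sim B v) \<Longrightarrow> (T \<noteq> 0 \<Longrightarrow> sim T t) \<Longrightarrow> Q u v t"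
    and f: "\<And>m n l A B T. (\<And>i. fform m (\<lambda>s. A s $ i)) \<Longrightarrow> (\<And>i. fform n (\<lambda>s. B s $ i)) \<Longrightarrow> (\<And>i. fform l (\<lambda>s. T s $ i)) \<Longrightarrow>
       \<exists>d g. fform d g \<and> (\<forall>s. g s \<noteq> 0 \<longleftrightarrow> Q (A s) (B s) (T s))"
    and w: "Q (tr k origin) (tr k r) r"
  shows "opn (\<lambda>s. \<forall>u v t. sumpt p s u \<longrightarrow> sumpt q (flip 0 s) v \<longrightarrow> sumpt u v t \<longrightarrow> Q u v t)"
proof -
  let ?w = "flip k p"
  have wJ: "?w \<in> J" "flip 0 ?w \<in> J" using J_flip p by blast+
  obtain i u where u: "sumpt p ?w u" "u = sm i p ?w" "sm i p ?w \<noteq> 0" using sumpt_exists[OF p wJ(1)] by metis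
  have su: "sim u (tr k origin)" using sumpt_unique[OF p wJ(1) u(1) sumpt_flip[OF p k]] .
  obtain j v where v: "sumpt q (flip 0 ?w) v" "v = sm j q (flip 0 ?w)" "sm j q (flip 0 ?w) \<noteq> 0" using sumpt_exists[OF q wJ(2)] by metis
  have sv: "sim v (tr k r)"
    using sumpt_unique[OF q wJ(2) v(1)] sumpt_tr[OF sumpt_swap[OF r] k] by (simp add: tr_def)
  have uv: "u \<in> J" "v \<in> J" using u v sumpt_in_J by blast+
  obtain l t where t: "sumpt u v t" "t = sm l u v" "sm l u v \<noteq> 0" using sumpt_exists[OF uv] by metis
  have "sumpt (tr k origin) (tr k r) r" using sumpt_tr_both[OF sumpt_origin_left[OF sumpt_in_J[OF r]] k] .
  then have "sumpt u v r" using sumpt_cong su sv sim_sym by blast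
  then have st: "sim t r" using sumpt_unique[OF uv t(1)] by blast
  have fA: "fform 2 (\<lambda>s. sm i p s $ n)" for n using bform_right[OF bform_sm] .
  have fB: "fform 2 (\<lambda>s. sm j q (flip 0 s) $ n)" for n using fform_comp[OF bform_right[OF bform_sm] fform_flip0] by simp
  have fT: "fform 8 (\<lambda>s. sm l (sm i p s) (sm j q (flip 0 s)) $ n)" for n using fform_sm_comp[OF fA fB] by simp
  obtain d g where g: "fform d g" "\<And>s. g s \<noteq> 0 \<longleftrightarrow> Q (sm i p s) (sm j q (flip 0 s)) (sm l (sm i p s) (sm j q (flip 0 s)))"
    using f[of 2 "\<lambda>s. sm i p s" 2 "\<lambda>s. sm j q (flip 0 s)" 8 "\<lambda>s. sm l (sm i p s) (sm j q (flip 0 s))", OF fA fB fT] by blast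
  show ?thesis
  proof (rule opnI[OF g(1) wJ(1)])
    have "Q u v t" by (rule Q[OF w]) (use su sv st sim_sym in blast)+
    then show "g ?w \<noteq> 0" using g(2) u v t by simp
    fix s assume s: "s \<in> J" "g s \<noteq> 0"
    show "\<forall>u v t. sumpt p s u \<longrightarrow> sumpt q (flip 0 s) v \<longrightarrow> sumpt u v t \<longrightarrow> Q u v t"
    proof (intro allI impI)
      fix u v t assume h: "sumpt p s u" "sumpt q (flip 0 s) v" "sumpt u v t"
      note n = g(2)[THEN iffD1, OF s(2)]
      show "Q u v t"
      proof (rule Q[OF n])
        show u: "sm i p s \<noteq> 0 \<Longrightarrow> sim (sm i p s) u" and v: "sm j q (flip 0 s) \<noteq> 0 \<Longrightarrow> sim (sm j q (flip 0 s)) v"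
          using sumpt_sim h by blast+
        assume T: "sm l (sm i p s) (sm j q (flip 0 s)) \<noteq> 0"
        then have "sm i p s \<noteq> 0" "sm j q (flip 0 s) \<noteq> 0" using sm_zero by metis+
        then have "sumpt (sm i p s) (sm j q (flip 0 s)) t" using sumpt_cong[OF h(3)] u v sim_sym by blast
        then show "sim (sm l (sm i p s) (sm j q (flip 0 s))) t" using sumpt_sim T by blast
      qed
    qed
  qed
qed

lemma cross_zero: "cross 0 y = 0" "cross x 0 = 0"
  by (simp_all add: cross_def ucoord_def vcoord_def)

lemma cross_sim2: "cross x y \<noteq> 0 \<Longrightarrow> (x \<noteq> 0 \<Longrightarrow> sim x x') \<Longrightarrow> (y \<noteq> 0 \<Longrightarrow> sim y y') \<Longrightarrow> cross x' y' \<noteq> 0"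
  using cross_simL cross_simR cross_zero by metis

lemma sim_minors:
  assumes "x \<in> J" "y \<in> J" "\<And>m n. x $ m * y $ n = x $ n * y $ m" shows "sim x y"
proof -
  obtain m where m: "x $ m \<noteq> 0" using J_two_nonzero(1)[OF assms(1)] by blast
  have e: "y $ n = (y $ m / x $ m) * x $ n" for n using assms(3)[of m n] m by (simp add: field_simps)
  have y: "y = (y $ m / x $ m) *s x" unfolding vec_eq_iff vector_smult_component using e by blast
  have "y $ m \<noteq> 0"
  proof
    assume "y $ m = 0"
    then have "y = 0" using y by simp
    then show False using assms(2) by (simp add: J_def)
  qed
  then show ?thesis unfolding sim_def using y m by (intro exI[of _ "y $ m / x $ m"]) simp
qed

text \<open>For generic \<open>s\<close> the sum of \<open>p + s\<close> and \<open>q - s\<close> represents the divisor class of \<open>p + q\<close>, so it is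
  a constant point; by continuity this point is the value at \<open>s = O\<close>.\<close>

lemma adds_main:
  assumes p: "p \<in> J" "\<not> sim origin p" and q: "q \<in> J" "\<not> sim origin q" and r: "sumpt p q r" "\<not> sim origin r"
  shows "adds p q r"
proof -
  have rJ: "r \<in> J" using r(1) sumpt_in_J by blast
  have g1: "opn (\<lambda>s. \<forall>u. sumpt p s u \<longrightarrow> adds p s u)"
    by (rule opn_mono[OF opn_cross_sum[OF p]]) (use adds_sumpt_generic p in blast)
  have "opn (\<lambda>s. \<forall>u. sumpt q s u \<longrightarrow> adds q s u)"
    by (rule opn_mono[OF opn_cross_sum[OF q]]) (use adds_sumpt_generic q in blast)
  from opn_flip[OF this] have g2: "opn (\<lambda>s. \<forall>v. sumpt q (flip 0 s) v \<longrightarrow> adds q (flip 0 s) v)" .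
  let ?R = "\<lambda>Q s. \<forall>u v t. sumpt p s u \<longrightarrow> sumpt q (flip 0 s) v \<longrightarrow> sumpt u v t \<longrightarrow> Q u v t"
  have a1: "opn (?R (\<lambda>u v t. cross u v \<noteq> 0))" if k: "k \<noteq> 0" "cross (tr k origin) (tr k r) \<noteq> 0" for k
  proof (rule opn_sum_sum[OF p(1) q(1) r(1) k(1)])
    fix A B T u v t
    assume "cross A B \<noteq> 0" and "A \<noteq> 0 \<Longrightarrow> sim A u" "B \<noteq> 0 \<Longrightarrow> sim B v" "T \<noteq> 0 \<Longrightarrow> sim T t"
    then show "cross u v \<noteq> 0" using cross_sim2[of A B u v] by simp
  next
    fix m n l and A B T :: "'k^4 \<Rightarrow> 'k^4"
    assume A: "\<And>i. fform m (\<lambda>s. A s $ i)" and B: "\<And>i. fform n (\<lambda>s. B s $ i)" and T: "\<And>i. fform l (\<lambda>s. T s $ i)"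
    show "\<exists>d g. fform d g \<and> (\<forall>s. g s \<noteq> 0 \<longleftrightarrow> cross (A s) (B s) \<noteq> 0)"
      using fform_cross_comp[of m A n B, OF A B] by blast
  qed (rule k(2))
  have a2: "opn (?R (\<lambda>u v t. cross u t \<noteq> 0))" if k: "k \<noteq> 0" "cross (tr k origin) r \<noteq> 0" for k
  proof (rule opn_sum_sum[OF p(1) q(1) r(1) k(1)])
    fix A B T u v t
    assume "cross A T \<noteq> 0" and "A \<noteq> 0 \<Longrightarrow> sim A u" "B \<noteq> 0 \<Longrightarrow> sim B v" "T \<noteq> 0 \<Longrightarrow> sim T t"
    then show "cross u t \<noteq> 0" using cross_sim2[of A T u t] by simp
  next
    fix m n l and A B T :: "'k^4 \<Rightarrow> 'k^4"
    assume A: "\<And>i. fform m (\<lambda>s. A s $ i)" and B: "\<And>i. fform n (\<lambda>s. B s $ i)" and T: "\<And>i. fform l (\<lambda>s. T s $ i)"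
    show "\<exists>d g. fform d g \<and> (\<forall>s. g s \<noteq> 0 \<longleftrightarrow> cross (A s) (T s) \<noteq> 0)"
      using fform_cross_comp[of m A l T, OF A T] by blast
  qed (rule k(2))
  have a3: "opn (?R (\<lambda>u v t. cross v t \<noteq> 0))" if k: "k \<noteq> 0" "cross (tr k r) r \<noteq> 0" for k
  proof (rule opn_sum_sum[OF p(1) q(1) r(1) k(1)])
    fix A B T u v t
    assume "cross B T \<noteq> 0" and "A \<noteq> 0 \<Longrightarrow> sim A u" "B \<noteq> 0 \<Longrightarrow> sim B v" "T \<noteq> 0 \<Longrightarrow> sim T t"
    then show "cross v t \<noteq> 0" using cross_sim2[of B T v t] by simp
  next
    fix m n l and A B T :: "'k^4 \<Rightarrow> 'k^4"
    assume A: "\<And>i. fform m (\<lambda>s. A s $ i)" and B: "\<And>i. fform n (\<lambda>s. B s $ i)" and T: "\<And>i. fform l (\<lambda>s. T s $ i)"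
    show "\<exists>d g. fform d g \<and> (\<forall>s. g s \<noteq> 0 \<longleftrightarrow> cross (B s) (T s) \<noteq> 0)"
      using fform_cross_comp[of n B l T, OF B T] by blast
  qed (rule k(2))
  note ct = cross_torsion[OF rJ r(2)]
  have b1: "opn (?R (\<lambda>u v t. cross u v \<noteq> 0))" using ct(3) a1[of 1] a1[of 3] by auto
  have b2: "opn (?R (\<lambda>u v t. cross u t \<noteq> 0))"
    using ct(1) a2[of 1] a2[of 3] cross_swap[of r "tr 1 origin"] cross_swap[of r "tr 3 origin"] by auto
  have b3: "opn (?R (\<lambda>u v t. cross v t \<noteq> 0))" using ct(4) a3[of 1] a3[of 2] a3[of 3] by auto
  define G where "G s \<longleftrightarrow> (\<forall>u v t. sumpt p s u \<longrightarrow> sumpt q (flip 0 s) v \<longrightarrow> sumpt u v t \<longrightarrow> adds p q t)" for s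
  have G: "opn G"
  proof (rule opn_mono[OF opn_conj[OF opn_conj[OF g1 g2] opn_conj[OF b1 opn_conj[OF b2 b3]]]])
    fix s assume s: "s \<in> J" and h: "((\<forall>u. sumpt p s u \<longrightarrow> adds p s u) \<and> (\<forall>v. sumpt q (flip 0 s) v \<longrightarrow> adds q (flip 0 s) v)) \<and>
      ?R (\<lambda>u v t. cross u v \<noteq> 0) s \<and> ?R (\<lambda>u v t. cross u t \<noteq> 0) s \<and> ?R (\<lambda>u v t. cross v t \<noteq> 0) s"
    show "G s" unfolding G_def
    proof (intro allI impI)
      fix u v t assume t: "sumpt p s u" "sumpt q (flip 0 s) v" "sumpt u v t"
      have "adds u v t"
        using adds_sumpt_generic[OF sumpt_in_J[OF t(1)] sumpt_in_J[OF t(2)] t(3)] h t by blast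
      moreover have "adds p s u" "adds q (flip 0 s) v" using h t by blast+
      \<comment> \<open>Add the three relations and subtract the one for s and - s; the terms for s,
        - s, u and v cancel.\<close>
      ultimately have "principal (\<lambda>x. ((point_div p x + point_div s x - point_div u x - point_div origin x)
         + (point_div q x + point_div (flip 0 s) x - point_div v x - point_div origin x)
         + (point_div u x + point_div v x - point_div t x - point_div origin x))
         - (point_div s x + point_div (flip 0 s) x - point_div origin x - point_div origin x))"
        using principal_diff[OF principal_add[OF principal_add]] adds_neg[OF s] unfolding adds_def by blast
      then show "adds p q t" unfolding adds_def by (rule principal_cong) simp
    qed
  qed
  \<comment> \<open>One generic s0 fixes a point t0 in the class of p + q; by uniqueness every
    generic s leads to the same point.\<close>
  obtain s0 where s0: "s0 \<in> J" "G s0" using opn_ex[OF G] by blast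
  obtain u0 where u0: "sumpt p s0 u0" using sumpt_exists[OF p(1) s0(1)] by metis
  obtain v0 where v0: "sumpt q (flip 0 s0) v0" using sumpt_exists[OF q(1) J_flip[OF s0(1)]] by metis
  obtain t0 where t0: "sumpt u0 v0 t0" using sumpt_exists[OF sumpt_in_J[OF u0] sumpt_in_J[OF v0]] by metis
  have a0: "adds p q t0" using s0(2) u0 v0 t0 unfolding G_def by blast
  have t0J: "t0 \<in> J" using t0 sumpt_in_J by blast
  obtain i where i: "p $ i \<noteq> 0" using J_two_nonzero(1)[OF p(1)] by blast
  obtain j where j: "q $ j \<noteq> 0" using J_two_nonzero(1)[OF q(1)] by blast
  obtain l l' where "sm l p q $ l' \<noteq> 0" using sm_complete[OF p(1) q(1)] .
  then have l: "sm l p q \<noteq> 0" by auto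
  have fA: "fform 2 (\<lambda>s. sm i p s $ n)" for n using bform_right[OF bform_sm] .
  have fB: "fform 2 (\<lambda>s. sm j q (flip 0 s) $ n)" for n using fform_comp[OF bform_right[OF bform_sm] fform_flip0] by simp
  \<comment> \<open>The entries of W are forms in s, so proportionality to t0, valid for generic s,
    extends to s = O. The rows i, j and l are chosen so that W is nonzero there.\<close>
  define W where "W s = sm l (sm i p s) (sm j q (flip 0 s))" for s
  have fW: "fform 8 (\<lambda>s. W s $ n)" for n unfolding W_def using fform_sm_comp[OF fA fB] by simp
  have minor: "W s $ m * t0 $ n - W s $ n * t0 $ m = 0" if s: "s \<in> J" for s m n
  proof (rule opn_form_zero[OF G _ _ s])
    have "(\<lambda>s. W s $ m * t0 $ n - W s $ n * t0 $ m) = (\<lambda>s. t0 $ n * W s $ m - t0 $ m * W s $ n)"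
      by (simp add: mult.commute)
    then show "fform 8 (\<lambda>s. W s $ m * t0 $ n - W s $ n * t0 $ m)"
      by (simp only:) (intro fform_diff fform_scale fW)
    fix s assume s: "s \<in> J" "G s"
    show "W s $ m * t0 $ n - W s $ n * t0 $ m = 0"
    proof (cases "W s = 0")
      case False
      then have n: "sm i p s \<noteq> 0" "sm j q (flip 0 s) \<noteq> 0" unfolding W_def using sm_zero by metis+
      have A: "sumpt p s (sm i p s)" "sumpt q (flip 0 s) (sm j q (flip 0 s))"
        using sumpt_row p(1) q(1) s(1) J_flip n by blast+
      then have "sumpt (sm i p s) (sm j q (flip 0 s)) (W s)"
        using sumpt_row sumpt_in_J False unfolding W_def by blast
      then have W: "adds p q (W s)" "W s \<in> J" using s(2) A sumpt_in_J unfolding G_def by blast+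
      then have "sim t0 (W s)" using adds_unique[OF a0 W(1) t0J W(2)] by blast
      then show ?thesis unfolding sim_def by auto
    qed simp
  qed
  have "sm i p origin = p $ i *s p" by (simp add: vec_eq_iff sm_origin_right[OF p(1)])
  moreover have "sm j q (flip 0 origin) = q $ j *s q" by (simp add: vec_eq_iff origin_flip0 sm_origin_right[OF q(1)])
  ultimately have Wo: "W origin = ((p $ i)^2 * (q $ j)^2) *s sm l p q" unfolding W_def by (simp add: sm_scale)
  have c: "(p $ i)^2 * (q $ j)^2 \<noteq> 0" using i j by simp
  have "sm l p q $ m * t0 $ n = sm l p q $ n * t0 $ m" for m n
    using minor[OF origin_in_J, of m n] c unfolding Wo by simp
  then have "sim (sm l p q) t0" using sim_minors[OF sm_on_curve[OF p(1) q(1) l] t0J] by blast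
  then have "sim t0 r" using sumpt_sim[OF r(1) l] sim_trans sim_sym by blast
  then show ?thesis using adds_cong[OF a0] sim_refl by blast
qed

lemma adds_cancel_left:
  assumes "adds p q r" "adds p q' r" "q \<in> J" "q' \<in> J" shows "sim q q'"
proof (rule principal_points_eq[OF assms(3,4)])
  have "principal (\<lambda>x. (point_div p x + point_div q x - point_div r x - point_div origin x)
      - (point_div p x + point_div q' x - point_div r x - point_div origin x))"
    using principal_diff assms(1,2) unfolding adds_def by blast
  then show "principal (\<lambda>x. point_div q x - point_div q' x)" by (rule principal_cong) simp
qed

lemma adds_sumpt_origin_cases:
  assumes p: "p \<in> J" and q: "q \<in> J" and r: "sumpt p q r" and c: "sim origin p \<or> sim origin q \<or> \<not> sim origin r"
  shows "adds p q r"
proof -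
  consider "sim origin p" | "sim origin q" | "\<not> sim origin p" "\<not> sim origin q" "\<not> sim origin r" using c by blast
  then show ?thesis
  proof cases
    case 1
    then have "sumpt p q q" using sumpt_cong[OF sumpt_origin_left[OF q]] sim_refl by blast
    then have "sim q r" using sumpt_unique[OF p q _ r] by blast
    then show ?thesis using adds_cong[OF adds_origin_left] 1 sim_refl by blast
  next
    case 2
    then have "sumpt p q p" using sumpt_cong[OF sumpt_origin_right[OF p]] sim_refl by blast
    then have "sim p r" using sumpt_unique[OF p q _ r] by blast
    moreover have "adds p origin p" using adds_origin_left adds_commute by blast
    ultimately show ?thesis using adds_cong 2 sim_refl by blast
  next
    case 3
    then show ?thesis using adds_main p q r by blast
  qed
qed

theorem adds_sumpt:
  assumes p: "p \<in> J" and q: "q \<in> J" and r: "sumpt p q r" shows "adds p q r"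
proof (cases "sim origin r")
  case False
  then show ?thesis using adds_sumpt_origin_cases assms by blast
next
  case True
  text \<open>Translating by a point of order 2 shows that \<open>q\<close> is the inverse of \<open>p\<close>.\<close>
  have "sumpt p (tr 1 q) (tr 1 r)" using sumpt_tr[OF r] by simp
  moreover have "sim (tr 1 r) (tr 1 origin)" unfolding tr_def using True sim_flip sim_sym by blast
  ultimately have 1: "sumpt p (tr 1 q) (tr 1 origin)" using sumpt_cong_right by blast
  have 2: "sumpt p (flip 1 p) (tr 1 origin)" using sumpt_flip[OF p] by simp
  have o: "\<not> sim origin (tr 1 origin)" by (rule tr_in_J_nz) simp
  have "adds p (tr 1 q) (tr 1 origin)" "adds p (flip 1 p) (tr 1 origin)"
    using adds_sumpt_origin_cases p J_tr q J_flip 1 2 o by blast+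
  then have "sim (tr 1 q) (flip 1 p)" using adds_cancel_left J_tr q J_flip p by blast
  then have "sim (flip 1 (flip 0 (tr 1 q))) (flip 1 (flip 0 (flip 1 p)))" using sim_flip by blast
  moreover have "flip 1 (flip 0 (tr 1 q)) = q" by (simp add: tr_def flip_flip)
  moreover have "flip 1 (flip 0 (flip 1 p)) = flip 0 p" by (simp add: vec4_eq_iff flip_nth)
  ultimately have "sim (flip 0 p) q" using sim_sym by simp
  then show ?thesis using adds_cong[OF adds_neg[OF p]] True sim_refl by blast
qed

section \<open>The operations on points\<close>

lemma addJ_sumpt:
  assumes "p \<in> J" "q \<in> J" "sumpt p q r"
  shows "addJ a b (abs_proj3 p) (abs_proj3 q) = abs_proj3 r"
  by (rule addJ_eq[OF assms(1,2) sumpt_in_J[OF assms(3)] adds_sumpt[OF assms]])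

lemma addJ_sm:
  assumes "P \<in> C" "Q \<in> C" "sm i (rep_proj3 P) (rep_proj3 Q) \<noteq> 0"
  shows "addJ a b P Q = abs_proj3 (sm i (rep_proj3 P) (rep_proj3 Q))"
proof -
  have "rep_proj3 P \<in> J" "rep_proj3 Q \<in> J" using assms rep_in_J by blast+
  from addJ_sumpt[OF this sumpt_row[OF this assms(3)]] show ?thesis by (simp add: abs_rep_proj3)
qed

lemma negJ_eq:
  assumes Q: "Q \<in> C" shows "negJ a b Q = abs_proj3 (flip 0 (rep_proj3 Q))"
  unfolding negJ_def
proof (rule the_equality)
  have q: "rep_proj3 Q \<in> J" using Q rep_in_J by blast
  have o: "originJ = abs_proj3 origin" by (simp add: originJ_def origin_def)
  have fq: "flip 0 (rep_proj3 Q) \<in> J" by (rule J_flip[OF q])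
  show "abs_proj3 (flip 0 (rep_proj3 Q)) \<in> C \<and> addJ a b Q (abs_proj3 (flip 0 (rep_proj3 Q))) = originJ"
    using addJ_eq[OF q fq origin_in_J adds_neg[OF q]] abs_in_C[OF fq] by (simp add: abs_rep_proj3 o)
  fix R assume R: "R \<in> C \<and> addJ a b Q R = originJ"
  then have r: "rep_proj3 R \<in> J" using rep_in_J by blast
  obtain t where t: "sumpt (rep_proj3 Q) (rep_proj3 R) t" using sumpt_exists[OF q r] by metis
  have "abs_proj3 t = abs_proj3 origin" using addJ_sumpt[OF q r t] R o by (simp add: abs_rep_proj3)
  then have "sim t origin" using abs_eq_iff sumpt_in_J[OF t] origin_in_J by blast
  then have "adds (rep_proj3 Q) (rep_proj3 R) origin" using adds_cong[OF adds_sumpt[OF q r t]] sim_refl by blast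
  then have "sim (rep_proj3 R) (flip 0 (rep_proj3 Q))" using adds_cancel_left adds_neg[OF q] r fq by blast
  then have "abs_proj3 (rep_proj3 R) = abs_proj3 (flip 0 (rep_proj3 Q))" using abs_eq_iff r fq by blast
  then show "R = abs_proj3 (flip 0 (rep_proj3 Q))" by (simp add: abs_rep_proj3)
qed

lemma sim_sm_rep:
  assumes "P \<in> C" "Q \<in> C" "sm i (rep_proj3 P) (rep_proj3 Q) \<noteq> 0"
  shows "sim (sm i (rep_proj3 P) (rep_proj3 Q)) (rep_proj3 (addJ a b P Q))"
proof -
  have "rep_proj3 P \<in> J" "rep_proj3 Q \<in> J" using assms rep_in_J by blast+
  then show ?thesis unfolding addJ_sm[OF assms] by (rule sim_rep_abs[OF sm_on_curve[OF _ _ assms(3)]])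
qed

lemma addJ_in_C: assumes "P \<in> C" "Q \<in> C" shows "addJ a b P Q \<in> C"
proof -
  have pq: "rep_proj3 P \<in> J" "rep_proj3 Q \<in> J" using assms rep_in_J by blast+
  obtain i j where "sm i (rep_proj3 P) (rep_proj3 Q) $ j \<noteq> 0" using sm_complete[OF pq] .
  then have "sm i (rep_proj3 P) (rep_proj3 Q) \<noteq> 0" by auto
  from sim_sm_rep[OF assms this] sm_on_curve[OF pq this] show ?thesis using rep_in_J sim_J by blast
qed

subsection \<open>The difference map and exceptional divisors\<close>

text \<open>Reflecting \<open>q\<close> transposes \<open>sm\<close>, so that this is a column of it; a nonzero column represents the difference.\<close>

definition diffv :: "4 \<Rightarrow> 'k ^ 4 \<Rightarrow> 'k ^ 4 \<Rightarrow> 'k ^ 4" where "diffv j p q = sm j p (flip 0 q)"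

lemma diffv_nth: "diffv j p q $ i = sm i p q $ j"
  unfolding diffv_def by (rule sm_flip_right)

lemma bform_diffv: "bform 2 2 (\<lambda>p q. diffv j p q $ i)"
  unfolding diffv_nth by (rule bform_sm)

lemma deltaJ_sim:
  assumes "P \<in> C" "Q \<in> C" "diffv j (rep_proj3 P) (rep_proj3 Q) \<noteq> 0"
  shows "deltaJ a b (P, Q) \<in> C" "sim (diffv j (rep_proj3 P) (rep_proj3 Q)) (rep_proj3 (deltaJ a b (P, Q)))"
proof -
  have pq: "rep_proj3 P \<in> J" "rep_proj3 Q \<in> J" "flip 0 (rep_proj3 Q) \<in> J" using assms rep_in_J J_flip by blast+
  have d: "deltaJ a b (P, Q) = addJ a b (abs_proj3 (rep_proj3 P)) (abs_proj3 (flip 0 (rep_proj3 Q)))"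
    by (simp add: deltaJ_def negJ_eq[OF assms(2)] abs_rep_proj3)
  have s: "sumpt (rep_proj3 P) (flip 0 (rep_proj3 Q)) (diffv j (rep_proj3 P) (rep_proj3 Q))"
    unfolding diffv_def by (rule sumpt_row[OF pq(1,3)]) (use assms(3) in \<open>simp add: diffv_def\<close>)
  have e: "deltaJ a b (P, Q) = abs_proj3 (diffv j (rep_proj3 P) (rep_proj3 Q))"
    unfolding d by (rule addJ_sumpt[OF pq(1,3) s])
  show "deltaJ a b (P, Q) \<in> C" "sim (diffv j (rep_proj3 P) (rep_proj3 Q)) (rep_proj3 (deltaJ a b (P, Q)))"
    unfolding e using abs_in_C[OF sumpt_in_J[OF s]] sim_rep_abs[OF sumpt_in_J[OF s]] by blast+
qed

abbreviation bilift :: "('k ^ 4 \<Rightarrow> 'k ^ 4 \<Rightarrow> 'k) \<Rightarrow> 'k proj3 \<times> 'k proj3 \<Rightarrow> 'k" where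
  "bilift h \<equiv> (\<lambda>(P, Q). h (rep_proj3 P) (rep_proj3 Q))"

lemma bilift_in: "bform d e h \<Longrightarrow> bilift h \<in> biforms d e"
  unfolding biforms_eq by blast

lemma biforms_in: "biforms d e \<in> forms33"
  unfolding forms33_def by blast

lemma near_bilift: "bform d e h \<Longrightarrow> bilift h x \<noteq> 0 \<Longrightarrow> near (C \<times> C) forms33 x (\<lambda>y. bilift h y \<noteq> 0)"
  by (rule S33.near_form[OF biforms_in bilift_in])

lemma near_diffv:
  assumes "bilift (\<lambda>p q. diffv j p q $ n) x \<noteq> 0"
  shows "near (C \<times> C) forms33 x (\<lambda>y. \<exists>r. r \<noteq> 0 \<and> deltaJ a b y \<in> C \<and> rep_proj3 (deltaJ a b y) = r *s diffv j (rep_proj3 (fst y)) (rep_proj3 (snd y)) \<and>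
     diffv j (rep_proj3 (fst y)) (rep_proj3 (snd y)) $ n \<noteq> 0)"
proof (rule S33.near_mono[OF near_bilift[OF bform_diffv assms]])
  fix y :: "'k proj3 \<times> 'k proj3"
  assume y: "y \<in> C \<times> C" "bilift (\<lambda>p q. diffv j p q $ n) y \<noteq> 0"
  obtain P Q where PQ: "y = (P, Q)" "P \<in> C" "Q \<in> C" using y(1) by blast
  have n: "diffv j (rep_proj3 P) (rep_proj3 Q) $ n \<noteq> 0" using y(2) PQ by simp
  then have "diffv j (rep_proj3 P) (rep_proj3 Q) \<noteq> 0" by auto
  from deltaJ_sim[OF PQ(2,3) this] n show "\<exists>r. r \<noteq> 0 \<and> deltaJ a b y \<in> C \<and> rep_proj3 (deltaJ a b y) = r *s diffv j (rep_proj3 (fst y)) (rep_proj3 (snd y)) \<and>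
     diffv j (rep_proj3 (fst y)) (rep_proj3 (snd y)) $ n \<noteq> 0"
    unfolding PQ sim_def by auto
qed

text \<open>Continuity of the difference map: near x it is given by one column of \<open>sm\<close>
  that is nonzero at x, and the entries of a column are biforms.\<close>

lemma near_delta:
  assumes x: "x \<in> C \<times> C" and j: "bilift (\<lambda>p q. diffv j p q $ n) x \<noteq> 0" and R: "near C forms3 (deltaJ a b x) R"
  shows "near (C \<times> C) forms33 x (\<lambda>y. R (deltaJ a b y))"
proof -
  obtain d g where g: "fform d g" "g (rep_proj3 (deltaJ a b x)) \<noteq> 0" "\<forall>y\<in>C. g (rep_proj3 y) \<noteq> 0 \<longrightarrow> R y"
    using R unfolding near_C_iff by blast
  note nd = near_diffv[OF j]
  have h: "bform (d * 2) (d * 2) (\<lambda>p q. g (diffv j p q))" by (rule fform_comp_bform[OF g(1) bform_diffv])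
  have hom: "g (r *s v) \<noteq> 0 \<longleftrightarrow> g v \<noteq> 0" if "r \<noteq> 0" for r v using fform_homogeneous[OF g(1)] that by simp
  have "bilift (\<lambda>p q. g (diffv j p q)) x \<noteq> 0"
    using S33.near_self[OF x nd] g(2) hom by (auto simp: case_prod_beta)
  from S33.near_conj[OF near_bilift[OF h this] nd] show ?thesis
  proof (rule S33.near_mono)
    fix y assume "bilift (\<lambda>p q. g (diffv j p q)) y \<noteq> 0 \<and> (\<exists>r. r \<noteq> 0 \<and> deltaJ a b y \<in> C \<and>
      rep_proj3 (deltaJ a b y) = r *s diffv j (rep_proj3 (fst y)) (rep_proj3 (snd y)) \<and> diffv j (rep_proj3 (fst y)) (rep_proj3 (snd y)) $ n \<noteq> 0)"
    then show "R (deltaJ a b y)" using g(3) hom by (auto simp: case_prod_beta)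
  qed
qed

lemma unit_delta:
  assumes x: "x \<in> C \<times> C" and j: "bilift (\<lambda>p q. diffv j p q $ n) x \<noteq> 0" and u: "unit_at C forms3 (deltaJ a b x) u"
  shows "unit_at (C \<times> C) forms33 x (\<lambda>y. u (deltaJ a b y))"
proof -
  obtain d f g where 1: "fform d f" "fform d g" "near C forms3 (deltaJ a b x) (\<lambda>y. g (rep_proj3 y) \<noteq> 0 \<and> u y = f (rep_proj3 y) / g (rep_proj3 y))"
    using u unfolding unit_at_def regular_C_iff by blast
  have f: "bform (d * 2) (d * 2) (\<lambda>p q. f (diffv j p q))" and g: "bform (d * 2) (d * 2) (\<lambda>p q. g (diffv j p q))"
    by (rule fform_comp_bform[OF 1(1) bform_diffv] fform_comp_bform[OF 1(2) bform_diffv])+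
  have "near (C \<times> C) forms33 x (\<lambda>y. bilift (\<lambda>p q. g (diffv j p q)) y \<noteq> 0 \<and>
      u (deltaJ a b y) = bilift (\<lambda>p q. f (diffv j p q)) y / bilift (\<lambda>p q. g (diffv j p q)) y)"
  proof (rule S33.near_mono[OF S33.near_conj[OF near_delta[OF x j 1(3)] near_diffv[OF j]]])
    fix y assume h: "(g (rep_proj3 (deltaJ a b y)) \<noteq> 0 \<and> u (deltaJ a b y) = f (rep_proj3 (deltaJ a b y)) / g (rep_proj3 (deltaJ a b y))) \<and>
      (\<exists>r. r \<noteq> 0 \<and> deltaJ a b y \<in> C \<and> rep_proj3 (deltaJ a b y) = r *s diffv j (rep_proj3 (fst y)) (rep_proj3 (snd y)) \<and>
        diffv j (rep_proj3 (fst y)) (rep_proj3 (snd y)) $ n \<noteq> 0)"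
    then obtain r where r: "r \<noteq> 0" "rep_proj3 (deltaJ a b y) = r *s diffv j (rep_proj3 (fst y)) (rep_proj3 (snd y))" by blast
    show "bilift (\<lambda>p q. g (diffv j p q)) y \<noteq> 0 \<and>
      u (deltaJ a b y) = bilift (\<lambda>p q. f (diffv j p q)) y / bilift (\<lambda>p q. g (diffv j p q)) y"
      using h r(1) unfolding r(2) by (simp add: case_prod_beta fform_homogeneous[OF 1(1)] fform_homogeneous[OF 1(2)])
  qed
  then have "regular_at (C \<times> C) forms33 x (\<lambda>y. u (deltaJ a b y))"
    unfolding regular_at_def using bilift_in[OF f] bilift_in[OF g] biforms_in by blast
  then show ?thesis using u unfolding unit_at_def by blast
qed

lemma cartier_eqI:
  assumes "\<And>x \<psi>. x \<in> C \<times> C \<Longrightarrow> \<psi> \<in> L x \<Longrightarrow> \<exists>\<psi>'\<in>L' x. associated_at (C \<times> C) forms33 x \<psi> \<psi>'"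
    and "\<And>x \<psi>. x \<in> C \<times> C \<Longrightarrow> \<psi> \<in> L' x \<Longrightarrow> \<exists>\<psi>'\<in>L x. associated_at (C \<times> C) forms33 x \<psi> \<psi>'"
  shows "cartier (C \<times> C) forms33 L = cartier (C \<times> C) forms33 L'"
  unfolding cartier_def using assms S33.associated_at_trans by blast

text \<open>Where X_j(P + Q) is nonzero, column j of \<open>sm\<close> is nonzero and represents the
  difference. Choosing n with entry (n, j) nonzero, entry (i, j) is entry (n, j) times X_i / X_n at
  the difference, and entry (n, j) divided by h is a unit; so the local equations of the two
  divisors agree.\<close>

lemma divisor_eq:
  fixes E :: "'k proj3 \<Rightarrow> 'k proj3 \<Rightarrow> 'k ^ 4"
  assumes r: "r \<noteq> 0" and E: "\<And>P Q. P \<in> C \<Longrightarrow> Q \<in> C \<Longrightarrow> E P Q = r *s sm i (rep_proj3 P) (rep_proj3 Q)"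
  shows "cartier (C \<times> C) forms33 (\<lambda>(P, Q). {(\<lambda>(P', Q'). E P' Q' $ j / h (P', Q')) |j h.
          rep_proj3 (addJ a b P Q) $ j \<noteq> 0 \<and> h \<in> biforms 2 2 \<and> h (P, Q) \<noteq> 0})
    = pullback (C \<times> C) forms33 (deltaJ a b) (coord_divisor a b i)"
  unfolding pullback_def
proof (rule cartier_eqI)
  \<comment> \<open>The sum is proportional to some nonzero row, so a nonzero coordinate of the sum
    is a nonzero entry in its column.\<close>
  have key: "\<exists>n. bilift (\<lambda>p q. diffv j p q $ n) (P, Q) \<noteq> 0" if P: "P \<in> C" "Q \<in> C" and j: "rep_proj3 (addJ a b P Q) $ j \<noteq> 0" for P Q j
  proof -
    have pq: "rep_proj3 P \<in> J" "rep_proj3 Q \<in> J" using P rep_in_J by blast+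
    obtain n l where "sm n (rep_proj3 P) (rep_proj3 Q) $ l \<noteq> 0" using sm_complete[OF pq] .
    then have "sm n (rep_proj3 P) (rep_proj3 Q) \<noteq> 0" by auto
    from sim_sm_rep[OF P this] j have "sm n (rep_proj3 P) (rep_proj3 Q) $ j \<noteq> 0" unfolding sim_def by auto
    then show ?thesis by (auto simp: diffv_nth)
  qed
  have assoc: "associated_at (C \<times> C) forms33 (P, Q) (\<lambda>(P', Q'). E P' Q' $ j / h (P', Q'))
      (\<lambda>y. rep_proj3 (deltaJ a b y) $ i / rep_proj3 (deltaJ a b y) $ n)"
    if P: "P \<in> C" "Q \<in> C" and n: "bilift (\<lambda>p q. diffv j p q $ n) (P, Q) \<noteq> 0" and h: "h \<in> biforms 2 2" "h (P, Q) \<noteq> 0" for P Q j n h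
  proof -
    define u where "u y = bilift (\<lambda>p q. r * (diffv j p q $ n)) y / h y" for y
    have nh: "near (C \<times> C) forms33 (P, Q) (\<lambda>y. h y \<noteq> 0)" by (rule S33.near_form[OF biforms_in h])
    have "near (C \<times> C) forms33 (P, Q) (\<lambda>y. h y \<noteq> 0 \<and> u y = bilift (\<lambda>p q. r * (diffv j p q $ n)) y / h y)"
      by (rule S33.near_mono[OF nh]) (simp add: u_def)
    then have "regular_at (C \<times> C) forms33 (P, Q) u"
      unfolding regular_at_def using bilift_in[OF bform_scale[OF bform_diffv]] h(1) biforms_in by blast
    moreover have "u (P, Q) \<noteq> 0" using n r h(2) by (simp add: u_def)
    ultimately have "unit_at (C \<times> C) forms33 (P, Q) u" by (simp add: unit_at_def)
    moreover have "near (C \<times> C) forms33 (P, Q) (\<lambda>y. (\<lambda>(P', Q'). E P' Q' $ j / h (P', Q')) y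
        = u y * (rep_proj3 (deltaJ a b y) $ i / rep_proj3 (deltaJ a b y) $ n))"
    proof (rule S33.near_mono[OF near_diffv[OF n]])
      fix y assume y: "y \<in> C \<times> C" and d: "\<exists>r. r \<noteq> 0 \<and> deltaJ a b y \<in> C \<and> rep_proj3 (deltaJ a b y) = r *s diffv j (rep_proj3 (fst y)) (rep_proj3 (snd y)) \<and>
        diffv j (rep_proj3 (fst y)) (rep_proj3 (snd y)) $ n \<noteq> 0"
      obtain P' Q' where PQ: "y = (P', Q')" "P' \<in> C" "Q' \<in> C" using y by blast
      from d obtain s where s: "s \<noteq> 0" "rep_proj3 (deltaJ a b y) = s *s diffv j (rep_proj3 P') (rep_proj3 Q')"
        "diffv j (rep_proj3 P') (rep_proj3 Q') $ n \<noteq> 0" unfolding PQ by auto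
      have "(\<lambda>(P', Q'). E P' Q' $ j / h (P', Q')) y = r * diffv j (rep_proj3 P') (rep_proj3 Q') $ i / h y"
        by (simp add: PQ E diffv_nth)
      also have "\<dots> = u y * (diffv j (rep_proj3 P') (rep_proj3 Q') $ i / diffv j (rep_proj3 P') (rep_proj3 Q') $ n)"
        using s(3) by (simp add: u_def PQ)
      also have "\<dots> = u y * (rep_proj3 (deltaJ a b y) $ i / rep_proj3 (deltaJ a b y) $ n)"
        using s(1) unfolding s(2) by simp
      finally show "(\<lambda>(P', Q'). E P' Q' $ j / h (P', Q')) y = u y * (rep_proj3 (deltaJ a b y) $ i / rep_proj3 (deltaJ a b y) $ n)" .
    qed
    ultimately show ?thesis unfolding associated_at_def by blast
  qed
  have rep_n: "deltaJ a b (P, Q) \<in> C \<and> (rep_proj3 (deltaJ a b (P, Q)) $ n \<noteq> 0 \<longleftrightarrow> bilift (\<lambda>p q. diffv j p q $ n) (P, Q) \<noteq> 0)"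
    if P: "P \<in> C" "Q \<in> C" and j: "bilift (\<lambda>p q. diffv j p q $ m) (P, Q) \<noteq> 0" for P Q j n m
  proof -
    have "diffv j (rep_proj3 P) (rep_proj3 Q) \<noteq> 0" using j by auto
    from deltaJ_sim[OF P this] show ?thesis unfolding sim_def by auto
  qed
  {
    fix x \<psi>
    assume x: "x \<in> C \<times> C" and "\<psi> \<in> (case x of (P, Q) \<Rightarrow> {(\<lambda>(P', Q'). E P' Q' $ j / h (P', Q')) |j h.
          rep_proj3 (addJ a b P Q) $ j \<noteq> 0 \<and> h \<in> biforms 2 2 \<and> h (P, Q) \<noteq> 0})"
    then obtain P Q j h where PQ: "x = (P, Q)" "P \<in> C" "Q \<in> C" and
      \<psi>: "\<psi> = (\<lambda>(P', Q'). E P' Q' $ j / h (P', Q'))" "rep_proj3 (addJ a b P Q) $ j \<noteq> 0" "h \<in> biforms 2 2" "h (P, Q) \<noteq> 0" by auto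
    obtain n where n: "bilift (\<lambda>p q. diffv j p q $ n) (P, Q) \<noteq> 0" using key[OF PQ(2,3) \<psi>(2)] by blast
    have d: "deltaJ a b x \<in> C" "rep_proj3 (deltaJ a b x) $ n \<noteq> 0" using rep_n[OF PQ(2,3) n, of n] n by (simp_all add: PQ)
    define \<phi> where "\<phi> R = rep_proj3 R $ i / rep_proj3 R $ n" for R :: "'k proj3"
    have "\<phi> = (\<lambda>R. rep_proj3 R $ i / rep_proj3 R $ n)" by (simp add: \<phi>_def fun_eq_iff)
    then have "\<phi> \<in> {\<lambda>R. rep_proj3 R $ i / rep_proj3 R $ n |n. rep_proj3 (deltaJ a b x) $ n \<noteq> 0}"
      using d(2) by blast
    then have "\<phi> \<in> coord_divisor a b i (deltaJ a b x)"
      unfolding coord_divisor_def cartier_def using d(1) S3.associated_at_refl by blast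
    moreover have "associated_at (C \<times> C) forms33 x \<psi> (\<phi> \<circ> deltaJ a b)"
      using assoc[OF PQ(2,3) n \<psi>(3,4)] by (simp add: PQ \<psi>(1) \<phi>_def comp_def)
    ultimately show "\<exists>\<psi>'\<in>{\<phi> \<circ> deltaJ a b |\<phi>. \<phi> \<in> coord_divisor a b i (deltaJ a b x)}. associated_at (C \<times> C) forms33 x \<psi> \<psi>'" by blast
  next
    fix x \<psi>
    assume x: "x \<in> C \<times> C" and "\<psi> \<in> {\<phi> \<circ> deltaJ a b |\<phi>. \<phi> \<in> coord_divisor a b i (deltaJ a b x)}"
    then obtain \<phi> where \<phi>: "\<psi> = \<phi> \<circ> deltaJ a b" "\<phi> \<in> coord_divisor a b i (deltaJ a b x)" by blast
    obtain P Q where PQ: "x = (P, Q)" "P \<in> C" "Q \<in> C" using x by blast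
    obtain n where n: "rep_proj3 (deltaJ a b x) $ n \<noteq> 0"
      "associated_at C forms3 (deltaJ a b x) \<phi> (\<lambda>R. rep_proj3 R $ i / rep_proj3 R $ n)"
      using \<phi>(2) unfolding coord_divisor_def cartier_def by auto
    obtain j where j: "rep_proj3 (addJ a b P Q) $ j \<noteq> 0"
      using addJ_in_C[OF PQ(2,3)] rep_in_J J_two_nonzero(1) by blast
    obtain m where "bilift (\<lambda>p q. diffv j p q $ m) (P, Q) \<noteq> 0" using key[OF PQ(2,3) j] by blast
    then have jn: "bilift (\<lambda>p q. diffv j p q $ n) (P, Q) \<noteq> 0" using rep_n[OF PQ(2,3), of j m n] n(1) by (simp add: PQ)
    obtain k where k: "rep_proj3 P $ k \<noteq> 0" using PQ rep_in_J J_two_nonzero(1) by blast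
    obtain l where l: "rep_proj3 Q $ l \<noteq> 0" using PQ rep_in_J J_two_nonzero(1) by blast
    have "bform 2 2 (\<lambda>x y. (x $ k)^2 * (y $ l)^2 :: 'k)"
      by (rule bform_mult[OF bform_power[OF bform_var1 refl refl] bform_power[OF bform_var2 refl refl]]) simp_all
    then have h: "bilift (\<lambda>x y. (x $ k)^2 * (y $ l)^2) \<in> biforms 2 2" by (rule bilift_in)
    have h0: "bilift (\<lambda>x y. (x $ k)^2 * (y $ l)^2) (P, Q) \<noteq> 0" using k l by simp
    obtain u where u: "unit_at C forms3 (deltaJ a b x) u" "near C forms3 (deltaJ a b x) (\<lambda>R. \<phi> R = u R * (rep_proj3 R $ i / rep_proj3 R $ n))"
      using n(2) unfolding associated_at_def by blast
    have "associated_at (C \<times> C) forms33 x \<psi> (\<lambda>y. rep_proj3 (deltaJ a b y) $ i / rep_proj3 (deltaJ a b y) $ n)"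
      unfolding associated_at_def \<phi>(1) comp_def
      using unit_delta[OF x _ u(1)] near_delta[OF x _ u(2)] jn PQ(1) by blast
    moreover have "associated_at (C \<times> C) forms33 x (\<lambda>y. rep_proj3 (deltaJ a b y) $ i / rep_proj3 (deltaJ a b y) $ n)
      (\<lambda>(P', Q'). E P' Q' $ j / bilift (\<lambda>x y. (x $ k)^2 * (y $ l)^2) (P', Q'))"
      using S33.associated_at_sym[OF x] assoc[OF PQ(2,3) jn h h0] PQ(1) by blast
    ultimately have "associated_at (C \<times> C) forms33 x \<psi> (\<lambda>(P', Q'). E P' Q' $ j / bilift (\<lambda>x y. (x $ k)^2 * (y $ l)^2) (P', Q'))"
      by (rule S33.associated_at_trans)
    then show "\<exists>\<psi>'\<in>(case x of (P, Q) \<Rightarrow> {(\<lambda>(P', Q'). E P' Q' $ j / h (P', Q')) |j h.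
          rep_proj3 (addJ a b P Q) $ j \<noteq> 0 \<and> h \<in> biforms 2 2 \<and> h (P, Q) \<noteq> 0}). associated_at (C \<times> C) forms33 x \<psi> \<psi>'"
      using j h h0 unfolding PQ(1) prod.case
      by (intro bexI[of _ "\<lambda>(P', Q'). E P' Q' $ j / bilift (\<lambda>x y. (x $ k)^2 * (y $ l)^2) (P', Q')"] CollectI
        exI[of _ j] exI[of _ "bilift (\<lambda>x y. (x $ k)^2 * (y $ l)^2)"] conjI) simp_all
  }
qed

end

subsection \<open>Nonsingularity and uniqueness of normal forms\<close>

lemma rank_le_1:
  fixes A :: "'k::field ^ 4 ^ 3"
  assumes "\<And>i. \<exists>r. A $ i = r *s w" shows "rank A \<le> 1"
proof -
  have "rows A \<subseteq> vec.span {w}"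
  proof
    fix v assume "v \<in> rows A"
    then obtain i where "v = A $ i" by (auto simp: rows_def row_def vec_eq_iff)
    then obtain r where "v = r *s w" using assms by blast
    then show "v \<in> vec.span {w}" by (simp add: vec.span_base vec.span_scale)
  qed
  then have "vec.dim (rows A) \<le> card {w}" by (intro vec.dim_le_card) auto
  then show ?thesis by (simp add: row_rank_def_gen)
qed

lemma all_3: "(\<forall>i::3. P i) \<longleftrightarrow> P 0 \<and> P 1 \<and> P 2"
proof -
  have "(3::3) = 0" by simp
  then have "P (3::3) \<longleftrightarrow> P 0" by (rule arg_cong)
  then show ?thesis unfolding forall_3 by blast
qed

text \<open>If a, b or c is zero, there is a point with two vanishing coordinates at which all rows
  of the Jacobian matrix are multiples of one vector. The scalar t appears because the chosen
  coordinate vector of a point is known only up to scaling.\<close>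

lemma nonsingularJ_imp:
  fixes a b :: "'k::alg_closed_field"
  assumes "nonsingularJ a b"
  shows "a \<noteq> 0 \<and> b \<noteq> 0 \<and> - a - b \<noteq> 0"
proof -
  have sq: "\<exists>y::'k. y^2 = x" for x by (metis nth_root_exists zero_less_numeral)
  have sc: "k * (t * x)^2 + (t * y)^2 = (t * z)^2" if "k * x^2 + y^2 = z^2" for k t x y z :: 'k
  proof -
    have "t^2 * (k * x^2 + y^2) = t^2 * z^2" using that by simp
    then show ?thesis by (simp add: power_mult_distrib algebra_simps)
  qed
  have no: "\<not> (\<forall>i. \<exists>r. jacobianJ a b (t *s v) $ i = r *s w)" if "v \<noteq> 0" "on_cone a b v" "rep_proj3 (abs_proj3 v) = t *s v" for v w t
  proof
    assume "\<forall>i. \<exists>r. jacobianJ a b (t *s v) $ i = r *s w"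
    then have "rank (jacobianJ a b (rep_proj3 (abs_proj3 v))) \<le> 1" unfolding that(3) using rank_le_1 by blast
    moreover have "abs_proj3 v \<in> curveJ a b"
      using that(2) by (simp add: curveJ_def on_cone_def Let_def that(3) sc)
    ultimately show False using assms unfolding nonsingularJ_def by fastforce
  qed
  have rep: "\<exists>t. rep_proj3 (abs_proj3 v) = t *s v" if "v \<noteq> 0" for v :: "'k^4"
  proof -
    have "abs_proj3 v = abs_proj3 (rep_proj3 (abs_proj3 v))" by (simp add: abs_rep_proj3)
    then show ?thesis using that
      by (subst (asm) abs_proj3_eq_iff) (auto simp: proportional_def rep_proj3_nonzero)
  qed
  have no': "\<not> (\<forall>i t. \<exists>r. jacobianJ a b (t *s v) $ i = r *s w)" if "v \<noteq> 0" "on_cone a b v" for v w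
    using no[OF that] rep[OF that(1)] by metis
  have z: "(0::3) \<noteq> 1" "(0::3) \<noteq> 2" "(1::3) \<noteq> 0" "(2::3) \<noteq> 0" "(1::3) \<noteq> 2" "(2::3) \<noteq> 1" by simp_all
  have "a \<noteq> 0"
  proof
    assume a: "a = 0"
    obtain y where y: "y^2 = b" using sq by blast
    have "\<exists>r. jacobianJ a b (t *s quad 1 0 0 y) $ i = r *s quad b 0 0 (- y)" for i t
    proof -
      have "\<forall>i. \<exists>r. jacobianJ a b (t *s quad 1 0 0 y) $ i = r *s quad b 0 0 (- y)"
        unfolding all_3 jacobianJ_def Let_def
        by (intro conjI exI[of _ 0] exI[of _ "2 * t"] exI[of _ "- 2 * t"]) (simp_all add: a vec4_eq_iff z)
      then show ?thesis by blast
    qed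
    moreover have "quad 1 0 0 y \<noteq> 0" "on_cone a b (quad 1 0 0 y)" using y a by (simp_all add: vec4_eq_iff on_cone_def)
    ultimately show False using no' by blast
  qed
  moreover have "b \<noteq> 0"
  proof
    assume b: "b = 0"
    obtain y where y: "y^2 = - a" using sq by blast
    have "\<exists>r. jacobianJ a b (t *s quad 1 y 0 0) $ i = r *s quad a y 0 0" for i t
    proof -
      have "\<forall>i. \<exists>r. jacobianJ a b (t *s quad 1 y 0 0) $ i = r *s quad a y 0 0"
        unfolding all_3 jacobianJ_def Let_def
        by (intro conjI exI[of _ 0] exI[of _ "2 * t"] exI[of _ "- 2 * t"]) (simp_all add: b vec4_eq_iff z)
      then show ?thesis by blast
    qed
    moreover have "quad 1 y 0 0 \<noteq> 0" "on_cone a b (quad 1 y 0 0)" using y b by (simp_all add: vec4_eq_iff on_cone_def)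
    ultimately show False using no' by blast
  qed
  moreover have "- a - b \<noteq> 0"
  proof
    assume "- a - b = 0"
    then have b: "b = - a" by (metis diff_eq_diff_eq diff_self minus_diff_commute right_minus_eq)
    obtain y where y: "y^2 = a" using sq by blast
    have "\<exists>r. jacobianJ a b (t *s quad 1 0 y 0) $ i = r *s quad a 0 (- y) 0" for i t
    proof -
      have "\<forall>i. \<exists>r. jacobianJ a b (t *s quad 1 0 y 0) $ i = r *s quad a 0 (- y) 0"
        unfolding all_3 jacobianJ_def Let_def
        by (intro conjI exI[of _ 0] exI[of _ "2 * t"] exI[of _ "- 2 * t"]) (simp_all add: b vec4_eq_iff z)
      then show ?thesis by blast
    qed
    moreover have "quad 1 0 y 0 \<noteq> 0" "on_cone a b (quad 1 0 y 0)" using y b by (simp_all add: vec4_eq_iff on_cone_def)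
    ultimately show False using no' by blast
  qed
  ultimately show ?thesis by blast
qed

context jacobi_curve
begin

section \<open>Uniqueness of normal forms\<close>

lemma bin_coeffs_zero:
  fixes r :: "nat \<Rightarrow> 'k"
  assumes "\<And>s t. (\<Sum>i\<le>n. r i * s ^ (n - i) * t ^ i) = 0" "i \<le> n" shows "r i = 0"
proof -
  define P where "P = (\<Sum>i\<le>n. monom (r i) i)"
  have "poly P t = 0" for t using assms(1)[of 1 t] by (simp add: P_def poly_sum poly_monom)
  then have "{t. poly P t = 0} = UNIV" by simp
  then have "P = 0" using poly_roots_finite[of P] infinite_alg_closed by metis
  moreover have "coeff P i = r i" using assms(2) by (simp add: P_def coeff_sum)
  ultimately show ?thesis by simp
qed

text \<open>The sign changes of X_2 and X_3 separate the four summands. Multiplying each by its own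
  factor X_2, X_3 or X_2 X_3 gives the coefficients times \<open>q2\<close>, \<open>q3\<close> or
  \<open>q2 q3\<close>, which are then cancelled.\<close>

lemma dec_unique:
  assumes b: "bin (d + 2) al" "bin (d + 1) be" "bin (d + 1) ga" "bin d ep"
    and z: "\<And>x. x \<in> J \<Longrightarrow> al (x$0) (x$1) + be (x$0) (x$1) * x$2 + ga (x$0) (x$1) * x$3 + ep (x$0) (x$1) * (x$2 * x$3) = 0"
  shows "al s t = 0" "be s t = 0" "ga s t = 0" "ep s t = 0"
proof -
  have core: "al s t = 0 \<and> be s t * y = 0 \<and> ga s t * w = 0 \<and> ep s t * (y * w) = 0"
    if x: "s \<noteq> 0 \<or> t \<noteq> 0" and y: "y^2 = q2 s t" "w^2 = q3 s t" for s t y w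
  proof -
    have J: "quad s t y' w' \<in> J" if "y'^2 = q2 s t" "w'^2 = q3 s t" for y' w'
      using x that by (auto simp: J_iff vec4_eq_iff q2_def q3_def)
    have e: "(al s t + ga s t * w) + (be s t * y + ep s t * (y * w)) = 0"
      "(al s t + ga s t * w) - (be s t * y + ep s t * (y * w)) = 0"
      "(al s t - ga s t * w) + (be s t * y - ep s t * (y * w)) = 0"
      "(al s t - ga s t * w) - (be s t * y - ep s t * (y * w)) = 0"
      by (rule trans[OF _ z[OF J[of y w]]] trans[OF _ z[OF J[of "- y" w]]] trans[OF _ z[OF J[of y "- w"]]]
        trans[OF _ z[OF J[of "- y" "- w"]]], use y in \<open>simp_all add: algebra_simps\<close>; fail)+
    show ?thesis using pm_zero[OF e(1,2)] pm_zero[OF e(3,4)] pm_zero by blast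
  qed
  have all: "al s t = 0 \<and> q2 s t * be s t = 0 \<and> q3 s t * ga s t = 0 \<and> (q2 s t * q3 s t) * ep s t = 0"
    if x: "s \<noteq> 0 \<or> t \<noteq> 0" for s t
  proof -
    obtain y w where y: "y^2 = q2 s t" "w^2 = q3 s t" using sqrt_exists by metis
    from core[OF x this] show ?thesis unfolding y[symmetric] by auto
  qed
  have one: "bin 0 (\<lambda>_ _. 1 :: 'k)" "bin 1 (\<lambda>s t. s :: 'k)" by (rule bin_const, rule bin_fst)
  have q: "q2 0 1 \<noteq> 0" "q3 0 1 \<noteq> 0" by (simp_all add: q2_def q3_def)
  have kill: "f s t = 0" if f: "bin e f" and h: "bin m h" "h s0 t0 \<noteq> 0" and z: "\<And>s t. s \<noteq> 0 \<or> t \<noteq> 0 \<Longrightarrow> h s t * f s t = 0" for f h :: "'k \<Rightarrow> 'k \<Rightarrow> 'k" and e m s0 t0 s t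
  proof -
    \<comment> \<open>The extra factor s removes the pair s = t = 0, which no point of the cone lies
      over.\<close>
    have sh: "bin (1 + m) (\<lambda>s t. s * h s t)" by (rule bin_mult[OF bin_fst h(1) refl])
    obtain t1 where "1 * h 1 t1 \<noteq> 0" using bin_mult_nonzero[OF h h] by auto
    from bin_cancel[OF sh this f] show ?thesis using z by (metis mult_eq_0_iff mult.assoc)
  qed
  show "al s t = 0" by (rule kill[OF b(1) bin_const[of 1]]) (use all in auto)
  show "be s t = 0" by (rule kill[OF b(2) bin_q2 q(1)]) (use all in auto)
  show "ga s t = 0" by (rule kill[OF b(3) bin_q3 q(2)]) (use all in auto)
  show "ep s t = 0"
  proof (rule kill[OF b(4) bin_mult[OF bin_q2 bin_q3 refl]])
    show "q2 0 1 * q3 0 1 \<noteq> 0" using q by simp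
  qed (use all in auto)
qed

text \<open>Linear independence of the 5 + 4 + 4 + 3 products in the normal form of a quartic.
  Restricting a biquadratic form to the graph of a reflection gives such a quartic.\<close>

lemma quartic_coeffs_zero:
  assumes z: "\<And>x. x \<in> J \<Longrightarrow> (a0 * (x$0)^4 + a1 * ((x$0)^3 * x$1) + a2 * ((x$0)^2 * (x$1)^2) + a3 * (x$0 * (x$1)^3) + a4 * (x$1)^4)
    + (b0 * (x$0)^3 + b1 * ((x$0)^2 * x$1) + b2 * (x$0 * (x$1)^2) + b3 * (x$1)^3) * x$2
    + (c0 * (x$0)^3 + c1 * ((x$0)^2 * x$1) + c2 * (x$0 * (x$1)^2) + c3 * (x$1)^3) * x$3
    + (d0 * (x$0)^2 + d1 * (x$0 * x$1) + d2 * (x$1)^2) * (x$2 * x$3) = 0"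
  shows "a0 = 0 \<and> a1 = 0 \<and> a2 = 0 \<and> a3 = 0 \<and> a4 = 0 \<and> b0 = 0 \<and> b1 = 0 \<and> b2 = 0 \<and> b3 = 0
    \<and> c0 = 0 \<and> c1 = 0 \<and> c2 = 0 \<and> c3 = 0 \<and> d0 = 0 \<and> d1 = 0 \<and> d2 = 0"
proof -
  have m: "bin k (\<lambda>s t. s ^ i * t ^ j :: 'k)" if "i + j = k" for i j k
    by (rule bin_mult[OF bin_power[OF bin_fst refl] bin_power[OF bin_snd refl]]) (use that in simp)
  have s: "bin n (\<lambda>s t. \<Sum>i\<le>n. r i * s ^ (n - i) * t ^ i)" for n and r :: "nat \<Rightarrow> 'k"
  proof -
    have "bin n (\<lambda>s t. \<Sum>i\<in>I. r i * s ^ (n - i) * t ^ i)" if "I \<subseteq> {..n}" "finite I" for I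
      using that(2,1)
    proof (induction I)
      case empty
      then show ?case using bin_zero by simp
    next
      case (insert i I)
      have "bin n (\<lambda>s t. r i * s ^ (n - i) * t ^ i)" using bin_scale[OF m[of "n - i" i n], of "r i"] insert.prems by (simp add: mult.assoc)
      then show ?case using insert bin_add by simp
    qed
    then show ?thesis by simp
  qed
  define A where "A = nth [a0, a1, a2, a3, a4]"
  define B where "B = nth [b0, b1, b2, b3]"
  define Cc where "Cc = nth [c0, c1, c2, c3]"
  define D where "D = nth [d0, d1, d2]"
  let ?f = "\<lambda>n r s t. (\<Sum>i\<le>n. r i * s ^ (n - i) * t ^ i) :: 'k"
  have z': "?f 4 A (x$0) (x$1) + ?f 3 B (x$0) (x$1) * x$2 + ?f 3 Cc (x$0) (x$1) * x$3 + ?f 2 D (x$0) (x$1) * (x$2 * x$3) = 0"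
    if "x \<in> J" for x
    using z[OF that] by (simp add: A_def B_def Cc_def D_def eval_nat_numeral sum.atMost_Suc algebra_simps)
  have fz: "?f 4 A s t = 0" "?f 3 B s t = 0" "?f 3 Cc s t = 0" "?f 2 D s t = 0" for s t
    by (rule dec_unique[of 2 "?f 4 A" "?f 3 B" "?f 3 Cc" "?f 2 D", OF _ _ _ _ z']; use s[of 4 A] s[of 3 B] s[of 3 Cc] s[of 2 D] in simp)+
  have "A i = 0" if "i \<le> 4" for i using bin_coeffs_zero[OF fz(1) that] .
  from this[of 0] this[of 1] this[of 2] this[of 3] this[of 4]
  have 1: "a0 = 0 \<and> a1 = 0 \<and> a2 = 0 \<and> a3 = 0 \<and> a4 = 0" by (simp add: A_def)
  have "B i = 0" if "i \<le> 3" for i using bin_coeffs_zero[OF fz(2) that] .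
  from this[of 0] this[of 1] this[of 2] this[of 3]
  have 2: "b0 = 0 \<and> b1 = 0 \<and> b2 = 0 \<and> b3 = 0" by (simp add: B_def)
  have "Cc i = 0" if "i \<le> 3" for i using bin_coeffs_zero[OF fz(3) that] .
  from this[of 0] this[of 1] this[of 2] this[of 3]
  have 3: "c0 = 0 \<and> c1 = 0 \<and> c2 = 0 \<and> c3 = 0" by (simp add: Cc_def)
  have "D i = 0" if "i \<le> 2" for i using bin_coeffs_zero[OF fz(4) that] .
  from this[of 0] this[of 1] this[of 2]
  have "d0 = 0 \<and> d1 = 0 \<and> d2 = 0" by (simp add: D_def)
  with 1 2 3 show ?thesis by blast
qed

end

subsection \<open>The space of addition laws\<close>

lemma mconst_simps:
  "mconst (0 :: 'a::comm_ring_1) = 0" "mconst (1 :: 'a) = 1" "mconst (r + s :: 'a) = mconst r + mconst s"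
  "mconst (r * s :: 'a) = mconst r * mconst s" "mconst (- r :: 'a) = - mconst r" "mconst (r - s :: 'a) = mconst r - mconst s"
  by (simp_all add: mconst_def single_add mult_single single_uminus single_diff)

lemma bihomogeneous_weight: "bihomogeneous d e p \<longleftrightarrow> (\<forall>m\<in>Poly_Mapping.keys p. weight biweight m = (d, e))"
  unfolding bihomogeneous_def weight_biweight by simp

lemma bihomogeneous_zero: "bihomogeneous d e 0"
  by (simp add: bihomogeneous_def)

lemma bihomogeneous_add: "bihomogeneous d e p \<Longrightarrow> bihomogeneous d e q \<Longrightarrow> bihomogeneous d e (p + q)"
  unfolding bihomogeneous_weight using keys_add[of p q] by blast

lemma bihomogeneous_mult:
  fixes p q :: "(4 + 4, 'a::comm_ring_1) mpol"
  assumes "bihomogeneous d e p" "bihomogeneous d' e' q" shows "bihomogeneous (d + d') (e + e') (p * q)"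
  unfolding bihomogeneous_weight
proof
  fix m assume "m \<in> Poly_Mapping.keys (p * q)"
  then obtain i j where "m = i + j" "i \<in> Poly_Mapping.keys p" "j \<in> Poly_Mapping.keys q"
    using keys_mult[of p q] by blast
  then show "weight biweight m = (d + d', e + e')" using assms unfolding bihomogeneous_weight by (simp add: weight_add)
qed

lemma bihomogeneous_mconst: "bihomogeneous 0 0 (mconst r)"
  by (simp add: bihomogeneous_def mconst_def)

lemma bihomogeneous_mvar: "bihomogeneous 1 0 (XX i)" "bihomogeneous 0 1 (YY i)"
  unfolding bihomogeneous_weight mvar_def by (auto simp: weight_single_1[unfolded One_nat_def] biweight_def split: if_splits)

lemma bihomogeneous_terms:
  "bihomogeneous 2 2 (mconst r * (XX i * XX j * (YY k * YY l)) + mconst r' * (XX i' * XX j' * (YY k' * YY l')))"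
proof -
  have "bihomogeneous (0 + ((1 + 1) + (0 + 0))) (0 + ((0 + 0) + (1 + 1))) (mconst r * (XX i * XX j * (YY k * YY l)))" for r :: 'a and i j k l
    by (intro bihomogeneous_mult bihomogeneous_mconst bihomogeneous_mvar)
  then have "bihomogeneous 2 2 (mconst r * (XX i * XX j * (YY k * YY l)))" for r :: 'a and i j k l
    by (simp add: numeral_2_eq_2)
  then show ?thesis by (intro bihomogeneous_add)
qed

lemma laws_bihomogeneous:
  "bihomogeneous 2 2 (law0 a b $ j)" "bihomogeneous 2 2 (law1 a b $ j)"
  "bihomogeneous 2 2 (law2 a b $ j)" "bihomogeneous 2 2 (law3 a b $ j)"
proof -
  have 00: "bihomogeneous 2 2 (law0 a b $ 0)"
    using bihomogeneous_terms[of "1" 0 0 1 1 "- 1" 1 1 0 0]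
    by (simp add: law0_def mconst_simps power2_eq_square algebra_simps)
  have 01: "bihomogeneous 2 2 (law0 a b $ 1)"
    using bihomogeneous_terms[of "1" 0 1 2 3 "- 1" 2 3 0 1]
    by (simp add: law0_def mconst_simps power2_eq_square algebra_simps)
  have 02: "bihomogeneous 2 2 (law0 a b $ 2)"
    using bihomogeneous_terms[of "1" 0 2 1 3 "- 1" 1 3 0 2]
    by (simp add: law0_def mconst_simps power2_eq_square algebra_simps)
  have 03: "bihomogeneous 2 2 (law0 a b $ 3)"
    using bihomogeneous_terms[of "1" 0 3 1 2 "- 1" 1 2 0 3]
    by (simp add: law0_def mconst_simps power2_eq_square algebra_simps)
  have 20: "bihomogeneous 2 2 (law2 a b $ 0)"
    using bihomogeneous_terms[of "1" 0 1 2 3 "1" 2 3 0 1]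
    by (simp add: law2_def mconst_simps power2_eq_square algebra_simps)
  have 21: "bihomogeneous 2 2 (law2 a b $ 1)"
    using bihomogeneous_terms[of "a * (- a - b)" 0 0 0 0 "1" 1 1 1 1]
    by (simp add: law2_def mconst_simps power2_eq_square algebra_simps)
  have 22: "bihomogeneous 2 2 (law2 a b $ 2)"
    using bihomogeneous_terms[of "a" 0 3 0 3 "1" 1 2 1 2]
    by (simp add: law2_def mconst_simps power2_eq_square algebra_simps)
  have 23: "bihomogeneous 2 2 (law2 a b $ 3)"
    using bihomogeneous_terms[of "- (- a - b)" 0 2 0 2 "1" 1 3 1 3]
    by (simp add: law2_def mconst_simps power2_eq_square algebra_simps)
  have 10: "bihomogeneous 2 2 (law1 a b $ 0)"
    using bihomogeneous_terms[of "1" 0 2 1 3 "1" 1 3 0 2]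
    by (simp add: law1_def mconst_simps power2_eq_square algebra_simps)
  have 11: "bihomogeneous 2 2 (law1 a b $ 1)"
    using bihomogeneous_terms[of "- a" 0 3 0 3 "1" 1 2 1 2]
    by (simp add: law1_def mconst_simps power2_eq_square algebra_simps)
  have 12: "bihomogeneous 2 2 (law1 a b $ 2)"
    using bihomogeneous_terms[of "a * b" 0 0 0 0 "1" 2 2 2 2]
    by (simp add: law1_def mconst_simps power2_eq_square algebra_simps)
  have 13: "bihomogeneous 2 2 (law1 a b $ 3)"
    using bihomogeneous_terms[of "b" 0 1 0 1 "1" 2 3 2 3]
    by (simp add: law1_def mconst_simps power2_eq_square algebra_simps)
  have 30: "bihomogeneous 2 2 (law3 a b $ 0)"
    using bihomogeneous_terms[of "a" 0 3 1 2 "a" 1 2 0 3]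
    by (simp add: law3_def mconst_simps power2_eq_square algebra_simps)
  have 31: "bihomogeneous 2 2 (law3 a b $ 1)"
    using bihomogeneous_terms[of "a * (- a - b)" 0 2 0 2 "a" 1 3 1 3]
    by (simp add: law3_def mconst_simps power2_eq_square algebra_simps)
  have 32: "bihomogeneous 2 2 (law3 a b $ 2)"
    using bihomogeneous_terms[of "- (a * b)" 0 1 0 1 "a" 2 3 2 3]
    by (simp add: law3_def mconst_simps power2_eq_square algebra_simps)
  have 33: "bihomogeneous 2 2 (law3 a b $ 3)"
    using bihomogeneous_terms[of "- b" 1 1 1 1 "- (- a - b)" 2 2 2 2]
    by (simp add: law3_def mconst_simps power2_eq_square algebra_simps)
  show "bihomogeneous 2 2 (law0 a b $ j)" using exhaust_0123[of j] 00 01 02 03 by blast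
  show "bihomogeneous 2 2 (law1 a b $ j)" using exhaust_0123[of j] 10 11 12 13 by blast
  show "bihomogeneous 2 2 (law2 a b $ j)" using exhaust_0123[of j] 20 21 22 23 by blast
  show "bihomogeneous 2 2 (law3 a b $ j)" using exhaust_0123[of j] 30 31 32 33 by blast
qed

interpretation tuples: Modules.module "scale_tuple :: 'a::field \<Rightarrow> 'a tuple \<Rightarrow> 'a tuple"
  by unfold_locales (simp_all add: scale_tuple_def vec_eq_iff mconst_simps algebra_simps)

lemma eval2_simps:
  "eval2 v w 0 = 0"
  "eval2 v w (p + q) = eval2 v w p + eval2 v w q" "eval2 v w (p * q) = eval2 v w p * eval2 v w q"
  "eval2 v w (mconst r) = to_ac r" "eval2 v w (XX i) = v $ i" "eval2 v w (YY i) = w $ i"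
  unfolding eval2_def by (simp_all add: mp_eval_add mp_eval_mult mp_eval_mconst mp_eval_mvar)

lemma eval2_uminus: "eval2 v w (- p) = - eval2 v w p"
  using eval2_simps(2)[of v w p "- p"] by (simp add: eval2_simps(1) eq_neg_iff_add_eq_0 add.commute)

lemma eval2_diff: "eval2 v w (p - q) = eval2 v w p - eval2 v w q"
  using eval2_simps(2)[of v w p "- q"] by (simp add: eval2_uminus)

lemma bform_eval2: "bihomogeneous d e p \<Longrightarrow> bform d e (\<lambda>v w. eval2 v w p)"
  unfolding eval2_def by (rule bform_mp_eval)

lemma bform_homogeneous:
  assumes "bform d e h" shows "h (r *s v) (s *s w) = r ^ d * (s ^ e * h v w)"
  using fform_homogeneous[OF bform_left[OF assms, of "s *s w"], of r v]
    fform_homogeneous[OF bform_right[OF assms, of v], of s w] by simp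

section \<open>Quadratic monomials, quadrics and their reflections\<close>

lemma prod_pow_step:
  fixes \<sigma> :: "4 \<Rightarrow> 'b::comm_ring_1"
  assumes "f i > (0::nat)"
  shows "(\<Prod>k\<in>UNIV. \<sigma> k ^ f k) = \<sigma> i * (\<Prod>k\<in>UNIV. \<sigma> k ^ (f(i := f i - 1)) k)"
proof -
  have "\<sigma> i ^ f i = \<sigma> i * \<sigma> i ^ (f i - 1)" using assms by (cases "f i") auto
  then show ?thesis by (simp add: prod.remove[of UNIV i] mult.assoc)
qed

lemma quadratic_monomial:
  fixes f :: "4 \<Rightarrow> nat"
  assumes "(\<Sum>k\<in>UNIV. f k) = 2"
  obtains i j where "\<And>\<sigma> :: 4 \<Rightarrow> 'b::comm_ring_1. (\<Prod>k\<in>UNIV. \<sigma> k ^ f k) = \<sigma> i * \<sigma> j"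
proof -
  have ex: "\<exists>i. g i > 0" if "(\<Sum>k\<in>UNIV. g k) \<noteq> 0" for g :: "4 \<Rightarrow> nat"
    using that by (meson not_gr_zero sum.neutral)
  have dec: "(\<Sum>k\<in>UNIV. (g(i := g i - 1)) k) = (\<Sum>k\<in>UNIV. g k) - 1" if "g i > 0" for g :: "4 \<Rightarrow> nat" and i
    using that by (simp add: sum.remove[of UNIV i])
  obtain i where i: "f i > 0" using ex[of f] assms by auto
  define g where "g = f(i := f i - 1)"
  have g1: "(\<Sum>k\<in>UNIV. g k) = 1" using dec[of f i] i assms by (simp add: g_def)
  obtain j where j: "g j > 0" using ex[of g] g1 by auto
  have "(\<Sum>k\<in>UNIV. (g(j := g j - 1)) k) = 0" using dec[of g j] j g1 by simp
  then have z: "(g(j := g j - 1)) k = 0" for k by (simp add: sum_eq_0_iff)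
  have "(\<Prod>k\<in>UNIV. \<sigma> k ^ f k) = \<sigma> i * \<sigma> j" for \<sigma> :: "4 \<Rightarrow> 'b"
  proof -
    have "(\<Prod>k\<in>UNIV. \<sigma> k ^ f k) = \<sigma> i * (\<Prod>k\<in>UNIV. \<sigma> k ^ g k)" unfolding g_def by (rule prod_pow_step[where f = f, OF i])
    also have "(\<Prod>k\<in>UNIV. \<sigma> k ^ g k) = \<sigma> j * (\<Prod>k\<in>UNIV. \<sigma> k ^ (g(j := g j - 1)) k)" by (rule prod_pow_step[where f = g, OF j])
    also have "(\<Prod>k\<in>UNIV. \<sigma> k ^ (g(j := g j - 1)) k) = 1" unfolding z by simp
    finally show ?thesis by simp
  qed
  then show ?thesis using that by blast
qed

lemma sum_8: "(\<Sum>i<8. f i) = f 0 + f 1 + f 2 + f 3 + f 4 + f 5 + f 6 + f (7::nat)"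
  by (simp add: eval_nat_numeral)

text \<open>A basis of the quadratic forms on the curve, ordered so that for \<open>i > 0\<close> each coordinate
  reflection changes the sign of exactly one of \<open>quadric v (2 * i)\<close> and \<open>quadric v (2 * i + 1)\<close>.\<close>

definition quadric :: "'k::comm_ring_1 ^ 4 \<Rightarrow> nat \<Rightarrow> 'k" where
  "quadric v = nth [(v$0)^2, (v$1)^2, v$0 * v$1, v$2 * v$3, v$0 * v$2, v$1 * v$3, v$0 * v$3, v$1 * v$2]"

lemma quadric_simps:
  "quadric v 0 = (v$0)^2" "quadric v 1 = (v$1)^2" "quadric v 2 = v$0 * v$1" "quadric v 3 = v$2 * v$3"
  "quadric v 4 = v$0 * v$2" "quadric v 5 = v$1 * v$3" "quadric v 6 = v$0 * v$3" "quadric v 7 = v$1 * v$2"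
  by (simp_all add: quadric_def)

context jacobi_curve
begin

lemma quadric_flip:
  fixes v :: "'k^4"
  assumes "j < 8"
  shows "quadric (flip 0 v) j = (if j \<in> {2, 4, 6} then - 1 else 1) * quadric v j"
    "quadric (flip 1 v) j = (if j \<in> {2, 5, 7} then - 1 else 1) * quadric v j"
    "quadric (flip 2 v) j = (if j \<in> {3, 4, 7} then - 1 else 1) * quadric v j"
    "quadric (flip 3 v) j = (if j \<in> {3, 5, 6} then - 1 else 1) * quadric v j"
proof -
  have j: "j = 0 \<or> j = 1 \<or> j = 2 \<or> j = 3 \<or> j = 4 \<or> j = 5 \<or> j = 6 \<or> j = 7" using assms by linarith
  show "quadric (flip 0 v) j = (if j \<in> {2, 4, 6} then - 1 else 1) * quadric v j"
    using j by (elim disjE; simp add: quadric_simps quadric_simps(2)[unfolded One_nat_def] flip_nth)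
  show "quadric (flip 1 v) j = (if j \<in> {2, 5, 7} then - 1 else 1) * quadric v j"
    using j by (elim disjE; simp add: quadric_simps quadric_simps(2)[unfolded One_nat_def] flip_nth)
  show "quadric (flip 2 v) j = (if j \<in> {3, 4, 7} then - 1 else 1) * quadric v j"
    using j by (elim disjE; simp add: quadric_simps quadric_simps(2)[unfolded One_nat_def] flip_nth)
  show "quadric (flip 3 v) j = (if j \<in> {3, 5, 6} then - 1 else 1) * quadric v j"
    using j by (elim disjE; simp add: quadric_simps quadric_simps(2)[unfolded One_nat_def] flip_nth)
qed

lemma four_nonzero: "(4::'k) \<noteq> 0"
proof -
  have "(4::'k) = 2 * 2" by simp
  then show ?thesis using two by (metis mult_eq_0_iff)
qed

text \<open>In terms of the four pair combinations the signs form a Hadamard matrix of order 4,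
  which is inverted up to the factor 4.\<close>

lemma opposite_sums_zero:
  fixes G :: "nat \<Rightarrow> 'k"
  assumes "G 0 + G 1 - G 2 + G 3 - G 4 + G 5 - G 6 + G 7 = 0" "G 0 + G 1 - G 2 + G 3 + G 4 - G 5 + G 6 - G 7 = 0"
    "G 0 + G 1 + G 2 - G 3 - G 4 + G 5 + G 6 - G 7 = 0" "G 0 + G 1 + G 2 - G 3 + G 4 - G 5 - G 6 + G 7 = 0"
  shows "G 0 + G 1 = 0" "G 2 - G 3 = 0" "G 4 - G 5 = 0" "G 6 - G 7 = 0"
proof -
  have "4 * (G 0 + G 1) = 0" "4 * (G 2 - G 3) = 0" "4 * (G 4 - G 5) = 0" "4 * (G 6 - G 7) = 0"
    using assms by Groebner_Basis.algebra+
  then show "G 0 + G 1 = 0" "G 2 - G 3 = 0" "G 4 - G 5 = 0" "G 6 - G 7 = 0"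
    using four_nonzero by (metis mult_eq_0_iff)+
qed

text \<open>Each reflection changes the signs of half of the quadrics, so the four equations combine into
  four relations among the products of two quadrics, whose coefficients are compared.\<close>

lemma form_vanishing_on_reflections:
  fixes c' :: "nat \<Rightarrow> nat \<Rightarrow> 'k"
  assumes z: "\<And>v k. v \<in> J \<Longrightarrow> (\<Sum>i<8. \<Sum>j<8. c' i j * quadric v i * quadric (flip k v) j) = 0"
  shows "(\<Sum>i<8. \<Sum>j<8. c' i j * quadric v i * quadric w j) =
    c' 0 1 * sm 0 v w $ 0 + c' 2 3 * sm 1 v w $ 0 + c' 4 5 * sm 2 v w $ 0 + c' 6 7 * sm 3 v w $ 0"
proof -
  \<comment> \<open>The part of the sum whose second factor is \<open>quadric x j\<close>;
    reflecting the second argument changes at most its sign.\<close>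
  define G where "G = (\<lambda>x j. (\<Sum>i<8. c' i j * quadric x i) * quadric x j)"
  have swap: "(\<Sum>i<8. \<Sum>j<8. c' i j * quadric x i * quadric y j) = (\<Sum>j<8. (\<Sum>i<8. c' i j * quadric x i) * quadric y j)" for x y :: "'k^4"
    by (subst sum.swap) (simp add: sum_distrib_right)
  have zG: "(\<Sum>j<8. (\<Sum>i<8. c' i j * quadric x i) * quadric (flip k x) j) = 0" if "x \<in> J" for x k
    using z[OF that, of k] unfolding swap .
  have G: "G x 0 + G x 1 = 0" "G x 2 - G x 3 = 0" "G x 4 - G x 5 = 0" "G x 6 - G x 7 = 0" if x: "x \<in> J" for x
  proof -
    define F where "F = (\<lambda>j. \<Sum>i<8. c' i j * quadric x i)"
    have GF: "G x = (\<lambda>j. F j * quadric x j)" by (simp add: G_def F_def fun_eq_iff)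
    have E: "(\<Sum>j<8. F j * quadric (flip k x) j) = 0" for k using zG[OF x, of k] unfolding F_def .
    have "G x 0 + G x 1 - G x 2 + G x 3 - G x 4 + G x 5 - G x 6 + G x 7 = 0"
      using E[of 0] unfolding GF sum_8 by (simp add: quadric_flip)
    moreover have "G x 0 + G x 1 - G x 2 + G x 3 + G x 4 - G x 5 + G x 6 - G x 7 = 0"
      using E[of 1] unfolding GF sum_8 by (simp add: quadric_flip)
    moreover have "G x 0 + G x 1 + G x 2 - G x 3 - G x 4 + G x 5 + G x 6 - G x 7 = 0"
      using E[of 2] unfolding GF sum_8 by (simp add: quadric_flip)
    moreover have "G x 0 + G x 1 + G x 2 - G x 3 + G x 4 - G x 5 - G x 6 + G x 7 = 0"
      using E[of 3] unfolding GF sum_8 by (simp add: quadric_flip)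
    ultimately show "G x 0 + G x 1 = 0" "G x 2 - G x 3 = 0" "G x 4 - G x 5 = 0" "G x 6 - G x 7 = 0"
      by (rule opposite_sums_zero)+
  qed
  note Gx = G_def sum_8 quadric_simps
  \<comment> \<open>Each relation is expanded in the sixteen quartic products of the normal form.
    The entry \<open>0 = 0\<close> stands for X_0 X_1 X_2 X_3, which does not occur in this
    relation.\<close>
  have a: "c' 0 0 = 0 \<and> c' 2 0 = 0 \<and> c' 1 0 + c' 0 1 = 0 \<and> c' 2 1 = 0 \<and> c' 1 1 = 0 \<and>
      c' 4 0 = 0 \<and> c' 7 0 = 0 \<and> c' 4 1 = 0 \<and> c' 7 1 = 0 \<and>
      c' 6 0 = 0 \<and> c' 5 0 = 0 \<and> c' 6 1 = 0 \<and> c' 5 1 = 0 \<and> c' 3 0 = 0 \<and> 0 = (0::'k) \<and> c' 3 1 = 0"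
  proof (rule quartic_coeffs_zero)
    fix x assume x: "x \<in> J"
    show "(c' 0 0 * (x$0)^4 + c' 2 0 * ((x$0)^3 * x$1) + (c' 1 0 + c' 0 1) * ((x$0)^2 * (x$1)^2) + c' 2 1 * (x$0 * (x$1)^3) + c' 1 1 * (x$1)^4)
      + (c' 4 0 * (x$0)^3 + c' 7 0 * ((x$0)^2 * x$1) + c' 4 1 * (x$0 * (x$1)^2) + c' 7 1 * (x$1)^3) * x$2
      + (c' 6 0 * (x$0)^3 + c' 5 0 * ((x$0)^2 * x$1) + c' 6 1 * (x$0 * (x$1)^2) + c' 5 1 * (x$1)^3) * x$3
      + (c' 3 0 * (x$0)^2 + 0 * (x$0 * x$1) + c' 3 1 * (x$1)^2) * (x$2 * x$3) = 0"
      using G(1)[OF x] unfolding Gx by Groebner_Basis.algebra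
  qed
  have b: "a * c * c' 3 3 = 0 \<and> c' 0 2 = 0 \<and> c' 2 2 - (a - c) * c' 3 3 = 0 \<and> c' 1 2 = 0 \<and> - c' 3 3 = 0 \<and>
      c * c' 6 3 = 0 \<and> c' 4 2 + c * c' 5 3 = 0 \<and> c' 7 2 - c' 6 3 = 0 \<and> - c' 5 3 = 0 \<and>
      - (a * c' 4 3) = 0 \<and> c' 6 2 - a * c' 7 3 = 0 \<and> c' 5 2 - c' 4 3 = 0 \<and> - c' 7 3 = 0 \<and>
      - c' 0 3 = 0 \<and> c' 3 2 - c' 2 3 = 0 \<and> - c' 1 3 = 0"
  proof (rule quartic_coeffs_zero)
    fix x assume x: "x \<in> J"
    show "(a * c * c' 3 3 * (x$0)^4 + c' 0 2 * ((x$0)^3 * x$1) + (c' 2 2 - (a - c) * c' 3 3) * ((x$0)^2 * (x$1)^2) + c' 1 2 * (x$0 * (x$1)^3) + - c' 3 3 * (x$1)^4)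
      + (c * c' 6 3 * (x$0)^3 + (c' 4 2 + c * c' 5 3) * ((x$0)^2 * x$1) + (c' 7 2 - c' 6 3) * (x$0 * (x$1)^2) + - c' 5 3 * (x$1)^3) * x$2
      + (- (a * c' 4 3) * (x$0)^3 + (c' 6 2 - a * c' 7 3) * ((x$0)^2 * x$1) + (c' 5 2 - c' 4 3) * (x$0 * (x$1)^2) + - c' 7 3 * (x$1)^3) * x$3
      + (- c' 0 3 * (x$0)^2 + (c' 3 2 - c' 2 3) * (x$0 * x$1) + - c' 1 3 * (x$1)^2) * (x$2 * x$3) = 0"
      using G(2)[OF x] J_eqs[OF x] unfolding Gx by Groebner_Basis.algebra
  qed
  have c: "a * c' 4 4 = 0 \<and> a * c' 7 4 + c * c' 6 5 = 0 \<and> c' 4 4 + c * c' 5 5 = 0 \<and> c' 7 4 - c' 6 5 = 0 \<and> - c' 5 5 = 0 \<and>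
      c' 0 4 = 0 \<and> c' 2 4 + c * c' 3 5 = 0 \<and> c' 1 4 = 0 \<and> - c' 3 5 = 0 \<and>
      a * c' 3 4 = 0 \<and> - c' 0 5 = 0 \<and> c' 3 4 - c' 2 5 = 0 \<and> - c' 1 5 = 0 \<and>
      c' 6 4 = 0 \<and> c' 5 4 - c' 4 5 = 0 \<and> - c' 7 5 = 0"
  proof (rule quartic_coeffs_zero)
    fix x assume x: "x \<in> J"
    show "(a * c' 4 4 * (x$0)^4 + (a * c' 7 4 + c * c' 6 5) * ((x$0)^3 * x$1) + (c' 4 4 + c * c' 5 5) * ((x$0)^2 * (x$1)^2) + (c' 7 4 - c' 6 5) * (x$0 * (x$1)^3) + - c' 5 5 * (x$1)^4)
      + (c' 0 4 * (x$0)^3 + (c' 2 4 + c * c' 3 5) * ((x$0)^2 * x$1) + c' 1 4 * (x$0 * (x$1)^2) + - c' 3 5 * (x$1)^3) * x$2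
      + (a * c' 3 4 * (x$0)^3 + - c' 0 5 * ((x$0)^2 * x$1) + (c' 3 4 - c' 2 5) * (x$0 * (x$1)^2) + - c' 1 5 * (x$1)^3) * x$3
      + (c' 6 4 * (x$0)^2 + (c' 5 4 - c' 4 5) * (x$0 * x$1) + - c' 7 5 * (x$1)^2) * (x$2 * x$3) = 0"
      using G(3)[OF x] J_eqs[OF x] unfolding Gx by Groebner_Basis.algebra
  qed
  have d: "- (c * c' 6 6) = 0 \<and> - (c * c' 5 6) - a * c' 4 7 = 0 \<and> c' 6 6 - a * c' 7 7 = 0 \<and> c' 5 6 - c' 4 7 = 0 \<and> - c' 7 7 = 0 \<and>
      - (c * c' 3 6) = 0 \<and> - c' 0 7 = 0 \<and> c' 3 6 - c' 2 7 = 0 \<and> - c' 1 7 = 0 \<and>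
      c' 0 6 = 0 \<and> c' 2 6 - a * c' 3 7 = 0 \<and> c' 1 6 = 0 \<and> - c' 3 7 = 0 \<and>
      c' 4 6 = 0 \<and> c' 7 6 - c' 6 7 = 0 \<and> - c' 5 7 = 0"
  proof (rule quartic_coeffs_zero)
    fix x assume x: "x \<in> J"
    show "(- (c * c' 6 6) * (x$0)^4 + (- (c * c' 5 6) - a * c' 4 7) * ((x$0)^3 * x$1) + (c' 6 6 - a * c' 7 7) * ((x$0)^2 * (x$1)^2) + (c' 5 6 - c' 4 7) * (x$0 * (x$1)^3) + - c' 7 7 * (x$1)^4)
      + (- (c * c' 3 6) * (x$0)^3 + - c' 0 7 * ((x$0)^2 * x$1) + (c' 3 6 - c' 2 7) * (x$0 * (x$1)^2) + - c' 1 7 * (x$1)^3) * x$2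
      + (c' 0 6 * (x$0)^3 + (c' 2 6 - a * c' 3 7) * ((x$0)^2 * x$1) + c' 1 6 * (x$0 * (x$1)^2) + - c' 3 7 * (x$1)^3) * x$3
      + (c' 4 6 * (x$0)^2 + (c' 7 6 - c' 6 7) * (x$0 * x$1) + - c' 5 7 * (x$1)^2) * (x$2 * x$3) = 0"
      using G(4)[OF x] J_eqs[OF x] unfolding Gx by Groebner_Basis.algebra
  qed
  \<comment> \<open>The coefficients with indices (6,5), (7,4) and those with (4,7), (5,6) satisfy
    two equations each; with a + c = - b these combine to b times one of them being zero.\<close>
  have bz: "b * y = 0 \<Longrightarrow> y = 0" for y using b0 by simp
  have "c' 7 4 = c' 6 5" "a * c' 7 4 + c * c' 6 5 = 0" using c by auto
  then have "b * c' 6 5 = 0" unfolding c_def by (simp add: algebra_simps)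
  then have c65: "c' 6 5 = 0" "c' 7 4 = 0" using bz[of "c' 6 5"] \<open>c' 7 4 = c' 6 5\<close> by simp_all
  have "c' 5 6 = c' 4 7" "- (c * c' 5 6) - a * c' 4 7 = 0" using d by auto
  then have "b * c' 4 7 = 0" unfolding c_def by (simp add: algebra_simps)
  then have c47: "c' 4 7 = 0" "c' 5 6 = 0" using bz[of "c' 4 7"] \<open>c' 5 6 = c' 4 7\<close> by simp_all
  \<comment> \<open>The surviving coefficients come in four pairs, whose relative signs are those of
    the two terms in each entry of the first column.\<close>
  have z1: "c' 1 0 = - c' 0 1" "c' 3 2 = c' 2 3" "c' 5 4 = c' 4 5" "c' 7 6 = c' 6 7"
    using a b c d by (auto simp: eq_neg_iff_add_eq_0)
  have za: "c' 0 0 = 0" "c' 2 0 = 0" "c' 2 1 = 0" "c' 1 1 = 0" "c' 4 0 = 0" "c' 7 0 = 0" "c' 4 1 = 0" "c' 7 1 = 0"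
      "c' 6 0 = 0" "c' 5 0 = 0" "c' 6 1 = 0" "c' 5 1 = 0" "c' 3 0 = 0" "c' 3 1 = 0" using a by auto
  have zb: "c' 3 3 = 0" "c' 0 2 = 0" "c' 2 2 = 0" "c' 1 2 = 0" "c' 6 3 = 0" "c' 4 2 = 0" "c' 7 2 = 0" "c' 5 3 = 0"
      "c' 4 3 = 0" "c' 6 2 = 0" "c' 5 2 = 0" "c' 7 3 = 0" "c' 0 3 = 0" "c' 1 3 = 0" using b a0 c0 by auto
  have zc: "c' 4 4 = 0" "c' 5 5 = 0" "c' 0 4 = 0" "c' 2 4 = 0" "c' 1 4 = 0" "c' 3 5 = 0" "c' 3 4 = 0" "c' 0 5 = 0"
      "c' 2 5 = 0" "c' 1 5 = 0" "c' 6 4 = 0" "c' 7 5 = 0" using c a0 by auto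
  have zd: "c' 6 6 = 0" "c' 7 7 = 0" "c' 3 6 = 0" "c' 0 7 = 0" "c' 2 7 = 0" "c' 1 7 = 0" "c' 0 6 = 0" "c' 2 6 = 0"
      "c' 1 6 = 0" "c' 3 7 = 0" "c' 4 6 = 0" "c' 5 7 = 0" using d c0 by auto
  show ?thesis
    unfolding sum_8 quadric_simps sm_simps za zb zc zd z1 c65 c47 by (simp add: algebra_simps)
qed

end

text \<open>The reduction of a product of coordinates to the eight quadrics involves only 0, 1, a
  and a + b as coefficients, so these lie in the base field although the vectors do not.\<close>

lemma quadric_coefficients:
  fixes a b :: "'a::field"
  shows "\<exists>\<alpha>. \<forall>v :: 'a alg_closure ^ 4. on_cone (to_ac a) (to_ac b) v \<longrightarrow> v $ i * v $ j = (\<Sum>n<8. to_ac (\<alpha> n) * quadric v n)"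
proof -
  define Q where "Q = (\<lambda>i j. \<exists>\<alpha>. \<forall>v :: 'a alg_closure ^ 4. on_cone (to_ac a) (to_ac b) v \<longrightarrow>
    v $ i * v $ j = (\<Sum>n<8. to_ac (\<alpha> n :: 'a) * quadric v n))"
  have Qc: "Q j i" if "Q i j" for i j using that unfolding Q_def by (simp add: mult.commute)
  have I: "Q i j" if "\<And>v :: 'a alg_closure ^ 4. on_cone (to_ac a) (to_ac b) v \<Longrightarrow> v $ i * v $ j = (\<Sum>n<8. to_ac (\<alpha> n) * quadric v n)" for i j \<alpha>
    using that unfolding Q_def by blast
  have 00: "Q 0 0" by (rule I[of _ _ "nth [1,0,0,0,0,0,0,0]"]) (simp add: sum_8 quadric_simps quadric_simps(2)[unfolded One_nat_def] power2_eq_square)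
  have 11: "Q 1 1" by (rule I[of _ _ "nth [0,1,0,0,0,0,0,0]"]) (simp add: sum_8 quadric_simps quadric_simps(2)[unfolded One_nat_def] power2_eq_square)
  have 01: "Q 0 1" by (rule I[of _ _ "nth [0,0,1,0,0,0,0,0]"]) (simp add: sum_8 quadric_simps quadric_simps(2)[unfolded One_nat_def])
  have 23: "Q 2 3" by (rule I[of _ _ "nth [0,0,0,1,0,0,0,0]"]) (simp add: sum_8 quadric_simps quadric_simps(2)[unfolded One_nat_def])
  have 02: "Q 0 2" by (rule I[of _ _ "nth [0,0,0,0,1,0,0,0]"]) (simp add: sum_8 quadric_simps quadric_simps(2)[unfolded One_nat_def])
  have 13: "Q 1 3" by (rule I[of _ _ "nth [0,0,0,0,0,1,0,0]"]) (simp add: sum_8 quadric_simps quadric_simps(2)[unfolded One_nat_def])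
  have 03: "Q 0 3" by (rule I[of _ _ "nth [0,0,0,0,0,0,1,0]"]) (simp add: sum_8 quadric_simps quadric_simps(2)[unfolded One_nat_def])
  have 12: "Q 1 2" by (rule I[of _ _ "nth [0,0,0,0,0,0,0,1]"]) (simp add: sum_8 quadric_simps quadric_simps(2)[unfolded One_nat_def])
  have 22: "Q 2 2"
  proof (rule I[of _ _ "nth [a,1,0,0,0,0,0,0]"])
    fix v :: "'a alg_closure ^ 4" assume "on_cone (to_ac a) (to_ac b) v"
    then have "(v$2)^2 = to_ac a * (v$0)^2 + (v$1)^2" by (simp add: on_cone_def Let_def)
    then show "v$2 * v$2 = (\<Sum>n<8. to_ac ([a,1,0,0,0,0,0,0] ! n) * quadric v n)"
      by (simp add: sum_8 quadric_simps quadric_simps(2)[unfolded One_nat_def] flip: power2_eq_square)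
  qed
  have 33: "Q 3 3"
  proof (rule I[of _ _ "nth [a + b,1,0,0,0,0,0,0]"])
    fix v :: "'a alg_closure ^ 4" assume "on_cone (to_ac a) (to_ac b) v"
    then have "(v$3)^2 = to_ac (a + b) * (v$0)^2 + (v$1)^2" by (auto simp: on_cone_def Let_def algebra_simps)
    then show "v$3 * v$3 = (\<Sum>n<8. to_ac ([a + b,1,0,0,0,0,0,0] ! n) * quadric v n)"
      by (simp add: sum_8 quadric_simps quadric_simps(2)[unfolded One_nat_def] flip: power2_eq_square)
  qed
  have "Q i j"
    using exhaust_0123[of i] exhaust_0123[of j] by (elim disjE; simp only: 00 01 02 03 11 12 13 22 23 33 Qc[OF 01] Qc[OF 02] Qc[OF 03] Qc[OF 12] Qc[OF 13] Qc[OF 23])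
  then show ?thesis unfolding Q_def .
qed

text \<open>The coefficients are taken from the base field. Otherwise the span would be obtained
  only over the algebraic closure.\<close>

lemma eval2_biquadratic:
  fixes p :: "(4 + 4, 'a::field) mpol"
  assumes p: "bihomogeneous 2 2 p"
  shows "\<exists>\<gamma>. \<forall>v w. on_cone (to_ac a) (to_ac b) v \<longrightarrow> on_cone (to_ac a) (to_ac b) w \<longrightarrow>
    eval2 v w p = (\<Sum>i<8. \<Sum>j<8. to_ac (\<gamma> i j) * quadric v i * quadric w j)"
proof -
  have "\<exists>\<gamma>. \<forall>v w. on_cone (to_ac a) (to_ac b) v \<longrightarrow> on_cone (to_ac a) (to_ac b) w \<longrightarrow>
    monom_value (case_sum (($) v) (($) w)) m = (\<Sum>i<8. \<Sum>j<8. to_ac (\<gamma> i j :: 'a) * quadric v i * quadric w j)"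
    if m: "m \<in> Poly_Mapping.keys p" for m
  proof -
    have "(\<Sum>i\<in>UNIV. Poly_Mapping.lookup m (Inl i)) = 2" "(\<Sum>i\<in>UNIV. Poly_Mapping.lookup m (Inr i)) = 2"
      using p m unfolding bihomogeneous_def by auto
    then obtain i j i' j' where ij: "\<And>\<sigma> :: 4 \<Rightarrow> 'a alg_closure. (\<Prod>k\<in>UNIV. \<sigma> k ^ Poly_Mapping.lookup m (Inl k)) = \<sigma> i * \<sigma> j"
      "\<And>\<sigma> :: 4 \<Rightarrow> 'a alg_closure. (\<Prod>k\<in>UNIV. \<sigma> k ^ Poly_Mapping.lookup m (Inr k)) = \<sigma> i' * \<sigma> j'"
      by (metis (no_types) quadratic_monomial)
    obtain \<alpha> where \<alpha>: "\<And>v :: 'a alg_closure ^ 4. on_cone (to_ac a) (to_ac b) v \<Longrightarrow> v $ i * v $ j = (\<Sum>n<8. to_ac (\<alpha> n) * quadric v n)"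
      using quadric_coefficients[of a b i j] by blast
    obtain \<beta> where \<beta>: "\<And>v :: 'a alg_closure ^ 4. on_cone (to_ac a) (to_ac b) v \<Longrightarrow> v $ i' * v $ j' = (\<Sum>n<8. to_ac (\<beta> n) * quadric v n)"
      using quadric_coefficients[of a b i' j'] by blast
    have "monom_value (case_sum (($) v) (($) w)) m = (\<Sum>i<8. \<Sum>j<8. to_ac (\<alpha> i * \<beta> j) * quadric v i * quadric w j)"
      if "on_cone (to_ac a) (to_ac b) v" "on_cone (to_ac a) (to_ac b) w" for v w
    proof -
      have "monom_value (case_sum (($) v) (($) w)) m = (\<Prod>u\<in>UNIV <+> UNIV. case_sum (($) v) (($) w) u ^ Poly_Mapping.lookup m u)"
        by (simp add: monom_value_def)
      also have "\<dots> = (\<Prod>k\<in>UNIV. (v $ k) ^ Poly_Mapping.lookup m (Inl k)) * (\<Prod>k\<in>UNIV. (w $ k) ^ Poly_Mapping.lookup m (Inr k))"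
        by (subst prod.Plus) simp_all
      also have "\<dots> = (\<Sum>n<8. to_ac (\<alpha> n) * quadric v n) * (\<Sum>n<8. to_ac (\<beta> n) * quadric w n)"
        unfolding ij \<alpha>[OF that(1)] \<beta>[OF that(2)] ..
      also have "\<dots> = (\<Sum>i<8. \<Sum>j<8. to_ac (\<alpha> i * \<beta> j) * quadric v i * quadric w j)"
        unfolding sum_product by (intro sum.cong refl) simp
      finally show ?thesis .
    qed
    then show ?thesis by (intro exI[of _ "\<lambda>i j. \<alpha> i * \<beta> j"]) blast
  qed
  then have "\<forall>m\<in>Poly_Mapping.keys p. \<exists>\<gamma>. \<forall>v w. on_cone (to_ac a) (to_ac b) v \<longrightarrow> on_cone (to_ac a) (to_ac b) w \<longrightarrow>
    monom_value (case_sum (($) v) (($) w)) m = (\<Sum>i<8. \<Sum>j<8. to_ac (\<gamma> i j :: 'a) * quadric v i * quadric w j)"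
    by blast
  from bchoice[OF this] obtain \<gamma> where \<gamma>: "\<And>m v w. m \<in> Poly_Mapping.keys p \<Longrightarrow> on_cone (to_ac a) (to_ac b) v \<Longrightarrow> on_cone (to_ac a) (to_ac b) w \<Longrightarrow>
    monom_value (case_sum (($) v) (($) w)) m = (\<Sum>i<8. \<Sum>j<8. to_ac (\<gamma> m i j :: 'a) * quadric v i * quadric w j)"
    by blast
  have "eval2 v w p = (\<Sum>i<8. \<Sum>j<8. to_ac (\<Sum>m\<in>Poly_Mapping.keys p. Poly_Mapping.lookup p m * \<gamma> m i j) * quadric v i * quadric w j)"
    if "on_cone (to_ac a) (to_ac b) v" "on_cone (to_ac a) (to_ac b) w" for v w
  proof -
    have "eval2 v w p = (\<Sum>m\<in>Poly_Mapping.keys p. \<Sum>i<8. \<Sum>j<8. to_ac (Poly_Mapping.lookup p m * \<gamma> m i j) * quadric v i * quadric w j)"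
      unfolding eval2_def mp_eval_def monom_value_keys
      by (rule sum.cong[OF refl]) (simp add: \<gamma>[OF _ that] sum_distrib_left mult.assoc)
    also have "\<dots> = (\<Sum>i<8. \<Sum>j<8. \<Sum>m\<in>Poly_Mapping.keys p. to_ac (Poly_Mapping.lookup p m * \<gamma> m i j) * quadric v i * quadric w j)"
      by (subst sum.swap, rule sum.cong[OF refl], subst sum.swap, rule refl)
    also have "\<dots> = (\<Sum>i<8. \<Sum>j<8. to_ac (\<Sum>m\<in>Poly_Mapping.keys p. Poly_Mapping.lookup p m * \<gamma> m i j) * quadric v i * quadric w j)"
      by (intro sum.cong refl) (simp only: to_ac_sum sum_distrib_right)
    finally show ?thesis .
  qed
  then show ?thesis by (intro exI[of _ "\<lambda>i j. \<Sum>m\<in>Poly_Mapping.keys p. Poly_Mapping.lookup p m * \<gamma> m i j"]) blast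
qed

section \<open>The laws over the base field\<close>

locale rational_jacobi =
  fixes a b :: "'a::field"
  assumes jacobi: "jacobi_curve (to_ac a) (to_ac b) (- to_ac a - to_ac b)"

sublocale rational_jacobi \<subseteq> jacobi_curve "to_ac a" "to_ac b" "- to_ac a - to_ac b"
  by (rule jacobi)

context rational_jacobi
begin

lemma eval2_law0: "eval2 v w (law0 a b $ j) = sm 0 v w $ j"
  using exhaust_0123[of j] by (elim disjE; simp add: law0_def eval2_simps eval2_diff sm_simps power2_eq_square)

lemma eval2_law1: "eval2 v w (law1 a b $ j) = sm 2 v w $ j"
  using exhaust_0123[of j] by (elim disjE; simp add: law1_def eval2_simps eval2_diff eval2_uminus sm_simps power2_eq_square)

lemma eval2_law2: "eval2 v w (law2 a b $ j) = sm 1 v w $ j"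
  using exhaust_0123[of j] by (elim disjE; simp add: law2_def Let_def eval2_simps eval2_diff eval2_uminus sm_simps power2_eq_square algebra_simps)

text \<open>The last component agrees with a times the symmetric entry only modulo the curve
  equations, hence the hypotheses on v and w.\<close>

lemma eval2_law3: assumes "v \<in> J" "w \<in> J" shows "eval2 v w (law3 a b $ j) = to_ac a * sm 3 v w $ j"
proof -
  have "- to_ac b * (v$1)^2 * (w$1)^2 - (- to_ac a - to_ac b) * (v$2)^2 * (w$2)^2 =
    to_ac a * (to_ac b * (- to_ac a - to_ac b) * (v$0)^2 * (w$0)^2 + (v$3)^2 * (w$3)^2)"
    unfolding J_eqs[OF assms(1)] J_eqs[OF assms(2)] by Groebner_Basis.algebra
  then show ?thesis
    using exhaust_0123[of j]
    by (elim disjE; simp add: law3_def Let_def eval2_simps eval2_diff eval2_uminus sm_simps mconst_simps power2_eq_square)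
qed

text \<open>The defining condition of an addition law made linear: all values are multiples of a
  vector representing the sum, with the multiple 0 allowed. Null tuples are thereby included, and
  closure under linear combinations is immediate.\<close>

definition sum_multiples :: "'a tuple set" where
  "sum_multiples = {s \<in> tuples22. \<forall>v\<in>J. \<forall>w\<in>J. \<forall>r. sumpt v w r \<longrightarrow> (\<exists>t. \<forall>j. eval2 v w (s $ j) = t * r $ j)}"

lemma eval2_scale:
  assumes "s \<in> tuples22" shows "eval2 (r *s v) (r' *s w) (s $ j) = r^2 * (r'^2 * eval2 v w (s $ j))"
  using bform_homogeneous[OF bform_eval2, of 2 2 "s $ j" r v r' w] assms unfolding tuples22_def by simp

lemma null_tuples_eq: "null_tuples a b = {s \<in> tuples22. \<forall>v\<in>J. \<forall>w\<in>J. \<forall>j. eval2 v w (s $ j) = 0}"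
  unfolding null_tuples_def ideal_JJ_def J_def by auto

lemma sum_multiples_eq: "addition_laws a b \<union> null_tuples a b = sum_multiples"
proof (intro subset_antisym subsetI)
  fix s assume s: "s \<in> addition_laws a b \<union> null_tuples a b"
  then have s22: "s \<in> tuples22" by (auto simp: addition_laws_def null_tuples_def)
  show "s \<in> sum_multiples"
    unfolding sum_multiples_def
  proof (intro CollectI conjI s22 ballI allI impI)
    fix v w r assume v: "v \<in> J" and w: "w \<in> J" and r: "sumpt v w r"
    obtain x where x: "x \<noteq> 0" "rep_proj3 (abs_proj3 v) = x *s v" using sim_rep_abs[OF v] unfolding sim_def by blast
    obtain y where y: "y \<noteq> 0" "rep_proj3 (abs_proj3 w) = y *s w" using sim_rep_abs[OF w] unfolding sim_def by blast
    have e: "eval_tuple s (abs_proj3 v) (abs_proj3 w) $ j = x^2 * (y^2 * eval2 v w (s $ j))" for j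
      unfolding eval_tuple_def x y by (simp add: eval2_scale[OF s22])
    show "\<exists>t. \<forall>j. eval2 v w (s $ j) = t * r $ j"
    proof (cases "\<forall>j. eval2 v w (s $ j) = 0")
      case True
      then show ?thesis by (intro exI[of _ 0]) simp
    next
      case False
      then have n: "s \<notin> null_tuples a b" using v w unfolding null_tuples_eq by blast
      have ne: "eval_tuple s (abs_proj3 v) (abs_proj3 w) \<noteq> 0"
        using False e x(1) y(1) by (metis mult_eq_0_iff power_not_zero zero_index)
      then have "abs_proj3 (eval_tuple s (abs_proj3 v) (abs_proj3 w)) = abs_proj3 r"
        using s n abs_in_C[OF v] abs_in_C[OF w] addJ_sumpt[OF v w r] unfolding addition_laws_def by auto
      moreover have "r \<noteq> 0" using sumpt_in_J[OF r] J_iff by blast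
      ultimately have "proportional (eval_tuple s (abs_proj3 v) (abs_proj3 w)) r"
        using abs_proj3_eq_iff[OF ne] by blast
      then obtain u where "u \<noteq> 0" "r = u *s eval_tuple s (abs_proj3 v) (abs_proj3 w)"
        unfolding proportional_def by blast
      then have "eval2 v w (s $ j) = inverse (u * (x^2 * y^2)) * r $ j" for j
        using x(1) y(1) by (simp add: e field_simps)
      then show ?thesis by blast
    qed
  qed
next
  fix s assume s: "s \<in> sum_multiples"
  show "s \<in> addition_laws a b \<union> null_tuples a b"
  proof (rule ccontr)
    assume "s \<notin> addition_laws a b \<union> null_tuples a b"
    then obtain P Q where P: "P \<in> C" "Q \<in> C" and ne: "eval_tuple s P Q \<noteq> 0" and no: "abs_proj3 (eval_tuple s P Q) \<noteq> addJ (to_ac a) (to_ac b) P Q"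
      using s unfolding addition_laws_def sum_multiples_def by blast
    have J: "rep_proj3 P \<in> J" "rep_proj3 Q \<in> J" using P rep_in_J by auto
    obtain r i where r: "sumpt (rep_proj3 P) (rep_proj3 Q) r" "r = sm i (rep_proj3 P) (rep_proj3 Q)" "sm i (rep_proj3 P) (rep_proj3 Q) \<noteq> 0"
      by (rule sumpt_exists[OF J])
    obtain t where "\<And>j. eval2 (rep_proj3 P) (rep_proj3 Q) (s $ j) = t * r $ j"
      using s J r(1) unfolding sum_multiples_def by blast
    then have t: "eval_tuple s P Q = t *s r" by (simp add: eval_tuple_def vec_eq_iff)
    then have "t \<noteq> 0" using ne by auto
    have r0: "r \<noteq> 0" using r by simp
    have "proportional r (eval_tuple s P Q)"
      unfolding proportional_def using t \<open>t \<noteq> 0\<close> r0 ne by blast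
    then have "abs_proj3 r = abs_proj3 (eval_tuple s P Q)" using abs_proj3_eq_iff[OF r0 ne] by blast
    then show False using no addJ_sumpt[OF J r(1)] unfolding abs_rep_proj3 by simp
  qed
qed

lemma subspace_sum_multiples: "tuples.subspace sum_multiples"
  unfolding tuples.subspace_def
proof (intro conjI ballI allI)
  show "0 \<in> sum_multiples"
    unfolding sum_multiples_def tuples22_def by (auto simp: bihomogeneous_zero eval2_simps intro!: exI[of _ 0])
next
  fix s s' assume s: "s \<in> sum_multiples" "s' \<in> sum_multiples"
  show "s + s' \<in> sum_multiples"
    unfolding sum_multiples_def
  proof (intro CollectI conjI ballI allI impI)
    show "s + s' \<in> tuples22" using s unfolding sum_multiples_def tuples22_def by (auto intro: bihomogeneous_add)
    fix v w r assume "v \<in> J" "w \<in> J" "sumpt v w r"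
    then obtain t t' where "\<forall>j. eval2 v w (s $ j) = t * r $ j" "\<forall>j. eval2 v w (s' $ j) = t' * r $ j"
      using s unfolding sum_multiples_def by blast
    then have "\<forall>j. eval2 v w ((s + s') $ j) = (t + t') * r $ j" by (simp add: eval2_simps distrib_right)
    then show "\<exists>t. \<forall>j. eval2 v w ((s + s') $ j) = t * r $ j" ..
  qed
next
  fix x s assume s: "s \<in> sum_multiples"
  show "scale_tuple x s \<in> sum_multiples"
    unfolding sum_multiples_def
  proof (intro CollectI conjI ballI allI impI)
    have "bihomogeneous (0 + 2) (0 + 2) (mconst x * s $ j)" for j
      using s unfolding sum_multiples_def tuples22_def by (intro bihomogeneous_mult bihomogeneous_mconst) blast
    then show "scale_tuple x s \<in> tuples22" by (simp only: add_0 tuples22_def scale_tuple_def vec_lambda_beta mem_Collect_eq) blast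
    fix v w r assume "v \<in> J" "w \<in> J" "sumpt v w r"
    then obtain t where "\<forall>j. eval2 v w (s $ j) = t * r $ j" using s unfolding sum_multiples_def by blast
    then have "\<forall>j. eval2 v w (scale_tuple x s $ j) = (to_ac x * t) * r $ j" by (simp add: scale_tuple_def eval2_simps)
    then show "\<exists>t. \<forall>j. eval2 v w (scale_tuple x s $ j) = t * r $ j" ..
  qed
qed

lemma laws_in_sum_multiples: "{law0 a b, law1 a b, law2 a b, law3 a b} \<subseteq> sum_multiples"
proof -
  have "s \<in> sum_multiples"
    if "s \<in> tuples22" "\<And>v w j. v \<in> J \<Longrightarrow> w \<in> J \<Longrightarrow> eval2 v w (s $ j) = x * sm i v w $ j" for s x i
    unfolding sum_multiples_def
  proof (intro CollectI conjI ballI allI impI that(1))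
    fix v w r assume v: "v \<in> J" "w \<in> J" "sumpt v w r"
    then obtain t where "sm i v w = t *s r" unfolding sumpt_def by blast
    then have "\<forall>j. eval2 v w (s $ j) = (x * t) * r $ j" by (simp add: that(2)[OF v(1,2)])
    then show "\<exists>t. \<forall>j. eval2 v w (s $ j) = t * r $ j" ..
  qed
  from this[of "law0 a b" 1 0] this[of "law1 a b" 1 2] this[of "law2 a b" 1 1] this[of "law3 a b" "to_ac a" 3]
  show ?thesis
    using laws_bihomogeneous[of a b] by (simp add: tuples22_def eval2_law0 eval2_law1 eval2_law2 eval2_law3)
qed

lemma origin_nth: "origin $ 0 = 0" "origin $ 1 = 1" "origin $ 2 = 1" "origin $ 3 = 1"
  by (simp_all add: origin_def)

text \<open>It remains to see that no law is null, and this is tested at pairs with Q = O, where the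
  matrix has the entries X_i X_j.\<close>

lemma laws_addition_laws: "{law0 a b, law1 a b, law2 a b, law3 a b} \<subseteq> addition_laws a b"
proof -
  obtain v where v: "v \<in> J" "v$0 = 1" using J_lift[of 1 0] by auto
  have "eval2 v origin (law0 a b $ 0) \<noteq> 0" "eval2 origin origin (law1 a b $ 2) \<noteq> 0"
    "eval2 origin origin (law2 a b $ 1) \<noteq> 0" "eval2 origin origin (law3 a b $ 3) \<noteq> 0"
    using v(2) a0 by (simp_all add: eval2_law0 eval2_law1 eval2_law2 eval2_law3[OF origin_in_J origin_in_J]
        sm_origin_right[OF v(1)] sm_origin_right[OF origin_in_J] origin_nth)
  then have "{law0 a b, law1 a b, law2 a b, law3 a b} \<inter> null_tuples a b = {}"
    using v(1) origin_in_J unfolding null_tuples_eq by blast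
  then show ?thesis using laws_in_sum_multiples sum_multiples_eq by blast
qed

text \<open>The sum of v with its reflection is the origin for k = 0 and a point of order two
  otherwise; X_0 vanishes at all four.\<close>

lemma sumpt_reflection:
  assumes v: "v \<in> J" obtains r where "sumpt v (flip k v) r" "r $ 0 = 0"
proof (cases "k = 0")
  case True
  obtain r i where r: "sumpt v (flip 0 v) r" "r = sm i v (flip 0 v)" "sm i v (flip 0 v) \<noteq> 0"
    by (rule sumpt_exists[OF v J_flip[OF v]])
  have "sim origin r"
    by (rule adds_unique[OF adds_neg[OF v] adds_sumpt[OF v J_flip[OF v] r(1)] origin_in_J sumpt_in_J[OF r(1)]])
  then have "r $ 0 = 0" unfolding sim_def by (auto simp: origin_def)
  then show ?thesis using that r(1) True by blast
next
  case False
  have "tr k origin $ 0 = 0" by (simp add: tr_nth[OF False] origin_def)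
  then show ?thesis using that sumpt_flip[OF v False] by blast
qed

text \<open>The values of \<open>s\<close> are multiples of the sum, whose coordinate \<open>X\<^sub>0\<close> is generically nonzero.\<close>

lemma null_tuplesI:
  assumes s: "s \<in> sum_multiples" and z: "\<And>v w. v \<in> J \<Longrightarrow> w \<in> J \<Longrightarrow> eval2 v w (s $ 0) = 0"
  shows "s \<in> null_tuples a b"
proof -
  have s22: "s \<in> tuples22" using s unfolding sum_multiples_def by blast
  have "eval2 v w (s $ j) = 0" if v: "v \<in> J" and w: "w \<in> J" for v w j
  proof (rule opn_form_zero[where f = "\<lambda>v. eval2 v w (s $ j)", OF _ _ _ v])
    show "fform 2 (\<lambda>v. eval2 v w (s $ j))"
      using s22 bform_left[OF bform_eval2, of 2 2 "s $ j" w] unfolding tuples22_def by blast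
    have "\<exists>x\<in>J. sm 0 x w $ 0 \<noteq> 0"
    proof (cases "w$0 = 0")
      case True
      then have "w$1 \<noteq> 0" using J_two_nonzero(1)[OF w] by blast
      moreover obtain x where "x \<in> J" "x$0 = 1" using J_lift[of 1 0] by auto
      ultimately show ?thesis using True by (intro bexI[of _ x]) (simp_all add: sm_simps)
    next
      case False
      then show ?thesis by (intro bexI[of _ origin] origin_in_J) (simp add: sm_simps origin_def)
    qed
    then obtain x where x: "x \<in> J" "sm 0 x w $ 0 \<noteq> 0" by blast
    show "opn (\<lambda>x. sm 0 x w $ 0 \<noteq> 0)"
      by (rule opnI[OF bform_left[OF bform_sm] x])
    fix x assume x: "x \<in> J" "sm 0 x w $ 0 \<noteq> 0"
    obtain r i where r: "sumpt x w r" "r = sm i x w" "sm i x w \<noteq> 0" by (rule sumpt_exists[OF x(1) w])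
    obtain t where t: "\<And>j. eval2 x w (s $ j) = t * r $ j" using s x(1) w r(1) unfolding sum_multiples_def by blast
    obtain u where "sm 0 x w = u *s r" using r(1) unfolding sumpt_def by blast
    then have "r $ 0 \<noteq> 0" using x(2) by auto
    then have "t = 0" using t[of 0] z[OF x(1) w] by simp
    then show "eval2 x w (s $ j) = 0" by (simp add: t)
  qed
  then show ?thesis using s22 unfolding null_tuples_eq by blast
qed

lemma sum_multiples_span: "sum_multiples = tuples.span ({law0 a b, law1 a b, law2 a b, law3 a b} \<union> null_tuples a b)"
  (is "_ = tuples.span (?L \<union> _)")
proof (rule subset_antisym)
  show "tuples.span (?L \<union> null_tuples a b) \<subseteq> sum_multiples"
    using laws_in_sum_multiples sum_multiples_eq by (intro tuples.span_minimal subspace_sum_multiples) blast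
  show "sum_multiples \<subseteq> tuples.span (?L \<union> null_tuples a b)"
  proof
    fix s assume s: "s \<in> sum_multiples"
    then have "bihomogeneous 2 2 (s $ 0)" unfolding sum_multiples_def tuples22_def by blast
    then obtain \<gamma> where "\<forall>v w. on_cone (to_ac a) (to_ac b) v \<longrightarrow> on_cone (to_ac a) (to_ac b) w \<longrightarrow>
        eval2 v w (s $ 0) = (\<Sum>i<8. \<Sum>j<8. to_ac (\<gamma> i j) * quadric v i * quadric w j)"
      using eval2_biquadratic[of "s $ 0" a b] by blast
    then have \<gamma>: "eval2 v w (s $ 0) = (\<Sum>i<8. \<Sum>j<8. to_ac (\<gamma> i j) * quadric v i * quadric w j)" if "v \<in> J" "w \<in> J" for v w
      using that unfolding J_def by blast
    have "(\<Sum>i<8. \<Sum>j<8. to_ac (\<gamma> i j) * quadric v i * quadric (flip k v) j) = 0" if v: "v \<in> J" for v k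
    proof -
      obtain r where r: "sumpt v (flip k v) r" "r $ 0 = 0" by (rule sumpt_reflection[OF v])
      obtain t where "\<And>j. eval2 v (flip k v) (s $ j) = t * r $ j"
        using s v J_flip[OF v] r(1) unfolding sum_multiples_def by blast
      then have "eval2 v (flip k v) (s $ 0) = 0" by (simp add: r(2))
      then show ?thesis using \<gamma>[OF v J_flip[OF v]] by simp
    qed
    note comb = form_vanishing_on_reflections[where c' = "\<lambda>i j. to_ac (\<gamma> i j)", OF this]
    have an: "to_ac a \<noteq> 0" by (rule a0)
    \<comment> \<open>Rows 0, 1, 2, 3 of the matrix belong to the laws 0, 2, 1, 3, and the last row
      is the law divided by a; this explains the order and the quotient.\<close>
    define l where "l = scale_tuple (\<gamma> 0 1) (law0 a b) + scale_tuple (\<gamma> 2 3) (law2 a b)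
      + scale_tuple (\<gamma> 4 5) (law1 a b) + scale_tuple (\<gamma> 6 7 / a) (law3 a b)"
    have lL: "l \<in> tuples.span ?L"
      unfolding l_def by (intro tuples.span_add tuples.span_scale tuples.span_base) auto
    have "l \<in> sum_multiples"
      using lL tuples.span_minimal[OF laws_in_sum_multiples subspace_sum_multiples] by blast
    then have d: "s - l \<in> sum_multiples" by (rule tuples.subspace_diff[OF subspace_sum_multiples s])
    have "s - l \<in> null_tuples a b"
    proof (rule null_tuplesI[OF d])
      fix v w assume v: "v \<in> J" "w \<in> J"
      have "eval2 v w (l $ 0) = to_ac (\<gamma> 0 1) * sm 0 v w $ 0 + to_ac (\<gamma> 2 3) * sm 1 v w $ 0
        + to_ac (\<gamma> 4 5) * sm 2 v w $ 0 + to_ac (\<gamma> 6 7) * sm 3 v w $ 0"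
        using an by (simp add: l_def scale_tuple_def eval2_simps eval2_law0 eval2_law1 eval2_law2 eval2_law3[OF v])
      then show "eval2 v w ((s - l) $ 0) = 0"
        using \<gamma>[OF v] comb[of v w] by (simp add: eval2_diff)
    qed
    then have "s - l \<in> tuples.span (?L \<union> null_tuples a b)" by (intro tuples.span_base) blast
    moreover have "l \<in> tuples.span (?L \<union> null_tuples a b)" using lL tuples.span_mono[of ?L "?L \<union> null_tuples a b"] by blast
    ultimately have "(s - l) + l \<in> tuples.span (?L \<union> null_tuples a b)" by (rule tuples.span_add)
    then show "s \<in> tuples.span (?L \<union> null_tuples a b)" by simp
  qed
qed

lemma exceptional_divisor_eq:
  assumes x: "x \<noteq> 0" and s: "\<And>v w j. v \<in> J \<Longrightarrow> w \<in> J \<Longrightarrow> eval2 v w (s $ j) = x * sm i v w $ j"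
  shows "exceptional_divisor a b s = delta_pullback a b i"
  unfolding exceptional_divisor_def delta_pullback_def Let_def
proof (rule divisor_eq[OF x])
  fix P Q assume "P \<in> C" "Q \<in> C"
  then have "rep_proj3 P \<in> J" "rep_proj3 Q \<in> J" using rep_in_J by auto
  then show "eval_tuple s P Q = x *s sm i (rep_proj3 P) (rep_proj3 Q)"
    by (simp add: eval_tuple_def vec_eq_iff s)
qed

end

theorem theorem12:
  fixes a b :: "'a::field"
  assumes "CHAR('a) \<noteq> 2"
    and "nonsingularJ (to_ac a) (to_ac b)"
  shows "{law0 a b, law1 a b, law2 a b, law3 a b} \<subseteq> addition_laws a b \<and>
    addition_laws a b \<union> null_tuples a b =
      module.span scale_tuple ({law0 a b, law1 a b, law2 a b, law3 a b} \<union> null_tuples a b) \<and>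
    exceptional_divisor a b (law0 a b) = delta_pullback a b 0 \<and>
    exceptional_divisor a b (law1 a b) = delta_pullback a b 2 \<and>
    exceptional_divisor a b (law2 a b) = delta_pullback a b 1 \<and>
    exceptional_divisor a b (law3 a b) = delta_pullback a b 3"
proof -
  have "(2::'a) \<noteq> 0"
  proof
    assume "(2::'a) = 0"
    then have "of_nat 2 = (0::'a)" by simp
    then have "CHAR('a) dvd 2" by (simp only: of_nat_eq_0_iff_char_dvd)
    then have "CHAR('a) = 1 \<or> CHAR('a) = 2" using two_is_prime_nat by (meson prime_nat_iff)
    then show False using assms(1) CHAR_not_1' by auto
  qed
  then have "(2::'a alg_closure) \<noteq> 0" by (metis to_ac_numeral to_ac_eq_0_iff)
  then interpret rational_jacobi a b
    using nonsingularJ_imp[OF assms(2)] by unfold_locales auto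
  show ?thesis
    unfolding sum_multiples_eq sum_multiples_span[symmetric]
  proof (intro conjI laws_addition_laws refl)
    show "exceptional_divisor a b (law0 a b) = delta_pullback a b 0" "exceptional_divisor a b (law1 a b) = delta_pullback a b 2"
      "exceptional_divisor a b (law2 a b) = delta_pullback a b 1"
      by (rule exceptional_divisor_eq[OF one_neq_zero]; simp add: eval2_law0 eval2_law1 eval2_law2)+
    show "exceptional_divisor a b (law3 a b) = delta_pullback a b 3"
      by (rule exceptional_divisor_eq[OF a0 eval2_law3])
  qed
qed

end
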